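(* Let $k$ be a positive integer, let $G$ be a $50k$-connected graph, and let $S \subseteq V(G)$. Then at least one of the following holds: (i) $G$ contains $k$ pairwise vertex-disjoint odd $S$-cycles; (ii) there is a set $X \subseteq V(G)$ with $|X| \le 2k-2$ such that $G - X$ contains no odd $S$-cycle, and, if moreover $|S| \ge k$, there is a set $Y \subseteq V(G)$ with $|Y| \le 3k-3$ such that $G - Y$ is bipartite.
   Context: All graphs are finite and simple. For $S \subseteq V(G)$, an $S$-cycle is a cycle of $G$ containing at least one vertex of $S$; an odd $S$-cycle is an $S$-cycle of odd length. *)

theory Defs
  imports Main
begin

definition simple_graph :: "'a set \<Rightarrow> ('a \<Rightarrow> 'a \<Rightarrow> bool) \<Rightarrow> bool" where
  "simple_graph V E \<longleftrightarrow> finite V \<and> (\<forall>u v. E u v \<longrightarrow> u \<in> V \<and> v \<in> V)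
     \<and> (\<forall>u v. E u v \<longrightarrow> E v u) \<and> (\<forall>u. \<not> E u u)"

definition connected_on :: "'a set \<Rightarrow> ('a \<Rightarrow> 'a \<Rightarrow> bool) \<Rightarrow> bool" where
  "connected_on V E \<longleftrightarrow>
     (\<forall>u\<in>V. \<forall>v\<in>V. (\<lambda>x y. x \<in> V \<and> y \<in> V \<and> E x y)\<^sup>*\<^sup>* u v)"

text \<open>k-connected (Diestel): more than k vertices and G - X connected for all |X| < k.\<close>
definition k_connected :: "'a set \<Rightarrow> ('a \<Rightarrow> 'a \<Rightarrow> bool) \<Rightarrow> nat \<Rightarrow> bool" where
  "k_connected V E n \<longleftrightarrow> card V > n \<and>
     (\<forall>X. X \<subseteq> V \<longrightarrow> card X < n \<longrightarrow> connected_on (V - X) E)"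

definition is_cycle :: "'a set \<Rightarrow> ('a \<Rightarrow> 'a \<Rightarrow> bool) \<Rightarrow> 'a list \<Rightarrow> bool" where
  "is_cycle V E c \<longleftrightarrow> distinct c \<and> length c \<ge> 3 \<and> set c \<subseteq> V \<and>
     (\<forall>i < length c. E (c ! i) (c ! ((i + 1) mod length c)))"

definition odd_S_cycle :: "'a set \<Rightarrow> ('a \<Rightarrow> 'a \<Rightarrow> bool) \<Rightarrow> 'a set \<Rightarrow> 'a list \<Rightarrow> bool" where
  "odd_S_cycle V E S c \<longleftrightarrow> is_cycle V E c \<and> odd (length c) \<and> set c \<inter> S \<noteq> {}"

definition bipartite_on :: "'a set \<Rightarrow> ('a \<Rightarrow> 'a \<Rightarrow> bool) \<Rightarrow> bool" where
  "bipartite_on V E \<longleftrightarrow> (\<exists>f :: 'a \<Rightarrow> bool. \<forall>u\<in>V. \<forall>v\<in>V. E u v \<longrightarrow> f u \<noteq> f v)"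

end

theory Submission
  imports Defs
begin

text \<open>Colour the vertices so that at least half of the edges are bichromatic. The bichromatic graph contains a dense
  part \<open>K\<close> in which any \<open>2 * k\<close> disjoint pairs are joined by disjoint bichromatic paths; this is a weak form of
  the theorem of Thomas and Wollan that average degree \<open>O(L)\<close> and connectivity \<open>2 * L\<close> force \<open>L\<close>-linkedness. Call a path
  with both ends and nothing else in \<open>K\<close> nonzero if its parity differs from that of a bichromatic path between its ends;
  closing up a nonzero path through \<open>K\<close> gives an odd cycle.

  Either there are \<open>k\<close> disjoint nonzero paths, or \<open>2 * k - 2\<close> vertices meet all odd cycles: this follows from the
  Tutte-Berge formula, applied to a two-level cover of the graph. Given \<open>k\<close> disjoint nonzero paths, those missing \<open>S\<close> are
  compensated by paths through further vertices of \<open>S\<close>, built from fans to \<open>K\<close> and made disjoint from the family by an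
  exchange argument. If such a path is not itself nonzero, it is joined through \<open>K\<close> to a nonzero path that misses \<open>S\<close>.
  For this to work, the nonzero paths must not use up \<open>S\<close>: either \<open>S\<close> has \<open>2 * k - 1\<close> vertices and a shortest family
  meets it at most twice in each path, or \<open>S\<close> has \<open>k\<close> vertices and all but one of them were deleted beforehand, which
  costs the extra \<open>k - 1\<close> vertices of \<open>Y\<close>.\<close>

section \<open>Paths and Menger's theorem\<close>

text \<open>The obstacle is parity: a linkage controls which vertices are joined, not how long the
  links are. Taking all links in the bichromatic graph lets the colours of the ends decide the
  parity of a link, so parity has to be managed only on the paths that leave \<open>K\<close>, where
  the values zero and nonzero add under joining and rerouting. The constant 50 arises as follows.
  Degree \<open>50 * k\<close> leaves bichromatic average degree at least \<open>25 * k\<close>. A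
  cycle may consist of two paths and two links, so \<open>2 * k\<close> links with
  \<open>4 * k\<close> ends are needed, and linking them requires density
  \<open>12 * (2 * k) = 24 * k\<close>; the difference pays for the arcs among the ends. The other
  uses of connectivity are cheaper. A fan has \<open>4 * k\<close> paths and avoids at most
  \<open>2 * k\<close> vertices of \<open>S\<close>, hence \<open>6 * k\<close>. After the exchange,
  a family of \<open>m < 2 * k\<close> paths meets at most \<open>2 * m\<close> paths of the fan, so
  two remain free. The Tutte-Berge alternative needs connectivity \<open>2 * k\<close> only.\<close>

definition gpath :: "('a \<Rightarrow> 'a \<Rightarrow> bool) \<Rightarrow> 'a list \<Rightarrow> bool" where
  "gpath E p \<longleftrightarrow> p \<noteq> [] \<and> distinct p \<and> successively E p"

lemma gpath_single [simp]: "gpath E [x]"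
  by (simp add: gpath_def)

lemma gpath_Nil [simp]: "\<not> gpath E []"
  by (simp add: gpath_def)

lemma gpath_append:
  "gpath E (p @ q) \<longleftrightarrow> (p = [] \<and> gpath E q) \<or> (q = [] \<and> gpath E p) \<or>
     (gpath E p \<and> gpath E q \<and> set p \<inter> set q = {} \<and> E (last p) (hd q))"
  by (auto simp: gpath_def successively_append_iff)

lemma gpath_Cons:
  "gpath E (x # q) \<longleftrightarrow> q = [] \<or> (gpath E q \<and> x \<notin> set q \<and> E x (hd q))"
  by (auto simp: gpath_def successively_Cons)

lemma gpath_mono:
  assumes "gpath E p" "\<And>x y. x \<in> set p \<Longrightarrow> y \<in> set p \<Longrightarrow> E x y \<Longrightarrow> E' x y"
  shows "gpath E' p"
  using assms by (auto simp: gpath_def intro: successively_mono)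

lemma gpath_rev:
  assumes "gpath E p" "symp E"
  shows "gpath E (rev p)"
proof -
  have "successively (\<lambda>x y. E y x) p"
    using assms(1) by (auto simp: gpath_def intro: successively_mono sympD[OF assms(2)])
  then show ?thesis using assms(1) by (simp add: gpath_def)
qed

lemma walk_to_path:
  assumes "w \<noteq> []" "successively E w"
  shows "\<exists>p. gpath E p \<and> set p \<subseteq> set w \<and> hd p = hd w \<and> last p = last w"
  using assms
proof (induction w)
  case (Cons x w)
  show ?case
  proof (cases "w = []")
    case True
    then show ?thesis by (intro exI[of _ "[x]"]) simp
  next
    case False
    with Cons obtain p where p: "gpath E p" "set p \<subseteq> set w" "hd p = hd w" "last p = last w"
      by (auto simp: successively_Cons)
    show ?thesis
    proof (cases "x \<in> set p")
      case True
      then obtain a b where ab: "p = a @ x # b" by (meson split_list)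
      with p have "gpath E (x # b)" by (auto simp: gpath_append)
      with p ab False show ?thesis by (intro exI[of _ "x # b"]) auto
    next
      case x: False
      with Cons.prems p False have "gpath E (x # p)"
        by (auto simp: gpath_Cons successively_Cons)
      moreover have "p \<noteq> []" using p(1) by (simp add: gpath_def)
      ultimately show ?thesis using p False by (intro exI[of _ "x # p"]) auto
    qed
  qed
qed simp

lemma split_first_in:
  assumes "set p \<inter> P \<noteq> {}"
  obtains a z b where "p = a @ z # b" "z \<in> P" "set a \<inter> P = {}"
  using split_list_first_prop[of p "\<lambda>x. x \<in> P"] assms by blast

lemma split_last_in:
  assumes "set p \<inter> P \<noteq> {}"
  obtains a z b where "p = a @ z # b" "z \<in> P" "set b \<inter> P = {}"
  using split_list_last_prop[of p "\<lambda>x. x \<in> P"] assms by blast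

lemma gpath_trim_last:
  assumes "gpath E p" "last p \<in> P"
  shows "\<exists>q r. p = q @ r \<and> gpath E q \<and> last q \<in> P \<and> set q \<inter> P = {last q} \<and> hd q = hd p"
proof -
  have "\<exists>x\<in>set p. x \<in> P" using assms by (auto simp: gpath_def)
  then obtain a x b where ab: "p = a @ x # b" "x \<in> P" "\<forall>y\<in>set a. y \<notin> P"
    using split_list_first_prop[of p "\<lambda>x. x \<in> P"] by auto
  then have "gpath E (a @ [x])" using assms by (auto simp: gpath_def successively_append_iff)
  with ab show ?thesis by (intro exI[of _ "a @ [x]"] exI[of _ b]) (auto simp: hd_append)
qed

lemma gpath_trim_hd:
  assumes "gpath E p" "hd p \<in> P"
  shows "\<exists>q r. p = r @ q \<and> gpath E q \<and> hd q \<in> P \<and> set q \<inter> P = {hd q} \<and> last q = last p"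
proof -
  have "\<exists>x\<in>set p. x \<in> P" using assms by (auto simp: gpath_def)
  then obtain a x b where ab: "p = a @ x # b" "x \<in> P" "\<forall>y\<in>set b. y \<notin> P"
    using split_list_last_prop[of p "\<lambda>x. x \<in> P"] by auto
  then have "gpath E (x # b)" using assms by (auto simp: gpath_append)
  with ab show ?thesis by (intro exI[of _ "x # b"] exI[of _ a]) auto
qed

section \<open>Connected vertex sets\<close>

lemma connected_on_path:
  assumes "connected_on W E" "u \<in> W" "v \<in> W"
  shows "\<exists>p. gpath E p \<and> set p \<subseteq> W \<and> hd p = u \<and> last p = v"
proof -
  have "(\<lambda>x y. x \<in> W \<and> y \<in> W \<and> E x y)\<^sup>*\<^sup>* u v"
    using assms by (auto simp: connected_on_def)
  then have "\<exists>w. w \<noteq> [] \<and> successively E w \<and> set w \<subseteq> W \<and> hd w = u \<and> last w = v"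
  proof induction
    case base
    then show ?case using assms by (intro exI[of _ "[u]"]) simp
  next
    case (step y z)
    then obtain w where "w \<noteq> []" "successively E w" "set w \<subseteq> W" "hd w = u" "last w = y" by blast
    with step show ?case by (intro exI[of _ "w @ [z]"]) (auto simp: successively_append_iff)
  qed
  then show ?thesis using walk_to_path by (metis order_trans)
qed

lemma path_reach:
  assumes "w \<noteq> []" "successively E w" "set w \<subseteq> W"
  shows "(\<lambda>x y. x \<in> W \<and> y \<in> W \<and> E x y)\<^sup>*\<^sup>* (hd w) (last w)"
  using assms
proof (induction w)
  case (Cons x w)
  show ?case
  proof (cases "w = []")
    case False
    with Cons have "(\<lambda>x y. x \<in> W \<and> y \<in> W \<and> E x y)\<^sup>*\<^sup>* (hd w) (last w)" "E x (hd w)" "x \<in> W" "hd w \<in> W"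
      by (auto simp: successively_Cons)
    with False show ?thesis by (simp add: converse_rtranclp_into_rtranclp)
  qed simp
qed simp

lemma connected_onI:
  assumes "r \<in> W" "symp E"
    and "\<And>v. v \<in> W \<Longrightarrow> \<exists>p. p \<noteq> [] \<and> successively E p \<and> set p \<subseteq> W \<and> hd p = r \<and> last p = v"
  shows "connected_on W E"
  unfolding connected_on_def
proof (intro ballI)
  fix u v assume "u \<in> W" "v \<in> W"
  let ?R = "\<lambda>x y. x \<in> W \<and> y \<in> W \<and> E x y"
  have *: "?R\<^sup>*\<^sup>* r x" if "x \<in> W" for x using assms(3)[OF that] path_reach[of _ E W] by blast
  have "?R\<inverse>\<inverse>\<^sup>*\<^sup>* u r" using *[OF \<open>u \<in> W\<close>] by (simp add: rtranclp_converseI)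
  moreover have "?R\<inverse>\<inverse> = ?R" using assms(2) by (auto simp: fun_eq_iff dest: sympD)
  ultimately have "?R\<^sup>*\<^sup>* u r" by simp
  then show "?R\<^sup>*\<^sup>* u v" using *[OF \<open>v \<in> W\<close>] by simp
qed

lemma connected_on_set_path:
  assumes "gpath E p" "symp E"
  shows "connected_on (set p) E"
proof (rule connected_onI[of "hd p"])
  show "hd p \<in> set p" using assms by (simp add: gpath_def)
  fix v assume "v \<in> set p"
  then obtain a b where "p = a @ v # b" by (meson split_list)
  with assms(1) show "\<exists>q. q \<noteq> [] \<and> successively E q \<and> set q \<subseteq> set p \<and> hd q = hd p \<and> last q = v"
    by (intro exI[of _ "a @ [v]"]) (auto simp: gpath_def successively_append_iff hd_append)
qed (fact assms(2))

lemma rtranclp_mono_imp: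
  assumes "R\<^sup>*\<^sup>* x y" "\<And>x y. R x y \<Longrightarrow> S x y" shows "S\<^sup>*\<^sup>* x y"
  using assms(1) by induction (auto intro: rtranclp.rtrancl_into_rtrancl assms(2))

lemma connected_on_mono:
  assumes "connected_on W E" "\<And>x y. x \<in> W \<Longrightarrow> y \<in> W \<Longrightarrow> E x y \<Longrightarrow> E' x y"
  shows "connected_on W E'"
  using assms unfolding connected_on_def by (blast intro: rtranclp_mono_imp)

lemma connected_on_Un:
  assumes "connected_on A E" "connected_on B E" "symp E"
    and "a \<in> A" "b \<in> B" "a = b \<or> E a b"
  shows "connected_on (A \<union> B) E"
proof -
  let ?R = "\<lambda>W x y. x \<in> W \<and> y \<in> W \<and> E x y"
  have A: "(?R (A \<union> B))\<^sup>*\<^sup>* x y" if "x \<in> A" "y \<in> A" for x y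
    using assms(1) that unfolding connected_on_def by (blast intro: rtranclp_mono_imp)
  have B: "(?R (A \<union> B))\<^sup>*\<^sup>* x y" if "x \<in> B" "y \<in> B" for x y
    using assms(2) that unfolding connected_on_def by (blast intro: rtranclp_mono_imp)
  have ab: "(?R (A \<union> B))\<^sup>*\<^sup>* a b" "(?R (A \<union> B))\<^sup>*\<^sup>* b a"
    using sympD[OF assms(3), of a b] assms(4-6) by (auto intro: r_into_rtranclp)
  have to_a: "(?R (A \<union> B))\<^sup>*\<^sup>* x a" if "x \<in> A \<union> B" for x
    using that A[OF _ assms(4)] rtranclp_trans[OF B[OF _ assms(5)] ab(2)] by blast
  have from_a: "(?R (A \<union> B))\<^sup>*\<^sup>* a x" if "x \<in> A \<union> B" for x
    using that A[OF assms(4)] rtranclp_trans[OF ab(1) B[OF assms(5)]] by blast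
  have "(?R (A \<union> B))\<^sup>*\<^sup>* x y" if "x \<in> A \<union> B" "y \<in> A \<union> B" for x y
    using rtranclp_trans[OF to_a[OF that(1)] from_a[OF that(2)]] .
  then show ?thesis unfolding connected_on_def by blast
qed

text \<open>The graph is a set of arcs because Menger's theorem is proved by induction on that set.
  One-vertex paths count, so a separator contains \<open>A \<inter> B\<close>.\<close>

definition separates :: "('a \<times> 'a) set \<Rightarrow> 'a set \<Rightarrow> 'a set \<Rightarrow> 'a set \<Rightarrow> bool" where
  "separates R A B S \<longleftrightarrow>
     (\<forall>p. gpath (\<lambda>x y. (x, y) \<in> R) p \<longrightarrow> hd p \<in> A \<longrightarrow> last p \<in> B \<longrightarrow> set p \<inter> S \<noteq> {})"

definition disjoint_paths :: "('a \<Rightarrow> 'a \<Rightarrow> bool) \<Rightarrow> 'a set \<Rightarrow> 'a set \<Rightarrow> nat \<Rightarrow> (nat \<Rightarrow> 'a list) \<Rightarrow> bool" where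
  "disjoint_paths E A B k f \<longleftrightarrow> (\<forall>i<k. gpath E (f i) \<and> hd (f i) \<in> A \<and> last (f i) \<in> B) \<and>
     (\<forall>i<k. \<forall>j<k. i \<noteq> j \<longrightarrow> set (f i) \<inter> set (f j) = {})"

lemma disjoint_paths_trim_last:
  assumes "disjoint_paths E A B k f"
  shows "\<exists>g. disjoint_paths E A B k g \<and> (\<forall>i<k. set (g i) \<inter> B = {last (g i)} \<and> set (g i) \<subseteq> set (f i))"
proof -
  have "\<forall>i. \<exists>q. i < k \<longrightarrow> set q \<subseteq> set (f i) \<and> gpath E q \<and> last q \<in> B \<and> set q \<inter> B = {last q} \<and> hd q = hd (f i)"
    using assms gpath_trim_last unfolding disjoint_paths_def by (metis set_append sup_ge1)
  then obtain g where "\<forall>i<k. set (g i) \<subseteq> set (f i) \<and> gpath E (g i) \<and> last (g i) \<in> B \<and>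
      set (g i) \<inter> B = {last (g i)} \<and> hd (g i) = hd (f i)"
    by metis
  then show ?thesis using assms unfolding disjoint_paths_def
    by (intro exI[of _ g]) (simp, blast)
qed

lemma disjoint_paths_trim_hd:
  assumes "disjoint_paths E A B k f"
  shows "\<exists>g. disjoint_paths E A B k g \<and> (\<forall>i<k. set (g i) \<inter> A = {hd (g i)} \<and> set (g i) \<subseteq> set (f i))"
proof -
  have "\<forall>i. \<exists>q. i < k \<longrightarrow> set q \<subseteq> set (f i) \<and> gpath E q \<and> hd q \<in> A \<and> set q \<inter> A = {hd q} \<and> last q = last (f i)"
    using assms gpath_trim_hd unfolding disjoint_paths_def by (metis set_append sup_ge2)
  then obtain g where "\<forall>i<k. set (g i) \<subseteq> set (f i) \<and> gpath E (g i) \<and> hd (g i) \<in> A \<and>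
      set (g i) \<inter> A = {hd (g i)} \<and> last (g i) = last (f i)"
    by metis
  then show ?thesis using assms unfolding disjoint_paths_def
    by (intro exI[of _ g]) (simp, blast)
qed

lemma gpath_insert_arc:
  assumes "gpath (\<lambda>u v. (u, v) \<in> insert (x, y) R) p" "x \<notin> set (butlast p)"
  shows "gpath (\<lambda>u v. (u, v) \<in> R) p"
  using assms
proof (induction p)
  case (Cons a p)
  show ?case
  proof (cases "p = []")
    case False
    with Cons show ?thesis by (auto simp: gpath_Cons)
  qed simp
qed (simp add: gpath_def)

text \<open>Goering's proof: delete an arc \<open>(x, y)\<close>. If the rest has a separator \<open>S\<close> that is too small, then \<open>S\<close> with
  \<open>x\<close> and \<open>S\<close> with \<open>y\<close> are minimum separators, and the paths to the first and from the second fit together.\<close>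

lemma menger:
  assumes "finite R" "finite A"
    and "\<And>S. finite S \<Longrightarrow> separates R A B S \<Longrightarrow> k \<le> card S"
  shows "\<exists>f. disjoint_paths (\<lambda>x y. (x, y) \<in> R) A B k f"
  using assms
proof (induction R arbitrary: A B rule: finite_induct)
  case empty
  \<comment> \<open>Without arcs every path is a single vertex, so the required paths are
    \<open>k\<close> points of \<open>A \<inter> B\<close>.\<close>
  have "separates {} A B (A \<inter> B)"
    unfolding separates_def
  proof (intro allI impI)
    fix p assume p: "gpath (\<lambda>x y. (x, y) \<in> {}) p" "hd p \<in> A" "last p \<in> B"
    then obtain x where "p = [x]" by (cases p rule: remdups_adj.cases) (auto simp: gpath_def)
    with p show "set p \<inter> (A \<inter> B) \<noteq> {}" by auto
  qed
  with empty have "k \<le> card (A \<inter> B)" by simp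
  then obtain g where g: "inj_on g {..<k}" "g ` {..<k} \<subseteq> A \<inter> B"
    by (metis card_le_inj card_lessThan empty.prems(1) finite_Int finite_lessThan)
  then show ?case
    by (intro exI[of _ "\<lambda>i. [g i]"]) (auto simp: disjoint_paths_def inj_on_def)
next
  case (insert e R)
  obtain x y where e: "e = (x, y)" by (cases e)
  let ?E = "\<lambda>u v. (u, v) \<in> R" and ?E' = "\<lambda>u v. (u, v) \<in> insert e R"
  have mono: "gpath ?E p \<Longrightarrow> gpath ?E' p" for p by (auto elim: gpath_mono)
  show ?case
  proof (cases "\<forall>S. finite S \<longrightarrow> separates R A B S \<longrightarrow> k \<le> card S")
    case True
    with insert.IH[OF insert.prems(1)] obtain f where "disjoint_paths ?E A B k f" by blast
    then show ?thesis using mono unfolding disjoint_paths_def by blast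
  next
    case False
    then obtain S where S: "finite S" "separates R A B S" "card S < k" by auto
    have sepx: "separates (insert e R) A B (insert x S)"
      unfolding separates_def
    proof (intro allI impI)
      fix p assume p: "gpath ?E' p" "hd p \<in> A" "last p \<in> B"
      show "set p \<inter> insert x S \<noteq> {}"
      proof (cases "x \<in> set p")
        case False
        with p(1) have "gpath ?E p" using gpath_insert_arc[of x y R p] e by (auto dest: in_set_butlastD)
        with S(2) p show ?thesis by (auto simp: separates_def)
      qed auto
    qed
    \<comment> \<open>The new arc ends in \<open>y\<close>, so a path using it has \<open>y\<close>
      after its first vertex.\<close>
    have y_free: "gpath ?E p" if "gpath ?E' p" "y \<notin> set (tl p)" for p
      using that by (induction p) (auto simp: gpath_Cons e dest: list.set_sel(2))
    have sepy: "separates (insert e R) A B (insert y S)"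
      unfolding separates_def
    proof (intro allI impI)
      fix p assume p: "gpath ?E' p" "hd p \<in> A" "last p \<in> B"
      show "set p \<inter> insert y S \<noteq> {}"
      proof (cases "y \<in> set p")
        case False
        with p(1) have "gpath ?E p" using y_free by (metis list.set_sel(2) gpath_def)
        with S(2) p show ?thesis by (auto simp: separates_def)
      qed auto
    qed
    have "k \<le> card (insert x S)" "k \<le> card (insert y S)"
      using insert.prems(2) sepx sepy S(1) by auto
    with S have xS: "x \<notin> S" and yS: "y \<notin> S" and k: "card (insert x S) = k" "card (insert y S) = k"
      by (auto simp: card_insert_if split: if_splits)
    have "\<exists>f. disjoint_paths ?E A (insert x S) k f"
    proof (rule insert.IH[OF insert.prems(1)])
      fix T assume T: "finite T" "separates R A (insert x S) T"
      \<comment> \<open>Up to its first vertex in \<open>insert x S\<close> a path does not leave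
        \<open>x\<close>, so this segment avoids the new arc and must meet \<open>T\<close>. The
        second application of the induction hypothesis is the mirror image, with the last vertex in
        \<open>insert y S\<close>.\<close>
      have "separates (insert e R) A B T"
        unfolding separates_def
      proof (intro allI impI)
        fix p assume p: "gpath ?E' p" "hd p \<in> A" "last p \<in> B"
        with sepx obtain a z b where ab: "p = a @ z # b" "z \<in> insert x S" "set a \<inter> insert x S = {}"
          using split_first_in[of p "insert x S"] unfolding separates_def by blast
        have "gpath ?E' (a @ [z])" using p(1) ab(1) by (auto simp: gpath_def successively_append_iff)
        then have "gpath ?E (a @ [z])" using gpath_insert_arc[of x y R "a @ [z]"] ab(3) e by auto
        moreover have "hd (a @ [z]) \<in> A" using p ab by (auto simp: hd_append)
        ultimately have "set (a @ [z]) \<inter> T \<noteq> {}"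
          using T(2) ab(2) unfolding separates_def by (metis last_snoc)
        then show "set p \<inter> T \<noteq> {}" using ab by auto
      qed
      with T insert.prems(2) show "k \<le> card T" by blast
    qed
    then obtain f0 where "disjoint_paths ?E A (insert x S) k f0" by blast
    from disjoint_paths_trim_last[OF this] obtain f where
      f: "disjoint_paths ?E A (insert x S) k f" "\<And>i. i < k \<Longrightarrow> set (f i) \<inter> insert x S = {last (f i)}" by blast
    have "\<exists>g. disjoint_paths ?E (insert y S) B k g"
    proof (rule insert.IH)
      fix T assume T: "finite T" "separates R (insert y S) B T"
      have "separates (insert e R) A B T"
        unfolding separates_def
      proof (intro allI impI)
        fix p assume p: "gpath ?E' p" "hd p \<in> A" "last p \<in> B"
        with sepy obtain a z b where ab: "p = a @ z # b" "z \<in> insert y S" "set b \<inter> insert y S = {}"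
          using split_last_in[of p "insert y S"] unfolding separates_def by blast
        have "gpath ?E' (z # b)" using p(1) ab(1) by (auto simp: gpath_append)
        then have "gpath ?E (z # b)" using ab(3) y_free[of "z # b"] by auto
        moreover have "last (z # b) \<in> B" using p ab by auto
        ultimately have "set (z # b) \<inter> T \<noteq> {}"
          using T(2) ab(2) unfolding separates_def by (metis list.sel(1))
        then show "set p \<inter> T \<noteq> {}" using ab by auto
      qed
      with T insert.prems(2) show "k \<le> card T" by blast
    qed (use S in auto)
    then obtain g0 where "disjoint_paths ?E (insert y S) B k g0" by blast
    from disjoint_paths_trim_hd[OF this] obtain g where
      g: "disjoint_paths ?E (insert y S) B k g" "\<And>i. i < k \<Longrightarrow> set (g i) \<inter> insert y S = {hd (g i)}" by blast
    \<comment> \<open>Splicing the two paths at a common vertex \<open>v\<close> gives a walk from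
      \<open>A\<close> to \<open>B\<close> without the new arc, so it meets \<open>S\<close>. The
      first path meets \<open>S\<close> only at its end and the second only at its beginning, which
      leaves \<open>v\<close> itself as the meeting point.\<close>
    have meet: "v \<in> S \<and> v = last (f i) \<and> v = hd (g j)"
      if ij: "i < k" "j < k" and v: "v \<in> set (f i)" "v \<in> set (g j)" for i j v
    proof -
      obtain a b where ab: "f i = a @ v # b" using v by (meson split_list)
      obtain c d where cd: "g j = c @ v # d" using v by (meson split_list)
      have pf: "gpath ?E (a @ [v])" using f(1) ij ab by (auto simp: disjoint_paths_def gpath_def successively_append_iff)
      have pg: "gpath ?E (v # d)" using g(1) ij cd by (auto simp: disjoint_paths_def gpath_append)
      have "a @ v # d \<noteq> []" "successively ?E (a @ v # d)"
        using pf pg by (auto simp: gpath_def successively_append_iff)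
      from walk_to_path[OF this] obtain p where p: "gpath ?E p" "set p \<subseteq> set (a @ v # d)"
        "hd p = hd (a @ v # d)" "last p = last (a @ v # d)" by blast
      have hA: "hd p \<in> A" using p ab f(1) ij by (cases a) (auto simp: disjoint_paths_def dest!: spec[of _ i])
      have lB: "last p \<in> B" using p cd g(1) ij by (auto simp: disjoint_paths_def dest!: spec[of _ j])
      obtain s where s: "s \<in> S" "s \<in> set (a @ v # d)"
        using S(2) p hA lB unfolding separates_def by blast
      have "distinct (f i)" "distinct (g j)" using f(1) g(1) ij by (auto simp: disjoint_paths_def gpath_def)
      then have df: "distinct (a @ v # b)" and dg: "distinct (c @ v # d)"
        unfolding ab cd by auto
      have "s = v"
      proof (rule ccontr)
        assume "s \<noteq> v"
        with s consider "s \<in> set a" | "s \<in> set d" by auto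
        then show False
        proof cases
          case 1
          then have "s \<in> set (f i) \<inter> insert x S" using s ab by auto
          then have "s = last (f i)" using f(2)[OF ij(1)] by auto
          with 1 df ab show False by (auto split: if_splits)
        next
          case 2
          then have "s \<in> set (g j) \<inter> insert y S" using s cd by auto
          then have "s = hd (g j)" using g(2)[OF ij(2)] by auto
          with 2 dg cd show False by (cases c) auto
        qed
      qed
      then have "v \<in> S" using s by simp
      moreover have "v \<in> set (f i) \<inter> insert x S" "v \<in> set (g j) \<inter> insert y S" using v \<open>v \<in> S\<close> by auto
      ultimately show ?thesis using f(2)[OF ij(1)] g(2)[OF ij(2)] by auto
    qed
    have nf: "f i \<noteq> []" if "i < k" for i using f(1) that by (auto simp: disjoint_paths_def gpath_def)
    have ng: "g i \<noteq> []" if "i < k" for i using g(1) that by (auto simp: disjoint_paths_def gpath_def)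
    have inj_g: "inj_on (\<lambda>j. hd (g j)) {..<k}"
      using g(1) ng unfolding disjoint_paths_def inj_on_def by (metis disjoint_iff hd_in_set lessThan_iff)
    have "(\<lambda>j. hd (g j)) ` {..<k} \<subseteq> insert y S" using g(1) by (auto simp: disjoint_paths_def)
    then have surj_g: "(\<lambda>j. hd (g j)) ` {..<k} = insert y S"
      using card_image[OF inj_g] k S(1) by (intro card_subset_eq) auto
    have inj_f: "inj_on (\<lambda>j. last (f j)) {..<k}"
      using f(1) nf unfolding disjoint_paths_def inj_on_def by (metis disjoint_iff last_in_set lessThan_iff)
    \<comment> \<open>The path ending in \<open>x\<close> continues across the arc to
      \<open>y\<close>; every other path continues from its own end in \<open>S\<close>.\<close>
    define tgt where "tgt = (\<lambda>i. if last (f i) = x then y else last (f i))"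
    have lastf: "last (f i) \<in> insert x S" if "i < k" for i using f(1) that by (auto simp: disjoint_paths_def)
    have "\<forall>i. \<exists>j. i < k \<longrightarrow> j < k \<and> hd (g j) = tgt i"
    proof (intro allI)
      fix i show "\<exists>j. i < k \<longrightarrow> j < k \<and> hd (g j) = tgt i"
      proof (cases "i < k")
        case True
        then have "tgt i \<in> insert y S" using lastf[of i] by (auto simp: tgt_def)
        then have "tgt i \<in> (\<lambda>j. hd (g j)) ` {..<k}" using surj_g by simp
        then show ?thesis by (metis imageE lessThan_iff)
      qed auto
    qed
    then obtain h where h: "\<And>i. i < k \<Longrightarrow> h i < k \<and> hd (g (h i)) = tgt i" by metis
    have inj_h: "h i \<noteq> h j" if "i < k" "j < k" "i \<noteq> j" for i j
    proof
      assume "h i = h j"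
      then have "tgt i = tgt j" using h that by metis
      moreover have "last (f i) \<noteq> last (f j)" using inj_f that by (auto simp: inj_on_def)
      ultimately show False using lastf[of i] lastf[of j] that yS by (auto simp: tgt_def split: if_splits)
    qed
    \<comment> \<open>The vertex common to both halves is dropped, except across the arc, where the
      halves are disjoint.\<close>
    define F where "F = (\<lambda>i. f i @ (if last (f i) = x then g (h i) else tl (g (h i))))"
    have setF: "set (F i) \<subseteq> set (f i) \<union> set (g (h i))" if "i < k" for i
      using ng[of "h i"] h[OF that] by (auto simp: F_def dest: list.set_sel(2))
    have "disjoint_paths ?E' A B k F"
      unfolding disjoint_paths_def
    proof (intro conjI allI impI)
      fix i assume i: "i < k"
      let ?g = "g (h i)"
      have gp: "gpath ?E (f i)" "gpath ?E ?g" "last ?g \<in> B" "hd (f i) \<in> A"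
        using f(1) g(1) i h[OF i] by (auto simp: disjoint_paths_def)
      obtain z d where gd: "?g = z # d" using ng[of "h i"] h[OF i] by (cases ?g) auto
      have z: "z = tgt i" using h[OF i] gd by simp
      show "hd (F i) \<in> A" using gp nf[OF i] by (simp add: F_def)
      show "gpath ?E' (F i)"
      proof (cases "last (f i) = x")
        case True
        then have "set (f i) \<inter> set ?g = {}" using meet[of i "h i"] i h[OF i] xS by blast
        then show ?thesis using gp mono True z gd e by (auto simp: F_def gpath_append tgt_def)
      next
        case False
        have "set (f i) \<inter> set d = {}"
        proof -
          have "z \<notin> set d" using gp(2) gd by (simp add: gpath_def)
          moreover have "v = z" if "v \<in> set (f i)" "v \<in> set d" for v
            using meet[of i "h i" v] that i h[OF i] gd by auto
          ultimately show ?thesis by blast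
        qed
        moreover have "d = [] \<or> gpath ?E d \<and> ?E z (hd d)" using gp(2) gd by (auto simp: gpath_Cons)
        ultimately show ?thesis using gp mono False z gd by (auto simp: F_def gpath_append tgt_def)
      qed
      show "last (F i) \<in> B" using gp gd z nf[OF i] by (auto simp: F_def tgt_def)
    next
      fix i j assume ij: "i < k" "j < k" "i \<noteq> j"
      have key: "set (F a) \<inter> set (f b) = {}" if "a < k" "b < k" "a \<noteq> b" for a b
      proof -
        have "set (f a) \<inter> set (f b) = {}" using f(1) that by (auto simp: disjoint_paths_def)
        moreover have False if v: "v \<in> set (g (h a))" "v \<in> set (f b)" "v \<in> set (F a)" for v
        proof -
          have "v \<in> S" "v = last (f b)" "v = hd (g (h a))" using meet[of b "h a" v] v \<open>a<k\<close> \<open>b<k\<close> h by auto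
          moreover then have "tgt a = v" using h \<open>a<k\<close> by simp
          ultimately have "last (f a) = last (f b)" using yS by (auto simp: tgt_def split: if_splits)
          then show False using inj_f \<open>a<k\<close> \<open>b<k\<close> \<open>a\<noteq>b\<close> by (auto simp: inj_on_def)
        qed
        ultimately show ?thesis using setF[OF that(1)] by blast
      qed
      have "set (g (h i)) \<inter> set (g (h j)) = {}" using g(1) ij h inj_h[of i j] by (auto simp: disjoint_paths_def)
      then show "set (F i) \<inter> set (F j) = {}"
        using key[of i j] key[of j i] ij setF[of i] setF[of j] by blast
    qed
    then show ?thesis by blast
  qed
qed


text \<open>\<open>Z\<close> is a minimum separator of \<open>X\<close> from \<open>C\<close>,
  chosen to be \<open>X\<close> itself if no smaller one exists, and \<open>W\<close> is what cannot
  be reached from \<open>X\<close> after removing \<open>Z\<close>. The paths are the parts from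
  \<open>Z\<close> on of disjoint Menger paths. The alternative for \<open>Z\<close> is what the
  applications need: \<open>Z = X\<close> links \<open>X\<close>, and a smaller \<open>Z\<close>
  yields a rigid set.\<close>

lemma menger_separator:
  assumes fin: "finite V" and sym: "symp E" and X: "X \<subseteq> V" and C: "C \<subseteq> V"
  shows "\<exists>Z W f. (card Z < card X \<or> Z = X) \<and> Z \<subseteq> V \<and> W \<subseteq> V - Z \<and> W \<inter> X = {} \<and> C \<subseteq> W \<union> Z \<and>
    (\<forall>w\<in>W. \<forall>v\<in>V. E w v \<longrightarrow> v \<in> W \<union> Z) \<and>
    (\<forall>z\<in>Z. gpath E (f z) \<and> set (f z) \<subseteq> W \<union> Z \<and> hd (f z) = z \<and>
       set (f z) \<inter> Z = {z} \<and> last (f z) \<in> C \<and> set (f z) \<inter> C = {last (f z)}) \<and>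
    (\<forall>z\<in>Z. \<forall>z'\<in>Z. z \<noteq> z' \<longrightarrow> set (f z) \<inter> set (f z') = {})"
proof -
  define R where "R = {(u, v). u \<in> V \<and> v \<in> V \<and> E u v}"
  let ?E = "\<lambda>u v. (u, v) \<in> R"
  have finR: "finite R" using fin by (intro finite_subset[of R "V \<times> V"]) (auto simp: R_def)
  have finX: "finite X" using X fin finite_subset by blast
  have inV: "set p \<subseteq> V" if "gpath ?E p" "hd p \<in> V" for p
    using that by (induction p) (auto simp: gpath_Cons R_def)
  have sepX: "separates R X C X" unfolding separates_def by (metis disjoint_iff gpath_Nil hd_in_set)
  define seps where "seps = {S. finite S \<and> S \<subseteq> V \<and> separates R X C S}"
  have "X \<in> seps" using sepX finX X by (simp add: seps_def)
  then obtain Z0 where Z0: "Z0 \<in> seps" "\<And>S. S \<in> seps \<Longrightarrow> card Z0 \<le> card S"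
    using ex_has_least_nat[of "\<lambda>S. S \<in> seps" X card] by blast
  define Z where "Z = (if card Z0 = card X then X else Z0)"
  have Z: "Z \<in> seps" "\<And>S. S \<in> seps \<Longrightarrow> card Z \<le> card S" "card Z < card X \<or> Z = X"
    using Z0 \<open>X \<in> seps\<close> by (auto simp: Z_def dest: le_neq_implies_less)
  have ZV: "Z \<subseteq> V" "finite Z" "separates R X C Z" using Z(1) by (auto simp: seps_def)
  have "\<exists>f. disjoint_paths ?E X C (card Z) f"
  proof (rule menger[OF finR finX])
    fix S assume S: "finite S" "separates R X C S"
    have "S \<inter> V \<in> seps" using S inV X unfolding seps_def separates_def by blast
    then have "card Z \<le> card (S \<inter> V)" by (rule Z(2))
    also have "\<dots> \<le> card S" using S by (intro card_mono) auto
    finally show "card Z \<le> card S" .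
  qed
  then obtain g0 where "disjoint_paths ?E X C (card Z) g0" by blast
  from disjoint_paths_trim_last[OF this] obtain g where
    g: "disjoint_paths ?E X C (card Z) g" "\<And>i. i < card Z \<Longrightarrow> set (g i) \<inter> C = {last (g i)}" by blast
  have gV: "set (g i) \<subseteq> V" if "i < card Z" for i
    using g(1) that X inV unfolding disjoint_paths_def by blast
  define pick where "pick = (\<lambda>i. SOME z. z \<in> set (g i) \<inter> Z)"
  have pick: "pick i \<in> set (g i) \<inter> Z" if "i < card Z" for i
  proof -
    have "set (g i) \<inter> Z \<noteq> {}" using g(1) that ZV(3) unfolding disjoint_paths_def separates_def by blast
    then show ?thesis unfolding pick_def by (metis ex_in_conv someI_ex)
  qed
  \<comment> \<open>There are \<open>card Z\<close> disjoint paths and each meets \<open>Z\<close>,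
    so each meets it exactly once and every vertex of \<open>Z\<close> is used.\<close>
  have "inj_on pick {..<card Z}"
  proof (rule inj_onI)
    fix i j assume ij: "i \<in> {..<card Z}" "j \<in> {..<card Z}" "pick i = pick j"
    show "i = j"
    proof (rule ccontr)
      assume "i \<noteq> j"
      then have "set (g i) \<inter> set (g j) = {}" using g(1) ij unfolding disjoint_paths_def by auto
      then show False using pick[of i] pick[of j] ij by auto
    qed
  qed
  moreover have "pick ` {..<card Z} \<subseteq> Z" using pick by auto
  ultimately have "pick ` {..<card Z} = Z"
    using ZV(2) card_image[of pick "{..<card Z}"] by (intro card_subset_eq) auto
  then have "\<forall>z. \<exists>i. z \<in> Z \<longrightarrow> i < card Z \<and> pick i = z" by (metis imageE lessThan_iff)
  then obtain idx where idx: "\<And>z. z \<in> Z \<Longrightarrow> idx z < card Z \<and> pick (idx z) = z" by metis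
  have only: "set (g (idx z)) \<inter> Z = {z}" if z: "z \<in> Z" for z
  proof -
    have "z' = z" if z': "z' \<in> set (g (idx z)) \<inter> Z" for z'
    proof (rule ccontr)
      assume "z' \<noteq> z"
      moreover have "z' \<in> Z" using z' by simp
      ultimately have "idx z' \<noteq> idx z" using idx[of z'] idx[OF z] by metis
      moreover note \<open>z' \<in> Z\<close>
      ultimately have "set (g (idx z')) \<inter> set (g (idx z)) = {}"
        using g(1) idx z unfolding disjoint_paths_def by blast
      moreover have "z' \<in> set (g (idx z'))" using pick[of "idx z'"] idx[OF \<open>z' \<in> Z\<close>] by simp
      ultimately show False using z' by blast
    qed
    moreover have "z \<in> set (g (idx z)) \<inter> Z" using pick[of "idx z"] idx[OF z] by simp
    ultimately show ?thesis by blast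
  qed
  have "\<forall>z. \<exists>q r. z \<in> Z \<longrightarrow> g (idx z) = r @ q \<and> gpath ?E q \<and> hd q = z \<and> last q = last (g (idx z))"
  proof (intro allI)
    fix z show "\<exists>q r. z \<in> Z \<longrightarrow> g (idx z) = r @ q \<and> gpath ?E q \<and> hd q = z \<and> last q = last (g (idx z))"
    proof (cases "z \<in> Z")
      case True
      then have "z \<in> set (g (idx z))" using only by blast
      then obtain r q where "g (idx z) = r @ z # q" by (meson split_list)
      moreover have "gpath ?E (g (idx z))" using g(1) idx[OF True] by (auto simp: disjoint_paths_def)
      ultimately show ?thesis by (intro exI[of _ "z # q"] exI[of _ r]) (auto simp: gpath_append)
    qed simp
  qed
  then obtain f r where f: "\<And>z. z \<in> Z \<Longrightarrow> g (idx z) = r z @ f z \<and> gpath ?E (f z) \<and> hd (f z) = z \<and>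
      last (f z) = last (g (idx z))" by metis
  define W where "W = {v \<in> V - Z. \<not> (\<exists>p. gpath ?E p \<and> hd p \<in> X \<and> last p = v \<and> set p \<inter> Z = {})}"
  have nb: "v \<in> W \<union> Z" if w: "w \<in> W" and v: "v \<in> V" "E w v" for w v
  proof (rule ccontr)
    assume "v \<notin> W \<union> Z"
    with v obtain p where p: "gpath ?E p" "hd p \<in> X" "last p = v" "set p \<inter> Z = {}" by (auto simp: W_def)
    have "p \<noteq> []" using p by auto
    have "w \<in> V - Z" using w by (simp add: W_def)
    have "?E v w" using v \<open>w \<in> V - Z\<close> sym by (auto simp: R_def dest: sympD)
    then have "successively ?E (p @ [w])" using p by (auto simp: gpath_def successively_append_iff)
    from walk_to_path[OF _ this] obtain q where "gpath ?E q" "set q \<subseteq> set (p @ [w])" "hd q = hd (p @ [w])" "last q = w"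
      by auto
    then have "gpath ?E q \<and> hd q \<in> X \<and> last q = w \<and> set q \<inter> Z = {}"
      using p \<open>p \<noteq> []\<close> \<open>w \<in> V - Z\<close> by auto
    then show False using w unfolding W_def by blast
  qed
  have WX: "W \<inter> X = {}"
  proof (rule ccontr)
    assume "W \<inter> X \<noteq> {}"
    then obtain v where v: "v \<in> W" "v \<in> X" by auto
    then have "gpath ?E [v] \<and> hd [v] \<in> X \<and> last [v] = v \<and> set [v] \<inter> Z = {}" by (auto simp: W_def)
    then show False using v unfolding W_def by blast
  qed
  have CW: "C \<subseteq> W \<union> Z"
  proof
    fix c assume c: "c \<in> C"
    show "c \<in> W \<union> Z"
    proof (rule ccontr)
      assume "c \<notin> W \<union> Z"
      with c C obtain p where "gpath ?E p" "hd p \<in> X" "last p = c" "set p \<inter> Z = {}" unfolding W_def by blast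
      then show False using ZV(3) c unfolding separates_def by blast
    qed
  qed
  have fz: "gpath E (f z) \<and> set (f z) \<subseteq> W \<union> Z \<and> hd (f z) = z \<and>
       set (f z) \<inter> Z = {z} \<and> last (f z) \<in> C \<and> set (f z) \<inter> C = {last (f z)}" if z: "z \<in> Z" for z
  proof -
    have i: "idx z < card Z" using idx z by blast
    have sub: "set (f z) \<subseteq> set (g (idx z))" using f[OF z] by (metis set_append sup_ge2)
    have ne: "f z \<noteq> []" using f[OF z] by auto
    have hz: "z \<in> set (f z)" using f[OF z] ne by (metis hd_in_set)
    have lst: "last (f z) = last (g (idx z))" using f[OF z] by blast
    have lC: "last (f z) \<in> C" using f[OF z] g(1) i by (auto simp: disjoint_paths_def)
    \<comment> \<open>If \<open>v\<close> on this part could be reached from \<open>X\<close>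
      without meeting \<open>Z\<close>, continuing from \<open>v\<close> along the path would give a
      walk from \<open>X\<close> to \<open>C\<close> that misses \<open>Z\<close>.\<close>
    have "set (f z) \<subseteq> W \<union> Z"
    proof
      fix v assume v: "v \<in> set (f z)"
      show "v \<in> W \<union> Z"
      proof (rule ccontr)
        assume nv: "v \<notin> W \<union> Z"
        then obtain p where p: "gpath ?E p" "hd p \<in> X" "last p = v" "set p \<inter> Z = {}"
          using v sub gV[OF i] by (auto simp: W_def)
        obtain a b where ab: "f z = a @ v # b" using v by (meson split_list)
        have "v \<noteq> z" using nv z by auto
        then have "a \<noteq> []" using f[OF z] ab by auto
        then have "z \<in> set a" using f[OF z] ab by (metis hd_append2 hd_in_set)
        have gf: "gpath ?E (a @ v # b)" using f[OF z] ab by simp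
        then have "gpath ?E (v # b)" and "z \<notin> set (v # b)"
          using \<open>z \<in> set a\<close> by (auto simp: gpath_append)
        have vb: "set (v # b) \<inter> Z = {}" using only[OF z] sub ab \<open>z \<notin> set (v # b)\<close> by auto
        have "p \<noteq> []" using p by auto
        have "successively ?E (p @ b)" using p(1,3) \<open>gpath ?E (v # b)\<close>
          by (auto simp: gpath_def successively_append_iff successively_Cons)
        from walk_to_path[OF _ this] \<open>p \<noteq> []\<close> obtain q where q: "gpath ?E q" "set q \<subseteq> set (p @ b)"
          "hd q = hd (p @ b)" "last q = last (p @ b)" by auto
        have "last q = last (f z)" using q ab p(3) \<open>p \<noteq> []\<close> by auto
        then have "last q \<in> C" "hd q \<in> X" using lC q p(2) \<open>p \<noteq> []\<close> by auto
        then have "set q \<inter> Z \<noteq> {}" using ZV(3) q(1) unfolding separates_def by blast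
        then show False using q(2) p(4) vb by auto
      qed
    qed
    moreover have "set (f z) \<inter> Z = {z}" using only[OF z] sub hz z by blast
    moreover have "set (f z) \<inter> C = {last (f z)}"
      using g(2)[OF i, folded lst] sub lC last_in_set[OF ne] by blast
    moreover have "gpath E (f z)" using f[OF z] by (auto simp: R_def elim: gpath_mono)
    ultimately show ?thesis using f[OF z] lC by blast
  qed
  have disj: "set (f z) \<inter> set (f z') = {}" if z: "z \<in> Z" "z' \<in> Z" "z \<noteq> z'" for z z'
  proof -
    have "idx z \<noteq> idx z'" using idx z by metis
    then have "set (g (idx z)) \<inter> set (g (idx z')) = {}" using g(1) idx z unfolding disjoint_paths_def by blast
    moreover have "set (f z) \<subseteq> set (g (idx z))" "set (f z') \<subseteq> set (g (idx z'))"
      using f[OF z(1)] f[OF z(2)] by (metis set_append sup_ge2)+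
    ultimately show ?thesis by blast
  qed
  have WV: "W \<subseteq> V - Z" by (auto simp: W_def)
  show ?thesis
    by (rule exI[of _ Z], rule exI[of _ W], rule exI[of _ f], intro conjI ballI impI)
      (use Z(3) ZV(1) WX CW nb fz disj WV in simp_all)
qed

section \<open>Linkages in dense graphs\<close>

definition pairing :: "nat set \<Rightarrow> (nat \<Rightarrow> 'a) \<Rightarrow> (nat \<Rightarrow> 'a) \<Rightarrow> 'a set \<Rightarrow> bool" where
  "pairing I s t X \<longleftrightarrow> finite I \<and> inj_on s I \<and> inj_on t I \<and> s ` I \<inter> t ` I = {} \<and> s ` I \<subseteq> X \<and> t ` I \<subseteq> X"

text \<open>Every path has an inner vertex. This is the point of the notion: a linkage found after
  turning \<open>X\<close> into a clique then uses no added edge, provided that all vertices of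
  \<open>X\<close> in \<open>C\<close> are among the ends.\<close>

definition slinked :: "'a set \<Rightarrow> ('a \<Rightarrow> 'a \<Rightarrow> bool) \<Rightarrow> nat \<Rightarrow> bool" where
  "slinked C E L \<longleftrightarrow> (\<forall>s t. pairing {..<L} s t C \<longrightarrow>
     (\<exists>p. (\<forall>i<L. gpath E (p i) \<and> 3 \<le> length (p i) \<and> hd (p i) = s i \<and> last (p i) = t i \<and> set (p i) \<subseteq> C) \<and>
          (\<forall>i<L. \<forall>j<L. i \<noteq> j \<longrightarrow> set (p i) \<inter> set (p j) = {})))"

lemma greedy_representatives:
  assumes "finite R" "\<And>i. i \<in> R \<Longrightarrow> finite (X i) \<and> card R \<le> card (X i)"
  shows "\<exists>h. inj_on h R \<and> (\<forall>i\<in>R. h i \<in> X i)"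
proof -
  have "\<exists>h. inj_on h Q \<and> (\<forall>i\<in>Q. h i \<in> X i)" if "Q \<subseteq> R" for Q
    using finite_subset[OF that assms(1)] that
  proof (induction Q rule: finite_induct)
    case (insert a Q)
    then obtain h where h: "inj_on h Q" "\<forall>i\<in>Q. h i \<in> X i" by auto
    have "card (h ` Q) \<le> card Q" using insert by (simp add: card_image_le)
    also have "\<dots> < card R" using insert assms(1) by (metis insert_subset psubset_card_mono psubsetI)
    also have "\<dots> \<le> card (X a)" using assms(2) insert by auto
    finally obtain y where "y \<in> X a" "y \<notin> h ` Q"
      using insert(1) by (metis card_mono finite_imageI linorder_not_le subsetI)
    with h insert show ?case
      by (intro exI[of _ "h(a := y)"]) (auto simp: inj_on_def)
  qed simp
  then show ?thesis by blast
qed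

lemma paired_representatives:
  assumes R: "finite R"
    and fin: "\<And>i. i \<in> R \<Longrightarrow> finite (A i) \<and> finite (B i) \<and> A i \<inter> B i = {}"
    and big: "\<And>i. i \<in> R \<Longrightarrow> card R < card (A i) \<and> card R < card (B i)"
  shows "\<exists>f g. inj_on f R \<and> inj_on g R \<and> f ` R \<inter> g ` R = {} \<and> (\<forall>i\<in>R. f i \<in> A i \<and> g i \<in> B i)"
proof -
  define S where "S = (\<lambda>(i, b). if b then A i else B i)"
  have "\<exists>h. inj_on h Q \<and> (\<forall>q\<in>Q. h q \<in> S q)" if "Q \<subseteq> R \<times> UNIV" for Q :: "('a \<times> bool) set"
    using finite_subset[OF that finite_cartesian_product[OF R finite]] that
  proof (induction Q rule: finite_induct)
    case (insert a Q)
    then obtain h where h: "inj_on h Q" "\<forall>q\<in>Q. h q \<in> S q" by auto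
    show ?case
    proof (cases "S a \<subseteq> h ` Q")
      case False
      then obtain y where "y \<in> S a" "y \<notin> h ` Q" by auto
      with h insert show ?thesis by (intro exI[of _ "h(a := y)"]) (auto simp: inj_on_def)
    next
      case True
      define Q1 where "Q1 = {q \<in> Q. h q \<in> S a}"
      have "h ` Q1 = S a" using True by (auto simp: Q1_def)
      moreover have "finite Q1" using insert by (auto simp: Q1_def)
      ultimately have "card (S a) \<le> card Q1" by (metis card_image_le)
      moreover have "card R < card (S a)" using insert.prems big by (auto simp: S_def)
      moreover have "fst ` Q1 \<subseteq> R" using insert.prems by (auto simp: Q1_def)
      ultimately have "\<not> inj_on fst Q1" using R card_inj_on_le[of fst Q1 R] by linarith
      then obtain q q' where "q \<in> Q1" "q' \<in> Q1" "fst q = fst q'" "q \<noteq> q'" by (auto simp: inj_on_def)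
      moreover obtain i b where "q = (i, b)" by fastforce
      moreover obtain i' b' where "q' = (i', b')" by fastforce
      ultimately have ib: "(i, b) \<in> Q1" "(i, b') \<in> Q1" "b \<noteq> b'" by auto
      then have iQ: "(i, c) \<in> Q1" for c by (cases "c = b") (use ib in auto)
      have iR: "i \<in> R" using iQ \<open>fst ` Q1 \<subseteq> R\<close> by force
      have "card Q < card (R \<times> (UNIV :: bool set))"
        using insert R by (intro psubset_card_mono) auto
      then have "card Q < 2 * card R" by (simp add: card_cartesian_product)
      then have "card (h ` Q) < 2 * card R" using card_image_le[OF insert(1), of h] by linarith
      also have "\<dots> < card (A i \<union> B i)" using fin[OF iR] big[OF iR] by (simp add: card_Un_disjoint)
      finally have "\<not> A i \<union> B i \<subseteq> h ` Q" using insert(1) by (meson card_mono finite_imageI linorder_not_less)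
      then obtain y where "y \<in> A i \<union> B i" and y2: "y \<notin> h ` Q" by blast
      then have "y \<in> S (i, True) \<or> y \<in> S (i, False)" by (auto simp: S_def)
      then obtain c where "y \<in> S (i, c)" by blast
      with y2 have y: "y \<in> S (i, c)" "y \<notin> h ` Q" by blast+
      have ic: "(i, c) \<in> Q" "h (i, c) \<in> S a" using iQ[of c] by (auto simp: Q1_def)
      define h' where "h' = h((i, c) := y, a := h (i, c))"
      have "inj_on h' (insert a Q)"
        using h(1) insert(2) y(2) ic(1) unfolding inj_on_def h'_def by auto
      moreover have "\<forall>q\<in>insert a Q. h' q \<in> S q"
        using h(2) insert(2) y(1) ic by (auto simp: h'_def)
      ultimately show ?thesis by blast
    qed
  qed simp
  from this[OF order_refl] obtain h where h: "inj_on h (R \<times> UNIV)" "\<forall>q\<in>R \<times> UNIV. h q \<in> S q" by blast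
  have "inj_on (\<lambda>i. h (i, b)) R" for b using h(1) by (auto simp: inj_on_def)
  moreover have "(\<lambda>i. h (i, True)) ` R \<inter> (\<lambda>i. h (i, False)) ` R = {}" using h(1) by (auto simp: inj_on_def)
  moreover have "h (i, True) \<in> A i \<and> h (i, False) \<in> B i" if "i \<in> R" for i
    using bspec[OF h(2), of "(i, True)"] bspec[OF h(2), of "(i, False)"] that by (simp add: S_def)
  ultimately show ?thesis by blast
qed

lemma card_inter_triple:
  "card ({a, b, c} \<inter> N) \<le> 3" "\<not> {a, b, c} \<subseteq> N \<Longrightarrow> card ({a, b, c} \<inter> N) \<le> 2"
  "card ({a, b} \<inter> N) \<le> 2" "\<not> {a, b} \<subseteq> N \<Longrightarrow> card ({a, b} \<inter> N) \<le> 1"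
  by (auto simp: Int_insert_left card_insert_if)

lemma sum_two_plus:
  assumes "finite J"
  shows "(\<Sum>j\<in>J. 2 + (if P j then 1 else 0)) = 2 * card J + card {j \<in> J. P j}"
  unfolding sum.distrib sum.inter_filter[OF assms, symmetric] by simp

lemma pairing_card:
  assumes "pairing {..<L} s t C"
  shows "card (s ` {..<L} \<union> t ` {..<L}) = 2 * L"
  using assms by (auto simp: pairing_def card_Un_disjoint card_image)

text \<open>Join as many pairs as possible through a single middle vertex. The vertices outside this system have so many
  common neighbours there that the remaining pairs can be joined by paths with three inner vertices.\<close>

lemma dense_slinked:
  assumes fin: "finite C" and sym: "symp E" and irr: "irreflp E"
    and deg: "\<And>x. x \<in> C \<Longrightarrow> d \<le> card {y \<in> C. E x y}"
    and d: "3 * L \<le> d" and dn: "7 * L + 3 * card C \<le> 6 * d + 6"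
  shows "slinked C E L"
  unfolding slinked_def
proof (intro allI impI)
  fix s t assume st: "pairing {..<L} s t C"
  define N where "N = (\<lambda>x. {y \<in> C. E x y})"
  have finN: "finite (N x)" for x using fin by (simp add: N_def)
  have degN: "x \<in> C \<Longrightarrow> d \<le> card (N x)" for x using deg by (simp add: N_def)
  have NE: "y \<in> N x \<longleftrightarrow> y \<in> C \<and> E x y" for x y by (simp add: N_def)
  have Esym: "E x y \<longleftrightarrow> E y x" for x y using sym by (auto dest: sympD)
  have Eirr: "\<not> E x x" for x using irr by (auto dest: irreflpD)
  define T where "T = s ` {..<L} \<union> t ` {..<L}"
  have sC: "i < L \<Longrightarrow> s i \<in> C" and tC: "i < L \<Longrightarrow> t i \<in> C" for i using st by (auto simp: pairing_def)
  have cT: "card T = 2 * L" unfolding T_def using pairing_card[OF st] .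
  have TC: "T \<subseteq> C" using sC tC by (auto simp: T_def)
  have s_inj: "s i = s j \<longleftrightarrow> i = j" and t_inj: "t i = t j \<longleftrightarrow> i = j" and st_ne: "s i \<noteq> t j"
    if "i < L" "j < L" for i j
    using st that by (auto simp: pairing_def inj_on_def)
  \<comment> \<open>\<open>J\<close> is the set of pairs already joined, and \<open>m i\<close> is
    the single middle vertex for the pair \<open>i\<close>.\<close>
  define sys where "sys = (\<lambda>J m. J \<subseteq> {..<L} \<and> inj_on m J \<and> m ` J \<subseteq> C - T \<and> (\<forall>i\<in>J. E (s i) (m i) \<and> E (m i) (t i)))"
  have "sys {} undefined" by (simp add: sys_def)
  moreover have "card J \<le> L" if "sys J m" for J m
    using that by (metis card_lessThan card_mono finite_lessThan sys_def)
  ultimately have "\<exists>J. (\<exists>m. sys J m) \<and> (\<forall>J'. (\<exists>m. sys J' m) \<longrightarrow> card J' \<le> card J)"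
    by (intro ex_has_greatest_nat[of _ "{}" _ "Suc L"]) (blast intro: le_imp_less_Suc)+
  then obtain J where J: "\<exists>m. sys J m" and Jmax: "\<And>J' m'. sys J' m' \<Longrightarrow> card J' \<le> card J" by blast
  then obtain m where m: "sys J m" by blast
  define R where "R = {..<L} - J"
  have JL: "J \<subseteq> {..<L}" and m_inj: "inj_on m J" and mCT: "m ` J \<subseteq> C - T"
    and mE: "\<And>i. i \<in> J \<Longrightarrow> E (s i) (m i) \<and> E (m i) (t i)"
    using m by (auto simp: sys_def)
  have finJ: "finite J" and finR: "finite R" using JL finite_subset by (auto simp: R_def)
  have cJR: "card J + card R = L" using JL finJ card_mono[OF _ JL] by (simp add: R_def card_Diff_subset)
  define Mid where "Mid = m ` J"
  have cMid: "card Mid = card J" using m_inj by (simp add: Mid_def card_image)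
  define U where "U = C - T - Mid"
  have finU: "finite U" using fin by (simp add: U_def)
  have "Mid \<subseteq> C - T" using mCT by (simp add: Mid_def)
  then have CU: "C = U \<union> (T \<union> Mid)" using TC by (auto simp: U_def)
  have "finite T" "finite Mid" using TC fin finJ by (auto simp: Mid_def dest: finite_subset)
  moreover have "U \<inter> (T \<union> Mid) = {}" "T \<inter> Mid = {}" using \<open>Mid \<subseteq> C - T\<close> by (auto simp: U_def)
  ultimately have "card (U \<union> (T \<union> Mid)) = card U + (card T + card Mid)"
    using finU by (simp add: card_Un_disjoint)
  then have "card C = card U + (card T + card Mid)" using CU by simp
  then have cU: "card U + 2 * L + card J = card C" using cT cMid by simp
  have noU: "\<not> (E (s i) u \<and> E u (t i))" if "i \<in> R" "u \<in> U" for i u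
  proof
    assume "E (s i) u \<and> E u (t i)"
    then have "sys (insert i J) (m(i := u))"
      using that m unfolding sys_def R_def U_def Mid_def by (auto simp: inj_on_def)
    from Jmax[OF this] show False using that finJ by (simp add: R_def)
  qed
  define I3 where "I3 = (\<lambda>i. {j \<in> J. {s j, t j, m j} \<subseteq> N (s i) \<inter> N (t i)})"
  \<comment> \<open>Otherwise \<open>u\<close> takes over the pair \<open>j\<close> and the released
    \<open>m j\<close> joins the pair \<open>i\<close>, which enlarges the system.\<close>
  have noI3: "\<not> (E u (s j) \<and> E u (t j))" if i: "i \<in> R" and j: "j \<in> I3 i" and u: "u \<in> U" for i j u
  proof
    assume a: "E u (s j) \<and> E u (t j)"
    have jJ: "j \<in> J" "E (s i) (m j)" "E (m j) (t i)" using j Esym by (auto simp: I3_def NE)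
    have ij: "i \<noteq> j" "i \<notin> J" using i jJ by (auto simp: R_def)
    have "u \<noteq> m a" if "a \<in> J" for a using u that by (auto simp: U_def Mid_def)
    then have "inj_on (m(j := u, i := m j)) (insert i J)"
      using m_inj ij jJ(1) unfolding inj_on_def by (metis fun_upd_apply insert_iff)
    moreover have "(m(j := u, i := m j)) ` insert i J \<subseteq> C - T"
      using mCT u jJ(1) by (auto simp: U_def)
    ultimately have "sys (insert i J) (m(j := u, i := m j))"
      using i JL jJ mE a Esym unfolding sys_def R_def by auto
    from Jmax[OF this] show False using ij finJ by simp
  qed
  \<comment> \<open>By degrees, \<open>s i\<close> and \<open>t i\<close> have at least
    \<open>2 * d - card C\<close> common neighbours, none of them in \<open>U\<close>. A joined
    triple contains at most two unless its index is in \<open>I3 i\<close>, another unjoined pair at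
    most two, and the pair \<open>i\<close> itself none.\<close>
  have cI3: "2 * d + 2 \<le> card C + 2 * L + card (I3 i)" if i: "i \<in> R" for i
  proof -
    let ?CN = "N (s i) \<inter> N (t i)"
    have iL: "i < L" using i by (simp add: R_def)
    have "card (N (s i)) + card (N (t i)) = card (N (s i) \<union> N (t i)) + card ?CN"
      using finN by (intro card_Un_Int)
    moreover have "card (N (s i) \<union> N (t i)) \<le> card C" using fin by (intro card_mono) (auto simp: NE)
    ultimately have c1: "2 * d \<le> card C + card ?CN" using degN[OF sC[OF iL]] degN[OF tC[OF iL]] by linarith
    have "?CN \<subseteq> (\<Union>j\<in>J. {s j, t j, m j} \<inter> ?CN) \<union> (\<Union>j\<in>R - {i}. {s j, t j} \<inter> ?CN)"
    proof
      fix x assume x: "x \<in> ?CN"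
      then have "x \<notin> U" using noU[OF i, of x] Esym by (auto simp: NE)
      then have "x \<in> T \<union> Mid" using x by (auto simp: U_def NE)
      moreover have "x \<noteq> s i" "x \<noteq> t i" using x Eirr by (auto simp: NE)
      ultimately show "x \<in> (\<Union>j\<in>J. {s j, t j, m j} \<inter> ?CN) \<union> (\<Union>j\<in>R - {i}. {s j, t j} \<inter> ?CN)"
        using x unfolding T_def Mid_def R_def by blast
    qed
    then have "card ?CN \<le> card ((\<Union>j\<in>J. {s j, t j, m j} \<inter> ?CN) \<union> (\<Union>j\<in>R - {i}. {s j, t j} \<inter> ?CN))"
      using finJ finR by (intro card_mono) auto
    also have "\<dots> \<le> card (\<Union>j\<in>J. {s j, t j, m j} \<inter> ?CN) + card (\<Union>j\<in>R - {i}. {s j, t j} \<inter> ?CN)"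
      by (rule card_Un_le)
    also have "card (\<Union>j\<in>J. {s j, t j, m j} \<inter> ?CN) \<le> (\<Sum>j\<in>J. card ({s j, t j, m j} \<inter> ?CN))"
      using finJ by (rule card_UN_le)
    also have "\<dots> \<le> (\<Sum>j\<in>J. 2 + (if j \<in> I3 i then 1 else 0))"
    proof (rule sum_mono)
      fix j assume "j \<in> J"
      then show "card ({s j, t j, m j} \<inter> ?CN) \<le> 2 + (if j \<in> I3 i then 1 else 0)"
        using card_inter_triple(1,2)[of "s j" "t j" "m j" ?CN] by (auto simp: I3_def)
    qed
    also have "\<dots> = 2 * card J + card (I3 i)"
      unfolding sum_two_plus[OF finJ] by (simp add: I3_def)
    also have "card (\<Union>j\<in>R - {i}. {s j, t j} \<inter> ?CN) \<le> (\<Sum>j\<in>R - {i}. card ({s j, t j} \<inter> ?CN))"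
      using finR by (intro card_UN_le) auto
    also have "\<dots> \<le> (\<Sum>j\<in>R - {i}. 2)" by (intro sum_mono card_inter_triple(3))
    also have "\<dots> = 2 * (card R - 1)" using i finR by simp
    finally have "card ?CN \<le> 2 * card J + card (I3 i) + 2 * (card R - 1)" by simp
    moreover have "1 \<le> card R" using i finR by (metis card_0_eq empty_iff less_one linorder_not_less)
    ultimately show ?thesis using c1 cJR by linarith
  qed
  \<comment> \<open>Inclusion-exclusion inside \<open>U\<close>, with \<open>half\<close> for both
    vertices and \<open>cI3\<close> for the gain. The numerical hypothesis \<open>dn\<close> is
    exactly what this sum requires.\<close>
  have com: "3 * card R \<le> card (N u \<inter> N w \<inter> U) + 2" if i: "i \<in> R" and u: "u \<in> U" and w: "w \<in> U" for i u w
  proof -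
    \<comment> \<open>Outside \<open>U\<close>, the vertex \<open>u\<close> has at most three
      neighbours in a joined triple, at most two if the index is in \<open>I3 i\<close>, and at most
      one in an unjoined pair.\<close>
    have half: "d \<le> card (N u \<inter> U) + 3 * card J + card R - card (I3 i)" "card (I3 i) \<le> card J" if u: "u \<in> U" for u
    proof -
      have "N u \<subseteq> (N u \<inter> U) \<union> ((\<Union>j\<in>J. {s j, t j, m j} \<inter> N u) \<union> (\<Union>j\<in>R. {s j, t j} \<inter> N u))"
        unfolding U_def T_def Mid_def R_def by (auto simp: NE)
      then have "card (N u) \<le> card ((N u \<inter> U) \<union> ((\<Union>j\<in>J. {s j, t j, m j} \<inter> N u) \<union> (\<Union>j\<in>R. {s j, t j} \<inter> N u)))"
        using finJ finR finU by (intro card_mono) auto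
      also have "\<dots> \<le> card (N u \<inter> U) + card ((\<Union>j\<in>J. {s j, t j, m j} \<inter> N u) \<union> (\<Union>j\<in>R. {s j, t j} \<inter> N u))"
        by (rule card_Un_le)
      also have "card ((\<Union>j\<in>J. {s j, t j, m j} \<inter> N u) \<union> (\<Union>j\<in>R. {s j, t j} \<inter> N u)) \<le>
          card (\<Union>j\<in>J. {s j, t j, m j} \<inter> N u) + card (\<Union>j\<in>R. {s j, t j} \<inter> N u)"
        by (rule card_Un_le)
      also have "card (\<Union>j\<in>J. {s j, t j, m j} \<inter> N u) \<le> (\<Sum>j\<in>J. card ({s j, t j, m j} \<inter> N u))"
        using finJ by (rule card_UN_le)
      also have "\<dots> \<le> (\<Sum>j\<in>J. 2 + (if j \<notin> I3 i then 1 else 0))"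
      proof (rule sum_mono)
        fix j assume "j \<in> J"
        show "card ({s j, t j, m j} \<inter> N u) \<le> 2 + (if j \<notin> I3 i then 1 else 0)"
        proof (cases "j \<in> I3 i")
          case True
          then have "\<not> {s j, t j, m j} \<subseteq> N u" using noI3[OF i _ u] by (auto simp: NE)
          from card_inter_triple(2)[OF this] show ?thesis by simp
        next
          case False
          then show ?thesis using card_inter_triple(1)[of "s j" "t j" "m j" "N u"] by simp
        qed
      qed
      also have "\<dots> = 2 * card J + card {j \<in> J. j \<notin> I3 i}"
        by (rule sum_two_plus[OF finJ])
      also have "{j \<in> J. j \<notin> I3 i} = J - I3 i" by auto
      also have "card (J - I3 i) = card J - card (I3 i)"
        using finJ by (intro card_Diff_subset) (auto simp: I3_def)
      also have "card (\<Union>j\<in>R. {s j, t j} \<inter> N u) \<le> (\<Sum>j\<in>R. card ({s j, t j} \<inter> N u))"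
        using finR by (rule card_UN_le)
      also have "\<dots> \<le> (\<Sum>j\<in>R. 1)"
      proof (rule sum_mono)
        fix j assume "j \<in> R"
        then have "\<not> {s j, t j} \<subseteq> N u" using noU[of j u] u Esym by (auto simp: NE)
        then show "card ({s j, t j} \<inter> N u) \<le> 1" by (rule card_inter_triple(4))
      qed
      also have "\<dots> = card R" by simp
      finally have "card (N u) \<le> card (N u \<inter> U) + (2 * card J + (card J - card (I3 i)) + card R)" by simp
      moreover show "card (I3 i) \<le> card J" using finJ by (intro card_mono) (auto simp: I3_def)
      moreover have "d \<le> card (N u)" using u by (intro degN) (auto simp: U_def)
      ultimately show "d \<le> card (N u \<inter> U) + 3 * card J + card R - card (I3 i)" by linarith
    qed
    have "card (N u \<inter> U) + card (N w \<inter> U) = card ((N u \<inter> U) \<union> (N w \<inter> U)) + card ((N u \<inter> U) \<inter> (N w \<inter> U))"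
      using finU by (intro card_Un_Int) auto
    moreover have "card ((N u \<inter> U) \<union> (N w \<inter> U)) \<le> card U" using finU by (intro card_mono) auto
    moreover have "(N u \<inter> U) \<inter> (N w \<inter> U) = N u \<inter> N w \<inter> U" by auto
    ultimately have "card (N u \<inter> U) + card (N w \<inter> U) \<le> card U + card (N u \<inter> N w \<inter> U)" by simp
    then show ?thesis using half[OF u] half[OF w] cI3[OF i] cU cJR dn by linarith
  qed
  have big: "card R < card (N x \<inter> U)" if x: "x \<in> s ` R \<union> t ` R" for x
  proof -
    have xT: "x \<in> T" using x by (auto simp: T_def R_def)
    have "N x \<subseteq> (N x \<inter> U) \<union> ((T - {x}) \<union> Mid)" using Eirr by (auto simp: NE U_def)
    then have "card (N x) \<le> card ((N x \<inter> U) \<union> ((T - {x}) \<union> Mid))"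
      using finU fin TC finJ by (intro card_mono) (auto simp: Mid_def dest: finite_subset)
    also have "\<dots> \<le> card (N x \<inter> U) + (card (T - {x}) + card Mid)"
      by (intro order_trans[OF card_Un_le] add_left_mono card_Un_le)
    also have "card (T - {x}) = 2 * L - 1" using xT cT by (simp add: card_Diff_singleton)
    finally have "card (N x) \<le> card (N x \<inter> U) + (2 * L - 1 + card J)" using cMid by simp
    moreover have "0 < L" using x by (auto simp: R_def)
    ultimately show ?thesis using degN[of x] xT TC d cJR by fastforce
  qed
  \<comment> \<open>These are the second and the fourth vertices of the remaining paths. By
    \<open>noU\<close>, the candidates next to \<open>s i\<close> and next to \<open>t i\<close> are
    disjoint.\<close>
  have "\<exists>f g. inj_on f R \<and> inj_on g R \<and> f ` R \<inter> g ` R = {} \<and> (\<forall>i\<in>R. f i \<in> N (s i) \<inter> U \<and> g i \<in> N (t i) \<inter> U)"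
  proof (rule paired_representatives[OF finR])
    fix i assume i: "i \<in> R"
    show "finite (N (s i) \<inter> U) \<and> finite (N (t i) \<inter> U) \<and> N (s i) \<inter> U \<inter> (N (t i) \<inter> U) = {}"
      using finU noU[OF i] Esym by (auto simp: NE)
    show "card R < card (N (s i) \<inter> U) \<and> card R < card (N (t i) \<inter> U)" using big i by auto
  qed
  then obtain f g where fg: "inj_on f R" "inj_on g R" "f ` R \<inter> g ` R = {}"
    and fgU: "\<forall>i\<in>R. f i \<in> N (s i) \<inter> U \<and> g i \<in> N (t i) \<inter> U"
    by (elim exE conjE) (rule that)
  have f: "f i \<in> N (s i) \<inter> U" and g: "g i \<in> N (t i) \<inter> U" if "i \<in> R" for i
    using bspec[OF fgU that] by simp_all
  \<comment> \<open>Of the at least \<open>3 * card R - 2\<close> common neighbours of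
    \<open>f i\<close> and \<open>g i\<close>, the values of \<open>f\<close> and \<open>g\<close>
    at other indices exclude at most \<open>2 * (card R - 1)\<close>, and \<open>f i\<close>,
    \<open>g i\<close> are not among them; \<open>card R\<close> candidates are left.\<close>
  have "\<exists>h. inj_on h R \<and> (\<forall>i\<in>R. h i \<in> (N (f i) \<inter> N (g i) \<inter> U) - (f ` R \<union> g ` R))"
  proof (rule greedy_representatives[OF finR])
    fix i assume i: "i \<in> R"
    let ?X = "N (f i) \<inter> N (g i) \<inter> U"
    have "?X - (f ` R \<union> g ` R) = ?X - (f ` (R - {i}) \<union> g ` (R - {i}))" using Eirr by (auto simp: NE)
    moreover have "card ?X - card (f ` (R - {i}) \<union> g ` (R - {i})) \<le> card (?X - (f ` (R - {i}) \<union> g ` (R - {i})))"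
      using finR by (intro diff_card_le_card_Diff) auto
    moreover have "card (f ` (R - {i}) \<union> g ` (R - {i})) \<le> 2 * (card R - 1)"
      using card_Un_le[of "f ` (R - {i})" "g ` (R - {i})"] card_image_le[of "R - {i}" f] card_image_le[of "R - {i}" g]
        finR i by simp
    moreover have "0 < card R" using i finR by (auto simp: card_gt_0_iff)
    ultimately show "finite (?X - (f ` R \<union> g ` R)) \<and> card R \<le> card (?X - (f ` R \<union> g ` R))"
      using com[OF i, of "f i" "g i"] f[OF i] g[OF i] finU by auto
  qed
  then obtain h where h_inj: "inj_on h R"
    and hall: "\<forall>i\<in>R. h i \<in> (N (f i) \<inter> N (g i) \<inter> U) - (f ` R \<union> g ` R)" by (elim exE conjE) (rule that)
  note h = bspec[OF hall]
  define p where "p = (\<lambda>i. if i \<in> J then [s i, m i, t i] else [s i, f i, h i, g i, t i])"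
  have UT: "u \<notin> T" "u \<notin> Mid" "u \<in> C" if "u \<in> U" for u using that by (auto simp: U_def)
  have sT: "i < L \<Longrightarrow> s i \<in> T" and tT: "i < L \<Longrightarrow> t i \<in> T" for i by (auto simp: T_def)
  have inR: "i \<in> R" if "i < L" "i \<notin> J" for i using that by (simp add: R_def)
  have fU: "f i \<in> U" "E (s i) (f i)" and gU: "g i \<in> U" "E (t i) (g i)"
    and hU: "h i \<in> U" "E (f i) (h i)" "E (g i) (h i)" "h i \<notin> f ` R" "h i \<notin> g ` R" if "i \<in> R" for i
    using f[OF that] g[OF that] h[OF that] by (auto simp: NE)
  have Midm: "i \<in> J \<Longrightarrow> m i \<in> Mid" for i by (simp add: Mid_def)
  have MT: "x \<in> Mid \<Longrightarrow> x \<notin> T \<and> x \<in> C" for x using mCT by (auto simp: Mid_def)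
  have pT: "set (p i) \<inter> T \<subseteq> {s i, t i}" if "i < L" for i
    using that UT(1)[OF fU(1)[OF inR]] UT(1)[OF gU(1)[OF inR]] UT(1)[OF hU(1)[OF inR]] MT[OF Midm] by (auto simp: p_def)
  have pinner: "set (p i) - T \<subseteq> (if i \<in> J then {m i} else {f i, g i, h i})" if "i < L" for i
    using that sT tT by (auto simp: p_def)
  show "\<exists>p. (\<forall>i<L. gpath E (p i) \<and> 3 \<le> length (p i) \<and> hd (p i) = s i \<and> last (p i) = t i \<and> set (p i) \<subseteq> C) \<and>
          (\<forall>i<L. \<forall>j<L. i \<noteq> j \<longrightarrow> set (p i) \<inter> set (p j) = {})"
  proof (intro exI[of _ p] conjI allI impI)
    fix i assume i: "i < L"
    have ne: "s i \<noteq> t i" using st_ne i by blast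
    show "gpath E (p i)"
    proof (cases "i \<in> J")
      case True
      have "m i \<noteq> s i" "m i \<noteq> t i" using MT[OF Midm[OF True]] sT[OF i] tT[OF i] by auto
      then show ?thesis using True mE ne by (auto simp: p_def gpath_def)
    next
      case False
      note R = inR[OF i False]
      have "f i \<noteq> g i" using fg(3) R by auto
      moreover have "h i \<noteq> f i" "h i \<noteq> g i" using hU(4,5)[OF R] R by auto
      moreover have "s i \<notin> U" "t i \<notin> U" using UT sT[OF i] tT[OF i] by auto
      ultimately show ?thesis using fU[OF R] gU[OF R] hU(1-3)[OF R] ne False Esym
        by (auto simp: p_def gpath_def)
    qed
    show "3 \<le> length (p i)" "hd (p i) = s i" "last (p i) = t i" by (auto simp: p_def)
    show "set (p i) \<subseteq> C" using i sC tC MT[OF Midm] UT(3)[OF fU(1)[OF inR]] UT(3)[OF gU(1)[OF inR]] UT(3)[OF hU(1)[OF inR]]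
      by (auto simp: p_def)
  next
    fix i j assume ij: "i < L" "j < L" "i \<noteq> j"
    have a: "{s i, t i} \<inter> {s j, t j} = {}" using s_inj t_inj st_ne ij by (metis Int_insert_left_if0 inf_bot_left insert_iff singletonD)
    have b: "(if i \<in> J then {m i} else {f i, g i, h i}) \<inter> (if j \<in> J then {m j} else {f j, g j, h j}) = {}"
    proof -
      have JJ: "m i \<noteq> m j" if "i \<in> J" "j \<in> J" using m_inj that ij(3) by (auto simp: inj_on_def)
      have JR: "m a \<notin> {f b, g b, h b}" if "a \<in> J" "b \<in> R" for a b
        using Midm[OF that(1)] UT(2)[OF fU(1)[OF that(2)]] UT(2)[OF gU(1)[OF that(2)]] UT(2)[OF hU(1)[OF that(2)]] by auto
      have RR: "{f i, g i, h i} \<inter> {f j, g j, h j} = {}" if "i \<in> R" "j \<in> R"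
      proof -
        have "f i \<noteq> f j" "g i \<noteq> g j" "h i \<noteq> h j" using fg h_inj that ij(3) by (auto simp: inj_on_def)
        moreover have "f i \<noteq> g j" "g i \<noteq> f j" using fg(3) that by auto
        moreover have "h i \<noteq> f j" "h i \<noteq> g j" "h j \<noteq> f i" "h j \<noteq> g i" using hU(4,5) that by auto
        ultimately show ?thesis by auto
      qed
      show ?thesis using JJ JR[of i j] JR[of j i] RR inR[OF ij(1)] inR[OF ij(2)] by auto
    qed
    show "set (p i) \<inter> set (p j) = {}"
      using a b pT[OF ij(1)] pT[OF ij(2)] pinner[OF ij(1)] pinner[OF ij(2)] by blast
  qed
qed

text \<open>Applied to a path that cannot be shortened by a detour through an outside vertex
  \<open>u\<close>, with the neighbours of \<open>u\<close> as \<open>Q\<close>: any two of them are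
  at most two steps apart, so all lie within three consecutive places from the first one on.\<close>

lemma window_of_three:
  assumes "distinct p"
    and "\<And>a x m y b. p = a @ x # m @ y # b \<Longrightarrow> x \<in> Q \<Longrightarrow> y \<in> Q \<Longrightarrow> length m \<le> 1"
  shows "card (set p \<inter> Q) \<le> 3"
    and "2 < card (set p \<inter> Q) \<Longrightarrow> \<exists>a x y z b. p = a @ x # y # z # b \<and> {x, y, z} \<subseteq> Q"
proof -
  have "card (set p \<inter> Q) \<le> 3 \<and> (2 < card (set p \<inter> Q) \<longrightarrow> (\<exists>a x y z b. p = a @ x # y # z # b \<and> {x, y, z} \<subseteq> Q))"
  proof (cases "set p \<inter> Q = {}")
    case False
    then obtain a x r where p: "p = a @ x # r" and x: "x \<in> Q" and a: "set a \<inter> Q = {}"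
      by (rule split_first_in)
    have "set p \<inter> Q \<subseteq> set (take 3 (x # r))"
    proof
      fix y assume y: "y \<in> set p \<inter> Q"
      show "y \<in> set (take 3 (x # r))"
      proof (cases "y = x")
        case False
        then have "y \<in> set r" using y p a by auto
        then obtain m b where r: "r = m @ y # b" by (meson split_list)
        with assms(2)[of a x m y b] p x y have "length m \<le> 1" by auto
        then show ?thesis unfolding r by (cases m) (auto simp: numeral_3_eq_3)
      qed (simp add: numeral_3_eq_3)
    qed
    then have sub: "set p \<inter> Q \<subseteq> set (take 3 (x # r)) \<inter> Q" by auto
    then have le: "card (set p \<inter> Q) \<le> card (set (take 3 (x # r)) \<inter> Q)" by (intro card_mono) auto
    also have "\<dots> \<le> card (set (take 3 (x # r)))" by (intro card_mono) auto
    also have "\<dots> \<le> 3" using card_length[of "take 3 (x # r)"] by simp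
    finally have "card (set p \<inter> Q) \<le> 3" .
    moreover have "\<exists>a x y z b. p = a @ x # y # z # b \<and> {x, y, z} \<subseteq> Q" if c: "2 < card (set p \<inter> Q)"
    proof -
      have "2 < length (take 3 (x # r))"
        using c le card_mono[of "set (take 3 (x # r))" "set (take 3 (x # r)) \<inter> Q"] card_length[of "take 3 (x # r)"]
        by simp
      then obtain y z b where r: "r = y # z # b"
        by (metis (no_types, lifting) One_nat_def Suc_1 length_Cons length_take less_Suc_eq list.exhaust list.size(3) min.absorb2
            min_less_iff_conj nat_less_le not_less_eq numeral_3_eq_3 zero_less_Suc)
      have "{x, y, z} \<subseteq> Q"
      proof (rule ccontr)
        assume "\<not> {x, y, z} \<subseteq> Q"
        then have "card ({x, y, z} \<inter> Q) \<le> 2" by (rule card_inter_triple(2))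
        then show False using c le by (simp add: r numeral_3_eq_3)
      qed
      with p r show ?thesis by blast
    qed
    ultimately show ?thesis by blast
  qed simp
  then show "card (set p \<inter> Q) \<le> 3"
    and "2 < card (set p \<inter> Q) \<Longrightarrow> \<exists>a x y z b. p = a @ x # y # z # b \<and> {x, y, z} \<subseteq> Q" by blast+
qed

text \<open>Assume the contrary, so the whole graph is not linked, and take a system of short paths that joins as many pairs as
  possible, with few vertices, and leaves a pair \<open>(s, t)\<close> unjoined. The vertices outside the system split into those at
  distance at most two from \<open>s\<close> and those at distance at most two from \<open>t\<close>, with no edge between the two parts, and the
  smaller part is dense enough for the preceding lemma.\<close>

lemma dense_contains_slinked:
  assumes fin: "finite D" and sym: "symp E" and irr: "irreflp E" and ne: "D \<noteq> {}"
    and deg: "\<And>x. x \<in> D \<Longrightarrow> 6 * L \<le> card {y \<in> D. E x y}" and small: "card D \<le> 12 * L"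
  shows "\<exists>C\<subseteq>D. 2 * L \<le> card C \<and> slinked C E L"
proof (cases "slinked D E L")
  case True
  obtain x where "x \<in> D" using ne by blast
  then have "6 * L \<le> card {y \<in> D. E x y}" by (rule deg)
  also have "\<dots> \<le> card D" using fin by (intro card_mono) auto
  finally show ?thesis using True by auto
next
  case False
  then obtain s t where st: "pairing {..<L} s t D"
    and unlinked: "\<And>p. (\<forall>i<L. gpath E (p i) \<and> 3 \<le> length (p i) \<and> hd (p i) = s i \<and> last (p i) = t i \<and> set (p i) \<subseteq> D) \<Longrightarrow>
          (\<forall>i<L. \<forall>j<L. i \<noteq> j \<longrightarrow> set (p i) \<inter> set (p j) = {}) \<Longrightarrow> False"
    unfolding slinked_def by blast
  define N where "N = (\<lambda>x. {y \<in> D. E x y})"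
  have finN: "finite (N x)" for x using fin by (simp add: N_def)
  have degN: "x \<in> D \<Longrightarrow> 6 * L \<le> card (N x)" for x using deg by (simp add: N_def)
  have NE: "y \<in> N x \<longleftrightarrow> y \<in> D \<and> E x y" for x y by (simp add: N_def)
  have Esym: "E x y \<longleftrightarrow> E y x" for x y using sym by (auto dest: sympD)
  have Eirr: "\<not> E x x" for x using irr by (auto dest: irreflpD)
  define T where "T = s ` {..<L} \<union> t ` {..<L}"
  have sD: "i < L \<Longrightarrow> s i \<in> D" and tD: "i < L \<Longrightarrow> t i \<in> D" for i using st by (auto simp: pairing_def)
  have sT: "i < L \<Longrightarrow> s i \<in> T" and tT: "i < L \<Longrightarrow> t i \<in> T" for i by (auto simp: T_def)
  have cT: "card T = 2 * L" unfolding T_def using pairing_card[OF st] .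
  have TD: "T \<subseteq> D" using sD tD by (auto simp: T_def)
  have s_inj: "s i = s j \<longleftrightarrow> i = j" and t_inj: "t i = t j \<longleftrightarrow> i = j" and st_ne: "s i \<noteq> t j"
    if "i < L" "j < L" for i j
    using st that by (auto simp: pairing_def inj_on_def)
  have ends_disj: "{s i, t i} \<inter> {s j, t j} = {}" if "i < L" "j < L" "i \<noteq> j" for i j
    using s_inj[OF that(1,2)] t_inj[OF that(1,2)] st_ne[OF that(1,2)] st_ne[OF that(2,1)] that(3) by auto
  \<comment> \<open>Six vertices leave room for four inner ones: a neighbour of each end and two
    adjacent vertices between them. This is what makes the balls of radius two around
    \<open>s j\<close> and \<open>t j\<close> disjoint without edges between them.\<close>
  define ok where "ok = (\<lambda>i p. gpath E p \<and> 3 \<le> length p \<and> length p \<le> 6 \<and> hd p = s i \<and> last p = t i \<and>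
      set p \<subseteq> D \<and> set p \<inter> T \<subseteq> {s i, t i})"
  define sys where "sys = (\<lambda>J P. J \<subseteq> {..<L} \<and> (\<forall>i\<in>J. ok i (P i)) \<and>
      (\<forall>i\<in>J. \<forall>k\<in>J. i \<noteq> k \<longrightarrow> set (P i) \<inter> set (P k) = {}))"
  define uu where "uu = (\<lambda>(J :: nat set) P. D - T - (\<Union>i\<in>J. set (P i :: 'a list)))"
  define tot where "tot = (\<lambda>(J :: nat set) P. \<Sum>i\<in>J. length (P i :: 'a list))"
  have add: "sys (insert i J) (P(i := p))"
    if "sys J P" "i < L" "i \<notin> J" "ok i p" "set p - T \<subseteq> uu J P" for J P i p
  proof -
    have "set p \<inter> set (P k) = {}" if k: "k \<in> J" for k
    proof -
      have kL: "k < L" "k \<noteq> i" using k that \<open>sys J P\<close> \<open>i \<notin> J\<close> by (auto simp: sys_def)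
      have "set (P k) \<inter> T \<subseteq> {s k, t k}" "set p \<inter> T \<subseteq> {s i, t i}"
        using \<open>sys J P\<close> k \<open>ok i p\<close> by (auto simp: sys_def ok_def)
      then show ?thesis using ends_disj[OF kL(1) \<open>i < L\<close> kL(2)] \<open>set p - T \<subseteq> uu J P\<close> k
        unfolding uu_def by blast
    qed
    then show ?thesis using that unfolding sys_def by (auto simp: Int_commute)
  qed
  have dropP: "sys (J - {i}) P" "uu (J - {i}) P \<supseteq> uu J P \<union> (set (P i) - T)" if "sys J P" "i \<in> J" for J P i
  proof -
    show "sys (J - {i}) P" using that by (auto simp: sys_def)
    have "set (P i) \<subseteq> D" using that by (auto simp: sys_def ok_def)
    moreover have "set (P i) \<inter> set (P k) = {}" if "k \<in> J - {i}" for k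
      using \<open>sys J P\<close> \<open>i \<in> J\<close> that by (auto simp: sys_def)
    ultimately show "uu (J - {i}) P \<supseteq> uu J P \<union> (set (P i) - T)" unfolding uu_def by blast
  qed
  have finJ: "finite J" if "sys J P" for J P using that finite_subset by (auto simp: sys_def)
  have "sys {} undefined" by (simp add: sys_def)
  moreover have "card J < Suc L" if "sys J P" for J P
    using that card_mono[of "{..<L}" J] by (simp add: sys_def)
  ultimately have "\<exists>J. (\<exists>P. sys J P) \<and> (\<forall>J'. (\<exists>P. sys J' P) \<longrightarrow> card J' \<le> card J)"
    by (intro ex_has_greatest_nat[of _ "{}" _ "Suc L"]) blast+
  then obtain J0 P0 where J0: "sys J0 P0" and Jmax: "\<And>J' P'. sys J' P' \<Longrightarrow> card J' \<le> card J0" by blast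
  define M where "M = card J0"
  have Mmax: "card J' \<le> M" if "sys J' P'" for J' P' using Jmax[OF that] by (simp add: M_def)
  have M_less: "M < L"
  proof (rule ccontr)
    assume "\<not> M < L"
    then have "J0 = {..<L}" using J0 by (intro card_subset_eq) (auto simp: M_def sys_def dest: card_mono[rotated])
    then show False using J0 by (intro unlinked[of P0]) (auto simp: sys_def ok_def)
  qed
  have "\<exists>JP. (sys (fst JP) (snd JP) \<and> card (fst JP) = M) \<and>
      (\<forall>JP'. sys (fst JP') (snd JP') \<and> card (fst JP') = M \<longrightarrow> tot (fst JP) (snd JP) \<le> tot (fst JP') (snd JP'))"
    by (rule ex_has_least_nat[of _ "(J0, P0)"]) (simp add: J0 M_def)
  then obtain J1 P1 where J1: "sys J1 P1" "card J1 = M"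
    and tmin: "\<And>J' P'. sys J' P' \<Longrightarrow> card J' = M \<Longrightarrow> tot J1 P1 \<le> tot J' P'" by force
  \<comment> \<open>The choice is extremal in three stages: as many joined pairs as possible, then
    the smallest total length, and finally, over all such systems and unjoined indices
    \<open>j\<close>, the smallest \<open>ball\<close> around \<open>s j\<close>.\<close>
  define opt where "opt = (\<lambda>J P j. sys J P \<and> card J = M \<and> tot J P = tot J1 P1 \<and> j < L \<and> j \<notin> J)"
  define ball where "ball = (\<lambda>U x. {v \<in> U. E x v \<or> (\<exists>u\<in>U. E x u \<and> E u v)})"
  have "J1 \<noteq> {..<L}" using J1 M_less by auto
  then obtain j1 where "j1 < L" "j1 \<notin> J1" using J1(1) by (auto simp: sys_def)
  then have "opt J1 P1 j1" using J1 by (simp add: opt_def)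
  then have "\<exists>x. (case x of (J, P, j) \<Rightarrow> opt J P j) \<and>
     (\<forall>y. (case y of (J, P, j) \<Rightarrow> opt J P j) \<longrightarrow>
       (case x of (J, P, j) \<Rightarrow> card (ball (uu J P) (s j))) \<le> (case y of (J, P, j) \<Rightarrow> card (ball (uu J P) (s j))))"
    by (intro ex_has_least_nat[of _ "(J1, P1, j1)"]) simp
  then obtain J P j where opt: "opt J P j"
    and bmin: "\<And>J' P' j'. opt J' P' j' \<Longrightarrow> card (ball (uu J P) (s j)) \<le> card (ball (uu J' P') (s j'))"
    by force

  have nolink: "False" if o: "opt J P j" and i: "i < L" "i \<notin> J"
    and w: "set w \<subseteq> uu J P" "length w \<le> 4" "successively E (s i # w @ [t i])" "w \<noteq> []" for J P j i w
  proof -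
    let ?E = "\<lambda>x y. E x y \<and> (x \<in> uu J P \<or> y \<in> uu J P)"
    have "successively ?E w" using w by (auto simp: successively_Cons successively_append_iff intro: successively_mono)
    then have "successively ?E (s i # w @ [t i])"
      using w by (auto simp: successively_Cons successively_append_iff dest: hd_in_set last_in_set)
    from walk_to_path[OF _ this] obtain p where p: "gpath ?E p" "set p \<subseteq> set (s i # w @ [t i])"
      "hd p = s i" "last p = t i" by auto
    have sti: "s i \<noteq> t i" using st_ne i by blast
    have nU: "s i \<notin> uu J P" "t i \<notin> uu J P" using sT tT i by (auto simp: uu_def)
    have "3 \<le> length p"
    proof (rule ccontr)
      assume "\<not> 3 \<le> length p"
      then consider "length p = 0" | "length p = 1" | "length p = 2" by linarith
      then show False
      proof cases
        case 2
        then obtain x where "p = [x]" by (metis One_nat_def length_0_conv length_Suc_conv)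
        then show False using p sti by simp
      next
        case 3
        then obtain x y where "p = [x, y]" by (metis One_nat_def Suc_1 length_0_conv length_Suc_conv)
        then show False using p nU by (simp add: gpath_def)
      qed (use p in auto)
    qed
    moreover have "length p \<le> 6"
    proof -
      have "length p = card (set p)" using p by (simp add: gpath_def distinct_card)
      also have "\<dots> \<le> card (set (s i # w @ [t i]))" using p by (intro card_mono) auto
      also have "\<dots> \<le> 6" using card_length[of "s i # w @ [t i]"] w by simp
      finally show ?thesis .
    qed
    moreover have "gpath E p" using p(1) by (auto elim: gpath_mono)
    moreover have wU: "set w \<subseteq> D" "set w \<inter> T = {}" using w(1) by (auto simp: uu_def)
    moreover have "set p \<subseteq> D" "set p \<inter> T \<subseteq> {s i, t i}"
      using p(2) wU sD[OF i(1)] tD[OF i(1)] by auto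
    moreover have "set p - T \<subseteq> set w" using p(2) sT[OF i(1)] tT[OF i(1)] by auto
    then have "set p - T \<subseteq> uu J P" using w(1) by (rule order_trans)
    ultimately have "sys (insert i J) (P(i := p))"
      using o i p by (intro add) (auto simp: opt_def ok_def)
    from Mmax[OF this] show False using o i finJ by (auto simp: opt_def)
  qed
  have noboth: "\<not> (E (s i) u \<and> E u (t i))" if "opt J P j" "i < L" "i \<notin> J" "u \<in> uu J P" for J P j i u
    using nolink[OF that(1-3), of "[u]"] that(4) by auto
  have tot_upd: "tot (insert i (J - {i'})) (P(i := p)) + length (P i') = tot J P + length p"
    if "sys J P" "i' \<in> J" "i = i' \<or> i \<notin> J" for J P i i' p
  proof -
    have "(\<Sum>k\<in>J - {i'}. length ((P(i := p)) k)) = (\<Sum>k\<in>J - {i'}. length (P k))"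
      using that by (intro sum.cong) auto
    moreover have "finite (J - {i'})" "i \<notin> J - {i'}" using that finJ[OF that(1)] by auto
    ultimately have "tot (insert i (J - {i'})) (P(i := p)) = length p + (\<Sum>k\<in>J - {i'}. length (P k))"
      unfolding tot_def by (simp add: sum.insert)
    moreover have "tot J P = length (P i') + (\<Sum>k\<in>J - {i'}. length (P k))"
      using that finJ[OF that(1)] unfolding tot_def by (subst sum.remove[of _ i']) auto
    ultimately show ?thesis by simp
  qed
  \<comment> \<open>Minimality of the total length forbids a shorter replacement; one of equal
    length again gives an optimal system.\<close>
  have replace: "length (P i) \<le> length p \<and> (length (P i) = length p \<longrightarrow> opt J (P(i := p)) j)"
    if o: "opt J P j" and i: "i \<in> J" and p: "ok i p" "set p - T \<subseteq> uu J P \<union> set (P i)" for J P j i p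
  proof -
    have sysJ: "sys J P" and iL: "i < L" using o i by (auto simp: opt_def sys_def)
    have "sys (insert i (J - {i})) (P(i := p))"
      using dropP[OF sysJ i] iL p by (intro add) auto
    then have sys': "sys J (P(i := p))" using i by (simp add: insert_absorb)
    moreover have "tot J (P(i := p)) + length (P i) = tot J P + length p"
      using tot_upd[OF sysJ i, of i p] i by (simp add: insert_absorb)
    moreover have "tot J1 P1 \<le> tot J (P(i := p))" using tmin[OF sys'] o by (simp add: opt_def)
    ultimately show ?thesis using o by (auto simp: opt_def)
  qed
  have window: "length m \<le> 1"
    if o: "opt J P j" and i: "i \<in> J" and u: "u \<in> uu J P" and P: "P i = a @ x # m @ y # b" "E u x" "E u y" for J P j i u a x m y b
  proof (rule ccontr)
    assume m: "\<not> length m \<le> 1"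
    have okP: "ok i (P i)" using o i by (auto simp: opt_def sys_def)
    have uP: "u \<notin> set (P i)" "u \<notin> T" "u \<in> D" using u i by (auto simp: uu_def)
    have "gpath E (a @ x # u # y # b)"
      using okP uP(1) P Esym unfolding ok_def P(1) gpath_def by (auto simp: successively_append_iff successively_Cons)
    moreover have "hd (a @ x # u # y # b) = s i" "last (a @ x # u # y # b) = t i"
      using okP unfolding ok_def P(1) by (cases a; simp)+
    ultimately have "ok i (a @ x # u # y # b)" using okP uP m unfolding ok_def P(1) by auto
    then have "length (P i) \<le> length (a @ x # u # y # b)"
      using replace[OF o i, of "a @ x # u # y # b"] P(1) u by auto
    then show False using m P(1) by simp
  qed
  have nbs3: "card (set (P i) \<inter> N u) \<le> 3"
       "2 < card (set (P i) \<inter> N u) \<Longrightarrow> \<exists>a x y z b. P i = a @ x # y # z # b \<and> {x, y, z} \<subseteq> N u"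
    if o: "opt J P j" and i: "i \<in> J" and u: "u \<in> uu J P" for J P j i u
  proof -
    have "distinct (P i)" using o i by (auto simp: opt_def sys_def ok_def gpath_def)
    moreover have "length m \<le> 1" if "P i = a @ x # m @ y # b" "x \<in> N u" "y \<in> N u" for a x m y b
      using window[OF o i u] that by (auto simp: NE)
    ultimately show "card (set (P i) \<inter> N u) \<le> 3"
       "2 < card (set (P i) \<inter> N u) \<Longrightarrow> \<exists>a x y z b. P i = a @ x # y # z # b \<and> {x, y, z} \<subseteq> N u"
      using window_of_three[of "P i" "N u"] by blast+
  qed
  \<comment> \<open>Giving up the pair \<open>i\<close> and joining \<open>j\<close> through
    \<open>x\<close> by three vertices keeps the number of joined pairs and lowers the total
    length.\<close>
  have noshare: "False"
    if o: "opt J P j" and i: "i \<in> J" and x: "x \<in> set (P i)" "x \<noteq> s i" "x \<noteq> t i" "E (s j) x" "E x (t j)"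
      and len: "4 \<le> length (P i)" for J P j i x
  proof -
    have sysJ: "sys J P" and iL: "i < L" and jL: "j < L" and jJ: "j \<notin> J" and okP: "ok i (P i)"
      using o i by (auto simp: opt_def sys_def)
    have xT: "x \<notin> T" "x \<in> D" using okP x by (auto simp: ok_def)
    have "s j \<noteq> t j" using st_ne jL by blast
    then have "ok j [s j, x, t j]"
      using xT x(4,5) sT[OF jL] tT[OF jL] sD[OF jL] tD[OF jL] by (auto simp: ok_def gpath_def)
    then have sys': "sys (insert j (J - {i})) (P(j := [s j, x, t j]))"
      using dropP[OF sysJ i] jJ jL x(1) xT sT[OF jL] tT[OF jL] by (intro add) auto
    have "card (insert j (J - {i})) = M" using o jJ card_Suc_Diff1[OF finJ[OF sysJ] i] finJ[OF sysJ] by (simp add: opt_def)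
    then have "tot J1 P1 \<le> tot (insert j (J - {i})) (P(j := [s j, x, t j]))" by (rule tmin[OF sys'])
    then show False using tot_upd[OF sysJ i, of j "[s j, x, t j]"] jJ len o by (simp add: opt_def)
  qed
  have cards: "card J + card ({..<L} - J) = L" "finite J" "1 \<le> card ({..<L} - J)"
    "card D = card (uu J P) + tot J P + 2 * card ({..<L} - J)" if o: "opt J P j" for J P j
  proof -
    have sysJ: "sys J P" using o by (simp add: opt_def)
    then have JL: "J \<subseteq> {..<L}" by (simp add: sys_def)
    show fJ: "finite J" by (rule finJ[OF sysJ])
    show LJ: "card J + card ({..<L} - J) = L" using JL fJ card_mono[OF _ JL] by (simp add: card_Diff_subset)
    show "1 \<le> card ({..<L} - J)" using o LJ M_less by (auto simp: opt_def)
    define Q where "Q = (\<Union>i\<in>J. set (P i))"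
    have cQ: "card Q = tot J P"
      unfolding Q_def tot_def using sysJ fJ
      by (subst card_UN_disjoint) (auto simp: sys_def ok_def gpath_def distinct_card intro!: sum.cong)
    define Q' where "Q' = s ` ({..<L} - J) \<union> t ` ({..<L} - J)"
    have "s ` {..<L} \<inter> t ` {..<L} = {}" "inj_on s {..<L}" "inj_on t {..<L}" using st by (auto simp: pairing_def)
    then have cQ': "card Q' = 2 * card ({..<L} - J)"
      unfolding Q'_def by (subst card_Un_disjoint) (auto simp: card_image inj_on_diff)
    have QD: "Q \<subseteq> D" using sysJ by (auto simp: Q_def sys_def ok_def)
    have Q'D: "Q' \<subseteq> T" by (auto simp: Q'_def T_def)
    have disj: "Q \<inter> Q' = {}"
    proof -
      have "v \<notin> Q'" if "v \<in> set (P i)" "i \<in> J" for v i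
      proof
        assume "v \<in> Q'"
        then obtain k where k: "k < L" "k \<notin> J" "v \<in> {s k, t k}" by (auto simp: Q'_def)
        have "set (P i) \<inter> T \<subseteq> {s i, t i}" using that sysJ by (simp add: sys_def ok_def)
        then have "v \<in> {s i, t i}" using that \<open>v \<in> Q'\<close> Q'D by blast
        moreover have "i < L" "i \<noteq> k" using k that JL by auto
        ultimately show False using ends_disj[OF \<open>i < L\<close> k(1)] k(3) by blast
      qed
      then show ?thesis by (auto simp: Q_def)
    qed
    have TQ: "T \<subseteq> Q \<union> Q'"
    proof -
      have "s i \<in> set (P i) \<and> t i \<in> set (P i)" if "i \<in> J" for i
        using sysJ that unfolding sys_def ok_def by (metis gpath_Nil hd_in_set last_in_set)
      then show ?thesis by (auto simp: T_def Q_def Q'_def)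
    qed
    have "D = uu J P \<union> (Q \<union> Q')" using TD QD Q'D TQ unfolding uu_def Q_def[symmetric] by blast
    moreover have "uu J P \<inter> (Q \<union> Q') = {}" using Q'D by (auto simp: uu_def Q_def)
    moreover have "finite Q" "finite Q'" "finite (uu J P)" using QD Q'D TD fin by (auto dest: finite_subset simp: uu_def)
    ultimately show "card D = card (uu J P) + tot J P + 2 * card ({..<L} - J)"
      using cQ cQ' disj by (metis card_Un_disjoint add.assoc finite_Un)
  qed
  have Nsplit: "card (N x) \<le> card (N x \<inter> uu J P) + ((\<Sum>i\<in>J. card (set (P i) \<inter> N x)) + (\<Sum>i\<in>{..<L} - J. card ({s i, t i} \<inter> N x)))"
    if o: "opt J P j" for J P j x
  proof -
    let ?R = "{..<L} - J"
    have fJ: "finite J" using cards[OF o] by blast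
    have "N x \<subseteq> (N x \<inter> uu J P) \<union> ((\<Union>i\<in>J. set (P i) \<inter> N x) \<union> (\<Union>i\<in>?R. {s i, t i} \<inter> N x))"
    proof
      fix y assume y: "y \<in> N x"
      show "y \<in> (N x \<inter> uu J P) \<union> ((\<Union>i\<in>J. set (P i) \<inter> N x) \<union> (\<Union>i\<in>?R. {s i, t i} \<inter> N x))"
      proof (cases "y \<in> T")
        case True
        then obtain i where i: "i < L" "y \<in> {s i, t i}" by (auto simp: T_def)
        show ?thesis
        proof (cases "i \<in> J")
          case True
          then have "y \<in> set (P i)" using i o unfolding opt_def sys_def ok_def
            by (metis gpath_Nil hd_in_set last_in_set insertE singletonD)
          then show ?thesis using y True by blast
        next
          case False
          then show ?thesis using y i by blast
        qed
      qed (use y in \<open>auto simp: uu_def NE\<close>)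
    qed
    then have "card (N x) \<le> card ((N x \<inter> uu J P) \<union> ((\<Union>i\<in>J. set (P i) \<inter> N x) \<union> (\<Union>i\<in>?R. {s i, t i} \<inter> N x)))"
      using fJ finN by (intro card_mono) auto
    also have "\<dots> \<le> card (N x \<inter> uu J P) + (card (\<Union>i\<in>J. set (P i) \<inter> N x) + card (\<Union>i\<in>?R. {s i, t i} \<inter> N x))"
      by (intro order_trans[OF card_Un_le] add_left_mono card_Un_le)
    also have "card (\<Union>i\<in>J. set (P i) \<inter> N x) \<le> (\<Sum>i\<in>J. card (set (P i) \<inter> N x))"
      using fJ by (rule card_UN_le)
    also have "card (\<Union>i\<in>?R. {s i, t i} \<inter> N x) \<le> (\<Sum>i\<in>?R. card ({s i, t i} \<inter> N x))"
      by (rule card_UN_le) simp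
    finally show ?thesis by simp
  qed
  have Rone: "(\<Sum>i\<in>{..<L} - J. card ({s i, t i} \<inter> N u)) \<le> card ({..<L} - J)"
    if o: "opt J P j" and u: "u \<in> uu J P" for J P j u
  proof -
    have "(\<Sum>i\<in>{..<L} - J. card ({s i, t i} \<inter> N u)) \<le> (\<Sum>i\<in>{..<L} - J. 1)"
    proof (rule sum_mono)
      fix i assume "i \<in> {..<L} - J"
      then have "\<not> {s i, t i} \<subseteq> N u" using noboth[OF o, of i u] u Esym by (auto simp: NE)
      then show "card ({s i, t i} \<inter> N u) \<le> 1" by (rule card_inter_triple(4))
    qed
    then show ?thesis by simp
  qed
  have finU: "finite (uu J P)" for J P using fin by (simp add: uu_def)
  have ballU: "ball U x \<subseteq> U" for U x by (auto simp: ball_def)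
  have apart: "v \<noteq> w \<and> \<not> E v w" if o: "opt J P j" and v: "v \<in> ball (uu J P) (s j)" and w: "w \<in> ball (uu J P) (t j)" for J P j v w
  proof -
    have jj: "j < L" "j \<notin> J" using o by (auto simp: opt_def)
    obtain a where a: "set a \<subseteq> uu J P" "length a \<le> 1" "successively E (s j # a @ [v])"
    proof (cases "E (s j) v")
      case True then show ?thesis using that[of "[]"] by simp
    next
      case False
      then obtain u where "u \<in> uu J P" "E (s j) u" "E u v" using v by (auto simp: ball_def)
      then show ?thesis using that[of "[u]"] by simp
    qed
    obtain b where b: "set b \<subseteq> uu J P" "length b \<le> 1" "successively E (w # b @ [t j])"
    proof (cases "E (t j) w")
      case True then show ?thesis using that[of "[]"] Esym by simp
    next
      case False
      then obtain u where "u \<in> uu J P" "E (t j) u" "E u w" using w by (auto simp: ball_def)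
      then show ?thesis using that[of "[u]"] Esym by simp
    qed
    have U: "v \<in> uu J P" "w \<in> uu J P" using v w by (auto simp: ball_def)
    have "v \<noteq> w"
    proof
      assume "v = w"
      then have "successively E (s j # (a @ v # b) @ [t j])"
        using a b by (auto simp: successively_append_iff successively_Cons hd_append)
      then show False using nolink[OF o jj, of "a @ v # b"] a b U by auto
    qed
    moreover have "\<not> E v w"
    proof
      assume "E v w"
      then have "successively E (s j # (a @ v # w # b) @ [t j])"
        using a b by (auto simp: successively_append_iff successively_Cons hd_append)
      then show False using nolink[OF o jj, of "a @ v # w # b"] a b U by auto
    qed
    ultimately show ?thesis by blast
  qed
  \<comment> \<open>A vertex \<open>z\<close> outside both balls has no common neighbour in
    \<open>uu J P\<close> with \<open>s j\<close> or \<open>t j\<close>, so the three neighbourhoods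
    there are disjoint, and \<open>z\<close> lies in none of them. Adding the three degrees, each at
    least \<open>6 * L\<close>, then exceeds what \<open>card D \<le> 12 * L\<close> allows.\<close>
  have cover: "uu J P = ball (uu J P) (s j) \<union> ball (uu J P) (t j)" if o: "opt J P j" for J P j
  proof (rule ccontr)
    let ?U = "uu J P" and ?R = "{..<L} - J"
    let ?S = "N (s j) \<inter> ?U" and ?T = "N (t j) \<inter> ?U"
    assume "?U \<noteq> ball ?U (s j) \<union> ball ?U (t j)"
    then obtain z where z: "z \<in> ?U" "z \<notin> ball ?U (s j)" "z \<notin> ball ?U (t j)" using ballU by blast
    have jj: "j < L" "j \<notin> J" using o by (auto simp: opt_def)
    have fJ: "finite J" using cards[OF o] by blast
    have sysJ: "sys J P" using o by (simp add: opt_def)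
    \<comment> \<open>The neighbourhoods of \<open>s j\<close> and \<open>t j\<close> share at most
      three vertices of a path: by \<open>noshare\<close> only its two ends if it has at least four
      vertices, and otherwise it has only three vertices.\<close>
    have pair: "card (set (P i) \<inter> N (s j)) + card (set (P i) \<inter> N (t j)) \<le> length (P i) + 3" if i: "i \<in> J" for i
    proof -
      let ?A = "set (P i) \<inter> N (s j)" and ?B = "set (P i) \<inter> N (t j)"
      have okP: "ok i (P i)" using sysJ i by (simp add: sys_def)
      then have len: "card (set (P i)) = length (P i)" by (simp add: ok_def gpath_def distinct_card)
      have "card ?A + card ?B = card (?A \<union> ?B) + card (?A \<inter> ?B)" by (rule card_Un_Int) auto
      moreover have "card (?A \<union> ?B) \<le> card (set (P i))" by (intro card_mono) auto
      moreover have "card (?A \<inter> ?B) \<le> 3"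
      proof (cases "4 \<le> length (P i)")
        case True
        have "x \<in> {s i, t i}" if "x \<in> ?A \<inter> ?B" for x
          using noshare[OF o i _ _ _ _ _ True, of x] that Esym[of "t j" x] by (auto simp: NE)
        then have "?A \<inter> ?B \<subseteq> {s i, t i}" by blast
        then have "card (?A \<inter> ?B) \<le> card {s i, t i}" by (intro card_mono) auto
        also have "\<dots> \<le> 2" by (simp add: card_insert_if)
        finally show ?thesis by simp
      next
        case False
        have "card (?A \<inter> ?B) \<le> card (set (P i))" by (intro card_mono) auto
        then show ?thesis using False len by simp
      qed
      ultimately show ?thesis using len by simp
    qed
    have "(\<Sum>i\<in>J. card (set (P i) \<inter> N (s j))) + (\<Sum>i\<in>J. card (set (P i) \<inter> N (t j))) \<le> (\<Sum>i\<in>J. length (P i) + 3)"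
      unfolding sum.distrib[symmetric] by (rule sum_mono[OF pair])
    also have "\<dots> = tot J P + 3 * card J" by (simp add: sum.distrib tot_def)
    finally have A: "(\<Sum>i\<in>J. card (set (P i) \<inter> N (s j))) + (\<Sum>i\<in>J. card (set (P i) \<inter> N (t j))) \<le> tot J P + 3 * card J" .
    have jR: "j \<in> ?R" using jj by simp
    have B: "(\<Sum>i\<in>?R. card ({s i, t i} \<inter> N x)) \<le> 1 + 2 * (card ?R - 1)" if "x \<in> {s j, t j}" for x
    proof -
      have "(\<Sum>i\<in>?R. card ({s i, t i} \<inter> N x)) = card ({s j, t j} \<inter> N x) + (\<Sum>i\<in>?R - {j}. card ({s i, t i} \<inter> N x))"
        using jR by (simp add: sum.remove)
      moreover have "card ({s j, t j} \<inter> N x) \<le> 1" using that Eirr by (intro card_inter_triple(4)) (auto simp: NE)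
      moreover have "(\<Sum>i\<in>?R - {j}. card ({s i, t i} \<inter> N x)) \<le> (\<Sum>i\<in>?R - {j}. 2)"
        by (intro sum_mono card_inter_triple(3))
      ultimately show ?thesis using jR by (simp add: mult.commute)
    qed
    have "12 * L \<le> card (N (s j)) + card (N (t j))" using degN[OF sD[OF jj(1)]] degN[OF tD[OF jj(1)]] by simp
    then have C: "12 * L \<le> card ?S + card ?T + tot J P + 3 * card J + 2 + 4 * (card ?R - 1)"
      using Nsplit[OF o, of "s j"] Nsplit[OF o, of "t j"] A B[of "s j"] B[of "t j"] by simp
    have ST: "?S \<inter> ?T = {}" using noboth[OF o jj] Esym by (auto simp: NE)
    have zN: "insert z (N z \<inter> ?U) \<inter> (?S \<union> ?T) = {}"
      using z Esym by (auto simp: ball_def NE)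
    have "card (insert z (N z \<inter> ?U)) + (card ?S + card ?T) = card (insert z (N z \<inter> ?U) \<union> (?S \<union> ?T))"
    proof -
      have "card ?S + card ?T = card (?S \<union> ?T)" using finU ST by (intro card_Un_disjoint[symmetric]) auto
      moreover have "card (insert z (N z \<inter> ?U)) + card (?S \<union> ?T) = card (insert z (N z \<inter> ?U) \<union> (?S \<union> ?T))"
        using finU zN by (intro card_Un_disjoint[symmetric]) auto
      ultimately show ?thesis by simp
    qed
    also have "\<dots> \<le> card ?U" using finU z by (intro card_mono) auto
    finally have F: "card (N z \<inter> ?U) + 1 + card ?S + card ?T \<le> card ?U"
      using finU Eirr by (simp add: NE)
    have "(\<Sum>i\<in>J. card (set (P i) \<inter> N z)) \<le> (\<Sum>i\<in>J. 3)" using nbs3(1)[OF o _ z(1)] by (rule sum_mono)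
    then have "card (N z) \<le> card (N z \<inter> ?U) + (3 * card J + card ?R)"
      using Nsplit[OF o, of z] Rone[OF o z(1)] by (simp add: mult.commute)
    moreover have "6 * L \<le> card (N z)" using z by (intro degN) (auto simp: uu_def)
    ultimately show False using C F cards(1,3,4)[OF o] small by linarith
  qed

  define U where "U = uu J P"
  define Bs where "Bs = ball U (s j)"
  define Bt where "Bt = ball U (t j)"
  define R where "R = {..<L} - J"
  have sysJ: "sys J P" and jL: "j < L" and jJ: "j \<notin> J" using opt by (auto simp: opt_def)
  have fJ: "finite J" using finJ[OF sysJ] .
  have UB: "U = Bs \<union> Bt" using cover[OF opt] by (simp add: U_def Bs_def Bt_def)
  have BB: "Bs \<inter> Bt = {}" and BE: "\<And>v w. v \<in> Bs \<Longrightarrow> w \<in> Bt \<Longrightarrow> \<not> E v w"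
    using apart[OF opt] by (auto simp: U_def Bs_def Bt_def)
  have "finite U" using finU by (simp add: U_def)
  then have finB: "finite Bs" "finite Bt" unfolding UB by simp_all
  \<comment> \<open>Exchanging \<open>u\<close> for \<open>y\<close> keeps the system optimal and
    frees \<open>y\<close>. Since \<open>y\<close> is adjacent to \<open>w\<close>, it joins the
    ball around \<open>t j\<close>, which loses nothing. The number of free vertices is unchanged,
    so the ball around \<open>s j\<close> shrinks, against its minimal choice.\<close>
  have swapF: "False"
    if i: "i \<in> J" and P: "P i = a @ x # y # z # b" and u: "u \<in> Bs" "E u x" "E u z" and w: "w \<in> Bt" "E w y" for i a x y z b u w
  proof -
    let ?p = "a @ x # u # z # b"
    let ?P = "P(i := ?p)"
    have okP: "ok i (P i)" using sysJ i by (simp add: sys_def)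
    have uU: "u \<in> uu J P" using u UB by (auto simp: U_def)
    have uP: "u \<notin> set (P i)" "u \<notin> T" "u \<in> D" using uU i by (auto simp: uu_def)
    have "gpath E ?p"
      using okP uP(1) u Esym unfolding ok_def P gpath_def by (auto simp: successively_append_iff successively_Cons)
    moreover have "hd ?p = s i" "last ?p = t i"
      using okP unfolding ok_def P by (cases a; simp)+
    ultimately have "ok i ?p" using okP uP unfolding ok_def P by auto
    then have opt': "opt J ?P j" using replace[OF opt i, of ?p] P uU by auto
    have dP: "distinct (P i)" using okP by (simp add: ok_def gpath_def)
    have yT: "y \<notin> T"
    proof
      assume "y \<in> T"
      have "set (P i) \<inter> T \<subseteq> {s i, t i}" "y \<in> set (P i)" using okP P by (simp_all add: ok_def)
      then have "y = s i \<or> y = t i" using \<open>y \<in> T\<close> by blast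
      moreover have "s i = hd (a @ x # y # z # b)" using okP P by (simp add: ok_def)
      then have "s i \<in> set (a @ [x])" by (cases a) auto
      moreover have "t i = last (a @ x # y # z # b)" using okP P by (simp add: ok_def)
      then have "t i \<in> set (z # b)" by (metis last_appendR last_ConsR last_in_set list.distinct(1))
      moreover have "distinct (a @ x # y # z # b)" using dP P by simp
      ultimately show False by auto
    qed
    have yD: "y \<in> D" using okP P by (auto simp: ok_def)
    have U': "uu J ?P = insert y (U - {u})"
    proof -
      have "y \<notin> set (P k)" if "k \<in> J" "k \<noteq> i" for k using sysJ i that P by (auto simp: sys_def)
      moreover have "(\<Union>k\<in>J. set (?P k)) = (\<Union>k\<in>J - {i}. set (P k)) \<union> set ?p"
        using i by (auto split: if_splits)
      moreover have "(\<Union>k\<in>J. set (P k)) = (\<Union>k\<in>J - {i}. set (P k)) \<union> set (P i)" using i by auto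
      ultimately show ?thesis using yT yD dP uP unfolding uu_def U_def P by auto
    qed
    have "y \<in> set (P i)" using P by simp
    then have yU: "y \<notin> U" using i by (auto simp: U_def uu_def)
    have sub: "Bt \<subseteq> ball (uu J ?P) (t j)"
    proof
      fix v assume v: "v \<in> Bt"
      have "v \<noteq> u" "v \<in> U" using v u BB UB by auto
      moreover have "E (t j) v \<or> (\<exists>c\<in>U - {u}. E (t j) c \<and> E c v)"
      proof (cases "E (t j) v")
        case False
        then obtain c where c: "c \<in> U" "E (t j) c" "E c v" using v by (auto simp: Bt_def ball_def)
        then have "c \<in> Bt" by (auto simp: Bt_def ball_def)
        then show ?thesis using c u BB by auto
      qed simp
      ultimately show "v \<in> ball (uu J ?P) (t j)" unfolding U' ball_def by auto
    qed
    have "y \<in> ball (uu J ?P) (s j) \<union> ball (uu J ?P) (t j)" using cover[OF opt'] U' by auto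
    moreover have "y \<notin> ball (uu J ?P) (s j)" using apart[OF opt', of y w] sub w Esym by auto
    ultimately have "insert y Bt \<subseteq> ball (uu J ?P) (t j)" using sub by auto
    then have "card (insert y Bt) \<le> card (ball (uu J ?P) (t j))"
      using finite_subset[OF ballU finU] by (intro card_mono)
    moreover have "y \<notin> Bt" using yU UB by auto
    ultimately have c1: "card Bt < card (ball (uu J ?P) (t j))" using finB by simp
    have "u \<in> U" using u UB by simp
    then have "card (uu J ?P) = card U" unfolding U' using \<open>finite U\<close> yU card_Suc_Diff1[of U u] by simp
    moreover have "card (uu J ?P) = card (ball (uu J ?P) (s j)) + card (ball (uu J ?P) (t j))"
      using apart[OF opt'] finite_subset[OF ballU finU]
      by (subst cover[OF opt'], intro card_Un_disjoint) blast+
    moreover have "card U = card Bs + card Bt" using UB BB finB by (simp add: card_Un_disjoint)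
    ultimately have "card (ball (uu J ?P) (s j)) < card Bs" using c1 by linarith
    then show False using bmin[OF opt'] by (simp add: Bs_def U_def)
  qed
  define A where "A = (\<lambda>X i. if \<exists>u\<in>X. 2 < card (set (P i) \<inter> N u) then 3 else 2 :: nat)"
  \<comment> \<open>With at least five vertices the trivial bound three on both sides suffices. With
    at most four, two windows of three consecutive vertices overlap so much that the middle of one
    lies in the other, and \<open>swapF\<close> excludes that both sides attain three.\<close>
  have AB: "2 * (A Bs i + A Bt i) \<le> length (P i) + 7" if i: "i \<in> J" for i
  proof -
    have len: "3 \<le> length (P i)" using sysJ i by (auto simp: sys_def ok_def)
    show ?thesis
    proof (cases "length (P i) \<le> 4")
      case True
      have "\<not> ((\<exists>u\<in>Bs. 2 < card (set (P i) \<inter> N u)) \<and> (\<exists>u\<in>Bt. 2 < card (set (P i) \<inter> N u)))"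
      proof
        assume "(\<exists>u\<in>Bs. 2 < card (set (P i) \<inter> N u)) \<and> (\<exists>u\<in>Bt. 2 < card (set (P i) \<inter> N u))"
        then obtain u w where u: "u \<in> Bs" "2 < card (set (P i) \<inter> N u)" and w: "w \<in> Bt" "2 < card (set (P i) \<inter> N w)"
          by blast
        have UU: "u \<in> uu J P" "w \<in> uu J P" using u w UB by (auto simp: U_def)
        obtain a x y z b where u3: "P i = a @ x # y # z # b" "{x, y, z} \<subseteq> N u"
          using nbs3(2)[OF opt i UU(1) u(2)] by blast
        obtain a' x' y' z' b' where w3: "P i = a' @ x' # y' # z' # b'" "{x', y', z'} \<subseteq> N w"
          using nbs3(2)[OF opt i UU(2) w(2)] by blast
        have "length (P i) = length a + length b + 3" by (simp add: u3(1))
        moreover have "length (P i) = length a' + length b' + 3" by (simp add: w3(1))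
        ultimately have la: "length a \<le> 1" "length a' \<le> 1" using True by simp_all
        have "y = P i ! (length a + 1)" by (simp add: u3(1) nth_append)
        moreover have "x' = P i ! (length a')" "y' = P i ! (length a' + 1)" "z' = P i ! (length a' + 2)"
          by (simp_all add: w3(1) nth_append)
        ultimately have "y \<in> {x', y', z'}" using la
          by (cases "length a = 0"; cases "length a' = 0") (auto simp: le_Suc_eq numeral_2_eq_2)
        then have "E w y" using w3(2) by (auto simp: NE)
        then show False using swapF[OF i u3(1) u(1) _ _ w(1)] u3(2) by (auto simp: NE)
      qed
      then show ?thesis using len by (auto simp: A_def)
    qed (auto simp: A_def)
  qed
  have A3: "A X i \<le> 3" for X i by (simp add: A_def)
  have degB: "6 * L \<le> card (N u \<inter> X) + ((\<Sum>i\<in>J. A X i) + card R)"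
    if X: "X = Bs \<or> X = Bt" and u: "u \<in> X" for X u
  proof -
    have uU: "u \<in> uu J P" using X u UB by (auto simp: U_def)
    have "v \<in> X" if "v \<in> N u \<inter> U" for v
      using X u UB that BE[of u v] BE[of v u] Esym[of u v] by (auto simp: NE)
    then have "N u \<inter> U \<subseteq> X" by blast
    then have "N u \<inter> uu J P = N u \<inter> X" using X UB by (auto simp: U_def)
    moreover have "(\<Sum>i\<in>J. card (set (P i) \<inter> N u)) \<le> (\<Sum>i\<in>J. A X i)"
    proof (rule sum_mono)
      fix i assume "i \<in> J"
      then have "card (set (P i) \<inter> N u) \<le> 3" using nbs3(1)[OF opt _ uU] by blast
      then show "card (set (P i) \<inter> N u) \<le> A X i" using u by (auto simp: A_def)
    qed
    moreover have "6 * L \<le> card (N u)" using uU by (intro degN) (auto simp: uu_def)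
    ultimately show ?thesis using Nsplit[OF opt, of u] Rone[OF opt uU] by (simp add: R_def)
  qed
  \<comment> \<open>An end has at most \<open>6 * card J + 2 * card R\<close> neighbours outside
    \<open>U\<close>, fewer than its degree because \<open>R\<close> is nonempty.\<close>
  have neB: "ball U x \<noteq> {}" if x: "x \<in> {s j, t j}" for x
  proof -
    have xD: "x \<in> D" using x sD tD jL by auto
    have "(\<Sum>i\<in>J. card (set (P i) \<inter> N x)) \<le> (\<Sum>i\<in>J. 6)"
    proof (rule sum_mono)
      fix i assume "i \<in> J"
      then have "length (P i) \<le> 6" using sysJ by (auto simp: sys_def ok_def)
      moreover have "card (set (P i) \<inter> N x) \<le> card (set (P i))" by (intro card_mono) auto
      ultimately show "card (set (P i) \<inter> N x) \<le> 6" using card_length[of "P i"] by linarith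
    qed
    moreover have "(\<Sum>i\<in>R. card ({s i, t i} \<inter> N x)) \<le> (\<Sum>i\<in>R. 2)" by (intro sum_mono card_inter_triple(3))
    ultimately have "card (N x) \<le> card (N x \<inter> U) + (6 * card J + 2 * card R)"
      using Nsplit[OF opt, of x] by (simp add: U_def R_def mult.commute)
    then have "N x \<inter> U \<noteq> {}" using degN[OF xD] cards(1,3)[OF opt] by (auto simp: R_def)
    then show ?thesis by (auto simp: ball_def NE)
  qed
  have final: "\<exists>C\<subseteq>D. 2 * L \<le> card C \<and> slinked C E L"
    if X: "X = Bs \<or> X = Bt" and good: "7 * L + 3 * card X \<le> 6 * (6 * L - ((\<Sum>i\<in>J. A X i) + card R)) + 6" for X
  proof -
    let ?d = "6 * L - ((\<Sum>i\<in>J. A X i) + card R)"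
    have "(\<Sum>i\<in>J. A X i) \<le> (\<Sum>i\<in>J. 3)" using A3 by (intro sum_mono)
    then have d: "3 * L \<le> ?d" using cards(1)[OF opt] by (simp add: R_def)
    have XD: "X \<subseteq> D" using X UB by (auto simp: U_def uu_def)
    have finX: "finite X" using X finB by auto
    have NX: "{y \<in> X. E x y} = N x \<inter> X" for x using XD by (auto simp: NE)
    have dX: "?d \<le> card {y \<in> X. E x y}" if "x \<in> X" for x
      unfolding NX using degB[OF X that] by linarith
    obtain x where x: "x \<in> X" using X neB by (auto simp: Bs_def Bt_def)
    have "card {y \<in> X. E x y} \<le> card X" using finX by (intro card_mono) auto
    then have "2 * L \<le> card X" using dX[OF x] d by linarith
    moreover have "slinked X E L" by (rule dense_slinked[OF finX sym irr dX d good])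
    ultimately show ?thesis using XD by blast
  qed
  show ?thesis
  \<comment> \<open>If both parts are too sparse, adding the two inequalities makes the total length
    cancel against \<open>card D\<close> and leaves
    \<open>22 * L + 12 < 21 * card J + 6 * card R\<close>, which is impossible.\<close>
  proof (rule ccontr)
    assume no: "\<not> ?thesis"
    have a: "6 * (6 * L - ((\<Sum>i\<in>J. A Bs i) + card R)) + 6 < 7 * L + 3 * card Bs"
      using final[of Bs] no by (meson linorder_not_le)
    have b: "6 * (6 * L - ((\<Sum>i\<in>J. A Bt i) + card R)) + 6 < 7 * L + 3 * card Bt"
      using final[of Bt] no by (meson linorder_not_le)
    have "(\<Sum>i\<in>J. 2 * (A Bs i + A Bt i)) \<le> (\<Sum>i\<in>J. length (P i) + 7)" by (rule sum_mono[OF AB])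
    then have c: "2 * (\<Sum>i\<in>J. A Bs i) + 2 * (\<Sum>i\<in>J. A Bt i) \<le> tot J P + 7 * card J"
      by (simp add: sum.distrib tot_def sum_distrib_left[symmetric])
    have "card U = card Bs + card Bt" using UB BB finB by (simp add: card_Un_disjoint)
    then have e: "card D = card Bs + card Bt + tot J P + 2 * card R" "card J + card R = L"
      using cards(1,4)[OF opt] by (auto simp: U_def R_def)
    show False using a b c e small by linarith
  qed
qed

section \<open>Massed pairs are linked\<close>

definition nbs :: "'a set \<Rightarrow> ('a \<Rightarrow> 'a \<Rightarrow> bool) \<Rightarrow> 'a set \<Rightarrow> 'a set" where
  "nbs V E W = {v \<in> V - W. \<exists>w\<in>W. E w v}"

text \<open>Edges are counted as ordered pairs, hence twice.\<close>

definition arcs :: "'a set \<Rightarrow> ('a \<Rightarrow> 'a \<Rightarrow> bool) \<Rightarrow> 'a set \<Rightarrow> ('a \<times> 'a) set" where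
  "arcs V E W = {(u, v). u \<in> V \<and> v \<in> V \<and> E u v \<and> (u \<in> W \<or> v \<in> W)}"

text \<open>Links are connected sets instead of paths because such sets survive unions and the
  undoing of a contraction without rerouting. They avoid every vertex of \<open>X\<close> except
  their own ends, paired or not.\<close>

definition linked :: "'a set \<Rightarrow> ('a \<Rightarrow> 'a \<Rightarrow> bool) \<Rightarrow> 'a set \<Rightarrow> bool" where
  "linked V E X \<longleftrightarrow> (\<forall>I s t. pairing I s t X \<longrightarrow>
     (\<exists>P. (\<forall>i\<in>I. connected_on (P i) E \<and> P i \<subseteq> V \<and> s i \<in> P i \<and> t i \<in> P i \<and> P i \<inter> X = {s i, t i}) \<and>
          (\<forall>i\<in>I. \<forall>j\<in>I. i \<noteq> j \<longrightarrow> P i \<inter> P j = {})))"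

text \<open>The massed pairs of Thomas and Wollan, in terms of neighbourhoods instead of
  separations: the part outside \<open>X\<close> is dense, but no part of it with a boundary smaller
  than \<open>X\<close> is. Since \<open>arcs\<close> counts edges twice, \<open>m\<close> is twice
  the number of edges per vertex.\<close>

definition massed :: "nat \<Rightarrow> 'a set \<Rightarrow> ('a \<Rightarrow> 'a \<Rightarrow> bool) \<Rightarrow> 'a set \<Rightarrow> bool" where
  "massed m V E X \<longleftrightarrow> m * card (V - X) < card (arcs V E (V - X)) \<and>
     (\<forall>W \<subseteq> V - X. card (nbs V E W) < card X \<longrightarrow> card (arcs V E W) \<le> m * card W)"

text \<open>A rigid separation: \<open>W\<close> can be cut off by at most \<open>card X\<close>
  vertices and, together with this boundary, can realise every linkage that a clique on the boundary
  would offer.\<close>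

definition rigid :: "'a set \<Rightarrow> ('a \<Rightarrow> 'a \<Rightarrow> bool) \<Rightarrow> 'a set \<Rightarrow> 'a set \<Rightarrow> 'a set \<Rightarrow> bool" where
  "rigid V E X W Z \<longleftrightarrow> W \<noteq> {} \<and> W \<subseteq> V - X \<and> Z \<subseteq> V - W \<and> nbs V E W \<subseteq> Z \<and> card Z \<le> card X \<and>
     linked (W \<union> Z) E Z"

definition clique :: "('a \<Rightarrow> 'a \<Rightarrow> bool) \<Rightarrow> 'a set \<Rightarrow> 'a \<Rightarrow> 'a \<Rightarrow> bool" where
  "clique E Z u v \<longleftrightarrow> E u v \<or> (u \<in> Z \<and> v \<in> Z \<and> u \<noteq> v)"

lemma clique_sym: "symp E \<Longrightarrow> symp (clique E Z)"
  unfolding clique_def by (rule sympI) (auto dest: sympD)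

lemma clique_irrefl: "irreflp E \<Longrightarrow> irreflp (clique E Z)"
  unfolding clique_def by (rule irreflpI) (auto dest: irreflpD)

lemma finite_arcs: "finite V \<Longrightarrow> finite (arcs V E W)"
  by (rule finite_subset[of _ "V \<times> V"]) (auto simp: arcs_def)

lemma linkedD:
  assumes "linked V E X" "pairing I s t X"
  obtains P where "\<And>i. i \<in> I \<Longrightarrow> connected_on (P i) E \<and> P i \<subseteq> V \<and> s i \<in> P i \<and> t i \<in> P i \<and> P i \<inter> X = {s i, t i}"
    and "\<And>i j. i \<in> I \<Longrightarrow> j \<in> I \<Longrightarrow> i \<noteq> j \<Longrightarrow> P i \<inter> P j = {}"
proof -
  from assms have "\<exists>P. (\<forall>i\<in>I. connected_on (P i) E \<and> P i \<subseteq> V \<and> s i \<in> P i \<and> t i \<in> P i \<and> P i \<inter> X = {s i, t i}) \<and>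
          (\<forall>i\<in>I. \<forall>j\<in>I. i \<noteq> j \<longrightarrow> P i \<inter> P j = {})"
    unfolding linked_def by simp
  then obtain P where P: "\<forall>i\<in>I. connected_on (P i) E \<and> P i \<subseteq> V \<and> s i \<in> P i \<and> t i \<in> P i \<and> P i \<inter> X = {s i, t i}"
    and D: "\<forall>i\<in>I. \<forall>j\<in>I. i \<noteq> j \<longrightarrow> P i \<inter> P j = {}" by (elim exE conjE)
  show ?thesis by (rule that[of P]) (use P D in simp_all)
qed

lemma linkedI:
  assumes "\<And>I s t. pairing I s t X \<Longrightarrow>
     \<exists>P. (\<forall>i\<in>I. connected_on (P i) E \<and> P i \<subseteq> V \<and> s i \<in> P i \<and> t i \<in> P i \<and> P i \<inter> X = {s i, t i}) \<and>
          (\<forall>i\<in>I. \<forall>j\<in>I. i \<noteq> j \<longrightarrow> P i \<inter> P j = {})"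
  shows "linked V E X"
  using assms unfolding linked_def by simp

lemma linked_mono:
  assumes "linked V E X" "V \<subseteq> V'" shows "linked V' E X"
proof (rule linkedI)
  fix I s t assume "pairing I s t X"
  from linkedD[OF assms(1) this] obtain P where
    "\<And>i. i \<in> I \<Longrightarrow> connected_on (P i) E \<and> P i \<subseteq> V \<and> s i \<in> P i \<and> t i \<in> P i \<and> P i \<inter> X = {s i, t i}"
    "\<And>i j. i \<in> I \<Longrightarrow> j \<in> I \<Longrightarrow> i \<noteq> j \<Longrightarrow> P i \<inter> P j = {}" by blast
  then show "\<exists>P. (\<forall>i\<in>I. connected_on (P i) E \<and> P i \<subseteq> V' \<and> s i \<in> P i \<and> t i \<in> P i \<and> P i \<inter> X = {s i, t i}) \<and>
          (\<forall>i\<in>I. \<forall>j\<in>I. i \<noteq> j \<longrightarrow> P i \<inter> P j = {})"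
    using assms(2) by (intro exI[of _ P]) (auto; blast)
qed

lemma linked_mono_edges:
  assumes "linked V E X" "\<And>u v. E u v \<Longrightarrow> E' u v" shows "linked V E' X"
proof -
  have "connected_on P E'" if "connected_on P E" for P
    by (rule connected_on_mono[OF that]) (rule assms(2))
  note c = this
  show ?thesis
  proof (rule linkedI)
    fix I s t assume "pairing I s t X"
    from linkedD[OF assms(1) this] obtain P where
      "\<And>i. i \<in> I \<Longrightarrow> connected_on (P i) E \<and> P i \<subseteq> V \<and> s i \<in> P i \<and> t i \<in> P i \<and> P i \<inter> X = {s i, t i}"
      "\<And>i j. i \<in> I \<Longrightarrow> j \<in> I \<Longrightarrow> i \<noteq> j \<Longrightarrow> P i \<inter> P j = {}" by blast
    then show "\<exists>P. (\<forall>i\<in>I. connected_on (P i) E' \<and> P i \<subseteq> V \<and> s i \<in> P i \<and> t i \<in> P i \<and> P i \<inter> X = {s i, t i}) \<and>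
            (\<forall>i\<in>I. \<forall>j\<in>I. i \<noteq> j \<longrightarrow> P i \<inter> P j = {})"
      using c by (intro exI[of _ P]) simp
  qed
qed

lemma linked_empty: "linked V E {}"
  unfolding linked_def pairing_def by auto

section \<open>Transfer of linkages through cliques, paths and contractions\<close>

lemma not_successively_split:
  "\<not> successively E p \<Longrightarrow> \<exists>a x y b. p = a @ x # y # b \<and> \<not> E x y"
proof (induction p rule: induct_list012)
  case (3 x y p)
  show ?case
  proof (cases "E x y")
    case True
    with 3 obtain a x' y' b where "y # p = a @ x' # y' # b" "\<not> E x' y'" by auto
    then show ?thesis by (intro exI[of _ "x # a"]) auto
  next
    case False
    then show ?thesis by (intro exI[of _ "[]"]) auto
  qed
qed auto

text \<open>Once an added edge is used, a third vertex of \<open>Z\<close> on the path would be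
  adjacent to one end of this edge and give a shortcut. So a shortest path contains one added edge
  and no vertex of \<open>Z\<close> besides its ends.\<close>

lemma clique_shortest_path:
  assumes p: "gpath (clique E Z) p"
    and short: "\<And>q. gpath (clique E Z) q \<Longrightarrow> set q \<subseteq> set p \<Longrightarrow> hd q = hd p \<Longrightarrow> last q = last p \<Longrightarrow> length p \<le> length q"
    and not: "\<not> gpath E p"
  shows "\<exists>a b. p = a @ b \<and> gpath E a \<and> gpath E b \<and> last a \<noteq> hd b \<and> set p \<inter> Z = {last a, hd b}"
proof -
  have "\<not> successively E p" using p not by (simp add: gpath_def)
  then obtain a x y b where ab: "p = a @ x # y # b" and xy: "\<not> E x y"
    using not_successively_split by blast
  have dp: "distinct (a @ x # y # b)" and sp: "successively (clique E Z) (a @ x # y # b)"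
    using p ab by (auto simp: gpath_def)
  have Z: "x \<in> Z" "y \<in> Z" using sp xy by (auto simp: successively_append_iff clique_def)
  have a: "z \<notin> Z" if "z \<in> set a" for z
  proof
    assume zZ: "z \<in> Z"
    obtain a1 a2 where a12: "a = a1 @ z # a2" using \<open>z \<in> set a\<close> by (meson split_list)
    have "clique E Z z y" using zZ Z dp a12 by (auto simp: clique_def)
    then have "gpath (clique E Z) (a1 @ z # y # b)"
      using dp sp unfolding a12 gpath_def by (auto simp: successively_append_iff successively_Cons)
    from short[OF this] show False unfolding ab a12 by (cases a1) auto
  qed
  have b: "z \<notin> Z" if "z \<in> set b" for z
  proof
    assume zZ: "z \<in> Z"
    obtain b1 b2 where b12: "b = b1 @ z # b2" using \<open>z \<in> set b\<close> by (meson split_list)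
    have "clique E Z x z" using zZ Z dp b12 by (auto simp: clique_def)
    then have "gpath (clique E Z) (a @ x # z # b2)"
      using dp sp unfolding b12 gpath_def by (auto simp: successively_append_iff successively_Cons)
    from short[OF this] show False unfolding ab b12 by (cases a) auto
  qed
  have "gpath (clique E Z) (a @ [x])" "gpath (clique E Z) (y # b)"
    using dp sp by (auto simp: gpath_def successively_append_iff successively_Cons)
  then have "gpath E (a @ [x])" "gpath E (y # b)"
    using a b by (auto elim!: gpath_mono simp: clique_def)
  moreover have "set p \<inter> Z = {x, y}" using a b Z ab by auto
  ultimately show ?thesis using ab dp by (intro exI[of _ "a @ [x]"] exI[of _ "y # b"]) auto
qed

text \<open>Every link needs at most one added edge, different links need disjoint pairs of
  \<open>Z\<close>, and the linkage inside \<open>W \<union> Z\<close> replaces all these edges at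
  once. It meets the rest of the graph only in the ends of the replaced edges.\<close>

lemma linked_replace_clique:
  assumes sym: "symp E" and W: "W \<inter> V = {}" and ZV: "Z \<subseteq> V" and XV: "X \<subseteq> V"
    and V: "linked V (clique E Z) X" and WZ: "linked (W \<union> Z) E Z"
  shows "linked (W \<union> V) E X"
proof (rule linkedI)
  fix I :: "nat set" and s t assume st: "pairing I s t X"
  from linkedD[OF V st] obtain P where
    P: "\<And>i. i \<in> I \<Longrightarrow> connected_on (P i) (clique E Z) \<and> P i \<subseteq> V \<and> s i \<in> P i \<and> t i \<in> P i \<and> P i \<inter> X = {s i, t i}"
    and Pd: "\<And>i j. i \<in> I \<Longrightarrow> j \<in> I \<Longrightarrow> i \<noteq> j \<Longrightarrow> P i \<inter> P j = {}"
    by blast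
  have "\<exists>p. gpath (clique E Z) p \<and> set p \<subseteq> P i \<and> hd p = s i \<and> last p = t i \<and>
      (gpath E p \<or> (\<exists>a b. p = a @ b \<and> gpath E a \<and> gpath E b \<and> last a \<noteq> hd b \<and> set p \<inter> Z = {last a, hd b}))"
    if i: "i \<in> I" for i
  proof -
    let ?Q = "\<lambda>p. gpath (clique E Z) p \<and> set p \<subseteq> P i \<and> hd p = s i \<and> last p = t i"
    have "\<exists>p. ?Q p" using connected_on_path P[OF i] by metis
    then obtain p where p: "?Q p" "\<And>q. ?Q q \<Longrightarrow> length p \<le> length q"
      using ex_has_least_nat[of ?Q _ length] by blast
    have "gpath E p \<or> (\<exists>a b. p = a @ b \<and> gpath E a \<and> gpath E b \<and> last a \<noteq> hd b \<and> set p \<inter> Z = {last a, hd b})"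
      using clique_shortest_path[of E Z p] p by (metis order_trans)
    then show ?thesis using p(1) by blast
  qed
  then obtain p where p: "\<And>i. i \<in> I \<Longrightarrow> set (p i) \<subseteq> P i \<and> hd (p i) = s i \<and> last (p i) = t i \<and> p i \<noteq> []"
    and split: "\<And>i. i \<in> I \<Longrightarrow> gpath E (p i) \<or> (\<exists>a b. p i = a @ b \<and> gpath E a \<and> gpath E b \<and> last a \<noteq> hd b \<and> set (p i) \<inter> Z = {last a, hd b})"
    by (metis gpath_Nil)
  define J where "J = {i \<in> I. \<not> gpath E (p i)}"
  have "\<forall>i. \<exists>a b. i \<in> J \<longrightarrow> p i = a @ b \<and> gpath E a \<and> gpath E b \<and> last a \<noteq> hd b \<and> set (p i) \<inter> Z = {last a, hd b}"
    using split unfolding J_def by blast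
  then obtain a b where ab: "\<And>i. i \<in> J \<Longrightarrow> p i = a i @ b i \<and> gpath E (a i) \<and> gpath E (b i) \<and> last (a i) \<noteq> hd (b i) \<and>
      set (p i) \<inter> Z = {last (a i), hd (b i)}" by metis
  have JI: "J \<subseteq> I" by (auto simp: J_def)
  have zP: "last (a i) \<in> P i" "hd (b i) \<in> P i" "last (a i) \<in> Z" "hd (b i) \<in> Z" if i: "i \<in> J" for i
  proof -
    have "set (p i) \<subseteq> P i" using p JI i by blast
    moreover have "{last (a i), hd (b i)} \<subseteq> set (p i) \<inter> Z" using ab[OF i] by blast
    ultimately show "last (a i) \<in> P i" "hd (b i) \<in> P i" "last (a i) \<in> Z" "hd (b i) \<in> Z" by blast+
  qed
  have apart: "P i \<inter> P j = {}" if "i \<in> J" "j \<in> J" "i \<noteq> j" for i j using Pd that JI by blast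
  have "pairing J (\<lambda>i. last (a i)) (\<lambda>i. hd (b i)) Z"
    unfolding pairing_def
  proof (intro conjI)
    show "finite J" using st JI finite_subset by (auto simp: pairing_def)
    show "inj_on (\<lambda>i. last (a i)) J" "inj_on (\<lambda>i. hd (b i)) J"
      using zP(1,2) apart unfolding inj_on_def by (metis disjoint_iff)+
    show "(\<lambda>i. last (a i)) ` J \<inter> (\<lambda>i. hd (b i)) ` J = {}"
      using zP(1,2) apart ab by (smt (verit) disjoint_iff imageE)
  qed (use zP in auto)
  from linkedD[OF WZ this] obtain Y where
    Y: "\<And>i. i \<in> J \<Longrightarrow> connected_on (Y i) E \<and> Y i \<subseteq> W \<union> Z \<and> last (a i) \<in> Y i \<and> hd (b i) \<in> Y i \<and> Y i \<inter> Z = {last (a i), hd (b i)}"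
    and Yd: "\<And>i j. i \<in> J \<Longrightarrow> j \<in> J \<Longrightarrow> i \<noteq> j \<Longrightarrow> Y i \<inter> Y j = {}"
    by blast
  define S where "S = (\<lambda>i. set (p i) \<union> (if i \<in> J then Y i else {}))"
  have YV: "Y i \<inter> V \<subseteq> {last (a i), hd (b i)}" if "i \<in> J" for i using Y[OF that] W by blast
  have YP: "Y i \<inter> V \<subseteq> P i" if i: "i \<in> J" for i using YV[OF i] zP[OF i] by blast
  have YI: "Y i \<inter> P j = {}" if "i \<in> J" "j \<in> I" "i \<noteq> j" for i j
    using YP[OF that(1)] P[OF that(2)] Pd[OF _ that(2,3)] that(1) JI by blast
  show "\<exists>P. (\<forall>i\<in>I. connected_on (P i) E \<and> P i \<subseteq> W \<union> V \<and> s i \<in> P i \<and> t i \<in> P i \<and> P i \<inter> X = {s i, t i}) \<and>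
          (\<forall>i\<in>I. \<forall>j\<in>I. i \<noteq> j \<longrightarrow> P i \<inter> P j = {})"
  proof (intro exI[of _ S] conjI ballI impI)
    fix i assume i: "i \<in> I"
    show "connected_on (S i) E"
    proof (cases "i \<in> J")
      case False
      then show ?thesis using connected_on_set_path[OF _ sym] i by (simp add: S_def J_def)
    next
      case True
      note abi = ab[OF True]
      have "connected_on (set (a i)) E" "connected_on (set (b i)) E"
        using abi connected_on_set_path[OF _ sym] by blast+
      moreover have "last (a i) \<in> set (a i)" "hd (b i) \<in> set (b i)"
        using abi by (metis gpath_Nil hd_in_set last_in_set)+
      ultimately have "connected_on (set (a i) \<union> Y i \<union> set (b i)) E"
        using Y[OF True] sym by (intro connected_on_Un[of _ _ _ "hd (b i)" "hd (b i)"]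
            connected_on_Un[of _ _ _ "last (a i)" "last (a i)"]) auto
      moreover have "S i = set (a i) \<union> Y i \<union> set (b i)" using True abi by (auto simp: S_def)
      ultimately show ?thesis by simp
    qed
    show "S i \<subseteq> W \<union> V" using p[OF i] P[OF i] Y[of i] ZV by (auto simp: S_def)
    have "s i \<in> set (p i)" "t i \<in> set (p i)" using p[OF i] by (metis hd_in_set, metis last_in_set)
    then show mem: "s i \<in> S i" "t i \<in> S i" by (simp_all add: S_def)
    have "S i \<inter> V \<subseteq> P i" using p[OF i] YP[of i] by (auto simp: S_def)
    then show "S i \<inter> X = {s i, t i}" using mem P[OF i] XV by blast
  next
    fix i j assume ij: "i \<in> I" "j \<in> I" "i \<noteq> j"
    have "set (p i) \<subseteq> P i" "set (p j) \<subseteq> P j" using p ij by blast+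
    moreover have "i \<in> J \<Longrightarrow> Y i \<inter> P j = {}" "j \<in> J \<Longrightarrow> Y j \<inter> P i = {}"
      "i \<in> J \<Longrightarrow> j \<in> J \<Longrightarrow> Y i \<inter> Y j = {}" using YI[of i j] YI[of j i] Yd[of i j] ij by blast+
    ultimately show "S i \<inter> S j = {}" using Pd[OF ij] unfolding S_def by (cases "i \<in> J"; cases "j \<in> J") (simp; blast)+
  qed
qed

text \<open>The linkage of \<open>Z\<close> is pushed along the disjoint paths \<open>f z\<close> to
  their ends in \<open>Q\<close>. A link inside \<open>Q\<close> can meet such a path only in its
  last vertex, and it avoids the ends that are not its own.\<close>

lemma linked_compose:
  assumes sym: "symp E"
    and f: "\<And>z. z \<in> Z \<Longrightarrow> gpath E (f z) \<and> hd (f z) = z \<and> set (f z) \<inter> Z = {z} \<and> set (f z) \<inter> Q = {last (f z)}"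
    and fd: "\<And>z z'. z \<in> Z \<Longrightarrow> z' \<in> Z \<Longrightarrow> z \<noteq> z' \<Longrightarrow> set (f z) \<inter> set (f z') = {}"
    and Q: "linked Q E ((\<lambda>z. last (f z)) ` Z)"
  shows "linked (Q \<union> (\<Union>z\<in>Z. set (f z))) E Z"
proof (rule linkedI)
  fix I :: "nat set" and s t assume st: "pairing I s t Z"
  let ?l = "\<lambda>z. last (f z)"
  have ne: "f z \<noteq> []" if "z \<in> Z" for z using f[OF that] by auto
  have linj: "z = z'" if "z \<in> Z" "z' \<in> Z" "?l z = ?l z'" for z z'
    using fd[OF that(1,2)] ne[OF that(1)] ne[OF that(2)] that(3) by (metis disjoint_iff last_in_set)
  have sZ: "i \<in> I \<Longrightarrow> s i \<in> Z" and tZ: "i \<in> I \<Longrightarrow> t i \<in> Z" for i using st by (auto simp: pairing_def)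
  have "pairing I (\<lambda>i. ?l (s i)) (\<lambda>i. ?l (t i)) (?l ` Z)"
    unfolding pairing_def
  proof (intro conjI)
    show "finite I" using st by (simp add: pairing_def)
    have "inj_on s I" "inj_on t I" and d: "s ` I \<inter> t ` I = {}" using st by (auto simp: pairing_def)
    have "i = j" if "i \<in> I" "j \<in> I" "?l (s i) = ?l (s j)" for i j
      using linj[OF sZ[OF that(1)] sZ[OF that(2)] that(3)] \<open>inj_on s I\<close> that(1,2) by (simp add: inj_onD)
    then show "inj_on (\<lambda>i. ?l (s i)) I" by (rule inj_onI)
    have "i = j" if "i \<in> I" "j \<in> I" "?l (t i) = ?l (t j)" for i j
      using linj[OF tZ[OF that(1)] tZ[OF that(2)] that(3)] \<open>inj_on t I\<close> that(1,2) by (simp add: inj_onD)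
    then show "inj_on (\<lambda>i. ?l (t i)) I" by (rule inj_onI)
    have "?l (s i) \<noteq> ?l (t j)" if "i \<in> I" "j \<in> I" for i j
      using linj[OF sZ[OF that(1)] tZ[OF that(2)]] that d by blast
    then show "(\<lambda>i. ?l (s i)) ` I \<inter> (\<lambda>i. ?l (t i)) ` I = {}" by blast
  qed (use sZ tZ in auto)
  from linkedD[OF Q this] obtain Y where
    Y: "\<And>i. i \<in> I \<Longrightarrow> connected_on (Y i) E \<and> Y i \<subseteq> Q \<and> ?l (s i) \<in> Y i \<and> ?l (t i) \<in> Y i \<and> Y i \<inter> ?l ` Z = {?l (s i), ?l (t i)}"
    and Yd: "\<And>i j. i \<in> I \<Longrightarrow> j \<in> I \<Longrightarrow> i \<noteq> j \<Longrightarrow> Y i \<inter> Y j = {}"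
    by blast
  define S where "S = (\<lambda>i. set (f (s i)) \<union> Y i \<union> set (f (t i)))"
  have Yf: "z = s i \<or> z = t i" if i: "i \<in> I" and z: "z \<in> Z" "v \<in> Y i" "v \<in> set (f z)" for i z v
  proof -
    have "v = ?l z" using f[OF z(1)] Y[OF i] z by blast
    then have "?l z \<in> {?l (s i), ?l (t i)}" using Y[OF i] z by blast
    then show ?thesis using linj sZ[OF i] tZ[OF i] z(1) by blast
  qed
  show "\<exists>P. (\<forall>i\<in>I. connected_on (P i) E \<and> P i \<subseteq> Q \<union> (\<Union>z\<in>Z. set (f z)) \<and> s i \<in> P i \<and> t i \<in> P i \<and> P i \<inter> Z = {s i, t i}) \<and>
          (\<forall>i\<in>I. \<forall>j\<in>I. i \<noteq> j \<longrightarrow> P i \<inter> P j = {})"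
  proof (intro exI[of _ S] conjI ballI impI)
    fix i assume i: "i \<in> I"
    note si = f[OF sZ[OF i]] and ti = f[OF tZ[OF i]]
    have cs: "connected_on (set (f (s i))) E" "connected_on (set (f (t i))) E"
      using si ti connected_on_set_path[OF _ sym] by blast+
    have ls: "?l (s i) \<in> set (f (s i))" "?l (t i) \<in> set (f (t i))" using ne sZ[OF i] tZ[OF i] by auto
    have "connected_on (set (f (s i)) \<union> Y i) E"
      by (rule connected_on_Un[OF cs(1) _ sym ls(1), where b = "?l (s i)"]) (use Y[OF i] in auto)
    then show "connected_on (S i) E" unfolding S_def
      by (rule connected_on_Un[OF _ cs(2) sym _ ls(2), where a = "?l (t i)"]) (use Y[OF i] in auto)
    show "S i \<subseteq> Q \<union> (\<Union>z\<in>Z. set (f z))" using Y[OF i] sZ[OF i] tZ[OF i] by (auto simp: S_def)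
    show mem: "s i \<in> S i" "t i \<in> S i" using si ti ne[OF sZ[OF i]] ne[OF tZ[OF i]] hd_in_set unfolding S_def by force+
    have "v = s i \<or> v = t i" if v: "v \<in> Y i" "v \<in> Z" for v
    proof -
      have "v \<in> set (f v)" using f[OF v(2)] by blast
      then show ?thesis using Yf[OF i v(2) v(1)] by blast
    qed
    then have "Y i \<inter> Z \<subseteq> {s i, t i}" by blast
    moreover have "set (f (s i)) \<inter> Z = {s i}" "set (f (t i)) \<inter> Z = {t i}" using si ti by blast+
    ultimately show "S i \<inter> Z = {s i, t i}" unfolding S_def Int_Un_distrib2 by blast
  next
    fix i j assume ij: "i \<in> I" "j \<in> I" "i \<noteq> j"
    have "inj_on s I" "inj_on t I" "s ` I \<inter> t ` I = {}" using st by (auto simp: pairing_def)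
    then have ne': "s i \<noteq> s j" "t i \<noteq> t j" "s i \<noteq> t j" "t i \<noteq> s j"
      using ij by (auto dest: inj_onD)
    have zZ: "{s i, t i} \<subseteq> Z" "{s j, t j} \<subseteq> Z" using sZ tZ ij by auto
    have "set (f z) \<inter> set (f z') = {}" if "z \<in> {s i, t i}" "z' \<in> {s j, t j}" for z z'
      using fd[of z z'] ne' that zZ by auto
    then have "set (f (s i)) \<inter> set (f (s j)) = {}" "set (f (s i)) \<inter> set (f (t j)) = {}"
      "set (f (t i)) \<inter> set (f (s j)) = {}" "set (f (t i)) \<inter> set (f (t j)) = {}" by simp_all
    moreover have "v \<notin> set (f z)" if "z \<in> {s j, t j}" "v \<in> Y i" for z v
      using Yf[OF ij(1), of z v] ne' that zZ by auto
    then have "Y i \<inter> set (f (s j)) = {}" "Y i \<inter> set (f (t j)) = {}" by auto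
    moreover have "v \<notin> set (f z)" if "z \<in> {s i, t i}" "v \<in> Y j" for z v
      using Yf[OF ij(2), of z v] ne' that zZ by auto
    then have "Y j \<inter> set (f (s i)) = {}" "Y j \<inter> set (f (t i)) = {}" by auto
    ultimately show "S i \<inter> S j = {}" using Yd[OF ij] unfolding S_def Int_Un_distrib Int_Un_distrib2 by (simp add: Int_commute)
  qed
qed

text \<open>The prescribed ends are completed to exactly \<open>2 * L\<close> vertices that contain
  \<open>Y\<close>, and hence all of \<open>X \<inter> C\<close>. An added edge on a path would join
  its two ends directly, which the inner vertex forbids.\<close>

lemma slinked_imp_linked:
  assumes fin: "finite C" and C: "slinked C (clique E X) L" "2 * L \<le> card C" and sym: "symp E"
    and Y: "Y \<subseteq> C" "card Y \<le> 2 * L" "X \<inter> C \<subseteq> Y"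
  shows "linked C E Y"
proof (rule linkedI)
  fix I :: "nat set" and s t assume st: "pairing I s t Y"
  have finI: "finite I" using st by (simp add: pairing_def)
  have finY: "finite Y" using fin Y finite_subset by blast
  define T where "T = s ` I \<union> t ` I"
  have cT: "card T = 2 * card I" using st unfolding T_def pairing_def by (auto simp: card_Un_disjoint card_image)
  have TY: "T \<subseteq> Y" using st by (auto simp: T_def pairing_def)
  obtain Y' where Y': "Y \<subseteq> Y'" "Y' \<subseteq> C" "card Y' = 2 * L"
    using exists_subset_between[OF Y(2) C(2) Y(1) fin] by blast
  have finY': "finite Y'" using fin Y' finite_subset by blast
  have rL: "card I \<le> L" using cT card_mono[OF finY TY] Y(2) by linarith
  have cYT: "card (Y' - T) = 2 * (L - card I)"
    using TY Y' finY' cT by (subst card_Diff_subset) (auto dest: finite_subset)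
  obtain h where h: "bij_betw h {..<card I} I" using ex_bij_betw_nat_finite[OF finI] by (auto simp: atLeast0LessThan)
  obtain g where g: "bij_betw g {..<2 * (L - card I)} (Y' - T)"
    using ex_bij_betw_nat_finite[of "Y' - T"] finY' cYT by (auto simp: atLeast0LessThan)
  \<comment> \<open>Indices from \<open>card I\<close> on pair up the filling vertices, even
    positions of \<open>g\<close> with the following odd ones.\<close>
  define s' where "s' = (\<lambda>i. if i < card I then s (h i) else g (2 * (i - card I)))"
  define t' where "t' = (\<lambda>i. if i < card I then t (h i) else g (2 * (i - card I) + 1))"
  have hI: "i < card I \<Longrightarrow> h i \<in> I" for i using h by (auto simp: bij_betw_def)
  have h_inj: "i < card I \<Longrightarrow> j < card I \<Longrightarrow> h i = h j \<longleftrightarrow> i = j" for i j using h by (auto simp: bij_betw_def inj_on_def)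
  have gY: "i < 2 * (L - card I) \<Longrightarrow> g i \<in> Y' - T" for i using g by (auto simp: bij_betw_def)
  have g_inj: "i < 2 * (L - card I) \<Longrightarrow> j < 2 * (L - card I) \<Longrightarrow> g i = g j \<longleftrightarrow> i = j" for i j
    using g by (auto simp: bij_betw_def inj_on_def)
  have sT: "i \<in> I \<Longrightarrow> s i \<in> T" and tT: "i \<in> I \<Longrightarrow> t i \<in> T" for i by (auto simp: T_def)
  have s_inj: "i \<in> I \<Longrightarrow> j \<in> I \<Longrightarrow> s i = s j \<longleftrightarrow> i = j" and t_inj: "i \<in> I \<Longrightarrow> j \<in> I \<Longrightarrow> t i = t j \<longleftrightarrow> i = j"
    and st_ne: "i \<in> I \<Longrightarrow> j \<in> I \<Longrightarrow> s i \<noteq> t j" for i j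
    using st by (auto simp: pairing_def inj_on_def)
  have sides: "s' i \<in> Y'" "t' i \<in> Y'" if "i < L" for i
    using that gY[of "2 * (i - card I)"] gY[of "2 * (i - card I) + 1"] sT[OF hI] tT[OF hI] TY Y'(1)
    unfolding s'_def t'_def by (auto split: if_splits)
  have "pairing {..<L} s' t' Y'"
    unfolding pairing_def
  proof (intro conjI)
    have low: "2 * (i - card I) < 2 * (L - card I)" "2 * (i - card I) + 1 < 2 * (L - card I)" if "i < L" "\<not> i < card I" for i
      using that by auto
    show "inj_on s' {..<L}"
    proof (rule inj_onI)
      fix i j assume ij: "i \<in> {..<L}" "j \<in> {..<L}" "s' i = s' j"
      then show "i = j"
        using h_inj[of i j] s_inj[OF hI hI, of i j] g_inj[OF low(1) low(1), of i j] sT[OF hI, of i] sT[OF hI, of j]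
          gY[OF low(1), of i] gY[OF low(1), of j]
        by (cases "i < card I"; cases "j < card I") (auto simp: s'_def)
    qed
    show "inj_on t' {..<L}"
    proof (rule inj_onI)
      fix i j assume ij: "i \<in> {..<L}" "j \<in> {..<L}" "t' i = t' j"
      then show "i = j"
        using h_inj[of i j] t_inj[OF hI hI, of i j] g_inj[OF low(2) low(2), of i j] tT[OF hI, of i] tT[OF hI, of j]
          gY[OF low(2), of i] gY[OF low(2), of j]
        by (cases "i < card I"; cases "j < card I") (auto simp: t'_def)
    qed
    have "s' i \<noteq> t' j" if ij: "i < L" "j < L" for i j
    proof
      assume eq: "s' i = t' j"
      have odd: "2 * (i - card I) \<noteq> 2 * (j - card I) + 1" by presburger
      show False
        using eq ij st_ne[OF hI hI, of i j] g_inj[OF low(1) low(2), of i j] odd sT[OF hI, of i] tT[OF hI, of j]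
          gY[OF low(1), of i] gY[OF low(2), of j]
        by (cases "i < card I"; cases "j < card I") (auto simp: s'_def t'_def)
    qed
    then show "s' ` {..<L} \<inter> t' ` {..<L} = {}" by auto
  qed (use sides in auto)
  note pr = this
  then have prC: "pairing {..<L} s' t' C" using Y'(2) by (auto simp: pairing_def)
  with C(1) have "\<exists>p. (\<forall>i<L. gpath (clique E X) (p i) \<and> 3 \<le> length (p i) \<and> hd (p i) = s' i \<and> last (p i) = t' i \<and> set (p i) \<subseteq> C) \<and>
      (\<forall>i<L. \<forall>j<L. i \<noteq> j \<longrightarrow> set (p i) \<inter> set (p j) = {})"
    unfolding slinked_def by simp
  then obtain p where
    p0: "\<forall>i<L. gpath (clique E X) (p i) \<and> 3 \<le> length (p i) \<and> hd (p i) = s' i \<and> last (p i) = t' i \<and> set (p i) \<subseteq> C"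
    and pd0: "\<forall>i<L. \<forall>j<L. i \<noteq> j \<longrightarrow> set (p i) \<inter> set (p j) = {}"
    by (elim exE conjE)
  have p: "gpath (clique E X) (p i) \<and> 3 \<le> length (p i) \<and> hd (p i) = s' i \<and> last (p i) = t' i \<and> set (p i) \<subseteq> C" if "i < L" for i
    using p0 that by simp
  have pd: "set (p i) \<inter> set (p j) = {}" if "i < L" "j < L" "i \<noteq> j" for i j using pd0 that by simp
  have ends: "s' i \<in> set (p i)" "t' i \<in> set (p i)" if "i < L" for i
    using p[OF that] by (metis gpath_Nil hd_in_set last_in_set)+
  have "s' ` {..<L} \<union> t' ` {..<L} = Y'"
    using pairing_card[OF pr] sides Y'(3) finY' by (intro card_subset_eq) auto
  then have pY: "set (p i) \<inter> Y' = {s' i, t' i}" if i: "i < L" for i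
  proof -
    have "v \<in> {s' i, t' i}" if v: "v \<in> set (p i)" "v \<in> Y'" for v
    proof -
      obtain j where j: "j < L" "v = s' j \<or> v = t' j" using v(2) \<open>s' ` {..<L} \<union> t' ` {..<L} = Y'\<close> by auto
      then have "j = i" using ends[OF j(1)] pd[OF j(1) i] v(1) by blast
      then show ?thesis using j by auto
    qed
    then show ?thesis using ends[OF i] sides[OF i] by blast
  qed
  have pE: "gpath E (p i)" if i: "i < L" for i
  proof (rule ccontr)
    assume "\<not> gpath E (p i)"
    then have "\<not> successively E (p i)" using p[OF i] by (simp add: gpath_def)
    then obtain a x y b where ab: "p i = a @ x # y # b" and xy: "\<not> E x y"
      using not_successively_split by blast
    have "clique E X x y" using p[OF i] ab by (auto simp: gpath_def successively_append_iff)
    then have "x \<in> X" "y \<in> X" using xy by (auto simp: clique_def)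
    moreover have "x \<in> C" "y \<in> C" using p[OF i] ab by auto
    ultimately have "x \<in> set (p i) \<inter> Y'" "y \<in> set (p i) \<inter> Y'" using Y(3) Y'(1) ab by auto
    then have xy': "x \<in> {hd (p i), last (p i)}" "y \<in> {hd (p i), last (p i)}" using pY[OF i] p[OF i] by auto
    have d: "distinct (a @ x # y # b)" and l: "3 \<le> length (a @ x # y # b)" using p[OF i] ab by (auto simp: gpath_def)
    have "a = [] \<or> hd (p i) \<in> set a" "b = [] \<or> last (p i) \<in> set b" unfolding ab by (cases a; simp)+
    moreover have "hd (p i) \<in> set (a @ [x])" "last (p i) \<in> set (y # b)" unfolding ab by (cases a; simp)+
    ultimately show False using xy' d l by auto
  qed
  define k where "k = inv_into {..<card I} h"
  have k: "k i < card I" "h (k i) = i" if "i \<in> I" for i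
    using that h unfolding k_def by (metis bij_betw_def inv_into_into lessThan_iff, metis bij_betw_inv_into_right)
  have kL: "k i < L" if "i \<in> I" for i using k[OF that] rL by linarith
  have ks: "s' (k i) = s i" "t' (k i) = t i" if "i \<in> I" for i using k[OF that] by (auto simp: s'_def t'_def)
  show "\<exists>P. (\<forall>i\<in>I. connected_on (P i) E \<and> P i \<subseteq> C \<and> s i \<in> P i \<and> t i \<in> P i \<and> P i \<inter> Y = {s i, t i}) \<and>
          (\<forall>i\<in>I. \<forall>j\<in>I. i \<noteq> j \<longrightarrow> P i \<inter> P j = {})"
  proof (intro exI[of _ "\<lambda>i. set (p (k i))"] conjI ballI impI)
    fix i assume i: "i \<in> I"
    show "connected_on (set (p (k i))) E" using pE[OF kL[OF i]] sym by (rule connected_on_set_path)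
    show "set (p (k i)) \<subseteq> C" using p[OF kL[OF i]] by blast
    show "s i \<in> set (p (k i))" "t i \<in> set (p (k i))" using ends[OF kL[OF i]] unfolding ks[OF i] by simp_all
    have "set (p (k i)) \<inter> Y' = {s i, t i}" using pY[OF kL[OF i]] unfolding ks[OF i] .
    moreover have "{s i, t i} \<subseteq> Y" using sT[OF i] tT[OF i] TY by blast
    ultimately show "set (p (k i)) \<inter> Y = {s i, t i}" using Y'(1) by blast
  next
    fix i j assume ij: "i \<in> I" "j \<in> I" "i \<noteq> j"
    then have "k i \<noteq> k j" using k by metis
    then show "set (p (k i)) \<inter> set (p (k j)) = {}" using pd kL ij by blast
  qed
qed

text \<open>The vertex \<open>v\<close> is merged into \<open>u\<close>: \<open>u\<close> inherits
  the edges of \<open>v\<close>, while \<open>v\<close> itself is removed separately from the vertex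
  set.\<close>

definition contract :: "'a \<Rightarrow> 'a \<Rightarrow> ('a \<Rightarrow> 'a \<Rightarrow> bool) \<Rightarrow> 'a \<Rightarrow> 'a \<Rightarrow> bool" where
  "contract v u E a b \<longleftrightarrow> a \<noteq> b \<and> (E a b \<or> (a = u \<and> E v b) \<or> (b = u \<and> E a v))"

lemma contract_sym: "symp E \<Longrightarrow> symp (contract v u E)"
  unfolding contract_def by (rule sympI) (auto dest: sympD)

lemma contract_irrefl: "irreflp (contract v u E)"
  unfolding contract_def by (rule irreflpI) auto

text \<open>An inherited edge at \<open>u\<close> is replaced by the detour through
  \<open>v\<close>.\<close>

lemma connected_on_contract:
  assumes sym: "symp E" and uv: "E v u" and P: "connected_on P (contract v u E)" and v: "v \<notin> P"
  shows "connected_on (if u \<in> P then insert v P else P) E"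
proof (cases "u \<in> P")
  case False
  then have "connected_on P E" using P by (rule_tac connected_on_mono[OF P]) (auto simp: contract_def)
  then show ?thesis using False by simp
next
  case True
  let ?R = "\<lambda>x y. x \<in> insert v P \<and> y \<in> insert v P \<and> E x y"
  have vu: "?R\<^sup>*\<^sup>* v u" "?R\<^sup>*\<^sup>* u v" using True uv sym by (auto dest: sympD intro!: r_into_rtranclp)
  have hop: "?R\<^sup>*\<^sup>* a b" if ab: "a \<in> P \<and> b \<in> P \<and> contract v u E a b" for a b
  proof -
    consider "E a b" | "a = u" "E v b" | "b = u" "E a v" using ab by (auto simp: contract_def)
    then show ?thesis
    proof cases
      case 2
      then have "?R\<^sup>*\<^sup>* v b" using ab by (auto intro!: r_into_rtranclp)
      with vu(2) 2 show ?thesis by (auto intro: rtranclp_trans)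
    next
      case 3
      then have "?R\<^sup>*\<^sup>* a v" using ab by (auto intro!: r_into_rtranclp)
      with vu(1) 3 show ?thesis by (auto intro: rtranclp_trans)
    qed (use ab in \<open>auto intro!: r_into_rtranclp\<close>)
  qed
  have PP: "?R\<^sup>*\<^sup>* a b" if ab: "a \<in> P" "b \<in> P" for a b
  proof -
    have "(\<lambda>x y. x \<in> P \<and> y \<in> P \<and> contract v u E x y)\<^sup>*\<^sup>* a b" using P ab unfolding connected_on_def by blast
    then show ?thesis
    proof induction
      case (step y z)
      from rtranclp_trans[OF step.IH hop[OF step.hyps(2)]] show ?case .
    qed simp
  qed
  have "?R\<^sup>*\<^sup>* a b" if ab: "a \<in> insert v P" "b \<in> insert v P" for a b
  proof -
    have "?R\<^sup>*\<^sup>* a u" using ab(1) PP[OF _ True] vu by auto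
    moreover have "?R\<^sup>*\<^sup>* u b" using ab(2) PP[OF True] vu by auto
    ultimately show ?thesis by (rule rtranclp_trans)
  qed
  then show ?thesis using True unfolding connected_on_def by auto
qed

lemma linked_uncontract:
  assumes sym: "symp E" and uv: "E v u" and V: "v \<notin> V" and X: "X \<subseteq> V" and l: "linked V (contract v u E) X"
  shows "linked (insert v V) E X"
proof (rule linkedI)
  fix I :: "nat set" and s t assume "pairing I s t X"
  from linkedD[OF l this] obtain P where
    P: "\<And>i. i \<in> I \<Longrightarrow> connected_on (P i) (contract v u E) \<and> P i \<subseteq> V \<and> s i \<in> P i \<and> t i \<in> P i \<and> P i \<inter> X = {s i, t i}"
    and Pd: "\<And>i j. i \<in> I \<Longrightarrow> j \<in> I \<Longrightarrow> i \<noteq> j \<Longrightarrow> P i \<inter> P j = {}" by blast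
  define S where "S = (\<lambda>i. if u \<in> P i then insert v (P i) else P i)"
  have vP: "v \<notin> P i" if "i \<in> I" for i using P[OF that] V by blast
  have vX: "v \<notin> X" using X V by blast
  show "\<exists>P. (\<forall>i\<in>I. connected_on (P i) E \<and> P i \<subseteq> insert v V \<and> s i \<in> P i \<and> t i \<in> P i \<and> P i \<inter> X = {s i, t i}) \<and>
          (\<forall>i\<in>I. \<forall>j\<in>I. i \<noteq> j \<longrightarrow> P i \<inter> P j = {})"
  proof (intro exI[of _ S] conjI ballI impI)
    fix i assume i: "i \<in> I"
    show "connected_on (S i) E" unfolding S_def
      using connected_on_contract[OF sym uv _ vP[OF i]] P[OF i] by blast
    show "S i \<subseteq> insert v V" "s i \<in> S i" "t i \<in> S i" using P[OF i] by (auto simp: S_def)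
    show "S i \<inter> X = {s i, t i}" using P[OF i] vX by (auto simp: S_def)
  next
    fix i j assume ij: "i \<in> I" "j \<in> I" "i \<noteq> j"
    show "S i \<inter> S j = {}" using Pd[OF ij] vP[OF ij(1)] vP[OF ij(2)] by (auto simp: S_def)
  qed
qed

lemma linked_subset:
  assumes "linked V E Z" "Y \<subseteq> Z" shows "linked V E Y"
proof (rule linkedI)
  fix I :: "nat set" and s t assume st: "pairing I s t Y"
  have "pairing I s t Z" using st assms(2) unfolding pairing_def by (intro conjI) (auto dest: subset_trans)
  from linkedD[OF assms(1) this] obtain P where
    P: "\<And>i. i \<in> I \<Longrightarrow> connected_on (P i) E \<and> P i \<subseteq> V \<and> s i \<in> P i \<and> t i \<in> P i \<and> P i \<inter> Z = {s i, t i}"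
    and Pd: "\<And>i j. i \<in> I \<Longrightarrow> j \<in> I \<Longrightarrow> i \<noteq> j \<Longrightarrow> P i \<inter> P j = {}" by blast
  have "P i \<inter> Y = {s i, t i}" if i: "i \<in> I" for i
  proof -
    have "{s i, t i} \<subseteq> Y" using st i by (auto simp: pairing_def)
    moreover have "P i \<inter> Z = {s i, t i}" using P[OF i] by simp
    ultimately show ?thesis using assms(2) by blast
  qed
  then show "\<exists>P. (\<forall>i\<in>I. connected_on (P i) E \<and> P i \<subseteq> V \<and> s i \<in> P i \<and> t i \<in> P i \<and> P i \<inter> Y = {s i, t i}) \<and>
      (\<forall>i\<in>I. \<forall>j\<in>I. i \<noteq> j \<longrightarrow> P i \<inter> P j = {})"
    using P Pd by (intro exI[of _ P]) simp
qed

text \<open>Because all neighbours of \<open>W\<close> lie in \<open>Z\<close>, subsets of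
  \<open>W\<close> have the same neighbours and the same arcs in \<open>W \<union> Z\<close> as in
  \<open>V\<close>.\<close>

lemma submassed:
  assumes sym: "symp E" and W: "W \<subseteq> V" and Z: "Z \<subseteq> V - W" "nbs V E W \<subseteq> Z"
    and m1: "m * card W < card (arcs V E W)"
    and m2: "\<And>Y. Y \<subseteq> W \<Longrightarrow> card (nbs V E Y) < card Z \<Longrightarrow> card (arcs V E Y) \<le> m * card Y"
  shows "massed m (W \<union> Z) E Z"
proof -
  have WZ: "W \<union> Z - Z = W" using Z by auto
  have in_WZ: "v \<in> W \<union> Z" if "w \<in> W" "v \<in> V" "E w v" for w v
    using that Z(2) by (auto simp: nbs_def)
  have nb: "nbs (W \<union> Z) E Y = nbs V E Y" if "Y \<subseteq> W" for Y
    using that in_WZ W Z(1) unfolding nbs_def by blast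
  have ar: "arcs (W \<union> Z) E Y = arcs V E Y" if Y: "Y \<subseteq> W" for Y
  proof -
    have "u \<in> W \<union> Z \<and> v \<in> W \<union> Z" if "u \<in> V" "v \<in> V" "E u v" "u \<in> Y \<or> v \<in> Y" for u v
      using that in_WZ[of u v] in_WZ[of v u] Y sympD[OF sym, of u v] by auto
    then show ?thesis using W Z(1) unfolding arcs_def by blast
  qed
  show ?thesis unfolding massed_def WZ using m1 m2 by (auto simp: nb ar)
qed

lemma massedD:
  "massed m V E X \<Longrightarrow> W \<subseteq> V - X \<Longrightarrow> card (nbs V E W) < card X \<Longrightarrow> card (arcs V E W) \<le> m * card W"
  by (simp add: massed_def)

text \<open>In a minimal counterexample a maximal rigid \<open>W\<close> is deleted and its boundary made a clique; the remaining pair is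
  still massed and hence linked, or a set violating this enlarges \<open>W\<close>.\<close>

lemma massed_no_rigid:
  fixes V :: "'a set"
  assumes fin: "finite V" and sym: "symp E" and irr: "irreflp E" and X: "X \<subseteq> V"
    and massed: "massed m V E X" and not: "\<not> linked V E X"
    and IH: "\<And>(V' :: 'a set) E' X'. card V' < card V \<Longrightarrow> finite V' \<Longrightarrow> symp E' \<Longrightarrow> irreflp E' \<Longrightarrow> X' \<subseteq> V' \<Longrightarrow>
      card X' \<le> card X \<Longrightarrow> massed m V' E' X' \<Longrightarrow> linked V' E' X'"
  shows "\<not> rigid V E X W Z"
proof
  assume "rigid V E X W Z"
  moreover have "card W' < Suc (card V)" if "rigid V E X W' Z'" for W' Z'
  proof -
    have "W' \<subseteq> V" using that by (auto simp: rigid_def)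
    then show ?thesis using card_mono[OF fin] by (simp add: less_Suc_eq_le)
  qed
  ultimately have "\<exists>WZ. rigid V E X (fst WZ) (snd WZ) \<and>
      (\<forall>WZ'. rigid V E X (fst WZ') (snd WZ') \<longrightarrow> card (fst WZ') \<le> card (fst WZ))"
    by (intro ex_has_greatest_nat[of _ "(W, Z)" _ "Suc (card V)"]) auto
  then obtain W Z where rigid: "rigid V E X W Z"
    and maxW: "\<And>W' Z'. rigid V E X W' Z' \<Longrightarrow> card W' \<le> card W" by auto
  have W: "W \<noteq> {}" "W \<subseteq> V - X" and Z: "Z \<subseteq> V - W" "nbs V E W \<subseteq> Z" "card Z \<le> card X"
    and WZ: "linked (W \<union> Z) E Z" using rigid by (auto simp: rigid_def)
  have finX: "finite X" and finW: "finite W" and finZ: "finite Z" using X W Z fin by (auto dest: finite_subset)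
  have nbW: "v \<in> W \<union> Z" if "w \<in> W" "v \<in> V" "E w v" for w v using that Z(2) by (auto simp: nbs_def)
  have bigger: "False" if r: "rigid V E X (W \<union> W') Z'" and W': "W' \<noteq> {}" "W' \<inter> W = {}" for W' Z'
  proof -
    have "W \<union> W' \<subseteq> V" using r by (auto simp: rigid_def)
    then have "finite (W \<union> W')" using fin finite_subset by blast
    then have "card W < card (W \<union> W')" using W' by (intro psubset_card_mono) auto
    then show False using maxW[OF r] by simp
  qed
  show False
  \<comment> \<open>With equality, Menger's theorem between \<open>X\<close> and \<open>Z\<close>
    outside \<open>W\<close> either transports the linkage of \<open>Z\<close> to \<open>X\<close>
    or finds a smaller separator, beyond which lies a larger rigid set.\<close>
  proof (cases "card Z = card X")
    case True
    let ?V = "V - W"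
    have "finite ?V" "X \<subseteq> ?V" "Z \<subseteq> ?V" using fin X W Z by auto
    from menger_separator[OF this(1) sym this(2,3)] obtain Z1 W1 f where
      Z1: "card Z1 < card X \<or> Z1 = X" "Z1 \<subseteq> ?V" and W1: "W1 \<subseteq> ?V - Z1" "W1 \<inter> X = {}" "Z \<subseteq> W1 \<union> Z1"
      and nb1: "\<forall>w\<in>W1. \<forall>v\<in>?V. E w v \<longrightarrow> v \<in> W1 \<union> Z1"
      and f: "\<forall>z\<in>Z1. gpath E (f z) \<and> set (f z) \<subseteq> W1 \<union> Z1 \<and> hd (f z) = z \<and>
         set (f z) \<inter> Z1 = {z} \<and> last (f z) \<in> Z \<and> set (f z) \<inter> Z = {last (f z)}"
      and fd: "\<forall>z\<in>Z1. \<forall>z'\<in>Z1. z \<noteq> z' \<longrightarrow> set (f z) \<inter> set (f z') = {}" by (elim exE conjE) (rule that)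
    have f': "gpath E (f z) \<and> hd (f z) = z \<and> set (f z) \<inter> Z1 = {z} \<and> set (f z) \<inter> (W \<union> Z) = {last (f z)}" if z: "z \<in> Z1" for z
    proof -
      have "set (f z) \<subseteq> W1 \<union> Z1" using f z by simp
      then have "set (f z) \<inter> W = {}" using W1(1) Z1(2) by blast
      then have "set (f z) \<inter> (W \<union> Z) = set (f z) \<inter> Z" by blast
      then show ?thesis using f z by simp
    qed
    have Y: "linked (W \<union> Z) E ((\<lambda>z. last (f z)) ` Z1)"
    proof -
      have "(\<lambda>z. last (f z)) ` Z1 \<subseteq> Z" using f by auto
      then show ?thesis by (rule linked_subset[OF WZ])
    qed
    have l1: "linked ((W \<union> Z) \<union> (\<Union>z\<in>Z1. set (f z))) E Z1"
      by (rule linked_compose[OF sym f' _ Y]) (use fd in auto)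
    have sub: "(W \<union> Z) \<union> (\<Union>z\<in>Z1. set (f z)) \<subseteq> (W \<union> W1) \<union> Z1" using f W1(3) by blast
    show False
    proof (cases "Z1 = X")
      case True
      have "(W \<union> Z) \<union> (\<Union>z\<in>Z1. set (f z)) \<subseteq> V" using sub W W1 Z1 by blast
      from linked_mono[OF l1 this] True not show False by simp
    next
      case False
      then have less: "card Z1 < card X" using Z1 by simp
      have "rigid V E X (W \<union> W1) Z1"
        unfolding rigid_def
      proof (intro conjI)
        show "nbs V E (W \<union> W1) \<subseteq> Z1" using nbW nb1 W1(3) unfolding nbs_def by blast
        show "linked (W \<union> W1 \<union> Z1) E Z1" using linked_mono[OF l1 sub] .
      qed (use W W1 Z1 less in auto)
      moreover have "W1 \<noteq> {}"
      proof
        assume "W1 = {}"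
        then have "Z \<subseteq> Z1" using W1 by simp
        then have "card Z \<le> card Z1" using Z1(2) fin by (intro card_mono) (auto dest: finite_subset)
        then show False using less \<open>card Z = card X\<close> by simp
      qed
      ultimately show False using bigger W1 by blast
    qed
  next
    case False
    then have less: "card Z < card X" using Z by simp
    let ?V = "V - W" and ?E = "clique E Z"
    have symE: "symp ?E" and irrE: "irreflp ?E" using clique_sym[OF sym] clique_irrefl[OF irr] .
    have ltV: "card ?V < card V" using W fin by (intro psubset_card_mono) auto
    have finV: "finite ?V" and XV: "X \<subseteq> ?V" and ZV: "Z \<subseteq> ?V" using fin X W Z by auto
    have nbWlt: "card (nbs V E W) < card X" using Z(2) finZ less card_mono le_less_trans by blast
    \<comment> \<open>The boundary of \<open>W\<close> is smaller than \<open>X\<close>, so deleting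
      \<open>W\<close> costs no more arcs than the loss of its vertices pays for.\<close>
    then have arW: "card (arcs V E W) \<le> m * card W" using massed W unfolding massed_def by blast
    have "arcs V E (V - X) \<subseteq> arcs ?V ?E (?V - X) \<union> arcs V E W" using W by (auto simp: arcs_def clique_def)
    then have "card (arcs V E (V - X)) \<le> card (arcs ?V ?E (?V - X) \<union> arcs V E W)"
      by (rule card_mono[rotated]) (simp add: finite_arcs[OF finV] finite_arcs[OF fin])
    also have "\<dots> \<le> card (arcs ?V ?E (?V - X)) + card (arcs V E W)" by (rule card_Un_le)
    finally have "m * card (V - X) < card (arcs ?V ?E (?V - X)) + m * card W"
      using arW massed unfolding massed_def by linarith
    moreover have "card (V - X) = card (?V - X) + card W"
    proof -
      have "V - X = (?V - X) \<union> W" "(?V - X) \<inter> W = {}" using W by auto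
      then show ?thesis using finV finW card_Un_disjoint[of "?V - X" W] by simp
    qed
    ultimately have M1: "m * card (?V - X) < card (arcs ?V ?E (?V - X))" by (simp add: algebra_simps)
    have lift: "linked (W \<union> (V' \<union> Z')) E Z'" if "V' \<subseteq> ?V" "Z' \<subseteq> ?V" "Z \<subseteq> V' \<union> Z'" "linked (V' \<union> Z') ?E Z'" for V' Z'
      by (rule linked_replace_clique[OF sym _ that(3) _ that(4) WZ]) (use that(1,2) in auto)
    show False
    proof (cases "massed m ?V ?E X")
      case True
      have "linked ?V ?E X" by (rule IH[OF ltV finV symE irrE XV order_refl True])
      then have "linked (W \<union> ?V) E X"
        by (intro linked_replace_clique[OF sym _ ZV XV _ WZ]) auto
      moreover have "W \<union> ?V = V" using W by auto
      ultimately show False using not by simp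
    next
      case False
      define bad where "bad = (\<lambda>Y. Y \<subseteq> ?V - X \<and> card (nbs ?V ?E Y) < card X \<and> m * card Y < card (arcs ?V ?E Y))"
      from False M1 obtain Y0 where "bad Y0" unfolding massed_def bad_def by (auto simp: not_le)
      \<comment> \<open>The boundary of \<open>Y\<close> is chosen minimal so that \<open>Y\<close>
        with this boundary is massed in its turn.\<close>
      then obtain Y where Y: "bad Y" and Ymin: "\<And>Y'. bad Y' \<Longrightarrow> card (nbs ?V ?E Y) \<le> card (nbs ?V ?E Y')"
        using ex_has_least_nat[of bad Y0 "\<lambda>Y. card (nbs ?V ?E Y)"] by blast
      define Z2 where "Z2 = nbs ?V ?E Y"
      have Y': "Y \<subseteq> ?V" "Y \<inter> X = {}" "card Z2 < card X" "m * card Y < card (arcs ?V ?E Y)"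
        using Y by (auto simp: bad_def Z2_def)
      have Z2: "Z2 \<subseteq> ?V - Y" by (auto simp: Z2_def nbs_def)
      show False
      proof (cases "Y \<inter> Z = {}")
        case True
        \<comment> \<open>Away from \<open>Z\<close> the added edges change nothing, so
          \<open>Y\<close> would already violate massedness in the original graph.\<close>
        have nbY: "nbs V E Y = nbs ?V ?E Y"
        proof -
          have "v \<notin> W" if "y \<in> Y" "E y v" for y v
            using nbW[of v y] that True Y'(1) sympD[OF sym, of y v] by auto
          then have "(\<exists>w\<in>Y. E w v) \<Longrightarrow> v \<notin> W" for v by blast
          moreover have "(\<exists>w\<in>Y. ?E w v) \<longleftrightarrow> (\<exists>w\<in>Y. E w v)" for v using True by (auto simp: clique_def)
          ultimately show ?thesis unfolding nbs_def by auto
        qed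
        have "arcs ?V ?E Y \<subseteq> arcs V E Y"
          using True by (auto simp: arcs_def clique_def)
        then have "card (arcs ?V ?E Y) \<le> card (arcs V E Y)" using finite_arcs[OF fin] card_mono by blast
        moreover have "Y \<subseteq> V - X" using Y' by auto
        from massedD[OF massed this] have "card (arcs V E Y) \<le> m * card Y" using Y'(3) nbY by (simp add: Z2_def)
        ultimately show False using Y'(4) by simp
      next
        case False
        \<comment> \<open>As \<open>Z\<close> is a clique and meets \<open>Y\<close>, it lies in
          \<open>Y\<close> and its boundary. Therefore the linkage of \<open>Z2\<close> obtained by
          induction can be lifted through \<open>W\<close>, and \<open>W \<union> Y\<close> is a
          larger rigid set.\<close>
        have ZY: "Z \<subseteq> Y \<union> Z2"
        proof
          fix z assume z: "z \<in> Z"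
          obtain y where y: "y \<in> Y" "y \<in> Z" using False by auto
          show "z \<in> Y \<union> Z2"
          proof (cases "z \<in> Y")
            case False
            then have "?E y z" using z y by (auto simp: clique_def)
            then show ?thesis using False y z ZV unfolding Z2_def nbs_def by blast
          qed simp
        qed
        have "massed m (Y \<union> Z2) ?E Z2"
        proof (rule submassed[OF symE Y'(1) Z2 _ Y'(4)])
          fix Q assume Q: "Q \<subseteq> Y" "card (nbs ?V ?E Q) < card Z2"
          show "card (arcs ?V ?E Q) \<le> m * card Q"
          proof (rule ccontr)
            assume "\<not> card (arcs ?V ?E Q) \<le> m * card Q"
            then have "bad Q" using Q Y' unfolding bad_def by auto
            then show False using Ymin Q unfolding Z2_def by fastforce
          qed
        qed (simp add: Z2_def)
        moreover have YZV: "Y \<union> Z2 \<subseteq> ?V" using Y' Z2 by auto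
        have "card (Y \<union> Z2) < card V" using card_mono[OF finV YZV] ltV by simp
        moreover have "finite (Y \<union> Z2)" using finV YZV finite_subset by blast
        ultimately have "linked (Y \<union> Z2) ?E Z2"
          using symE irrE Y'(3) by (intro IH) simp_all
        then have "linked (W \<union> (Y \<union> Z2)) E Z2" using Y' Z2 ZY by (intro lift) auto
        moreover have "nbs V E (W \<union> Y) \<subseteq> Z2"
        proof
          fix v assume v: "v \<in> nbs V E (W \<union> Y)"
          then have vV: "v \<in> ?V" "v \<notin> Y" by (auto simp: nbs_def)
          from v obtain w where w: "w \<in> W \<or> w \<in> Y" "E w v" by (auto simp: nbs_def)
          show "v \<in> Z2"
          proof (cases "w \<in> W")
            case True
            then have "v \<in> Z" using nbW w vV by auto
            then show ?thesis using ZY vV by auto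
          next
            case False
            then show ?thesis using w vV unfolding Z2_def nbs_def by (auto simp: clique_def)
          qed
        qed
        ultimately have "rigid V E X (W \<union> Y) Z2"
          using W Y' Z2 unfolding rigid_def by (auto simp: Un_assoc)
        moreover have "Y \<noteq> {}" using False by auto
        ultimately show False using bigger Y'(1) by blast
      qed
    qed
  qed
qed

section \<open>Degree and contraction counts\<close>

lemma card_arcs_star:
  assumes fin: "finite V" and sym: "symp E" and v: "v \<in> V" "\<not> E v v"
  shows "card (arcs V E {v}) = 2 * card {u \<in> V. E v u}"
proof -
  let ?D = "{u \<in> V. E v u}"
  have "arcs V E {v} = (\<lambda>u. (v, u)) ` ?D \<union> (\<lambda>u. (u, v)) ` ?D"
    using v sympD[OF sym] by (auto simp: arcs_def)
  moreover have "(\<lambda>u. (v, u)) ` ?D \<inter> (\<lambda>u. (u, v)) ` ?D = {}" using v by auto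
  ultimately have "card (arcs V E {v}) = card ((\<lambda>u. (v, u)) ` ?D) + card ((\<lambda>u. (u, v)) ` ?D)"
    using fin by (simp add: card_Un_disjoint)
  also have "\<dots> = 2 * card ?D" by (simp add: card_image inj_on_def)
  finally show ?thesis .
qed

text \<open>The arcs lost are those of the edge between \<open>u\<close> and \<open>v\<close> and,
  for each neighbour \<open>w\<close> of \<open>v\<close>, those of an edge that becomes parallel to
  an existing one or falls inside \<open>X\<close>, where arcs are not counted. Both kinds of
  \<open>w\<close> together are the neighbours of \<open>u\<close> after turning \<open>X\<close>
  into a clique.\<close>

lemma contract_arcs:
  assumes fin: "finite V" and sym: "symp E" and irr: "irreflp E" and v: "v \<in> V - X" and u: "u \<in> V" "E v u"
  shows "card (arcs V E (V - X)) \<le> card (arcs (V - {v}) (contract v u E) (V - {v} - X)) +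
    2 * (1 + card {w \<in> V. E v w \<and> clique E X u w})"
proof -
  let ?D = "{w \<in> V. E v w}" and ?C = "{w \<in> V. E v w \<and> clique E X u w}"
  let ?V = "V - {v}" and ?E = "contract v u E"
  let ?B = "?D - {u} - ?C"
  define A where "A = {(a, b). a \<in> ?V \<and> b \<in> ?V \<and> E a b \<and> (a \<in> V - X \<or> b \<in> V - X)}"
  have nEvv: "\<not> E v v" "\<not> E u u" using irr by (auto dest: irreflpD)
  have uC: "u \<notin> ?C" using nEvv by (auto simp: clique_def)
  have finD: "finite ?D" using fin by simp
  have cB: "card ?B + 1 + card ?C = card ?D"
  proof -
    have "?D = insert u (?B \<union> ?C)" using u by auto
    then have "card ?D = card (insert u (?B \<union> ?C))" by (rule arg_cong)
    also have "\<dots> = Suc (card (?B \<union> ?C))" by (rule card_insert_disjoint) (use fin uC in auto)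
    finally have "card ?D = Suc (card (?B \<union> ?C))" .
    moreover have "card (?B \<union> ?C) = card ?B + card ?C" using fin by (intro card_Un_disjoint) auto
    ultimately show ?thesis by simp
  qed
  have "arcs V E (V - X) = A \<union> arcs V E {v}" using v by (auto simp: arcs_def A_def)
  then have "card (arcs V E (V - X)) \<le> card A + 2 * card ?D"
    using card_Un_le[of A "arcs V E {v}"] card_arcs_star[OF fin sym _ nEvv(1)] v by simp
  moreover have "card A + 2 * card ?B \<le> card (arcs ?V ?E (?V - X))"
  proof -
    let ?P = "(\<lambda>w. (u, w)) ` ?B" and ?Q = "(\<lambda>w. (w, u)) ` ?B"
    have nB: "\<not> E u w" "\<not> E w u" "w \<noteq> u" "w \<notin> X \<or> u \<notin> X" "w \<in> ?V" "E v w" "E w v" if "w \<in> ?B" for w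
      using that nEvv sympD[OF sym] by (auto simp: clique_def)
    have uV: "u \<in> ?V" using u nEvv by auto
    have "u \<notin> ?B" by simp
    then have "?P \<inter> ?Q = {}" by blast
    then have "card (?P \<union> ?Q) = 2 * card ?B"
      using fin by (simp add: card_Un_disjoint card_image inj_on_def)
    moreover have "A \<inter> (?P \<union> ?Q) = {}" using nB(1,2) unfolding A_def by blast
    moreover have "finite A" unfolding A_def by (rule finite_subset[of _ "V \<times> V"]) (use fin in auto)
    ultimately have "card A + 2 * card ?B = card (A \<union> (?P \<union> ?Q))"
      using fin by (simp add: card_Un_disjoint)
    also have "\<dots> \<le> card (arcs ?V ?E (?V - X))"
    proof (rule card_mono)
      show "finite (arcs ?V ?E (?V - X))" using fin by (simp add: finite_arcs)
      have "A \<subseteq> arcs ?V ?E (?V - X)" using nEvv irr by (auto simp: A_def arcs_def contract_def dest: irreflpD)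
      moreover have "?P \<union> ?Q \<subseteq> arcs ?V ?E (?V - X)"
      proof -
        have "(u, w) \<in> arcs ?V ?E (?V - X) \<and> (w, u) \<in> arcs ?V ?E (?V - X)" if "w \<in> ?B" for w
          using nB[OF that] uV by (auto simp: arcs_def contract_def)
        then show ?thesis by blast
      qed
      ultimately show "A \<union> (?P \<union> ?Q) \<subseteq> arcs ?V ?E (?V - X)" by blast
    qed
    finally show ?thesis .
  qed
  moreover have "a \<le> r + 2 * (1 + c)" if "a \<le> x + 2 * d" "x + 2 * b \<le> r" "b + 1 + c = d" for a x d b r c :: nat
    using that by simp
  ultimately show ?thesis using cB by blast
qed

text \<open>If all degrees outside \<open>X\<close> exceeded \<open>12 * L\<close>, the slack of two
  arcs would leave at most two vertices outside \<open>X\<close>, and then their degrees are at most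
  \<open>2 * L + 1\<close>.\<close>

lemma exists_low_degree:
  assumes fin: "finite V" and irr: "irreflp E" and X: "card X \<le> 2 * L" "X \<subseteq> V" and L: "1 \<le> L"
    and few: "card (arcs V E (V - X)) \<le> 12 * L * card (V - X) + 2" and ne: "V - X \<noteq> {}"
  shows "\<exists>v\<in>V - X. card {u \<in> V. E v u} \<le> 12 * L"
proof (rule ccontr)
  assume "\<not> ?thesis"
  then have big: "\<And>v. v \<in> V - X \<Longrightarrow> 12 * L + 1 \<le> card {u \<in> V. E v u}" by (auto simp: not_le Suc_le_eq)
  have finVX: "finite (V - X)" using fin by simp
  have "(\<Sum>v\<in>V - X. 12 * L + 1) \<le> (\<Sum>v\<in>V - X. card {u \<in> V. E v u})" using big by (rule sum_mono)
  also have "\<dots> = card (SIGMA v:V - X. {u \<in> V. E v u})" using fin by (subst card_SigmaI) auto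
  also have "\<dots> \<le> card (arcs V E (V - X))" using finite_arcs[OF fin] by (rule card_mono) (auto simp: arcs_def)
  finally have "(12 * L + 1) * card (V - X) \<le> 12 * L * card (V - X) + 2" using few by (simp add: mult.commute)
  then have c: "card (V - X) \<le> 2" by (simp add: algebra_simps)
  obtain v where v: "v \<in> V - X" using ne by auto
  have "card {u \<in> V. E v u} \<le> card (X \<union> (V - X - {v}))"
    using fin X irr by (intro card_mono) (auto dest: finite_subset irreflpD)
  also have "\<dots> \<le> card X + card (V - X - {v})" by (rule card_Un_le)
  also have "card (V - X - {v}) = card (V - X) - 1" using v by simp
  finally have "card {u \<in> V. E v u} \<le> 2 * L + 1" using c X by linarith
  then show False using big[OF v] L by linarith
qed

text \<open>In a minimal counterexample, no edge can be deleted or contracted. The former bounds the number of edges, so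
  some vertex outside \<open>X\<close> has low degree; the latter makes its neighbourhood dense, so it contains a linked set,
  which Menger's theorem connects to \<open>X\<close>.\<close>

theorem massed_linked:
  fixes V :: "'a set"
  assumes "1 \<le> L" "finite V" "symp E" "irreflp E" "X \<subseteq> V" "card X \<le> 2 * L" "massed (12 * L) V E X"
  shows "linked V E X"
  using assms(2-)
proof (induction "card V" arbitrary: V E X rule: less_induct)
  case outer: (less V E X)
  from outer.prems show ?case
  \<comment> \<open>Contraction lowers the number of vertices, deletion only the number of arcs, so
    a second induction is nested inside the first.\<close>
  proof (induction "card (arcs V E (V - X))" arbitrary: E rule: less_induct)
    case (less E)
    note fin = less.prems(1) and sym = less.prems(2) and irr = less.prems(3) and X = less.prems(4)
      and cX = less.prems(5) and ms = less.prems(6)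
    have L: "1 \<le> L" by fact
    have IH: "linked V' E' X'" if "card V' < card V" "finite V'" "symp E'" "irreflp E'" "X' \<subseteq> V'"
      "card X' \<le> card X" "massed (12 * L) V' E' X'" for V' :: "'a set" and E' X'
      by (rule outer.hyps[OF that(1-5) _ that(7)]) (use that(6) cX in simp)
    show ?case
    proof (rule ccontr)
      assume not: "\<not> linked V E X"
      have no_rigid: "\<not> rigid V E X W Z" for W Z
        by (rule massed_no_rigid[OF fin sym irr X ms not]) (rule IH)
      have finX: "finite X" using X fin finite_subset by blast
      have finVX: "finite (V - X)" using fin by simp
      have VX: "V - X \<noteq> {}"
      proof
        assume e: "V - X = {}"
        have "12 * L * card (V - X) < card (arcs V E (V - X))" using ms by (simp only: massed_def)
        then show False unfolding e arcs_def by simp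
      qed
      have M2: "card (arcs V E W) \<le> 12 * L * card W" if "W \<subseteq> V - X" "card (nbs V E W) < card X" for W
        by (rule massedD[OF ms that])
      have few: "card (arcs V E (V - X)) \<le> 12 * L * card (V - X) + 2"
      proof (rule ccontr)
        assume many: "\<not> ?thesis"
        \<comment> \<open>The edge to delete must not be the only connection of a vertex of
          \<open>X\<close> to the outside. If no such edge existed, each vertex of \<open>X\<close>
          would receive at most one edge and there would be no others, giving at most
          \<open>4 * L\<close> arcs.\<close>
        have "\<exists>x y. x \<in> V - X \<and> y \<in> V \<and> E x y \<and> \<not> (y \<in> X \<and> (\<forall>x'\<in>V - X. E x' y \<longrightarrow> x' = x))"
        proof (rule ccontr)
          assume "\<not> ?thesis"
          then have all: "y \<in> X \<and> (\<forall>x'\<in>V - X. E x' y \<longrightarrow> x' = x)" if "x \<in> V - X" "y \<in> V" "E x y" for x y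
            using that by blast
          define B where "B = {(x, y). x \<in> V - X \<and> y \<in> V \<and> E x y}"
          have "inj_on snd B" using all unfolding inj_on_def B_def by fastforce
          moreover have "snd ` B \<subseteq> X" using all by (auto simp: B_def)
          ultimately have cB: "card B \<le> card X" using finX card_inj_on_le by blast
          have finB: "finite B" unfolding B_def by (rule finite_subset[of _ "V \<times> V"]) (use fin in auto)
          have "arcs V E (V - X) \<subseteq> B \<union> prod.swap ` B"
          proof (clarify)
            fix a b assume "(a, b) \<in> arcs V E (V - X)" "(a, b) \<notin> prod.swap ` B"
            then show "(a, b) \<in> B" using sympD[OF sym, of a b]
              by (auto simp: arcs_def B_def image_iff) 
          qed
          then have "card (arcs V E (V - X)) \<le> card (B \<union> prod.swap ` B)" using finB by (intro card_mono) auto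
          also have "\<dots> \<le> card B + card (prod.swap ` B)" by (rule card_Un_le)
          also have "\<dots> \<le> 2 * card B" using card_image_le[OF finB, of prod.swap] by simp
          also have "\<dots> \<le> 4 * L" using cB cX by simp
          also have "\<dots> \<le> 12 * L * card (V - X)"
          proof -
            have "0 < card (V - X)" using VX finVX by (simp add: card_gt_0_iff)
            then have "12 * L * 1 \<le> 12 * L * card (V - X)" by (intro mult_left_mono) auto
            then show ?thesis by simp
          qed
          finally show False using many by simp
        qed
        then obtain x y where x: "x \<in> V - X" and y: "y \<in> V" "E x y"
          and xy: "y \<in> X \<Longrightarrow> \<exists>x'\<in>V - X. E x' y \<and> x' \<noteq> x" by blast
        define F where "F = (\<lambda>a b. E a b \<and> {a, b} \<noteq> {x, y})"
        have symF: "symp F" unfolding F_def by (rule sympI) (use sympD[OF sym] in \<open>auto simp: insert_commute\<close>)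
        have irrF: "irreflp F" unfolding F_def using irr by (auto simp: irreflp_def)
        have xney: "x \<noteq> y" using y irr by (auto dest: irreflpD)
        have arF: "arcs V F W \<subseteq> arcs V E W" for W by (auto simp: arcs_def F_def)
        have "arcs V E (V - X) = arcs V F (V - X) \<union> {(x, y), (y, x)}"
          using x y sympD[OF sym, of x y] by (auto simp: arcs_def F_def doubleton_eq_iff)
        then have c: "card (arcs V E (V - X)) \<le> card (arcs V F (V - X)) + 2"
          using card_Un_le[of "arcs V F (V - X)" "{(x, y), (y, x)}"] xney by simp
        have lt: "card (arcs V F (V - X)) < card (arcs V E (V - X))"
        proof (rule psubset_card_mono[OF finite_arcs[OF fin]])
          have "(x, y) \<in> arcs V E (V - X)" "(x, y) \<notin> arcs V F (V - X)" using x y by (auto simp: arcs_def F_def)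
          then show "arcs V F (V - X) \<subset> arcs V E (V - X)" using arF by blast
        qed
        have "\<not> massed (12 * L) V F X"
        proof
          assume "massed (12 * L) V F X"
          from less.hyps[OF lt fin symF irrF X cX this] have "linked V E X"
            by (rule linked_mono_edges) (simp add: F_def)
          then show False using not by simp
        qed
        moreover have "12 * L * card (V - X) < card (arcs V F (V - X))" using many c by linarith
        \<comment> \<open>Deleting an edge removes two arcs, which \<open>many\<close> tolerates, so
          it is the condition on small boundaries that fails after the deletion.\<close>
        ultimately obtain W where W: "W \<subseteq> V - X" "card (nbs V F W) < card X" "12 * L * card W < card (arcs V F W)"
          unfolding massed_def by (auto simp: not_le)
        have arW: "12 * L * card W < card (arcs V E W)"
          using W(3) card_mono[OF finite_arcs[OF fin] arF] by (rule less_le_trans)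
        have big: "card X \<le> card (nbs V E W)" using M2[OF W(1)] arW by (meson not_le)
        \<comment> \<open>The boundary of \<open>W\<close> falls below \<open>card X\<close> only
          through the deletion, so it had exactly \<open>card X\<close> vertices, and one of them,
          \<open>q\<close>, was attached to \<open>W\<close> by the deleted edge alone.\<close>
        have "\<exists>q. q \<in> {x, y} \<and> q \<notin> W \<and> nbs V E W \<subseteq> insert q (nbs V F W)"
        proof (rule ccontr)
          assume no: "\<not> ?thesis"
          have "nbs V E W \<subseteq> nbs V F W"
          proof
            fix q assume q: "q \<in> nbs V E W"
            then obtain w where w: "w \<in> W" "E w q" "q \<in> V - W" by (auto simp: nbs_def)
            show "q \<in> nbs V F W"
            proof (cases "{w, q} = {x, y}")
              case False
              then show ?thesis using w by (auto simp: nbs_def F_def)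
            next
              case True
              then have qxy: "q \<in> {x, y}" "{x, y} \<subseteq> insert q W" using w by (auto simp: doubleton_eq_iff)
              have "nbs V E W \<subseteq> insert q (nbs V F W)"
                using qxy by (auto simp: nbs_def F_def doubleton_eq_iff)
              then show ?thesis using no qxy w by blast
            qed
          qed
          then have "card (nbs V E W) \<le> card (nbs V F W)" using fin by (intro card_mono) (auto simp: nbs_def)
          then show False using big W(2) by simp
        qed
        then obtain q where q: "q \<in> {x, y}" "q \<notin> W" "nbs V E W \<subseteq> insert q (nbs V F W)" by blast
        define Z where "Z = nbs V E W"
        have finF: "finite (nbs V F W)" using fin by (auto simp: nbs_def)
        have ZV: "Z \<subseteq> V - W" by (auto simp: Z_def nbs_def)
        have "card Z \<le> card (insert q (nbs V F W))" using q(3) finF by (auto simp: Z_def intro: card_mono)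
        also have "\<dots> \<le> Suc (card (nbs V F W))" using finF by (simp add: card_insert_if)
        finally have cZ: "card Z = card X" using W(2) big by (simp add: Z_def)
        have qF: "q \<notin> nbs V F W"
        proof
          assume "q \<in> nbs V F W"
          then have "card Z \<le> card (nbs V F W)" using q(3) finF by (intro card_mono) (auto simp: Z_def)
          then show False using cZ W(2) by simp
        qed
        have Zm: "massed (12 * L) (W \<union> Z) E Z"
          by (rule submassed[OF sym _ ZV _ arW]) (use W M2 cZ in \<open>auto simp: Z_def\<close>)
        have Wne: "W \<noteq> {}" using arW by (auto simp: arcs_def)
        show False
        proof (cases "W \<union> Z = V")
          case False
          then have "W \<union> Z \<subset> V" using W ZV by blast
          then have "card (W \<union> Z) < card V" using fin by (rule psubset_card_mono[rotated])
          moreover have "finite (W \<union> Z)" using \<open>W \<union> Z \<subset> V\<close> fin finite_subset by blast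
          ultimately have "linked (W \<union> Z) E Z" using IH[OF _ _ sym irr _ _ Zm] cZ by auto
          then have "rigid V E X W Z" using Wne W ZV cZ by (auto simp: rigid_def Z_def)
          then show False using no_rigid by blast
        next
          case True
          \<comment> \<open>Here \<open>W\<close> is everything outside \<open>X\<close>, so
            \<open>q\<close> is the end \<open>y\<close> in \<open>X\<close>; its second outside
            neighbour \<open>x'\<close> keeps it in the boundary.\<close>
          have "X \<subseteq> Z" using True X W by blast
          then have XZ: "X = Z" using cZ fin ZV by (intro card_subset_eq) (auto dest: finite_subset)
          then have WX: "W = V - X" using True W ZV by blast
          then have qy: "q = y" "y \<in> X" using q x y by auto
          then obtain x' where x': "x' \<in> V - X" "E x' y" "x' \<noteq> x" using xy by blast
          then have "F x' y" using xney by (auto simp: F_def doubleton_eq_iff)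
          then have "q \<in> nbs V F W" using x' WX qy y by (auto simp: nbs_def)
          then show False using qF by simp
        qed
      qed
      obtain v where v: "v \<in> V - X" and dv: "card {u \<in> V. E v u} \<le> 12 * L"
        using exists_low_degree[OF fin irr cX X L few VX] by blast
      define D where "D = {u \<in> V. E v u}"
      have Eirr: "\<not> E a a" for a using irr by (auto dest: irreflpD)
      have Esym: "E a b \<Longrightarrow> E b a" for a b using sym by (rule sympD)
      have Dne: "D \<noteq> {}"
      proof
        assume "D = {}"
        then have "nbs V E {v} \<subseteq> {}" by (auto simp: nbs_def D_def)
        then have "rigid V E X {v} {}" using v linked_empty by (auto simp: rigid_def)
        then show False using no_rigid by blast
      qed
      \<comment> \<open>Contracting the edge between \<open>v\<close> and \<open>u\<close> removes
        one vertex, so at most \<open>12 * L\<close> arcs may be lost. With fewer than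
        \<open>6 * L\<close> such neighbours this bound holds, and only the condition on small
        boundaries can fail.\<close>
      have degD: "6 * L \<le> card {w \<in> D. clique E X u w}" if uD: "u \<in> D" for u
      proof (rule ccontr)
        assume small: "\<not> ?thesis"
        have u: "u \<in> V" "E v u" "u \<noteq> v" using uD Eirr by (auto simp: D_def)
        let ?V = "V - {v}" and ?E = "contract v u E"
        have symE: "symp ?E" and irrE: "irreflp ?E" using contract_sym[OF sym] contract_irrefl .
        have finV: "finite ?V" and XV: "X \<subseteq> ?V" using fin v X by auto
        have ltV: "card ?V < card V" using v fin by (intro card_Diff1_less) auto
        have "{w \<in> V. E v w \<and> clique E X u w} = {w \<in> D. clique E X u w}" by (auto simp: D_def)
        then have "card (arcs V E (V - X)) \<le> card (arcs ?V ?E (?V - X)) + 2 * (1 + card {w \<in> D. clique E X u w})"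
          using contract_arcs[OF fin sym irr v u(1,2)] by simp
        moreover have "2 * (1 + card {w \<in> D. clique E X u w}) \<le> 12 * L" using small by simp
        moreover have "card (V - X) = Suc (card (?V - X))"
        proof -
          have "?V - X = (V - X) - {v}" by auto
          then show ?thesis using v finVX by (metis card_Suc_Diff1)
        qed
        moreover have "12 * L * card (V - X) < card (arcs V E (V - X))" using ms by (simp add: massed_def)
        ultimately have M1: "12 * L * card (?V - X) < card (arcs ?V ?E (?V - X))" by simp
        have "\<not> massed (12 * L) ?V ?E X"
        proof
          assume "massed (12 * L) ?V ?E X"
          then have "linked ?V ?E X" using IH[OF ltV finV symE irrE XV] by simp
          from linked_uncontract[OF sym u(2) _ XV this] have "linked (insert v ?V) E X" by simp
          then show False using not v by (simp add: insert_absorb)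
        qed
        define bad where "bad = (\<lambda>Y. Y \<subseteq> ?V - X \<and> card (nbs ?V ?E Y) < card X \<and> 12 * L * card Y < card (arcs ?V ?E Y))"
        from \<open>\<not> massed (12 * L) ?V ?E X\<close> M1 obtain Y0 where "bad Y0"
          unfolding massed_def bad_def by (auto simp: not_le)
        then obtain W where W: "bad W" and Wmin: "\<And>Y'. bad Y' \<Longrightarrow> card (nbs ?V ?E W) \<le> card (nbs ?V ?E Y')"
          using ex_has_least_nat[of bad Y0 "\<lambda>Y. card (nbs ?V ?E Y)"] by blast
        define N where "N = nbs ?V ?E W"
        have W': "W \<subseteq> ?V" "W \<inter> X = {}" "card N < card X" "12 * L * card W < card (arcs ?V ?E W)"
          using W by (auto simp: bad_def N_def)
        have NV: "N \<subseteq> ?V - W" by (auto simp: N_def nbs_def)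
        have Wne: "W \<noteq> {}" using W'(4) by (auto simp: arcs_def)
        have finN: "finite N" using NV finV finite_subset by blast
        have toN: "b \<in> W \<union> N" if "a \<in> W" "b \<in> ?V" "?E a b" for a b
          using that by (auto simp: N_def nbs_def)
        consider "u \<in> W" | "u \<in> N" | "u \<notin> W" "u \<notin> N" by blast
        then show False
        proof cases
          \<comment> \<open>The merged vertex lies inside \<open>W\<close>: undoing the contraction
            adds \<open>v\<close> to \<open>W\<close> and keeps the boundary, so the result is
            rigid.\<close>
          case 1
          have "massed (12 * L) (W \<union> N) ?E N"
          proof (rule submassed[OF symE W'(1) NV _ W'(4)])
            fix Q assume Q: "Q \<subseteq> W" "card (nbs ?V ?E Q) < card N"
            show "card (arcs ?V ?E Q) \<le> 12 * L * card Q"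
            proof (rule ccontr)
              assume "\<not> card (arcs ?V ?E Q) \<le> 12 * L * card Q"
              then have "bad Q" using Q W' unfolding bad_def by auto
              then show False using Wmin Q unfolding N_def by fastforce
            qed
          qed (simp add: N_def)
          moreover have sub: "W \<union> N \<subseteq> ?V" using W' NV by auto
          have "card (W \<union> N) < card V" using card_mono[OF finV sub] ltV by simp
          moreover have "finite (W \<union> N)" using finV sub finite_subset by blast
          ultimately have "linked (W \<union> N) ?E N" using symE irrE W'(3) by (intro IH) simp_all
          from linked_uncontract[OF sym u(2) _ _ this] have "linked (insert v W \<union> N) E N" using sub by auto
          moreover have "nbs V E (insert v W) \<subseteq> N"
          proof
            fix b assume "b \<in> nbs V E (insert v W)"
            then obtain a where a: "a = v \<or> a \<in> W" "E a b" "b \<in> ?V" "b \<notin> W" by (auto simp: nbs_def)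
            have "b \<noteq> a" using a Eirr by auto
            show "b \<in> N"
            proof (cases "a = v")
              case True
              then have "?E u b" using a \<open>u \<in> W\<close> by (auto simp: contract_def)
              then show ?thesis using toN[OF 1 a(3)] a(4) by simp
            next
              case False
              then have "?E a b" using a \<open>b \<noteq> a\<close> by (auto simp: contract_def)
              then show ?thesis using toN[OF _ a(3)] a False by auto
            qed
          qed
          ultimately have "rigid V E X (insert v W) N"
            using W' NV v by (auto simp: rigid_def)
          then show False using no_rigid by blast
        next
          \<comment> \<open>The merged vertex lies in the boundary: \<open>v\<close> is put back
            there as well, and the boundary still has at most \<open>card X\<close>
            vertices.\<close>
          case 2
          then have uW: "u \<notin> W" using NV by auto
          define Z where "Z = insert v N"
          have ZV: "Z \<subseteq> V - W" using NV W' v by (auto simp: Z_def)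
          have cZ: "card Z \<le> card X" using W'(3) finN by (auto simp: Z_def card_insert_if)
          have nb: "nbs V E W \<subseteq> Z"
          proof
            fix b assume "b \<in> nbs V E W"
            then obtain a where a: "a \<in> W" "E a b" "b \<in> V" "b \<notin> W" by (auto simp: nbs_def)
            show "b \<in> Z"
            proof (cases "b = v")
              case False
              have "?E a b" using a Eirr by (auto simp: contract_def)
              then show ?thesis using toN[OF a(1)] a False by (auto simp: Z_def)
            qed (simp add: Z_def)
          qed
          \<comment> \<open>An arc at \<open>u\<close> that is new in the contraction came from
            \<open>v\<close> and is sent back there.\<close>
          define h where "h = (\<lambda>(a, b). if E a b then (a, b) else if a = u then (v, b) else (a, v))"
          have "inj_on h (arcs ?V ?E W)"
          proof (rule inj_onI)
            fix p q assume p: "p \<in> arcs ?V ?E W" and q: "q \<in> arcs ?V ?E W" and eq: "h p = h q"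
            then show "p = q" using uW
              by (cases p; cases q) (auto simp: h_def arcs_def contract_def split: if_splits)
          qed
          moreover have "h p \<in> arcs V E W" if "p \<in> arcs ?V ?E W" for p
            using that uW v by (cases p) (auto simp: h_def arcs_def contract_def split: if_splits)
          then have "h ` arcs ?V ?E W \<subseteq> arcs V E W" by blast
          ultimately have "card (arcs ?V ?E W) \<le> card (arcs V E W)"
            using finite_arcs[OF fin] card_inj_on_le by blast
          then have arW: "12 * L * card W < card (arcs V E W)" using W'(4) by simp
          have "massed (12 * L) (W \<union> Z) E Z"
          proof (rule submassed[OF sym _ ZV nb arW])
            show "W \<subseteq> V" using W' by auto
            fix Q assume Q: "Q \<subseteq> W" "card (nbs V E Q) < card Z"
            then show "card (arcs V E Q) \<le> 12 * L * card Q" using W' cZ by (intro M2) auto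
          qed
          moreover have "\<not> X \<subseteq> Z"
          proof
            assume "X \<subseteq> Z"
            then have "X \<subseteq> N" using v by (auto simp: Z_def)
            then show False using W'(3) card_mono[OF finN] by (meson not_le)
          qed
          then have sub: "W \<union> Z \<subset> V" using W' ZV X by blast
          have "card (W \<union> Z) < card V" using psubset_card_mono[OF fin sub] .
          moreover have "finite (W \<union> Z)" using sub fin finite_subset by blast
          ultimately have "linked (W \<union> Z) E Z" using sym irr cZ by (intro IH) simp_all
          then have "rigid V E X W Z" using W' ZV nb cZ Wne by (auto simp: rigid_def)
          then show False using no_rigid by blast
        next
          \<comment> \<open>The merged vertex is away from \<open>W\<close> and its boundary, so
            \<open>W\<close> already violated massedness before the contraction.\<close>
          case 3
          have nv: "\<not> E a v" if a: "a \<in> W" for a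
          proof
            assume "E a v"
            then have "?E a u" using 3 a by (auto simp: contract_def)
            then show False using toN[OF a, of u] 3 u by auto
          qed
          have nu: "\<not> ?E a u" if a: "a \<in> W" for a using toN[OF a, of u] 3 u by auto
          have "nbs V E W \<subseteq> N"
          proof
            fix b assume "b \<in> nbs V E W"
            then obtain a where a: "a \<in> W" "E a b" "b \<in> V" "b \<notin> W" by (auto simp: nbs_def)
            have "b \<noteq> v" using nv a by auto
            have "?E a b" using a Eirr by (auto simp: contract_def)
            then show "b \<in> N" using toN[OF a(1)] a \<open>b \<noteq> v\<close> by auto
          qed
          then have "card (nbs V E W) < card X" using card_mono[OF finN] W'(3) by (meson le_less_trans)
          moreover have "W \<subseteq> V - X" using W' by auto
          ultimately have "card (arcs V E W) \<le> 12 * L * card W" using M2 by blast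
          moreover have "arcs ?V ?E W \<subseteq> arcs V E W"
          proof (clarify)
            fix a b assume ab: "(a, b) \<in> arcs ?V ?E W"
            have "b \<noteq> u" if "a \<in> W" using nu[OF that] ab by (auto simp: arcs_def)
            moreover have "a \<noteq> u" if "b \<in> W" using nu[OF that] ab sympD[OF symE, of a b] by (auto simp: arcs_def)
            ultimately show "(a, b) \<in> arcs V E W" using ab 3 by (auto simp: arcs_def contract_def)
          qed
          then have "card (arcs ?V ?E W) \<le> card (arcs V E W)" using finite_arcs[OF fin] card_mono by blast
          ultimately show False using W'(4) by simp
        qed
      qed
      have finD: "finite D" using fin by (simp add: D_def)
      obtain C where C: "C \<subseteq> D" "2 * L \<le> card C" "slinked C (clique E X) L"
        using dense_contains_slinked[OF finD clique_sym[OF sym] clique_irrefl[OF irr] Dne degD] dv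
        by (auto simp: D_def)
      have CV: "C \<subseteq> V" using C by (auto simp: D_def)
      have finC: "finite C" using C finD finite_subset by blast
      from menger_separator[OF fin sym X CV] obtain Z W f where
        Z: "card Z < card X \<or> Z = X" "Z \<subseteq> V" and W: "W \<subseteq> V - Z" "W \<inter> X = {}" "C \<subseteq> W \<union> Z"
        and nb: "\<forall>w\<in>W. \<forall>v\<in>V. E w v \<longrightarrow> v \<in> W \<union> Z"
        and f: "\<forall>z\<in>Z. gpath E (f z) \<and> set (f z) \<subseteq> W \<union> Z \<and> hd (f z) = z \<and>
           set (f z) \<inter> Z = {z} \<and> last (f z) \<in> C \<and> set (f z) \<inter> C = {last (f z)}"
        and fd: "\<forall>z\<in>Z. \<forall>z'\<in>Z. z \<noteq> z' \<longrightarrow> set (f z) \<inter> set (f z') = {}" by (elim exE conjE) (rule that)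
      have cZ: "card Z \<le> card X" "finite Z" using Z fin finite_subset by auto
      let ?Y = "(\<lambda>z. last (f z)) ` Z"
      have "linked C E ?Y"
      proof (rule slinked_imp_linked[OF finC C(3,2) sym])
        show "?Y \<subseteq> C" using f by auto
        show "card ?Y \<le> 2 * L" using card_image_le[OF cZ(2), of "\<lambda>z. last (f z)"] cZ cX by linarith
        \<comment> \<open>A vertex of \<open>X\<close> in \<open>C\<close> must lie on the
          separator. The path starting there is already in \<open>C\<close> and meets
          \<open>C\<close> only at its end, so it consists of this vertex.\<close>
        show "X \<inter> C \<subseteq> ?Y"
        proof
          fix x assume x: "x \<in> X \<inter> C"
          then have xZ: "x \<in> Z" using W by auto
          then have "x \<in> set (f x)" using f by blast
          then have "x \<in> {last (f x)}" using f xZ x by blast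
          then show "x \<in> ?Y" using xZ by auto
        qed
      qed
      then have l: "linked (C \<union> (\<Union>z\<in>Z. set (f z))) E Z"
        by (intro linked_compose[OF sym]) (use f fd in auto)
      have sub: "C \<union> (\<Union>z\<in>Z. set (f z)) \<subseteq> W \<union> Z" using f W(3) by blast
      show False
      proof (cases "Z = X")
        case True
        have "C \<union> (\<Union>z\<in>Z. set (f z)) \<subseteq> V" using sub W Z by blast
        from linked_mono[OF l this] True not show False by simp
      next
        case False
        then have less: "card Z < card X" using Z by simp
        have "W \<noteq> {}"
        proof
          assume "W = {}"
          then have "card C \<le> card Z" using W(3) cZ by (intro card_mono) auto
          then show False using C(2) less cX by linarith
        qed
        moreover have "nbs V E W \<subseteq> Z" using nb by (auto simp: nbs_def)
        ultimately have "rigid V E X W Z"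
          using linked_mono[OF l sub] W Z cZ by (auto simp: rigid_def)
        then show False using no_rigid by blast
      qed
    qed
  qed
qed

section \<open>The Tutte-Berge formula\<close>

definition comp_of :: "'a set \<Rightarrow> ('a \<Rightarrow> 'a \<Rightarrow> bool) \<Rightarrow> 'a \<Rightarrow> 'a set" where
  "comp_of V E v = {w \<in> V. (\<lambda>x y. x \<in> V \<and> y \<in> V \<and> E x y)\<^sup>*\<^sup>* v w}"

lemma comp_of_self: "v \<in> V \<Longrightarrow> v \<in> comp_of V E v"
  by (simp add: comp_of_def)

lemma comp_of_subset: "comp_of V E v \<subseteq> V"
  by (auto simp: comp_of_def)

lemma comp_of_eq:
  assumes "symp E" "w \<in> comp_of V E v" shows "comp_of V E w = comp_of V E v"
proof -
  let ?R = "\<lambda>x y. x \<in> V \<and> y \<in> V \<and> E x y"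
  have vw: "?R\<^sup>*\<^sup>* v w" using assms(2) by (simp add: comp_of_def)
  then have "?R\<inverse>\<inverse>\<^sup>*\<^sup>* w v" by (rule rtranclp_converseI)
  moreover have "?R\<inverse>\<inverse> = ?R" using assms(1) by (auto simp: fun_eq_iff dest: sympD)
  ultimately have "?R\<^sup>*\<^sup>* w v" by simp
  then show ?thesis using vw unfolding comp_of_def by (auto intro: rtranclp_trans)
qed

lemma comp_of_step:
  assumes "u \<in> comp_of V E v" "w \<in> V" "E u w" shows "w \<in> comp_of V E v"
  using assms unfolding comp_of_def by (auto intro: rtranclp.rtrancl_into_rtrancl)

text \<open>A matching is a symmetric set of ordered pairs, so its domain is the set of covered vertices.\<close>

definition matching :: "'a set \<Rightarrow> ('a \<Rightarrow> 'a \<Rightarrow> bool) \<Rightarrow> ('a \<times> 'a) set \<Rightarrow> bool" where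
  "matching V E M \<longleftrightarrow> M \<subseteq> {(u, v). u \<in> V \<and> v \<in> V \<and> E u v} \<and> sym M \<and> single_valued M"

lemma even_card_involution:
  assumes "finite S" "\<And>x. x \<in> S \<Longrightarrow> f x \<in> S \<and> f x \<noteq> x \<and> f (f x) = x"
  shows "even (card S)"
  using assms
proof (induction "card S" arbitrary: S rule: less_induct)
  case less
  show ?case
  proof (cases "S = {}")
    case False
    then obtain x where x: "x \<in> S" by auto
    let ?S = "S - {x, f x}"
    have fx: "f x \<in> S" "f x \<noteq> x" using less.prems(2) x by auto
    have c: "card ?S = card S - 2" using x fx less.prems(1) by (subst card_Diff_subset) auto
    have "card {x, f x} \<le> card S" using x fx less.prems(1) by (intro card_mono) auto
    then have c2: "2 \<le> card S" using fx by simp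
    have "f y \<in> ?S \<and> f y \<noteq> y \<and> f (f y) = y" if y: "y \<in> ?S" for y
    proof -
      have "f y \<noteq> x" "f y \<noteq> f x" using less.prems(2)[of y] less.prems(2)[of x] x y by auto
      then show ?thesis using less.prems(2)[of y] y by auto
    qed
    then have "even (card ?S)" using less.hyps[of ?S] less.prems(1) c c2 by simp
    then show ?thesis using c c2 by simp
  qed simp
qed

lemma even_matched_set:
  assumes "finite V" "irreflp E" "matching V E M" "\<And>x y. x \<in> S \<Longrightarrow> (x, y) \<in> M \<Longrightarrow> y \<in> S" "S \<subseteq> Domain M"
  shows "even (card S)"
proof -
  have "\<forall>x\<in>S. \<exists>y. (x, y) \<in> M" using assms(5) by blast
  then obtain f where f: "\<And>x. x \<in> S \<Longrightarrow> (x, f x) \<in> M" by metis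
  have M: "sym M" "single_valued M" "M \<subseteq> {(u, v). u \<in> V \<and> v \<in> V \<and> E u v}" using assms(3) by (auto simp: matching_def)
  have "finite S" using assms(1,5) M(3) by (intro finite_subset[of S V]) auto
  then show ?thesis
  proof (rule even_card_involution)
    fix x assume x: "x \<in> S"
    have fS: "f x \<in> S" using assms(4)[OF x f[OF x]] .
    moreover have "f x \<noteq> x" using f[OF x] M(3) assms(2) by (auto dest: irreflpD)
    moreover have "(f x, x) \<in> M" using f[OF x] M(1) by (meson symD)
    then have "f (f x) = x" using f[OF fS] M(2) by (meson single_valuedD)
    ultimately show "f x \<in> S \<and> f x \<noteq> x \<and> f (f x) = x" by blast
  qed
qed

lemma matching_add:
  assumes "matching V E M" "symp E" "x \<in> V" "y \<in> V" "E x y" "x \<notin> Domain M" "y \<notin> Domain M" "x \<noteq> y"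
  shows "matching V E (M \<union> {(x, y), (y, x)})"
proof -
  have M: "sym M" "single_valued M" "M \<subseteq> {(u, v). u \<in> V \<and> v \<in> V \<and> E u v}" using assms(1) by (auto simp: matching_def)
  have "sym (M \<union> {(x, y), (y, x)})" using M(1) by (auto simp: sym_def)
  moreover have "single_valued (M \<union> {(x, y), (y, x)})"
    using M(2) assms(6-8) by (auto simp: single_valued_def)
  ultimately show ?thesis using M(3) assms(2-5) unfolding matching_def by (auto dest: sympD)
qed

definition max_matching :: "'a set \<Rightarrow> ('a \<Rightarrow> 'a \<Rightarrow> bool) \<Rightarrow> ('a \<times> 'a) set \<Rightarrow> bool" where
  "max_matching V E M \<longleftrightarrow> matching V E M \<and> (\<forall>M'. matching V E M' \<longrightarrow> card (Domain M') \<le> card (Domain M))"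

lemma max_matchingD: "max_matching V E M \<Longrightarrow> matching V E M' \<Longrightarrow> card (Domain M') \<le> card (Domain M)"
  by (simp add: max_matching_def)

lemma matching_domain: "matching V E M \<Longrightarrow> Domain M \<subseteq> V"
  by (auto simp: matching_def)

lemma max_matching_exists:
  assumes "finite V" shows "\<exists>M. max_matching V E M"
proof -
  have "matching V E {}" by (auto simp: matching_def sym_def)
  moreover have "card (Domain M) < Suc (card V)" if "matching V E M" for M
    using card_mono[OF assms matching_domain[OF that]] by simp
  ultimately have "\<exists>M. matching V E M \<and> (\<forall>M'. matching V E M' \<longrightarrow> card (Domain M') \<le> card (Domain M))"
    by (intro ex_has_greatest_nat[of _ "{}" _ "Suc (card V)"]) auto
  then show ?thesis by (simp add: max_matching_def)
qed

lemma max_matching_no_free_edge: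
  assumes fin: "finite V" and sym: "symp E" and irr: "irreflp E" and M: "max_matching V E M"
    and xy: "x \<in> V" "y \<in> V" "E x y" shows "x \<in> Domain M \<or> y \<in> Domain M"
proof (rule ccontr)
  assume no: "\<not> ?thesis"
  have "x \<noteq> y" using xy irr by (auto dest: irreflpD)
  then have m: "matching V E (M \<union> {(x, y), (y, x)})"
    using M no xy sym by (intro matching_add) (auto simp: max_matching_def)
  have "matching V E M" using M by (simp add: max_matching_def)
  then have "finite (Domain M)" using fin matching_domain finite_subset by metis
  then have "card (Domain M) < card (Domain (M \<union> {(x, y), (y, x)}))"
    using no by (intro psubset_card_mono) auto
  moreover have "card (Domain (M \<union> {(x, y), (y, x)})) \<le> card (Domain M)"
    by (rule max_matchingD[OF M m])
  ultimately show False by linarith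
qed

text \<open>Gallai's lemma in relational form: if every vertex is avoidable, then being unavoidable as a pair is transitive.\<close>

lemma gallai_transitive:
  assumes fin: "finite V" and sym: "symp E" and irr: "irreflp E"
    and t: "\<exists>M. max_matching V E M \<and> t \<notin> Domain M"
    and ut: "\<And>M. max_matching V E M \<Longrightarrow> u \<in> Domain M \<or> t \<in> Domain M"
    and tv: "\<And>M. max_matching V E M \<Longrightarrow> t \<in> Domain M \<or> v \<in> Domain M"
    and uv: "u \<noteq> v" and M: "max_matching V E M"
  shows "u \<in> Domain M \<or> v \<in> Domain M"
proof (rule ccontr)
  assume no: "\<not> ?thesis"
  define good where "good = (\<lambda>N. max_matching V E N \<and> t \<notin> Domain N)"
  have finM: "finite M" using M fin by (intro finite_subset[of M "V \<times> V"]) (auto simp: max_matching_def matching_def)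
  have "card (M \<inter> N) < Suc (card M)" for N using card_mono[OF finM, of "M \<inter> N"] by simp
  \<comment> \<open>Among the maximum matchings that miss \<open>t\<close>, one sharing as many
    pairs as possible with \<open>M\<close> is chosen.\<close>
  then have "\<exists>N. good N \<and> (\<forall>N'. good N' \<longrightarrow> card (M \<inter> N') \<le> card (M \<inter> N))"
    using t by (elim exE) (rule ex_has_greatest_nat[of good _ "\<lambda>N. card (M \<inter> N)" "Suc (card M)"], auto simp: good_def)
  then obtain N where N: "good N" and Nmax: "\<And>N'. good N' \<Longrightarrow> card (M \<inter> N') \<le> card (M \<inter> N)" by blast
  have mM: "matching V E M" and mN: "matching V E N" and mxN: "max_matching V E N" and tN: "t \<notin> Domain N"
    using M N by (auto simp: max_matching_def good_def)
  have finD: "finite (Domain M)" "finite (Domain N)" using finite_subset[OF matching_domain[OF mM] fin] finite_subset[OF matching_domain[OF mN] fin] .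
  have uN: "u \<in> Domain N" "v \<in> Domain N" using ut[OF mxN] tv[OF mxN] tN by auto
  have eq: "card (Domain M) = card (Domain N)"
    using max_matchingD[OF M mN] max_matchingD[OF mxN mM] by simp
  have "card {u, v} \<le> card (Domain N - Domain M)" using uN no finD by (intro card_mono) auto
  then have "2 \<le> card (Domain N - Domain M)" using uv by simp
  \<comment> \<open>Both matchings cover equally many vertices, and \<open>N\<close> covers
    \<open>u\<close> and \<open>v\<close> while \<open>M\<close> does not. So \<open>M\<close>
    covers at least two vertices that \<open>N\<close> misses, one of them different from
    \<open>t\<close>.\<close>
  also have "\<dots> = card (Domain M - Domain N)"
    using eq finD by (metis card_Diff_subset_Int finite_Int inf_commute)
  finally have "\<not> Domain M - Domain N \<subseteq> {t}"
    using card_mono[of "{t}" "Domain M - Domain N"] by auto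
  then obtain x where x: "x \<in> Domain M" "x \<notin> Domain N" "x \<noteq> t" by auto
  then obtain y where y: "(x, y) \<in> M" by auto
  have M': "Relation.sym M" "single_valued M" "M \<subseteq> {(u, v). u \<in> V \<and> v \<in> V \<and> E u v}" using mM by (auto simp: matching_def)
  have N': "Relation.sym N" "single_valued N" "N \<subseteq> {(u, v). u \<in> V \<and> v \<in> V \<and> E u v}" using mN by (auto simp: matching_def)
  have xyV: "x \<in> V" "y \<in> V" "E x y" using y M' by auto
  then have "y \<in> Domain N" using max_matching_no_free_edge[OF fin sym irr mxN xyV] x by auto
  then obtain z where z: "(y, z) \<in> N" by auto
  have zy: "(z, y) \<in> N" using z N'(1) by (meson symD)
  have yx: "(y, x) \<in> M" using y M'(1) by (meson symD)
  have xz: "x \<noteq> z" using zy x by auto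
  have ty: "t \<noteq> y" using \<open>y \<in> Domain N\<close> tN by auto
  have zne: "z \<noteq> y" "x \<noteq> y" using z xyV N'(3) irr by (auto dest: irreflpD)
  \<comment> \<open>In \<open>N\<close>, the edge \<open>y z\<close> is exchanged for the edge
    \<open>x y\<close> of \<open>M\<close>: the size and the freedom of \<open>t\<close> are kept,
    and the agreement with \<open>M\<close> grows.\<close>
  define K where "K = N - {(y, z), (z, y)}"
  have onlyy: "w = z" if "(y, w) \<in> N" for w using that z N'(2) by (meson single_valuedD)
  have onlyz: "w = y" if "(z, w) \<in> N" for w using that zy N'(2) by (meson single_valuedD)
  have domK: "Domain K = Domain N - {y, z}"
  proof
    show "Domain K \<subseteq> Domain N - {y, z}" using onlyy onlyz by (auto simp: K_def)
    show "Domain N - {y, z} \<subseteq> Domain K" by (auto simp: K_def)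
  qed
  have "matching V E K"
    unfolding matching_def
  proof (intro conjI)
    show "K \<subseteq> {(u, v). u \<in> V \<and> v \<in> V \<and> E u v}" using N'(3) by (auto simp: K_def)
    show "Relation.sym K" using N'(1) unfolding sym_def K_def by blast
    show "single_valued K" using N'(2) unfolding single_valued_def K_def by blast
  qed
  then have mK: "matching V E (K \<union> {(x, y), (y, x)})"
    using sym xyV x domK zne by (intro matching_add) auto
  have domK': "Domain (K \<union> {(x, y), (y, x)}) = insert x (Domain N - {z})"
    using domK \<open>y \<in> Domain N\<close> zne by auto
  moreover have "z \<in> Domain N" using zy by auto
  ultimately have "card (Domain (K \<union> {(x, y), (y, x)})) = card (Domain N)"
    using finD x by (metis DiffE card_Suc_Diff1 card_insert_disjoint finite_Diff)
  then have "good (K \<union> {(x, y), (y, x)})"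
    using mK mxN domK' tN x unfolding good_def max_matching_def by auto
  then have "card (M \<inter> (K \<union> {(x, y), (y, x)})) \<le> card (M \<inter> N)" by (rule Nmax)
  moreover have "card (M \<inter> N) < card (M \<inter> (K \<union> {(x, y), (y, x)}))"
  proof (rule psubset_card_mono)
    show "finite (M \<inter> (K \<union> {(x, y), (y, x)}))" using finM by simp
    have "(y, z) \<notin> M" using yx M'(2) xz by (meson single_valuedD)
    moreover then have "(z, y) \<notin> M" using M'(1) by (meson symD)
    ultimately have "M \<inter> N \<subseteq> M \<inter> (K \<union> {(x, y), (y, x)})" by (auto simp: K_def)
    moreover have "(x, y) \<notin> N" using x by auto
    ultimately show "M \<inter> N \<subset> M \<inter> (K \<union> {(x, y), (y, x)})" using y by blast
  qed
  ultimately show False by simp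
qed

text \<open>A vertex covered by every maximum matching is moved to the barrier. If no such vertex
  exists, Gallai's lemma leaves at most one uncovered vertex in each component, and the empty
  barrier works.\<close>

theorem tutte_berge:
  assumes "finite V" "symp E" "irreflp E"
  shows "\<exists>M U. matching V E M \<and> U \<subseteq> V \<and>
    card V + card U \<le> card (Domain M) + card {C \<in> comp_of (V - U) E ` (V - U). odd (card C)}"
  using assms
proof (induction "card V" arbitrary: V rule: less_induct)
  case less
  note fin = less.prems(1) and sym = less.prems(2) and irr = less.prems(3)
  obtain M where M: "max_matching V E M" using max_matching_exists[OF fin] by blast
  have mM: "matching V E M" using M by (simp add: max_matching_def)
  have evenM: "even (card (Domain M))" if "matching V E M" for M
    by (rule even_matched_set[OF fin irr that _ order_refl]) (use that in \<open>auto simp: matching_def dest: symD\<close>)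
  show ?case
  proof (cases "\<exists>v\<in>V. \<forall>M. max_matching V E M \<longrightarrow> v \<in> Domain M")
    case True
    then obtain v where v: "v \<in> V" "\<And>M. max_matching V E M \<Longrightarrow> v \<in> Domain M" by blast
    have "card (V - {v}) < card V" using v fin by (intro card_Diff1_less)
    then obtain M' U where MU: "matching (V - {v}) E M'" "U \<subseteq> V - {v}"
      "card (V - {v}) + card U \<le> card (Domain M') + card {C \<in> comp_of (V - {v} - U) E ` (V - {v} - U). odd (card C)}"
      using less.hyps[of "V - {v}"] fin sym irr by auto
    have mM': "matching V E M'" using MU(1) by (auto simp: matching_def)
    have "v \<notin> Domain M'" using MU(1) matching_domain by blast
    then have "\<not> max_matching V E M'" using v(2) by blast
    then obtain N where "matching V E N" "card (Domain M') < card (Domain N)"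
      using mM' unfolding max_matching_def by (auto simp: not_le)
    then have "card (Domain M') < card (Domain M)" using max_matchingD[OF M, of N] by simp
    \<comment> \<open>Covered sets are even, so losing a vertex that cannot be avoided costs two
      covered vertices; this pays for the barrier growing by one and the vertex set shrinking by
      one.\<close>
    then have "card (Domain M') + 2 \<le> card (Domain M)" using evenM[OF mM] evenM[OF mM'] by presburger
    moreover have "V - {v} - U = V - insert v U" by auto
    moreover have "finite U" "v \<notin> U" using MU(2) fin finite_subset[OF MU(2)] by auto
    then have "card (insert v U) = card U + 1" by simp
    moreover have "card V = card (V - {v}) + 1" using v fin by (metis Suc_eq_plus1 card_Suc_Diff1)
    ultimately show ?thesis using MU(2,3) mM v by (intro exI[of _ M] exI[of _ "insert v U"]) auto
  next
    case False
    then have avoid: "\<exists>M. max_matching V E M \<and> v \<notin> Domain M" if "v \<in> V" for v using that by blast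
    \<comment> \<open>Adjacent vertices are never both uncovered, and transitivity extends this
      along a path to any two vertices of a component.\<close>
    have reach: "u = w \<or> u \<in> Domain M \<or> w \<in> Domain M"
      if "w \<in> comp_of V E u" "max_matching V E M" for u w M
    proof -
      have "(\<lambda>x y. x \<in> V \<and> y \<in> V \<and> E x y)\<^sup>*\<^sup>* u w" using that by (simp add: comp_of_def)
      then have "\<forall>M. max_matching V E M \<longrightarrow> u = w \<or> u \<in> Domain M \<or> w \<in> Domain M"
      proof induction
        case (step y z)
        have e: "y \<in> Domain M \<or> z \<in> Domain M" if "max_matching V E M" for M
          using max_matching_no_free_edge[OF fin sym irr that] step.hyps(2) by blast
        show ?case
        proof (cases "u = y \<or> u = z")
          case True
          then show ?thesis using e by blast
        next
          case False
          then show ?thesis using gallai_transitive[OF fin sym irr avoid[of y] _ e] step by blast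
        qed
      qed simp
      then show ?thesis using that by blast
    qed
    have MV: "Domain M \<subseteq> V" using matching_domain[OF mM] .
    let ?O = "{C \<in> comp_of V E ` V. odd (card C)}"
    have "comp_of V E ` (V - Domain M) \<subseteq> ?O"
    proof
      fix C assume "C \<in> comp_of V E ` (V - Domain M)"
      then obtain v where v: "v \<in> V" "v \<notin> Domain M" "C = comp_of V E v" by auto
      have vC: "v \<in> C" using v comp_of_self by auto
      have CV: "C \<subseteq> V" unfolding v(3) by (rule comp_of_subset)
      have "even (card (C - {v}))"
      proof (rule even_matched_set[OF fin irr mM])
        fix x y assume x: "x \<in> C - {v}" "(x, y) \<in> M"
        have "(y, x) \<in> M" using x(2) mM by (simp add: matching_def symD)
        have "E x y" "y \<in> V" using x(2) mM by (auto simp: matching_def)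
        then have "y \<in> C" using x(1) comp_of_step[of x V E v y] unfolding v(3) by simp
        moreover have "y \<noteq> v" using \<open>(y, x) \<in> M\<close> v by auto
        ultimately show "y \<in> C - {v}" by simp
      next
        show "C - {v} \<subseteq> Domain M" using reach[OF _ M, of _ v] v by auto
      qed
      moreover have "card C = Suc (card (C - {v}))" using vC CV fin by (metis card_Suc_Diff1 finite_subset)
      ultimately show "C \<in> ?O" using v by auto
    qed
    moreover have "finite ?O" using fin by simp
    ultimately have "card (comp_of V E ` (V - Domain M)) \<le> card ?O" by (intro card_mono)
    moreover have "inj_on (comp_of V E) (V - Domain M)"
    proof (rule inj_onI)
      fix a b assume ab: "a \<in> V - Domain M" "b \<in> V - Domain M" "comp_of V E a = comp_of V E b"
      then have "b \<in> comp_of V E a" using comp_of_self[of b V E] by simp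
      then show "a = b" using reach[OF _ M] ab by blast
    qed
    ultimately have "card (V - Domain M) \<le> card ?O" by (simp add: card_image)
    moreover have "card V = card (V - Domain M) + card (Domain M)"
      using MV fin by (metis card_Diff_subset card_mono finite_subset le_add_diff_inverse2)
    ultimately show ?thesis using mM by (intro exI[of _ M] exI[of _ "{}"]) simp
  qed
qed

section \<open>Disjoint nonzero paths\<close>

text \<open>Lengths count vertices: a bichromatic path has an even number of them exactly if its
  ends differ in colour, and this is the opposite case.\<close>

definition nonzero :: "('a \<Rightarrow> bool) \<Rightarrow> 'a list \<Rightarrow> bool" where
  "nonzero col p \<longleftrightarrow> (even (length p) \<longleftrightarrow> col (hd p) = col (last p))"

definition apath :: "'a set \<Rightarrow> ('a \<Rightarrow> 'a \<Rightarrow> bool) \<Rightarrow> 'a set \<Rightarrow> 'a list \<Rightarrow> bool" where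
  "apath V E A p \<longleftrightarrow> gpath E p \<and> set p \<subseteq> V \<and> 2 \<le> length p \<and> set p \<inter> A = {hd p, last p}"

lemma comps_disjoint:
  assumes "symp E" "C \<in> comp_of V E ` V" "C' \<in> comp_of V E ` V" "x \<in> C" "x \<in> C'" shows "C = C'"
proof -
  obtain u v where "C = comp_of V E u" "C' = comp_of V E v" using assms(2,3) by blast
  then show ?thesis using comp_of_eq[OF assms(1), of x V u] comp_of_eq[OF assms(1), of x V v] assms(4,5) by simp
qed

lemma comps_step:
  assumes "C \<in> comp_of V E ` W" "x \<in> C" "y \<in> V" "E x y" shows "y \<in> C"
  using assms comp_of_step[of x V E _ y] by (elim imageE) simp

lemma comps_subset: "C \<in> comp_of V E ` W \<Longrightarrow> C \<subseteq> V"
  using comp_of_subset[of V E] by (elim imageE) simp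

lemma card_comp_sum:
  assumes fin: "finite V" and sym: "symp E" and S: "S \<subseteq> V"
  shows "(\<Sum>C\<in>comp_of V E ` V. card (S \<inter> C)) = card S"
proof -
  let ?C = "comp_of V E ` V"
  have finS: "finite S" using S fin finite_subset by blast
  have "card (\<Union>C\<in>?C. S \<inter> C) = (\<Sum>C\<in>?C. card (S \<inter> C))"
  proof (rule card_UN_disjoint)
    show "\<forall>C\<in>?C. finite (S \<inter> C)" using finS by simp
    show "\<forall>C\<in>?C. \<forall>C'\<in>?C. C \<noteq> C' \<longrightarrow> (S \<inter> C) \<inter> (S \<inter> C') = {}"
    proof (intro ballI impI equals0I)
      fix C C' x assume "C \<in> ?C" "C' \<in> ?C" "C \<noteq> C'" "x \<in> (S \<inter> C) \<inter> (S \<inter> C')"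
      then show False using comps_disjoint[OF sym, of C V C' x] by simp
    qed
  qed (use fin in simp)
  moreover have "(\<Union>C\<in>?C. S \<inter> C) = S"
  proof (intro equalityI subsetI)
    fix x assume "x \<in> S"
    then have "x \<in> V" "x \<in> comp_of V E x" using S comp_of_self[of x V E] by auto
    with \<open>x \<in> S\<close> show "x \<in> (\<Union>C\<in>?C. S \<inter> C)" by (intro UN_I[of "comp_of V E x"]) simp_all
  qed simp
  ultimately show ?thesis by simp
qed

text \<open>The two-level cover: \<open>A\<close> is kept only on the level given by the colouring, every other vertex on both levels.
  A path of the graph lifts to the cover, changing level at every inner vertex, so it joins two vertices of \<open>A\<close>
  in the cover exactly when it is nonzero.\<close>

definition cover_verts :: "'a set \<Rightarrow> 'a set \<Rightarrow> ('a \<Rightarrow> bool) \<Rightarrow> ('a \<times> bool) set" where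
  "cover_verts V A col = {(v, b). v \<in> V \<and> (v \<in> A \<longrightarrow> b = col v)}"

definition cover_adj :: "('a \<Rightarrow> 'a \<Rightarrow> bool) \<Rightarrow> 'a set \<Rightarrow> 'a \<times> bool \<Rightarrow> 'a \<times> bool \<Rightarrow> bool" where
  "cover_adj E A x y \<longleftrightarrow> (E (fst x) (fst y) \<and> snd x = snd y) \<or> (fst x = fst y \<and> fst x \<notin> A \<and> snd x \<noteq> snd y)"

definition flip :: "'a \<times> bool \<Rightarrow> 'a \<times> bool" where
  "flip x = (fst x, \<not> snd x)"

lemma cover_adj_sym: "symp E \<Longrightarrow> symp (cover_adj E A)"
  by (rule sympI) (auto simp: cover_adj_def dest: sympD)

lemma cover_adj_irrefl: "irreflp E \<Longrightarrow> irreflp (cover_adj E A)"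
  by (rule irreflpI) (auto simp: cover_adj_def dest: irreflpD)

lemma finite_cover: "finite V \<Longrightarrow> finite (cover_verts V A col)"
  by (rule finite_subset[of _ "V \<times> UNIV"]) (auto simp: cover_verts_def)

lemma flip_simps [simp]: "flip (flip x) = x" "flip x \<noteq> x" "fst (flip x) = fst x" "snd (flip x) = (\<not> snd x)"
  by (cases x; simp add: flip_def)+

lemma card_cover_outside:
  assumes "finite V"
  shows "card {x \<in> cover_verts V A col. fst x \<notin> A} = 2 * card (V - A)"
proof -
  have "{x \<in> cover_verts V A col. fst x \<notin> A} = (V - A) \<times> UNIV" by (auto simp: cover_verts_def)
  then show ?thesis by (simp add: card_cartesian_product)
qed

lemma card_cover:
  assumes "finite V" "A \<subseteq> V"
  shows "card (cover_verts V A col) = 2 * card (V - A) + card A"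
proof -
  have "cover_verts V A col = (V - A) \<times> UNIV \<union> (\<lambda>a. (a, col a)) ` A" using assms(2) by (auto simp: cover_verts_def)
  moreover have "(V - A) \<times> UNIV \<inter> (\<lambda>a. (a, col a)) ` A = {}" by auto
  moreover have "finite A" using assms finite_subset by blast
  moreover have "card ((\<lambda>a. (a, col a)) ` A) = card A" by (intro card_image) (auto simp: inj_on_def)
  ultimately show ?thesis using assms(1) by (simp add: card_Un_disjoint card_cartesian_product)
qed

text \<open>Twins on the path merge into one vertex of the projection. The path starts with a
  matched pair, since the twin of its first vertex is absent; as the matching is single-valued,
  matched pairs and twin pairs then alternate. Matched pairs become edges and keep the level, twin
  pairs change it at each inner vertex, so the levels of the ends record the parity.\<close>

lemma project_cover_path:
  assumes M: "\<And>x y. (x, y) \<in> M \<Longrightarrow> cover_adj E A x y" "sym M" "single_valued M"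
  shows "gpath (\<lambda>x y. (x, y) \<in> M \<or> (y = flip x \<and> fst x \<notin> A)) p \<Longrightarrow> 2 \<le> length p \<Longrightarrow> flip (hd p) \<notin> set p \<Longrightarrow>
      fst (last p) \<in> A \<Longrightarrow> (\<And>x. x \<in> set (butlast (tl p)) \<Longrightarrow> fst x \<notin> A) \<Longrightarrow>
    \<exists>q. gpath E q \<and> set q = fst ` set p \<and> hd q = fst (hd p) \<and> last q = fst (last p) \<and>
      (even (length q) \<longleftrightarrow> snd (hd p) = snd (last p))"
proof (induction "length p" arbitrary: p rule: less_induct)
  case less
  let ?H = "\<lambda>x y. (x, y) \<in> M \<or> (y = flip x \<and> fst x \<notin> A)"
  obtain x y r where p: "p = x # y # r" using less.prems(2)
    by (cases p; cases "tl p") auto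
  have gp: "gpath ?H (x # y # r)" using less.prems(1) p by simp
  then have xyM: "(x, y) \<in> M" using less.prems(3) p by (auto simp: gpath_def)
  have ny: "y \<noteq> flip x" using less.prems(3) p by auto
  then have xy: "E (fst x) (fst y)" "snd x = snd y" using M(1)[OF xyM]
    by (auto simp: cover_adj_def flip_def prod_eq_iff)
  have nfst: "fst w \<noteq> fst x" if "w \<in> set (y # r)" for w
  proof
    assume "fst w = fst x"
    then have "w = x \<or> w = flip x" by (auto simp: flip_def prod_eq_iff)
    then show False using that gp less.prems(3) p by (auto simp: gpath_def)
  qed
  show ?case
  proof (cases "r = []")
    case True
    then show ?thesis using p xy nfst[of y]
      by (intro exI[of _ "[fst x, fst y]"]) (auto simp: gpath_def)
  next
    case False
    then obtain z r' where r: "r = z # r'" by (cases r) auto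
    have yA: "fst y \<notin> A" using less.prems(5)[of y] p False by simp
    have "(y, x) \<in> M" using xyM M(2) by (meson symD)
    moreover have "z \<noteq> x" "?H y z" using gp r by (auto simp: gpath_def)
    ultimately have z: "z = flip y" using M(3) by (auto dest: single_valuedD)
    then have "r' \<noteq> []" using less.prems(4) p r yA by auto
    then have "2 \<le> length (z # r')" by (cases r') auto
    moreover have "gpath ?H (z # r')" using gp r by (auto simp: gpath_def)
    moreover have "flip (hd (z # r')) \<notin> set (z # r')" using gp r z by (auto simp: gpath_def)
    moreover have "fst (last (z # r')) \<in> A" using less.prems(4) p r by simp
    moreover have "fst w \<notin> A" if "w \<in> set (butlast (tl (z # r')))" for w
      using less.prems(5)[of w] that p r \<open>r' \<noteq> []\<close> by simp
    moreover have "length (z # r') < length p" using p r by simp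
    ultimately obtain q where q: "gpath E q" "set q = fst ` set (z # r')" "hd q = fst z" "last q = fst (last (z # r'))"
      "even (length q) \<longleftrightarrow> snd z = snd (last (z # r'))" using less.hyps[of "z # r'"] by auto
    have "q \<noteq> []" using q(1) by auto
    have "fst x \<notin> set q"
    proof
      assume "fst x \<in> set q"
      then have "fst x \<in> fst ` set (z # r')" using q(2) by simp
      then obtain w where "w \<in> set (z # r')" "fst x = fst w" by (rule imageE)
      then show False using nfst[of w] r by simp
    qed
    then have "gpath E (fst x # q)" using q(1,3) xy z by (auto simp: gpath_Cons)
    moreover have "set (fst x # q) = fst ` set p" using q(2) p r z by auto
    moreover have "last (fst x # q) = fst (last p)" using q(4) p r \<open>q \<noteq> []\<close> by simp
    moreover have "even (length (fst x # q)) \<longleftrightarrow> snd x = snd (last p)"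
      using q(5) z xy(2) p r by auto
    ultimately show ?thesis using p by (intro exI[of _ "fst x # q"]) simp
  qed
qed

text \<open>Matched pairs and twin pairs together form a graph of maximum degree two. Twin pairs
  perfectly match the vertices outside \<open>A\<close>, so a component in which the matching covers
  more vertices than that is a path with both ends in \<open>A\<close>. Each such component gains
  two, hence there are \<open>k\<close> of them.\<close>

lemma matching_gives_paths:
  assumes fin: "finite V" and sym: "symp E" and irr: "irreflp E" and A: "A \<subseteq> V"
    and M: "matching (cover_verts V A col) (cover_adj E A) M"
    and big: "2 * card (V - A) + 2 * k \<le> card (Domain M)"
  shows "\<exists>P. (\<forall>i<k. apath V E A (P i) \<and> nonzero col (P i)) \<and> (\<forall>i<k. \<forall>j<k. i \<noteq> j \<longrightarrow> set (P i) \<inter> set (P j) = {})"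
proof -
  let ?V = "cover_verts V A col" and ?E = "cover_adj E A"
  let ?H = "\<lambda>x y. (x, y) \<in> M \<or> (y = flip x \<and> fst x \<notin> A)"
  have finV: "finite ?V" using finite_cover[OF fin] .
  have irrE: "irreflp ?E" using cover_adj_irrefl[OF irr] .
  have symM: "sym M" and svM: "single_valued M" and MV: "\<And>x y. (x, y) \<in> M \<Longrightarrow> x \<in> ?V \<and> y \<in> ?V \<and> ?E x y"
    using M by (auto simp: matching_def)
  have symH: "symp ?H" by (rule sympI) (use symM in \<open>auto dest: symD\<close>)
  have flipV: "flip x \<in> ?V" if "x \<in> ?V" "fst x \<notin> A" for x using that by (auto simp: cover_verts_def flip_def)
  have Acopy: "x = y" if "x \<in> ?V" "y \<in> ?V" "fst x = fst y" "fst x \<in> A" for x y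
    using that by (auto simp: cover_verts_def)
  define comps where "comps = comp_of ?V ?H ` ?V"
  have fincomps: "finite comps" using finV by (simp add: comps_def)
  have closed: "y \<in> C" if "C \<in> comps" "x \<in> C" "y \<in> ?V" "?H x y" for C x y
    using that comps_step[of C ?V ?H ?V x y] by (simp add: comps_def)
  have CV: "C \<subseteq> ?V" if "C \<in> comps" for C using that comps_subset[of C ?V ?H ?V] by (simp add: comps_def)
  have finC: "finite C" if "C \<in> comps" for C using CV[OF that] finV finite_subset by blast
  define out where "out = {x \<in> ?V. fst x \<notin> A}"
  define good where "good = {C \<in> comps. card (out \<inter> C) < card (Domain M \<inter> C)}"
  have struct: "\<exists>p. gpath ?H p \<and> set p = C \<and> hd p \<noteq> last p \<and> {x \<in> C. fst x \<in> A} = {hd p, last p}"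
    "card (Domain M \<inter> C) \<le> card (out \<inter> C) + 2" if C: "C \<in> good" for C
  proof -
    have Cc: "C \<in> comps" and lt: "card (out \<inter> C) < card (Domain M \<inter> C)" using C by (auto simp: good_def)
    have "even (card (Domain M \<inter> C))"
    proof (rule even_matched_set[OF finV irrE M])
      fix x y assume "x \<in> Domain M \<inter> C" "(x, y) \<in> M"
      then show "y \<in> Domain M \<inter> C" using closed[OF Cc, of x y] MV symM by (auto dest: symD)
    qed simp
    moreover have "even (card (out \<inter> C))"
    proof (rule even_card_involution)
      show "finite (out \<inter> C)" using finC[OF Cc] by simp
      fix x assume x: "x \<in> out \<inter> C"
      then have "flip x \<in> ?V" "fst x \<notin> A" using flipV by (auto simp: out_def)
      then have "flip x \<in> out \<inter> C" using closed[OF Cc, of x "flip x"] x by (auto simp: out_def)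
      then show "flip x \<in> out \<inter> C \<and> flip x \<noteq> x \<and> flip (flip x) = x" by simp
    qed
    \<comment> \<open>Both numbers are even, so a surplus is at least two and forces two vertices of
      \<open>A\<close> into the component.\<close>
    ultimately have two: "card (out \<inter> C) + 2 \<le> card (Domain M \<inter> C)" using lt by presburger
    define AC where "AC = {x \<in> C. fst x \<in> A}"
    have finAC: "finite AC" using finC[OF Cc] by (simp add: AC_def)
    have "Domain M \<inter> C \<subseteq> (out \<inter> C) \<union> AC" using CV[OF Cc] by (auto simp: out_def AC_def)
    then have "card (Domain M \<inter> C) \<le> card ((out \<inter> C) \<union> AC)" using finAC finC[OF Cc] by (intro card_mono) auto
    also have "\<dots> \<le> card (out \<inter> C) + card AC" by (rule card_Un_le)
    finally have le: "card (Domain M \<inter> C) \<le> card (out \<inter> C) + card AC" .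
    then have AC2: "2 \<le> card AC" using two by linarith
    then obtain a where a: "a \<in> AC" by (metis card.empty ex_in_conv not_numeral_le_zero)
    \<comment> \<open>A vertex of \<open>A\<close> has no twin and hence at most one neighbour in
      \<open>?H\<close>, so a longest path starting there exhausts its component.\<close>
    define Q where "Q = (\<lambda>p. gpath ?H p \<and> set p \<subseteq> C \<and> hd p = a)"
    have "Q [a]" using a by (auto simp: Q_def AC_def)
    moreover have "length p < Suc (card C)" if "Q p" for p
      using that card_mono[OF finC[OF Cc], of "set p"] by (auto simp: Q_def gpath_def distinct_card)
    ultimately have "\<exists>p. Q p \<and> (\<forall>q. Q q \<longrightarrow> length q \<le> length p)"
      by (intro ex_has_greatest_nat[of Q "[a]" length "Suc (card C)"]) auto
    then obtain p where p: "gpath ?H p" "set p \<subseteq> C" "hd p = a" and pmax: "\<And>q. Q q \<Longrightarrow> length q \<le> length p"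
      by (auto simp: Q_def)
    have pne: "p \<noteq> []" using p by auto
    have inner: "fst x \<notin> A \<and> (\<forall>w. ?H x w \<longrightarrow> w = x' \<or> w = x'')" if s: "p = l @ x' # x # x'' # r" for l x' x x'' r
    proof -
      have H: "?H x' x" "?H x x''" "x' \<noteq> x''" using p(1) s by (auto simp: gpath_def successively_append_iff)
      have "?H x x'" using H(1) sympD[OF symH] by blast
      then show ?thesis using H svM by (auto dest: single_valuedD)
    qed
    have pclosed: "w \<in> set p" if x: "x \<in> set p" and w: "?H x w" "w \<in> ?V" for x w
    proof (rule ccontr)
      assume nw: "w \<notin> set p"
      have wC: "w \<in> C" using closed[OF Cc _ w(2,1)] x p(2) by blast
      obtain l r where s: "p = l @ x # r" using x by (meson split_list)
      show False
      proof (cases "r = []")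
        case True
        then have "last p = x" using s by simp
        then have "?H (last p) (hd [w])" using w(1) by simp
        moreover have "set p \<inter> set [w] = {}" using nw by simp
        ultimately have "gpath ?H (p @ [w])" using p(1) gpath_single[of ?H w] unfolding gpath_append by blast
        then have "Q (p @ [w])" using p wC pne by (auto simp: Q_def)
        from pmax[OF this] show False by simp
      next
        case False
        then obtain x'' r' where r: "r = x'' # r'" by (cases r) auto
        show False
        proof (cases "l = []")
          case True
          then have "x = a" using s p(3) by simp
          moreover have "?H x x''" using p(1) s r by (auto simp: gpath_def successively_append_iff)
          ultimately show False using a w nw s r svM by (auto simp: AC_def dest: single_valuedD)
        next
          case False
          then obtain l' x' where l: "l = l' @ [x']" by (metis rev_exhaust)
          have s': "p = l' @ x' # x # x'' # r'" using s l r by simp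
          have "w = x' \<or> w = x''" using inner[OF s'] w(1) by blast
          then show False using s' nw by (elim disjE) simp_all
        qed
      qed
    qed
    have "C \<subseteq> set p"
    proof
      fix w assume "w \<in> C"
      obtain c where "c \<in> ?V" "C = comp_of ?V ?H c" using Cc by (auto simp: comps_def)
      then have "w \<in> comp_of ?V ?H a" using comp_of_eq[OF symH, of a ?V c] a \<open>w \<in> C\<close> by (simp add: AC_def)
      then have "(\<lambda>x y. x \<in> ?V \<and> y \<in> ?V \<and> ?H x y)\<^sup>*\<^sup>* a w" by (simp add: comp_of_def)
      then show "w \<in> set p"
      proof induction
        case base
        show ?case using p(3) pne by (metis hd_in_set)
      next
        case (step y z)
        then show ?case using pclosed by blast
      qed
    qed
    then have setp: "set p = C" using p(2) by blast
    have ACp: "AC \<subseteq> {hd p, last p}"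
    proof
      fix x assume x: "x \<in> AC"
      then have "x \<in> set p" using setp by (simp add: AC_def)
      then obtain l r where s: "p = l @ x # r" by (meson split_list)
      show "x \<in> {hd p, last p}"
      proof (rule ccontr)
        assume n: "x \<notin> {hd p, last p}"
        have "l \<noteq> []" "r \<noteq> []" using n s by auto
        then obtain l' x' x'' r' where "l = l' @ [x']" "r = x'' # r'" by (metis rev_exhaust list.exhaust)
        then have s': "p = l' @ x' # x # x'' # r'" using s by simp
        show False using conjunct1[OF inner[OF s']] x by (simp add: AC_def)
      qed
    qed
    then have "card AC \<le> card {hd p, last p}" by (intro card_mono) auto
    then have "card {hd p, last p} = 2" "hd p \<noteq> last p" using AC2 by (auto simp: card_insert_if split: if_splits)
    moreover have "AC = {hd p, last p}" using ACp AC2 \<open>card {hd p, last p} = 2\<close> by (intro card_seteq) simp_all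
    ultimately show "\<exists>p. gpath ?H p \<and> set p = C \<and> hd p \<noteq> last p \<and> {x \<in> C. fst x \<in> A} = {hd p, last p}"
      and "card (Domain M \<inter> C) \<le> card (out \<inter> C) + 2"
      using p(1) setp le by (auto simp: AC_def)
  qed
  have "2 * card (V - A) + 2 * k \<le> (\<Sum>C\<in>comps. card (Domain M \<inter> C))"
    using big card_comp_sum[OF finV symH matching_domain[OF M]] by (simp add: comps_def)
  also have "\<dots> \<le> (\<Sum>C\<in>comps. card (out \<inter> C) + (if C \<in> good then 2 else 0))"
  proof (rule sum_mono)
    fix C assume "C \<in> comps"
    then show "card (Domain M \<inter> C) \<le> card (out \<inter> C) + (if C \<in> good then 2 else 0)"
      using struct(2)[of C] by (auto simp: good_def)
  qed
  also have "\<dots> = card out + 2 * card good"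
  proof -
    have "(\<Sum>C\<in>comps. card (out \<inter> C)) = card out"
      using card_comp_sum[OF finV symH, of out] by (auto simp: comps_def out_def)
    moreover have "(\<Sum>C\<in>comps. if C \<in> good then 2 else 0 :: nat) = (\<Sum>C\<in>{C \<in> comps. C \<in> good}. 2)"
      using sum.inter_filter[OF fincomps, of "\<lambda>_. 2 :: nat" "\<lambda>C. C \<in> good"] by simp
    moreover have "{C \<in> comps. C \<in> good} = good" by (auto simp: good_def)
    ultimately show ?thesis by (simp add: sum.distrib)
  qed
  also have "card out = 2 * card (V - A)" unfolding out_def by (rule card_cover_outside[OF fin])
  finally have "k \<le> card good" by simp
  moreover have fingood: "finite good" using fincomps by (simp add: good_def)
  ultimately obtain g where g: "inj_on g {..<k}" "g ` {..<k} \<subseteq> good"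
    by (metis card_le_inj card_lessThan finite_lessThan)
  have "\<exists>q. apath V E A q \<and> nonzero col q \<and> set q = fst ` C" if C: "C \<in> good" for C
  proof -
    have Cc: "C \<in> comps" using C by (simp add: good_def)
    from struct(1)[OF C] obtain p where p: "gpath ?H p" "set p = C" "hd p \<noteq> last p" "{x \<in> C. fst x \<in> A} = {hd p, last p}" by blast
    have hl: "hd p \<in> C" "last p \<in> C" "fst (hd p) \<in> A" "fst (last p) \<in> A" using p(4) by auto
    have pne: "p \<noteq> []" using p(1) by auto
    have len: "2 \<le> length p" using p(3) pne by (cases p; cases "tl p") auto
    have flip: "flip (hd p) \<notin> set p"
    proof
      assume "flip (hd p) \<in> set p"
      then have "flip (hd p) = hd p" using p(2) CV[OF Cc] hl by (intro Acopy) auto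
      then show False by simp
    qed
    have mid: "fst x \<notin> A" if x: "x \<in> set (butlast (tl p))" for x
    proof
      assume "fst x \<in> A"
      moreover have "x \<in> set p" using x by (metis in_set_butlastD list.set_sel(2) pne)
      ultimately have "x = hd p \<or> x = last p" using p(2,4) by auto
      moreover have "distinct p" using p(1) by (simp add: gpath_def)
      ultimately show False using x
        by (cases p; cases "tl p" rule: rev_cases) auto
    qed
    obtain q where q: "gpath E q" "set q = fst ` set p" "hd q = fst (hd p)" "last q = fst (last p)"
      "even (length q) \<longleftrightarrow> snd (hd p) = snd (last p)"
      using project_cover_path[OF _ symM svM p(1) len flip hl(4) mid] MV by blast
    have sn: "snd (hd p) = col (hd q)" "snd (last p) = col (last q)"
      using hl CV[OF Cc] q(3,4) by (auto simp: cover_verts_def)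
    have "hd q \<noteq> last q" using Acopy[of "hd p" "last p"] p(3) hl CV[OF Cc] q(3,4) by auto
    then have "2 \<le> length q" using q(1) by (cases q; cases "tl q") auto
    moreover have "set q \<inter> A = {hd q, last q}"
    proof -
      have "set q \<inter> A = fst ` {x \<in> C. fst x \<in> A}" using q(2) p(2) by auto
      then show ?thesis using p(4) q(3,4) by simp
    qed
    moreover have "set q \<subseteq> V" using q(2) p(2) CV[OF Cc] by (auto simp: cover_verts_def)
    ultimately show ?thesis using q sn p(2) by (intro exI[of _ q]) (auto simp: apath_def nonzero_def)
  qed
  then obtain path where path: "\<And>C. C \<in> good \<Longrightarrow> apath V E A (path C) \<and> nonzero col (path C) \<and> set (path C) = fst ` C"
    by metis
  have gg: "g i \<in> good" if "i < k" for i using g(2) that by auto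
  \<comment> \<open>Twins outside \<open>A\<close> lie in the same component and a vertex of
    \<open>A\<close> has only one copy, so projections of different components are disjoint.\<close>
  have "fst ` C \<inter> fst ` C' = {}" if C: "C \<in> good" "C' \<in> good" "C \<noteq> C'" for C C'
  proof (rule ccontr)
    have Cc: "C \<in> comps" "C' \<in> comps" using C by (auto simp: good_def)
    assume "fst ` C \<inter> fst ` C' \<noteq> {}"
    then obtain x y where xy: "x \<in> C" "y \<in> C'" "fst x = fst y" by auto
    have V: "x \<in> ?V" "y \<in> ?V" using xy CV Cc by auto
    have "y \<in> C"
    proof (cases "x = y")
      case False
      then have "y = flip x" using xy(3) by (auto simp: flip_def prod_eq_iff)
      moreover have "fst x \<notin> A" using Acopy[OF V xy(3)] False by blast
      ultimately show ?thesis using closed[OF Cc(1) xy(1) V(2)] by blast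
    qed (use xy in simp)
    then show False using comps_disjoint[OF symH, of C ?V C' y] xy Cc C(3) by (auto simp: comps_def)
  qed
  then have "set (path (g i)) \<inter> set (path (g j)) = {}" if "i < k" "j < k" "i \<noteq> j" for i j
    using path gg that g(1) by (metis inj_onD lessThan_iff)
  then show ?thesis using path gg by (intro exI[of _ "\<lambda>i. path (g i)"]) auto
qed

text \<open>If the cover has no large matching, let \<open>U\<close> be a Tutte-Berge barrier. The components of the rest that contain no
  vertex of \<open>A\<close> and no vertex whose twin lies in \<open>U\<close> are invariant under \<open>flip\<close>, hence even. In every other component one
  such boundary vertex is kept, and the projections of the remaining ones, with those of the parts of \<open>U\<close> in \<open>A\<close> or
  closed under \<open>flip\<close>, are deleted. By connectivity no pair of twins survives, and the levels of the kept vertices give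
  the bipartition.\<close>

theorem nonzero_paths_or_bipartite:
  assumes fin: "finite V" and sym: "symp E" and irr: "irreflp E" and A: "A \<subseteq> V" "2 * k \<le> card A" and k: "1 \<le> k"
    and conn: "\<And>X. X \<subseteq> V \<Longrightarrow> card X < 2 * k \<Longrightarrow> connected_on (V - X) E"
  shows "(\<exists>P. (\<forall>i<k. apath V E A (P i) \<and> nonzero col (P i)) \<and> (\<forall>i<k. \<forall>j<k. i \<noteq> j \<longrightarrow> set (P i) \<inter> set (P j) = {})) \<or>
    (\<exists>X\<subseteq>V. card X \<le> 2 * k - 2 \<and> bipartite_on (V - X) E)"
proof -
  let ?V = "cover_verts V A col" and ?E = "cover_adj E A"
  have finV: "finite ?V" using finite_cover[OF fin] .
  have irrE: "irreflp ?E" and symE: "symp ?E" using cover_adj_irrefl[OF irr] cover_adj_sym[OF sym] .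
  from tutte_berge[OF finV symE irrE] obtain M U where M: "matching ?V ?E M" and U: "U \<subseteq> ?V"
    and tb: "card ?V + card U \<le> card (Domain M) + card {C \<in> comp_of (?V - U) ?E ` (?V - U). odd (card C)}" by blast
  show ?thesis
  proof (cases "2 * card (V - A) + 2 * k \<le> card (Domain M)")
    case True
    from matching_gives_paths[OF fin sym irr A(1) M this] show ?thesis by blast
  next
    case False
    have "even (card (Domain M))"
      by (rule even_matched_set[OF finV irrE M]) (use M in \<open>auto simp: matching_def dest: symD\<close>)
    with False have dM: "card (Domain M) + 2 \<le> 2 * card (V - A) + 2 * k" by presburger
    define Q where "Q = ?V - U"
    define comps where "comps = comp_of Q ?E ` Q"
    \<comment> \<open>The boundary consists of the vertices outside the barrier whose twin is
      missing, either because they belong to \<open>A\<close> or because the twin is in the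
      barrier.\<close>
    define Bd where "Bd = {x \<in> Q. fst x \<in> A \<or> flip x \<in> U}"
    have finQ: "finite Q" and finU: "finite U" and finBd: "finite Bd" and fincomps: "finite comps"
      using finV U finite_subset by (auto simp: Q_def Bd_def comps_def)
    have CQ: "C \<subseteq> Q" if "C \<in> comps" for C using that comps_subset[of C Q ?E Q] by (simp add: comps_def)
    have closed: "y \<in> C" if "C \<in> comps" "x \<in> C" "y \<in> Q" "?E x y" for C x y
      using that comps_step[of C Q ?E Q x y] by (simp add: comps_def)
    have inC: "\<exists>C\<in>comps. x \<in> C" if "x \<in> Q" for x using that comp_of_self[of x Q ?E] by (auto simp: comps_def)
    have flipQ: "flip x \<in> Q" "?E x (flip x)" if "x \<in> Q" "x \<notin> Bd" for x
      using that by (auto simp: Q_def Bd_def cover_verts_def flip_def cover_adj_def)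
    define touch where "touch = {C \<in> comps. C \<inter> Bd \<noteq> {}}"
    have "{C \<in> comps. odd (card C)} \<subseteq> touch"
    proof
      fix C assume C: "C \<in> {C \<in> comps. odd (card C)}"
      have "C \<inter> Bd \<noteq> {}"
      proof
        assume no: "C \<inter> Bd = {}"
        have "even (card C)"
        proof (rule even_card_involution)
          show "finite C" using C CQ finQ finite_subset by blast
          fix x assume x: "x \<in> C"
          then have "x \<in> Q" "x \<notin> Bd" using C CQ no by auto
          then show "flip x \<in> C \<and> flip x \<noteq> x \<and> flip (flip x) = x" using closed[of C x "flip x"] C x flipQ[of x] by auto
        qed
        then show False using C by simp
      qed
      then show "C \<in> touch" using C by (simp add: touch_def)
    qed
    then have odd_le: "card {C \<in> comps. odd (card C)} \<le> card touch" using fincomps by (intro card_mono) (auto simp: touch_def)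
    define r where "r = (\<lambda>C. SOME x. x \<in> C \<inter> Bd)"
    have r: "r C \<in> C \<inter> Bd" if "C \<in> touch" for C
      using that unfolding touch_def r_def by (metis (mono_tags, lifting) ex_in_conv mem_Collect_eq someI_ex)
    define Sel where "Sel = r ` touch"
    have r_eq: "r C = x" if h: "C \<in> comps" "x \<in> C" "x \<in> Sel" for C x
    proof -
      obtain C' where C': "C' \<in> touch" "x = r C'" using h(3) by (auto simp: Sel_def)
      then have "x \<in> C'" "C' \<in> comps" using r by (auto simp: touch_def)
      then have "C' = C" using comps_disjoint[OF symE, of C' Q C x] h by (simp add: comps_def)
      then show ?thesis using C' by simp
    qed
    have "inj_on r touch"
    proof (rule inj_onI)
      fix C C' assume c: "C \<in> touch" "C' \<in> touch" "r C = r C'"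
      then show "C = C'" using r[OF c(1)] r[OF c(2)] comps_disjoint[OF symE, of C Q C' "r C"] by (auto simp: touch_def comps_def)
    qed
    then have cSel: "card Sel = card touch" by (simp add: Sel_def card_image)
    have SelBd: "Sel \<subseteq> Bd" using r by (auto simp: Sel_def)
    define UA where "UA = {x \<in> U. fst x \<in> A}"
    define U1 where "U1 = {x \<in> U. fst x \<notin> A \<and> flip x \<notin> U}"
    define U2 where "U2 = {x \<in> U. fst x \<notin> A \<and> flip x \<in> U \<and> snd x}"
    \<comment> \<open>The part of the barrier recorded in \<open>U1\<close> is not deleted: its
      vertices are represented by their twins in \<open>Bd\<close>.\<close>
    define X where "X = fst ` (Bd - Sel) \<union> fst ` UA \<union> fst ` U2"
    have "card X \<le> card (Bd - Sel) + card UA + card U2"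
      unfolding X_def using finBd finU
      by (intro order_trans[OF card_Un_le] add_mono card_image_le) (auto simp: UA_def U2_def)
    also have "card (Bd - Sel) = card Bd - card Sel" using SelBd finBd finite_subset by (intro card_Diff_subset) auto
    finally have cX: "card X \<le> card Bd - card Sel + card UA + card U2" .
    \<comment> \<open>Boundary and barrier vertices over \<open>A\<close> project injectively into
      \<open>A\<close>; the other boundary vertices are twins of \<open>U1\<close>.\<close>
    have "card Bd + card UA \<le> card A + card U1"
    proof -
      let ?BA = "{x \<in> Bd. fst x \<in> A}" and ?BN = "{x \<in> Bd. fst x \<notin> A}"
      have "inj_on fst (?BA \<union> UA)"
      proof (rule inj_onI)
        fix x y assume xy: "x \<in> ?BA \<union> UA" "y \<in> ?BA \<union> UA" "fst x = fst y"
        have "x \<in> ?V" "y \<in> ?V" "fst x \<in> A" using xy(1,2) U by (auto simp: Bd_def UA_def Q_def)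
        then show "x = y" using xy(3) by (auto simp: cover_verts_def prod_eq_iff)
      qed
      moreover have "fst ` (?BA \<union> UA) \<subseteq> A" by (auto simp: UA_def)
      moreover have "finite A" using A fin finite_subset by blast
      ultimately have "card (?BA \<union> UA) \<le> card A" using card_inj_on_le by blast
      moreover have "card (?BA \<union> UA) = card ?BA + card UA"
      proof (rule card_Un_disjoint)
        show "finite ?BA" using finBd by simp
        show "finite UA" using finU by (simp add: UA_def)
        show "?BA \<inter> UA = {}" by (auto simp: UA_def Bd_def Q_def)
      qed
      moreover have "card ?BN \<le> card U1"
      proof (rule card_inj_on_le[of flip])
        show "inj_on flip ?BN" by (rule inj_onI) (metis flip_simps(1))
        show "flip ` ?BN \<subseteq> U1" by (auto simp: Bd_def U1_def Q_def)
        show "finite U1" using finU by (simp add: U1_def)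
      qed
      moreover have "card Bd = card ?BA + card ?BN"
      proof -
        have "Bd = ?BA \<union> ?BN" by auto
        moreover have "card (?BA \<union> ?BN) = card ?BA + card ?BN" using finBd by (intro card_Un_disjoint) auto
        ultimately show ?thesis by simp
      qed
      ultimately show ?thesis by linarith
    qed
    moreover have "card UA + card U1 + card U2 \<le> card U"
    proof -
      have fU: "finite UA" "finite U1" "finite U2" using finU by (simp_all add: UA_def U1_def U2_def)
      have "card (UA \<union> U1) = card UA + card U1" using fU by (intro card_Un_disjoint) (auto simp: UA_def U1_def)
      moreover have "card (UA \<union> U1 \<union> U2) = card (UA \<union> U1) + card U2"
        using fU by (intro card_Un_disjoint) (auto simp: UA_def U1_def U2_def)
      ultimately have "card UA + card U1 + card U2 = card (UA \<union> U1 \<union> U2)" by simp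
      also have "\<dots> \<le> card U" using finU by (intro card_mono) (auto simp: UA_def U1_def U2_def)
      finally show ?thesis .
    qed
    \<comment> \<open>The Tutte-Berge inequality, with one kept vertex for each odd
      component.\<close>
    moreover have "card A + card U + 2 \<le> 2 * k + card Sel"
      using tb dM card_cover[OF fin A(1), of col] odd_le cSel unfolding Q_def[symmetric] comps_def[symmetric] by linarith
    ultimately have cX: "card X + 2 \<le> 2 * k" using cX card_mono[OF finBd SelBd] by linarith
    have XV: "X \<subseteq> V" using U by (auto simp: X_def Bd_def Q_def UA_def U2_def cover_verts_def)
    have finX: "finite X" using XV fin finite_subset by blast
    have memSel: "x \<in> Sel" if "x \<in> Bd" "fst x \<notin> X" for x using that by (auto simp: X_def)
    have inQ: "(v, col v) \<in> Bd" if v: "v \<in> V - X" "v \<in> A" for v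
    proof -
      have "(v, col v) \<notin> UA" using v by (force simp: X_def)
      then show ?thesis using v by (auto simp: Bd_def Q_def UA_def cover_verts_def)
    qed
    have notboth: "(v, True) \<notin> U \<or> (v, False) \<notin> U" if v: "v \<in> V - X" "v \<notin> A" for v
    proof (rule ccontr)
      assume "\<not> ?thesis"
      then have "(v, True) \<in> U2" using v by (auto simp: U2_def flip_def)
      then show False using v by (force simp: X_def)
    qed
    \<comment> \<open>Suppose both copies of \<open>v\<close> survive. The vertices with both copies
      in this component form a set \<open>I\<close> that can be left only through \<open>X\<close>
      or the projection \<open>B\<close> of the single kept vertex. Fewer than \<open>2 * k\<close>
      vertices cannot separate, so \<open>I\<close> would contain a vertex of \<open>A\<close>,
      which has only one copy.\<close>
    have one: "(v, True) \<in> U \<or> (v, False) \<in> U" if v: "v \<in> V - X" "v \<notin> A" for v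
    proof (rule ccontr)
      assume none: "\<not> ?thesis"
      have vQ: "(v, b) \<in> Q" for b using v none by (cases b) (auto simp: Q_def cover_verts_def)
      obtain C where C: "C \<in> comps" "(v, True) \<in> C" using inC vQ by blast
      have "(v, False) \<in> C" using closed[OF C(1,2) vQ, of False] v by (simp add: cover_adj_def)
      define I where "I = {w \<in> V - X. w \<notin> A \<and> (w, True) \<in> C \<and> (w, False) \<in> C}"
      define B where "B = fst ` (C \<inter> Sel)"
      have vI: "v \<in> I" using v C \<open>(v, False) \<in> C\<close> by (simp add: I_def)
      have "B \<subseteq> {fst (r C)}" using r_eq[OF C(1)] by (auto simp: B_def)
      then have cB: "card B \<le> 1" "finite B" using card_mono[of "{fst (r C)}" B] finite_subset by auto
      have BV: "B \<subseteq> V" using CQ[OF C(1)] by (auto simp: B_def Q_def cover_verts_def)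
      have step: "w' \<in> I \<union> B" if w: "w \<in> I" "w' \<in> V - X" "E w w'" for w w'
      proof -
        have wC: "(w, b) \<in> C" for b using w(1) by (cases b) (auto simp: I_def)
        have inB: "w' \<in> B" if "(w', b) \<in> Bd" for b
        proof -
          have "(w', b) \<in> Q" using that by (simp add: Bd_def)
          then have "(w', b) \<in> C" using closed[OF C(1) wC[of b]] w(3) by (simp add: cover_adj_def)
          moreover have "(w', b) \<in> Sel" using memSel[OF that] w(2) by simp
          ultimately show ?thesis by (force simp: B_def)
        qed
        show ?thesis
        proof (cases "w' \<in> A")
          case True
          then show ?thesis using inB inQ w(2) by blast
        next
          case w'A: False
          show ?thesis
          proof (cases "\<exists>b. (w', b) \<in> U")
            case True
            then obtain b where b: "(w', b) \<in> U" by blast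
            then have "(w', \<not> b) \<notin> U" using notboth[OF w(2) w'A] by (cases b) auto
            then have "(w', \<not> b) \<in> Bd" using b w(2) w'A by (auto simp: Bd_def Q_def cover_verts_def flip_def)
            then show ?thesis using inB by blast
          next
            case False
            then have "(w', b) \<in> Q" for b using w(2) w'A by (auto simp: Q_def cover_verts_def)
            then have "(w', b) \<in> C" for b using closed[OF C(1) wC[of b]] w(3) by (simp add: cover_adj_def)
            then show ?thesis using w(2) w'A by (simp add: I_def)
          qed
        qed
      qed
      have "card (X \<union> B) < 2 * k" using card_Un_le[of X B] cX cB by linarith
      then have con: "connected_on (V - (X \<union> B)) E" using XV BV by (intro conn) auto
      have "\<not> A \<subseteq> X \<union> B"
      proof
        assume "A \<subseteq> X \<union> B"
        then have "card A \<le> card (X \<union> B)" using finX cB by (intro card_mono) auto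
        then show False using A(2) \<open>card (X \<union> B) < 2 * k\<close> by simp
      qed
      then obtain a where a: "a \<in> A" "a \<notin> X \<union> B" by blast
      have "v \<notin> B"
      proof
        assume "v \<in> B"
        then obtain b where "(v, b) \<in> Bd" using SelBd by (auto simp: B_def)
        then show False using v none by (cases b) (auto simp: Bd_def flip_def)
      qed
      then have "(\<lambda>x y. x \<in> V - (X \<union> B) \<and> y \<in> V - (X \<union> B) \<and> E x y)\<^sup>*\<^sup>* v a"
        using con v a A unfolding connected_on_def by blast
      then have "a \<in> I"
      proof induction
        case (step y z)
        then show ?case using \<open>\<And>w w'. w \<in> I \<Longrightarrow> w' \<in> V - X \<Longrightarrow> E w w' \<Longrightarrow> w' \<in> I \<union> B\<close>[of y z] by auto
      qed (rule vI)
      then show False using a by (simp add: I_def)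
    qed
    define f where "f = (\<lambda>v. if v \<in> A then col v else (v, True) \<notin> U)"
    have fBd: "(v, f v) \<in> Bd" if v: "v \<in> V - X" for v
    proof (cases "v \<in> A")
      case True
      then show ?thesis using inQ[OF v] by (simp add: f_def)
    next
      case False
      then show ?thesis using one[OF v False] notboth[OF v False] v
        by (auto simp: f_def Bd_def Q_def cover_verts_def flip_def)
    qed
    have "bipartite_on (V - X) E"
      unfolding bipartite_on_def
    proof (intro exI[of _ f] ballI impI)
      fix u v assume uv: "u \<in> V - X" "v \<in> V - X" "E u v"
      show "f u \<noteq> f v"
      proof
        assume eq: "f u = f v"
        have Q: "(u, f u) \<in> Q" "(v, f u) \<in> Q" using fBd[OF uv(1)] fBd[OF uv(2)] eq by (auto simp: Bd_def)
        obtain C where C: "C \<in> comps" "(u, f u) \<in> C" using inC[OF Q(1)] by blast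
        have "(v, f u) \<in> C" using closed[OF C Q(2)] uv(3) by (simp add: cover_adj_def)
        moreover have "(u, f u) \<in> Sel" "(v, f u) \<in> Sel"
          using memSel[OF fBd[OF uv(1)]] memSel[OF fBd[OF uv(2)]] uv(1,2) eq by simp_all
        \<comment> \<open>Adjacent vertices of equal level lie in the same component, and only one
          boundary vertex was kept there.\<close>
        ultimately have "(u, f u) = (v, f u)"
          using r_eq[OF C] r_eq[OF C(1), of "(v, f u)"] by simp
        then show False using uv(3) irr by (auto dest: irreflpD)
      qed
    qed
    moreover have "card X \<le> 2 * k - 2" using cX by simp
    ultimately show ?thesis using XV by blast
  qed
qed

section \<open>Exchange and fans\<close>

lemma gpath_rev_iff: "symp E \<Longrightarrow> gpath E (rev p) \<longleftrightarrow> gpath E p"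
  using gpath_rev[of E p] gpath_rev[of E "rev p"] by auto

lemma apath_rev: assumes "symp E" "apath V E A p" shows "apath V E A (rev p)"
proof -
  have "p \<noteq> []" using assms(2) by (auto simp: apath_def)
  then show ?thesis using assms by (auto simp: apath_def gpath_rev_iff hd_rev last_rev)
qed

lemma apath_switch1:
  assumes p: "apath V E A (p @ x # r)" and x: "x \<notin> A" and q: "gpath E (x # q)" "q \<noteq> []" "set q \<subseteq> V" "set q \<inter> A = {last q}"
    "set q \<inter> set (p @ x # r) = {}"
  shows "apath V E A (p @ x # q)" "p \<noteq> []" "hd p \<in> A"
proof -
  have pA: "set (p @ x # r) \<inter> A = {hd (p @ x # r), last (p @ x # r)}" and gp: "gpath E (p @ x # r)"
    and pV: "set (p @ x # r) \<subseteq> V" using p unfolding apath_def by blast+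
  have "hd (p @ x # r) \<in> A" "last (p @ x # r) \<in> A" using pA by blast+
  then show ne: "p \<noteq> []" and hA: "hd p \<in> A" using x by (cases p; simp)+
  have rne: "r \<noteq> []" using \<open>last (p @ x # r) \<in> A\<close> x by auto
  have "last r \<notin> set p" using gp rne last_in_set[OF rne] by (auto simp: gpath_def)
  then have "set p \<inter> A \<subseteq> {hd p}" using pA ne rne by auto
  then have "set p \<inter> A = {hd p}" using hA ne by auto
  then have "set (p @ x # q) \<inter> A = {hd (p @ x # q), last (p @ x # q)}" using x q(2,4) ne by auto
  moreover have "gpath E (p @ x # q)"
    using gp q(1,5) ne unfolding gpath_append by auto
  moreover have "2 \<le> length (p @ x # q)" using q(2) by (cases q) auto
  ultimately show "apath V E A (p @ x # q)" using pV q(3) unfolding apath_def by auto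
qed

lemma apath_switch:
  assumes sym: "symp E" and p: "apath V E A (p @ x # r)" and x: "x \<notin> A" and q: "gpath E (x # q)" "q \<noteq> []" "set q \<subseteq> V" "set q \<inter> A = {last q}"
    "set q \<inter> set (p @ x # r) = {}"
  shows "apath V E A (p @ x # q)" "apath V E A (rev q @ x # r)" "p \<noteq> []" "r \<noteq> []" "hd p \<in> A" "last r \<in> A"
proof -
  show "apath V E A (p @ x # q)" "p \<noteq> []" "hd p \<in> A" using apath_switch1[OF p x q] by auto
  have r: "apath V E A (rev r @ x # rev p)" using apath_rev[OF sym p] by simp
  have "set q \<inter> set (rev r @ x # rev p) = {}" using q(5) by auto
  from apath_switch1[OF r x q(1-4) this] have "apath V E A (rev r @ x # q)" "r \<noteq> []" "last r \<in> A" by (auto simp: hd_rev)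
  with apath_rev[OF sym this(1)] show "apath V E A (rev q @ x # r)" "r \<noteq> []" "last r \<in> A" by auto
qed

text \<open>The parity values of the two reroutings add up to that of the original path, since
  \<open>q\<close> is counted twice; so they cannot both be zero.\<close>

lemma nonzero_switch:
  assumes "nonzero col (p @ x # r)" "p \<noteq> []" "r \<noteq> []" "q \<noteq> []"
  shows "nonzero col (p @ x # q) \<or> nonzero col (rev q @ x # r)"
  using assms by (auto simp: nonzero_def hd_rev hd_append)

definition apath_family :: "'a set \<Rightarrow> ('a \<Rightarrow> 'a \<Rightarrow> bool) \<Rightarrow> 'a set \<Rightarrow> nat \<Rightarrow> (nat \<Rightarrow> 'a list) \<Rightarrow> bool" where
  "apath_family V E A m fam \<longleftrightarrow> (\<forall>i<m. apath V E A (fam i)) \<and> (\<forall>i<m. \<forall>j<m. i \<noteq> j \<longrightarrow> set (fam i) \<inter> set (fam j) = {})"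

lemma apath_familyD:
  assumes "apath_family V E A m fam"
  shows "i < m \<Longrightarrow> apath V E A (fam i)" "i < m \<Longrightarrow> j < m \<Longrightarrow> i \<noteq> j \<Longrightarrow> set (fam i) \<inter> set (fam j) = {}"
  using assms by (auto simp: apath_family_def)

lemma apath_family_update:
  assumes fam: "apath_family V E A m fam" and i: "i < m" and r: "apath V E A r" "set r \<subseteq> set (fam i) \<union> Q"
    and Q: "\<And>j. j < m \<Longrightarrow> Q \<inter> set (fam j) = {}"
  shows "apath_family V E A m (fam(i := r))"
proof -
  have rd: "set r \<inter> set (fam j) = {}" if "j < m" "j \<noteq> i" for j
    using r(2) Q[OF that(1)] apath_familyD(2)[OF fam i that(1)] that(2) by blast
  show ?thesis
    unfolding apath_family_def
  proof (intro conjI allI impI)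
    fix a b assume "a < m" "b < m" "a \<noteq> b"
    then show "set ((fam(i := r)) a) \<inter> set ((fam(i := r)) b) = {}"
      using rd[of a] rd[of b] apath_familyD(2)[OF fam, of a b] by (auto simp: Int_commute)
  qed (use r apath_familyD(1)[OF fam] in auto)
qed

lemma apath_family_extend:
  assumes fam: "apath_family V E A m fam" and r: "apath V E A r" "\<And>j. j < m \<Longrightarrow> set r \<inter> set (fam j) = {}"
  shows "apath_family V E A (Suc m) (fam(m := r))"
  unfolding apath_family_def
proof (intro conjI allI impI)
  fix a b assume "a < Suc m" "b < Suc m" "a \<noteq> b"
  then show "set ((fam(m := r)) a) \<inter> set ((fam(m := r)) b) = {}"
    using r(2)[of a] r(2)[of b] apath_familyD(2)[OF fam, of a b] by (auto simp: Int_commute less_Suc_eq)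
qed (use r apath_familyD(1)[OF fam] in \<open>auto simp: less_Suc_eq\<close>)

text \<open>The cost in the exchange argument: the number of steps outside \<open>R\<close>.\<close>

fun irregular :: "('a \<Rightarrow> 'a \<Rightarrow> bool) \<Rightarrow> 'a list \<Rightarrow> nat" where
  "irregular R (x # y # r) = (if R x y then 0 else 1) + irregular R (y # r)"
| "irregular R _ = 0"

lemma irregular_append: "irregular R (p @ x # q) = irregular R (p @ [x]) + irregular R (x # q)"
proof (induction p)
  case (Cons a p)
  then show ?case by (cases p) auto
qed simp

lemma irregular_eq_0: "irregular R p = 0 \<longleftrightarrow> successively R p"
  by (induction R p rule: irregular.induct) auto

text \<open>The exchange argument: rerouting a member of the family along the last segment of a path of \<open>F\<close> that it meets
  removes a step that leaves the paths of \<open>F\<close>. In a family with the fewest such steps, a path of \<open>F\<close> is met only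
  if its end in \<open>A\<close> is.\<close>

lemma exchange:
  fixes fam0 :: "nat \<Rightarrow> 'a list"
  assumes sym: "symp E"
    and F: "\<And>j. j < n \<Longrightarrow> gpath E (F j) \<and> set (F j) \<subseteq> V \<and> set (F j) \<inter> A = {last (F j)}"
    and Fdisj: "\<And>i j. i < n \<Longrightarrow> j < n \<Longrightarrow> i \<noteq> j \<Longrightarrow> set (F i) \<inter> set (F j) = {}"
    and fam0: "apath_family V E A m fam0" "C fam0"
    and closure: "\<And>fam i p x r q. C fam \<Longrightarrow> i < m \<Longrightarrow> fam i = p @ x # r \<Longrightarrow> p \<noteq> [] \<Longrightarrow> r \<noteq> [] \<Longrightarrow> q \<noteq> [] \<Longrightarrow>
      x \<in> (\<Union>j<n. set (F j)) \<Longrightarrow> set q \<subseteq> (\<Union>j<n. set (F j)) \<Longrightarrow>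
      apath_family V E A m (fam(i := p @ x # q)) \<Longrightarrow> apath_family V E A m (fam(i := rev q @ x # r)) \<Longrightarrow>
      C (fam(i := p @ x # q)) \<or> C (fam(i := rev q @ x # r))"
  shows "\<exists>fam. C fam \<and> apath_family V E A m fam \<and> card {j. j < n \<and> (\<exists>i<m. set (F j) \<inter> set (fam i) \<noteq> {})} \<le> 2 * m"
proof -
  \<comment> \<open>Steps between two vertices of one path of \<open>F\<close> are free of
    cost.\<close>
  define R where "R = (\<lambda>u v. \<exists>j<n. u \<in> set (F j) \<and> v \<in> set (F j))"
  define St where "St = (\<lambda>fam. C fam \<and> apath_family V E A m fam)"
  define cost where "cost = (\<lambda>fam. \<Sum>i<m. irregular R (fam i))"
  have "St fam0" using fam0 by (simp add: St_def)
  then obtain fam where fam: "St fam" and best: "\<And>fam'. St fam' \<Longrightarrow> cost fam \<le> cost fam'"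
    using ex_has_least_nat[of St fam0 cost] by blast
  have fC: "C fam" and fF: "apath_family V E A m fam" using fam by (auto simp: St_def)
  note fA = apath_familyD(1)[OF fF]
  define P where "P = (\<Union>i<m. set (fam i))"
  have inF: "set p \<subseteq> set (F j)" if "successively R p" "hd p \<in> set (F j)" "j < n" for p j
    using that
  proof (induction p)
    case (Cons a p)
    show ?case
    proof (cases "p = []")
      case False
      then have "R a (hd p)" "successively R p" using Cons.prems(1) by (auto simp: successively_Cons)
      then obtain j' where j': "j' < n" "a \<in> set (F j')" "hd p \<in> set (F j')" by (auto simp: R_def)
      then have "j' = j" using Fdisj[of j' j] Cons.prems(2,3) by auto
      then show ?thesis using Cons.IH \<open>successively R p\<close> j' Cons.prems by simp
    qed (use Cons.prems in simp)
  qed simp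
  have regular: "irregular R p = 0" if "set p \<subseteq> set (F j)" "j < n" for p j
  proof -
    have "successively (\<lambda>u v. u \<in> set p \<and> v \<in> set p) p" by (simp add: successively_conv_nth)
    then have "successively R p" by (rule successively_mono) (use that in \<open>auto simp: R_def\<close>)
    then show ?thesis by (simp add: irregular_eq_0)
  qed
  have upd: False if i: "i < m" and r: "apath_family V E A m (fam(i := r))" "C (fam(i := r))"
    and lt: "irregular R r < irregular R (fam i)" for i r
  proof -
    have "cost (fam(i := r)) < cost fam"
      unfolding cost_def by (rule sum_strict_mono_ex1) (use lt i in auto)
    then show False using best[of "fam(i := r)"] r by (simp add: St_def)
  qed
  have hit: "\<exists>i<m. last (F j) \<in> set (fam i)" if j: "j < n" "\<exists>i<m. set (F j) \<inter> set (fam i) \<noteq> {}" for j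
  proof (rule ccontr)
    assume no: "\<not> ?thesis"
    then have lastP: "last (F j) \<notin> P" by (auto simp: P_def)
    have "set (F j) \<inter> P \<noteq> {}" using j(2) by (auto simp: P_def)
    \<comment> \<open>\<open>x\<close> is the last vertex of the path that lies on the family, so
      its remaining segment \<open>q\<close> is free for rerouting.\<close>
    then obtain q1 x q where s: "F j = q1 @ x # q" and xP: "x \<in> P" and qP: "set q \<inter> P = {}" by (rule split_last_in)
    have qne: "q \<noteq> []" using lastP xP s by auto
    have Fj: "gpath E (F j)" "set (F j) \<subseteq> V" "set (F j) \<inter> A = {last (F j)}" using F[OF j(1)] by auto
    have xF: "x \<in> set (F j)" and qF: "set q \<subseteq> set (F j)" using s by auto
    have only: "y = last (F j)" if "y \<in> set (F j)" "y \<in> A" for y using Fj(3) that by blast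
    have xA: "x \<notin> A" using only[OF xF] xP lastP by auto
    have lq: "last (F j) = last q" using s qne by simp
    have qA: "set q \<inter> A = {last q}" using only qF lq last_in_set[OF qne] Fj(3) by auto
    have gq: "gpath E (x # q)" using Fj(1) s by (auto simp: gpath_append)
    obtain i where i: "i < m" "x \<in> set (fam i)" using xP by (auto simp: P_def)
    then obtain p r where pr: "fam i = p @ x # r" by (meson split_list)
    have "set (fam i) \<subseteq> P" using i by (auto simp: P_def)
    then have "set q \<inter> set (p @ x # r) = {}" using qP pr by auto
    note sw = apath_switch[OF sym fA[OF i(1), unfolded pr] xA gq qne subset_trans[OF qF Fj(2)] qA this]
    have Fs: "x \<in> (\<Union>j<n. set (F j))" "set q \<subseteq> (\<Union>j<n. set (F j))" using xF qF j(1) by auto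
    have endP: "last r \<in> P" "hd p \<in> P" using i pr sw(3,4) by (auto simp: P_def intro!: bexI[of _ i])
    have xqF: "set (x # q) \<subseteq> set (F j)" "set (rev q @ [x]) \<subseteq> set (F j)" using xF qF by auto
    have qd: "set q \<inter> set (fam j) = {}" if "j < m" for j using qP that by (auto simp: P_def)
    have ups: "apath_family V E A m (fam(i := p @ x # q))" "apath_family V E A m (fam(i := rev q @ x # r))"
      by (rule apath_family_update[OF fF i(1) _ _ qd]; use sw(1,2) pr in auto)+
    from closure[OF fC i(1) pr sw(3,4) qne Fs ups] show False
    proof
      assume c: "C (fam(i := p @ x # q))"
      \<comment> \<open>Without a costly step the discarded part would stay on \<open>F j\<close>
        and reach its end in \<open>A\<close>, which the family does not contain. The added part
        costs nothing, so the total cost drops.\<close>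
      have "irregular R (x # r) \<noteq> 0"
      proof
        assume "irregular R (x # r) = 0"
        then have "set (x # r) \<subseteq> set (F j)" using inF[of "x # r" j] xF j(1) by (simp add: irregular_eq_0)
        then have "last r \<in> set (F j) \<inter> A" using sw(4,6) by auto
        then show False using only endP(1) lastP by auto
      qed
      then have "irregular R (p @ x # q) < irregular R (fam i)"
        using regular[OF xqF(1) j(1)] irregular_append[of R p x q] irregular_append[of R p x r] pr by simp
      from upd[OF i(1) ups(1) c this] show False .
    next
      assume c: "C (fam(i := rev q @ x # r))"
      have "irregular R (p @ [x]) \<noteq> 0"
      proof
        assume "irregular R (p @ [x]) = 0"
        then have "successively R (p @ [x])" by (simp add: irregular_eq_0)
        moreover have "(\<lambda>u v. R v u) = R" by (auto simp: R_def)
        ultimately have "successively R (rev (p @ [x]))" by (simp only: successively_rev)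
        then have "set (rev (p @ [x])) \<subseteq> set (F j)" using inF[of "rev (p @ [x])" j] xF j(1) by simp
        then have "hd p \<in> set (F j) \<inter> A" using sw(3,5) by auto
        then show False using only endP(2) lastP by auto
      qed
      then have "irregular R (rev q @ x # r) < irregular R (fam i)"
        using regular[OF xqF(2) j(1)] irregular_append[of R "rev q" x r] irregular_append[of R p x r] pr by simp
      from upd[OF i(1) ups(2) c this] show False .
    qed
  qed
  let ?hit = "{j. j < n \<and> (\<exists>i<m. set (F j) \<inter> set (fam i) \<noteq> {})}"
  \<comment> \<open>Every path of \<open>F\<close> that is hit has its own end in \<open>A\<close>
    on the family, and the family has only \<open>2 * m\<close> vertices in
    \<open>A\<close>.\<close>
  have "card ?hit \<le> card (\<Union>i<m. {hd (fam i), last (fam i)})"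
  proof (rule card_inj_on_le[of "\<lambda>j. last (F j)"])
    show "inj_on (\<lambda>j. last (F j)) ?hit"
    proof (rule inj_onI)
      fix j j' assume jj: "j \<in> ?hit" "j' \<in> ?hit" "last (F j) = last (F j')"
      have "last (F j) \<in> set (F j)" "last (F j') \<in> set (F j')" using F[of j] F[of j'] jj by auto
      then show "j = j'" using Fdisj[of j j'] jj by auto
    qed
    show "(\<lambda>j. last (F j)) ` ?hit \<subseteq> (\<Union>i<m. {hd (fam i), last (fam i)})"
    proof
      fix v assume "v \<in> (\<lambda>j. last (F j)) ` ?hit"
      then obtain j where j: "j < n" "\<exists>i<m. set (F j) \<inter> set (fam i) \<noteq> {}" "v = last (F j)" by auto
      then obtain i where i: "i < m" "v \<in> set (fam i)" using hit by auto
      have "v \<in> A" using F[OF j(1)] j(3) by auto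
      then have "v \<in> {hd (fam i), last (fam i)}" using fA[OF i(1)] i(2) unfolding apath_def by blast
      then show "v \<in> (\<Union>i<m. {hd (fam i), last (fam i)})" using i(1) by blast
    qed
  qed simp
  also have "\<dots> \<le> (\<Sum>i<m. card {hd (fam i), last (fam i)})" by (rule card_UN_le) simp
  also have "\<dots> \<le> (\<Sum>i<m. 2)" by (rule sum_mono) (simp add: card_insert_if)
  finally have "card ?hit \<le> 2 * m" by simp
  then show ?thesis using fC fF by blast
qed

text \<open>Menger's theorem from the neighbours of \<open>s\<close> to \<open>A\<close>, after
  deleting \<open>S\<close>. Fewer than \<open>n\<close> further vertices and \<open>S\<close>
  together are fewer than \<open>c\<close>, so they exhaust neither side and do not disconnect. The
  paths start at neighbours of \<open>s\<close>, not at \<open>s\<close>.\<close>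

lemma fan:
  assumes fin: "finite V" and S: "S \<subseteq> V" and A: "A \<subseteq> V" and c: "card S + n \<le> c"
    and conn: "\<And>X. X \<subseteq> V \<Longrightarrow> card X < c \<Longrightarrow> connected_on (V - X) E"
    and deg: "c \<le> card {y \<in> V. E s y}" and cA: "c \<le> card A"
  shows "\<exists>F. \<forall>j<n. gpath E (F j) \<and> set (F j) \<subseteq> V - S \<and> set (F j) \<inter> A = {last (F j)} \<and> E s (hd (F j)) \<and>
    (\<forall>i<n. i \<noteq> j \<longrightarrow> set (F i) \<inter> set (F j) = {})"
proof -
  define R where "R = {(u, v). u \<in> V - S \<and> v \<in> V - S \<and> E u v}"
  let ?N = "{y \<in> V. E s y}"
  have finR: "finite R" by (rule finite_subset[of R "V \<times> V"]) (use fin in \<open>auto simp: R_def\<close>)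
  have finS: "finite S" using S fin finite_subset by blast
  have "\<exists>f. disjoint_paths (\<lambda>x y. (x, y) \<in> R) (?N - S) (A - S) n f"
  proof (rule menger[OF finR])
    fix Z assume Z: "finite Z" "separates R (?N - S) (A - S) Z"
    show "n \<le> card Z"
    proof (rule ccontr)
      assume "\<not> n \<le> card Z"
      then have lt: "card (S \<union> Z) < c" using card_Un_le[of S Z] c by linarith
      have "\<not> ?N \<subseteq> S \<union> Z"
      proof
        assume "?N \<subseteq> S \<union> Z"
        then have "card ?N \<le> card (S \<union> Z)" using finS Z(1) by (intro card_mono) auto
        then show False using lt deg by simp
      qed
      then obtain y where y: "y \<in> ?N" "y \<notin> S \<union> Z" by blast
      have "\<not> A \<subseteq> S \<union> Z"
      proof
        assume "A \<subseteq> S \<union> Z"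
        then have "card A \<le> card (S \<union> Z)" using finS Z(1) by (intro card_mono) auto
        then show False using lt cA by simp
      qed
      then obtain a where a: "a \<in> A" "a \<notin> S \<union> Z" by blast
      have "card ((S \<union> Z) \<inter> V) \<le> card (S \<union> Z)" using finS Z(1) by (intro card_mono) auto
      then have "connected_on (V - (S \<union> Z) \<inter> V) E" using lt by (intro conn) auto
      from connected_on_path[OF this, of y a] obtain p where p: "gpath E p" "set p \<subseteq> V - (S \<union> Z) \<inter> V" "hd p = y" "last p = a"
        using y a A by auto
      have "gpath (\<lambda>x y. (x, y) \<in> R) p" by (rule gpath_mono[OF p(1)]) (use p(2) in \<open>auto simp: R_def\<close>)
      then have "set p \<inter> Z \<noteq> {}" using Z(2)[unfolded separates_def, rule_format, of p] p(3,4) y a by simp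
      then show False using p(2) by blast
    qed
  qed (use fin in simp)
  then obtain f where "disjoint_paths (\<lambda>x y. (x, y) \<in> R) (?N - S) (A - S) n f" by blast
  from disjoint_paths_trim_last[OF this] obtain g where g: "disjoint_paths (\<lambda>x y. (x, y) \<in> R) (?N - S) (A - S) n g"
    "\<And>j. j < n \<Longrightarrow> set (g j) \<inter> (A - S) = {last (g j)}" by blast
  have gp: "gpath (\<lambda>x y. (x, y) \<in> R) (g j)" "hd (g j) \<in> ?N - S" if "j < n" for j using g(1) that by (auto simp: disjoint_paths_def)
  have sub: "set (g j) \<subseteq> V - S" if j: "j < n" for j
  proof -
    have "x \<in> V - S" if x: "x \<in> set (g j)" for x
    proof -
      obtain l r where s: "g j = l @ x # r" using x by (meson split_list)
      show ?thesis
      proof (cases l rule: rev_cases)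
        case Nil
        then show ?thesis using s gp(2)[OF j] by simp
      next
        case (snoc l' y)
        then have "(y, x) \<in> R" using gp(1)[OF j] s by (simp add: gpath_def successively_append_iff)
        then show ?thesis by (simp add: R_def)
      qed
    qed
    then show ?thesis by blast
  qed
  show ?thesis
  proof (intro exI[of _ g] allI impI conjI)
    fix j assume j: "j < n"
    show "gpath E (g j)" by (rule gpath_mono[OF gp(1)[OF j]]) (simp add: R_def)
    show "set (g j) \<subseteq> V - S" by (rule sub[OF j])
    show "set (g j) \<inter> A = {last (g j)}" using g(2)[OF j] sub[OF j] by blast
    show "E s (hd (g j))" using gp(2)[OF j] by simp
    fix i assume "i < n" "i \<noteq> j"
    then show "set (g i) \<inter> set (g j) = {}" using g(1) j by (auto simp: disjoint_paths_def)
  qed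
qed

lemma two_unhit:
  assumes "card {j. j < n \<and> P j} + 2 \<le> n"
  obtains a b where "a < n" "b < n" "a \<noteq> b" "\<not> P a" "\<not> P b"
proof -
  let ?U = "{j. j < n \<and> \<not> P j}"
  have "{..<n} = {j. j < n \<and> P j} \<union> ?U" by auto
  then have "n = card ({j. j < n \<and> P j} \<union> ?U)" by (metis card_lessThan)
  also have "\<dots> \<le> card {j. j < n \<and> P j} + card ?U" by (rule card_Un_le)
  finally have "2 \<le> card ?U" using assms by linarith
  then obtain T where "T \<subseteq> ?U" "card T = 2" by (meson obtain_subset_with_card_n)
  then obtain a b where "T = {a, b}" "a \<noteq> b" by (meson card_2_iff)
  then show thesis using \<open>T \<subseteq> ?U\<close> by (intro that[of a b]) auto
qed

definition nonzero_family :: "'a set \<Rightarrow> ('a \<Rightarrow> 'a \<Rightarrow> bool) \<Rightarrow> 'a set \<Rightarrow> ('a \<Rightarrow> bool) \<Rightarrow> nat \<Rightarrow> (nat \<Rightarrow> 'a list) \<Rightarrow> bool" where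
  "nonzero_family V E A col k fam \<longleftrightarrow> apath_family V E A k fam \<and> (\<forall>i<k. nonzero col (fam i))"

lemma sum_fun_upd_le:
  fixes h :: "'b \<Rightarrow> nat" and k :: nat
  assumes "h r \<le> h (fam i)"
  shows "(\<Sum>j<k. h ((fam(i := r)) j)) \<le> (\<Sum>j<k. h (fam j))"
  by (rule sum_mono) (use assms in auto)

lemma sum_fun_upd_less:
  fixes h :: "'b \<Rightarrow> nat" and k :: nat
  assumes "h r < h (fam i)" "i < k"
  shows "(\<Sum>j<k. h ((fam(i := r)) j)) < (\<Sum>j<k. h (fam j))"
  by (rule sum_strict_mono_ex1) (use assms in auto)

text \<open>In a family sharing as few vertices as possible with \<open>S\<close>, rerouting from the second of three shared vertices of a
  path along an unhit path of a fan would lose a shared vertex.\<close>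

lemma few_shared:
  assumes fin: "finite V" and sym: "symp E" and S: "S \<subseteq> V" "card S \<le> 2 * k" and A: "A \<subseteq> V" and k: "1 \<le> k"
    and conn: "\<And>X. X \<subseteq> V \<Longrightarrow> card X < 6 * k \<Longrightarrow> connected_on (V - X) E"
    and deg: "\<And>v. v \<in> V \<Longrightarrow> 6 * k \<le> card {y \<in> V. E v y}" and cA: "6 * k \<le> card A"
    and fam: "nonzero_family V E A col k fam"
  shows "\<exists>fam. nonzero_family V E A col k fam \<and> (\<forall>i<k. card (set (fam i) \<inter> S) \<le> 2)"
proof -
  have finS: "finite S" using S fin finite_subset by blast
  define tot where "tot = (\<lambda>fam. \<Sum>i<k. card (set (fam i) \<inter> S))"
  obtain fam where fam: "nonzero_family V E A col k fam"
    and best: "\<And>fam'. nonzero_family V E A col k fam' \<Longrightarrow> tot fam \<le> tot fam'"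
    using ex_has_least_nat[of "nonzero_family V E A col k" fam tot] fam by blast
  have "card (set (fam i0) \<inter> S) \<le> 2" if i0: "i0 < k" for i0
  proof (rule ccontr)
    assume three: "\<not> ?thesis"
    define f3 where "f3 = filter (\<lambda>v. v \<in> S) (fam i0)"
    have "distinct (fam i0)" using fam i0 by (auto simp: nonzero_family_def apath_family_def apath_def gpath_def)
    then have df3: "distinct f3" and sf3: "set f3 = set (fam i0) \<inter> S" by (auto simp: f3_def)
    have lf3: "3 \<le> length f3" using three distinct_card[OF df3] sf3 by simp
    \<comment> \<open>Index 1 is the second of at least three shared vertices, so each rerouting at
      \<open>s\<close> discards a shared vertex.\<close>
    define s where "s = f3 ! 1"
    have sS: "s \<in> S" using lf3 sf3 nth_mem[of 1 f3] by (simp add: s_def)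
    have "card S + 4 * k \<le> 6 * k" using S by simp
    from fan[OF fin S(1) A this conn deg cA] sS S(1) obtain F where
      F: "\<forall>j<4*k. gpath E (F j) \<and> set (F j) \<subseteq> V - S \<and> set (F j) \<inter> A = {last (F j)} \<and> E s (hd (F j)) \<and>
      (\<forall>i<4*k. i \<noteq> j \<longrightarrow> set (F i) \<inter> set (F j) = {})" by blast
    let ?U = "\<Union>j<4*k. set (F j)"
    have US: "?U \<inter> S = {}" using F by blast
    \<comment> \<open>Reroutings along the fan can only lose vertices of \<open>S\<close>, and
      minimality of \<open>tot\<close> forbids any loss. Hence the list of shared vertices on the
      path \<open>i0\<close>, and with it the position of \<open>s\<close>, stays fixed.\<close>
    define C where "C = (\<lambda>fam'. (\<forall>i<k. nonzero col (fam' i) \<and> distinct (fam' i)) \<and> tot fam' \<le> tot fam \<and> filter (\<lambda>v. v \<in> S) (fam' i0) = f3)"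
    have "\<exists>fam. C fam \<and> apath_family V E A k fam \<and> card {j. j < 4 * k \<and> (\<exists>i<k. set (F j) \<inter> set (fam i) \<noteq> {})} \<le> 2 * k"
    proof (rule exchange[OF sym, where ?fam0.0 = fam])
      fix fam' i p x r q
      assume C: "C fam'" and i: "i < k" and s: "fam' i = p @ x # r" and ne: "p \<noteq> []" "r \<noteq> []" "q \<noteq> []"
        and xU: "x \<in> ?U" and qU: "set q \<subseteq> ?U"
        and ap: "apath_family V E A k (fam'(i := p @ x # q))" "apath_family V E A k (fam'(i := rev q @ x # r))"
      have nz: "nonzero col (fam' i)" if "i < k" for i using C that by (simp add: C_def)
      have tot: "tot fam' \<le> tot fam" and filt: "filter (\<lambda>v. v \<in> S) (fam' i0) = f3" using C by (auto simp: C_def)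
      have outS: "x \<notin> S" "set q \<inter> S = {}" using xU qU US by auto
      then have fq: "filter (\<lambda>v. v \<in> S) q = []" by (auto simp: filter_empty_conv)
      have good: "C (fam'(i := t))" if t: "nonzero col t" "apath_family V E A k (fam'(i := t))"
        "set t \<inter> S \<subseteq> set (fam' i) \<inter> S" "set t \<inter> S = set (fam' i) \<inter> S \<Longrightarrow> filter (\<lambda>v. v \<in> S) t = filter (\<lambda>v. v \<in> S) (fam' i)" for t
      proof -
        have nzf: "\<forall>j<k. nonzero col ((fam'(i := t)) j)" using t(1) nz by simp
        have "distinct t" using apath_familyD(1)[OF t(2) i] by (simp add: apath_def gpath_def)
        then have df: "\<forall>j<k. distinct ((fam'(i := t)) j)" using C by (simp add: C_def)
        have "tot fam \<le> tot (fam'(i := t))" using best[of "fam'(i := t)"] t(2) nzf unfolding nonzero_family_def by blast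
        have "card (set t \<inter> S) \<le> card (set (fam' i) \<inter> S)" using t(3) finS by (intro card_mono) auto
        then have le: "tot (fam'(i := t)) \<le> tot fam'"
          using sum_fun_upd_le[of "\<lambda>t. card (set t \<inter> S)" t fam' i k] by (simp add: tot_def)
        have "set t \<inter> S = set (fam' i) \<inter> S"
        proof (rule ccontr)
          assume "set t \<inter> S \<noteq> set (fam' i) \<inter> S"
          then have "card (set t \<inter> S) < card (set (fam' i) \<inter> S)" using t(3) finS by (intro psubset_card_mono) auto
          then have "tot (fam'(i := t)) < tot fam'"
            using sum_fun_upd_less[of "\<lambda>t. card (set t \<inter> S)" t fam' i k] i by (simp add: tot_def)
          then show False using tot \<open>tot fam \<le> tot (fam'(i := t))\<close> by simp
        qed
        then have "filter (\<lambda>v. v \<in> S) t = filter (\<lambda>v. v \<in> S) (fam' i)" by (rule t(4))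
        then show ?thesis using nzf df le tot filt by (auto simp: C_def)
      qed
      have dist: "distinct (p @ x # r)" using C i by (simp add: C_def flip: s)
      from nonzero_switch[of col p x r q] nz[OF i] ne s
      consider "nonzero col (p @ x # q)" | "nonzero col (rev q @ x # r)" by auto
      then show "C (fam'(i := p @ x # q)) \<or> C (fam'(i := rev q @ x # r))"
      proof cases
        case 1
        have "C (fam'(i := p @ x # q))"
        proof (rule good[OF 1 ap(1)])
          show "set (p @ x # q) \<inter> S \<subseteq> set (fam' i) \<inter> S" using outS s by auto
          assume "set (p @ x # q) \<inter> S = set (fam' i) \<inter> S"
          then have "set r \<inter> S \<subseteq> set p" using outS s by auto
          then have "filter (\<lambda>v. v \<in> S) r = []" using dist by (auto simp: filter_empty_conv)
          then show "filter (\<lambda>v. v \<in> S) (p @ x # q) = filter (\<lambda>v. v \<in> S) (fam' i)" using fq s by simp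
        qed
        then show ?thesis ..
      next
        case 2
        have "C (fam'(i := rev q @ x # r))"
        proof (rule good[OF 2 ap(2)])
          show "set (rev q @ x # r) \<inter> S \<subseteq> set (fam' i) \<inter> S" using outS s by auto
          assume "set (rev q @ x # r) \<inter> S = set (fam' i) \<inter> S"
          then have "set p \<inter> S \<subseteq> set r" using outS s by auto
          then have "filter (\<lambda>v. v \<in> S) p = []" using dist by (auto simp: filter_empty_conv)
          then show "filter (\<lambda>v. v \<in> S) (rev q @ x # r) = filter (\<lambda>v. v \<in> S) (fam' i)" using fq s
            by (simp flip: rev_filter)
        qed
        then show ?thesis ..
      qed
    next
      show "apath_family V E A k fam" using fam by (simp add: nonzero_family_def)
      show "C fam" using fam by (simp add: C_def nonzero_family_def f3_def apath_family_def apath_def gpath_def)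
    qed (use F in auto)
    then obtain fam' where C: "C fam'" and ap: "apath_family V E A k fam'"
      and hit: "card {j. j < 4 * k \<and> (\<exists>i<k. set (F j) \<inter> set (fam' i) \<noteq> {})} \<le> 2 * k" by blast
    have "card {j. j < 4 * k \<and> (\<exists>i<k. set (F j) \<inter> set (fam' i) \<noteq> {})} + 2 \<le> 4 * k" using hit k by linarith
    then obtain j where j: "j < 4 * k" "\<not> (\<exists>i<k. set (F j) \<inter> set (fam' i) \<noteq> {})" by (rule two_unhit)
    have nz: "nonzero col (fam' i)" if "i < k" for i using C that by (simp add: C_def)
    have tot: "tot fam' \<le> tot fam" and filt: "filter (\<lambda>v. v \<in> S) (fam' i0) = f3" using C by (auto simp: C_def)
    have "s \<in> set f3" using lf3 by (simp add: s_def)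
    then have "s \<in> set (fam' i0)" unfolding filt[symmetric] by simp
    then obtain p r where pr: "fam' i0 = p @ s # r" by (meson split_list)
    have f3: "f3 = filter (\<lambda>v. v \<in> S) p @ s # filter (\<lambda>v. v \<in> S) r" using filt pr sS by simp
    have "length (filter (\<lambda>v. v \<in> S) p) = 1"
      using nth_eq_iff_index_eq[OF df3, of 1 "length (filter (\<lambda>v. v \<in> S) p)"] lf3 f3
      unfolding s_def by (metis One_nat_def f3 length_append length_Cons less_add_Suc1 add_Suc_right less_le_trans
          Suc_le_eq numeral_3_eq_3 nth_append_length s_def Suc_leD)
    then have "filter (\<lambda>v. v \<in> S) p \<noteq> []" "filter (\<lambda>v. v \<in> S) r \<noteq> []" using lf3 f3 by auto
    then have pS: "set p \<inter> S \<noteq> {}" and rS: "set r \<inter> S \<noteq> {}" by (auto simp: filter_empty_conv)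
    have ap0: "apath V E A (p @ s # r)" using apath_familyD(1)[OF ap i0] pr by simp
    then have dist: "distinct (p @ s # r)" by (simp add: apath_def gpath_def)
    have ne: "p \<noteq> []" "r \<noteq> []" using pS rS by auto
    have "s \<notin> A"
    proof
      assume "s \<in> A"
      then have "s \<in> {hd (p @ s # r), last (p @ s # r)}" using ap0 unfolding apath_def by auto
      then have "s = hd p \<or> s = last r" using ne by auto
      then show False using dist hd_in_set[OF ne(1)] last_in_set[OF ne(2)] by auto
    qed
    have Fj: "gpath E (F j)" "set (F j) \<subseteq> V - S" "set (F j) \<inter> A = {last (F j)}" "E s (hd (F j))" using F j(1) by blast+
    have sF: "s \<notin> set (F j)" using Fj(2) sS by blast
    have Fne: "F j \<noteq> []" using Fj(1) by auto
    have gq: "gpath E (s # F j)" using Fj(1,4) sF by (simp add: gpath_Cons)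
    have un: "set (F j) \<inter> set (fam' i) = {}" if "i < k" for i using j(2) that by blast
    have "set (F j) \<inter> set (p @ s # r) = {}" using un[OF i0] pr by simp
    note sw = apath_switch[OF sym ap0 \<open>s \<notin> A\<close> gq Fne _ Fj(3) this]
    have FV: "set (F j) \<subseteq> V" using Fj(2) by blast
    have contra: False if t: "nonzero col t" "apath V E A t" "set t \<subseteq> set (fam' i0) \<union> set (F j)" "set t \<inter> S \<subset> set (fam' i0) \<inter> S" for t
    proof -
      have "apath_family V E A k (fam'(i0 := t))" by (rule apath_family_update[OF ap i0 t(2,3) un])
      then have "nonzero_family V E A col k (fam'(i0 := t))" using nz t(1) by (simp add: nonzero_family_def)
      then have "tot fam \<le> tot (fam'(i0 := t))" by (rule best)
      moreover have "card (set t \<inter> S) < card (set (fam' i0) \<inter> S)" using t(4) finS by (intro psubset_card_mono) auto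
      then have "tot (fam'(i0 := t)) < tot fam'"
        using sum_fun_upd_less[of "\<lambda>t. card (set t \<inter> S)" t fam' i0 k] i0 by (simp add: tot_def)
      ultimately show False using tot by simp
    qed
    have FS: "set (F j) \<inter> S = {}" using Fj(2) by blast
    from nonzero_switch[of col p s r "F j"] nz[OF i0] ne Fne pr
    consider "nonzero col (p @ s # F j)" | "nonzero col (rev (F j) @ s # r)" by auto
    then show False
    proof cases
      case 1
      show False
      proof (rule contra[OF 1 sw(1)[OF FV]])
        show "set (p @ s # F j) \<subseteq> set (fam' i0) \<union> set (F j)" using pr by auto
        obtain v where "v \<in> set r" "v \<in> S" using rS by blast
        then have "v \<in> set (fam' i0) \<inter> S" "v \<notin> set (p @ s # F j) \<inter> S" using pr dist FS by auto
        moreover have "set (p @ s # F j) \<inter> S \<subseteq> set (fam' i0) \<inter> S" using pr FS by auto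
        ultimately show "set (p @ s # F j) \<inter> S \<subset> set (fam' i0) \<inter> S" by blast
      qed
    next
      case 2
      show False
      proof (rule contra[OF 2 sw(2)[OF FV]])
        show "set (rev (F j) @ s # r) \<subseteq> set (fam' i0) \<union> set (F j)" using pr by auto
        obtain v where "v \<in> set p" "v \<in> S" using pS by blast
        then have "v \<in> set (fam' i0) \<inter> S" "v \<notin> set (rev (F j) @ s # r) \<inter> S" using pr dist FS by auto
        moreover have "set (rev (F j) @ s # r) \<inter> S \<subseteq> set (fam' i0) \<inter> S" using pr FS by auto
        ultimately show "set (rev (F j) @ s # r) \<inter> S \<subset> set (fam' i0) \<inter> S" by blast
      qed
    qed
  qed
  then show ?thesis using fam by blast
qed

text \<open>The paths with index at least \<open>k\<close> are arbitrary paths through one vertex of \<open>S\<close> each; they need not be nonzero.\<close>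

lemma extend_family:
  assumes fin: "finite V" and sym: "symp E" and S: "S \<subseteq> V" "card S \<le> 2 * k" and A: "A \<subseteq> V"
    and conn: "\<And>X. X \<subseteq> V \<Longrightarrow> card X < 6 * k \<Longrightarrow> connected_on (V - X) E"
    and deg: "\<And>v. v \<in> V \<Longrightarrow> 6 * k \<le> card {y \<in> V. E v y}" and cA: "6 * k \<le> card A"
    and fam: "nonzero_family V E A col k fam" and few: "(\<Sum>i<k. card (set (fam i) \<inter> S) - 1) + k \<le> card S"
  shows "\<exists>j fam. j \<le> k \<and> apath_family V E A (k + j) fam \<and> (\<forall>i<k. nonzero col (fam i)) \<and>
    (\<forall>i. k \<le> i \<longrightarrow> i < k + j \<longrightarrow> set (fam i) \<inter> S \<noteq> {}) \<and> k \<le> card {i. i < k \<and> set (fam i) \<inter> S \<noteq> {}} + j"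
proof -
  have finS: "finite S" using S fin finite_subset by blast
  \<comment> \<open>The sum is the excess: vertices of \<open>S\<close> on nonzero paths beyond the
    first one on each. Only so many are wasted, and each later path uses exactly one.\<close>
  define St where "St = (\<lambda>j fam. (\<forall>i<k. nonzero col (fam i)) \<and> (\<Sum>i<k. card (set (fam i) \<inter> S) - 1) + k \<le> card S \<and>
    (\<forall>i. k \<le> i \<longrightarrow> i < k + j \<longrightarrow> card (set (fam i) \<inter> S) = 1))"
  define Q where "Q = (\<lambda>j. j \<le> k \<and> (\<exists>fam. St j fam \<and> apath_family V E A (k + j) fam))"
  have "Q 0" using fam few by (auto simp: Q_def St_def nonzero_family_def)
  moreover have "j < Suc k" if "Q j" for j using that by (simp add: Q_def)
  ultimately have "\<exists>j. Q j \<and> (\<forall>j'. Q j' \<longrightarrow> j' \<le> j)" by (intro ex_has_greatest_nat[of Q 0 "\<lambda>j. j" "Suc k"]) auto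
  then obtain j where "Q j" and jmax: "\<And>j'. Q j' \<Longrightarrow> j' \<le> j" by blast
  then obtain fam where jk: "j \<le> k" and St: "St j fam" and ap: "apath_family V E A (k + j) fam" by (auto simp: Q_def)
  show ?thesis
  proof (cases "k \<le> card {i. i < k \<and> set (fam i) \<inter> S \<noteq> {}} + j")
    case True
    have "set (fam i) \<inter> S \<noteq> {}" if "k \<le> i" "i < k + j" for i
      using St that by (metis (no_types, lifting) St_def card.empty zero_neq_one)
    then show ?thesis using True jk ap St by (intro exI[of _ j] exI[of _ fam]) (simp add: St_def)
  next
    case False
    define m where "m = k + j"
    \<comment> \<open>If all of \<open>S\<close> were used up, its size would be the excess, plus
      the number of nonzero paths meeting \<open>S\<close>, plus \<open>j\<close>; this is less than
      the excess plus \<open>k\<close>.\<close>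
    have "\<not> S \<subseteq> (\<Union>i<m. set (fam i))"
    proof
      assume "S \<subseteq> (\<Union>i<m. set (fam i))"
      then have "S = (\<Union>i<m. set (fam i) \<inter> S)" by auto
      then have "card S \<le> (\<Sum>i<m. card (set (fam i) \<inter> S))" by (metis card_UN_le finite_lessThan)
      also have "\<dots> = (\<Sum>i<k. card (set (fam i) \<inter> S)) + (\<Sum>i\<in>{k..<m}. card (set (fam i) \<inter> S))"
        using sum.atLeastLessThan_concat[of 0 k m "\<lambda>i. card (set (fam i) \<inter> S)"] by (simp add: m_def lessThan_atLeast0)
      also have "(\<Sum>i\<in>{k..<m}. card (set (fam i) \<inter> S)) = (\<Sum>i\<in>{k..<m}. 1)"
        by (rule sum.cong) (use St in \<open>auto simp: St_def m_def\<close>)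
      also have "\<dots> = j" by (simp add: m_def)
      also have "(\<Sum>i<k. card (set (fam i) \<inter> S)) =
        (\<Sum>i<k. (card (set (fam i) \<inter> S) - 1) + (if set (fam i) \<inter> S \<noteq> {} then 1 else 0))"
      proof (rule sum.cong)
        fix i
        have "finite (set (fam i) \<inter> S)" by simp
        then show "card (set (fam i) \<inter> S) = (card (set (fam i) \<inter> S) - 1) + (if set (fam i) \<inter> S \<noteq> {} then 1 else 0)"
          using card_gt_0_iff[of "set (fam i) \<inter> S"] by auto
      qed simp
      also have "\<dots> = (\<Sum>i<k. card (set (fam i) \<inter> S) - 1) + card {i. i < k \<and> set (fam i) \<inter> S \<noteq> {}}"
      proof -
        have "{i. i < k \<and> set (fam i) \<inter> S \<noteq> {}} = {..<k} \<inter> {i. set (fam i) \<inter> S \<noteq> {}}" by auto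
        then show ?thesis by (simp add: sum.distrib sum.If_cases)
      qed
      finally show False using St False by (auto simp: St_def)
    qed
    then obtain s where s: "s \<in> S" "\<And>i. i < m \<Longrightarrow> s \<notin> set (fam i)" by blast
    have sV: "s \<in> V" using s S by blast
    have "card S + 4 * k \<le> 6 * k" using S by simp
    from fan[OF fin S(1) A this conn deg[OF sV] cA] obtain F where
      F: "\<forall>j<4*k. gpath E (F j) \<and> set (F j) \<subseteq> V - S \<and> set (F j) \<inter> A = {last (F j)} \<and> E s (hd (F j)) \<and>
      (\<forall>i<4*k. i \<noteq> j \<longrightarrow> set (F i) \<inter> set (F j) = {})" by blast
    let ?U = "\<Union>j<4*k. set (F j)"
    have US: "?U \<inter> S = {}" using F by blast
    define C where "C = (\<lambda>fam. St j fam \<and> (\<forall>i<m. s \<notin> set (fam i)))"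
    have "\<exists>fam. C fam \<and> apath_family V E A m fam \<and> card {j. j < 4 * k \<and> (\<exists>i<m. set (F j) \<inter> set (fam i) \<noteq> {})} \<le> 2 * m"
    proof (rule exchange[OF sym, where ?fam0.0 = fam])
      fix fam i p x r q
      assume C: "C fam" and i: "i < m" and pr: "fam i = p @ x # r" and ne: "p \<noteq> []" "r \<noteq> []" "q \<noteq> []"
        and xU: "x \<in> ?U" and qU: "set q \<subseteq> ?U"
      have outS: "x \<notin> S" "set q \<inter> S = {}" using xU qU US by auto
      have nz: "nonzero col (fam i)" if "i < k" for i using C that by (simp add: C_def St_def)
      have few: "(\<Sum>i<k. card (set (fam i) \<inter> S) - 1) + k \<le> card S" and one: "\<And>i. k \<le> i \<Longrightarrow> i < k + j \<Longrightarrow> card (set (fam i) \<inter> S) = 1"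
        and sno: "\<And>i. i < m \<Longrightarrow> s \<notin> set (fam i)" using C by (auto simp: C_def St_def)
      have good: "C (fam(i := t))" if t: "set t \<inter> S \<subseteq> set (fam i) \<inter> S" "i < k \<Longrightarrow> nonzero col t" "k \<le> i \<Longrightarrow> card (set t \<inter> S) = 1" for t
      proof -
        have "s \<notin> set t" using t(1) sno[OF i] s(1) by blast
        moreover have "card (set t \<inter> S) \<le> card (set (fam i) \<inter> S)" using t(1) finS by (intro card_mono) auto
        then have "(\<Sum>j<k. card (set ((fam(i := t)) j) \<inter> S) - 1) + k \<le> card S"
          using sum_fun_upd_le[of "\<lambda>t. card (set t \<inter> S) - 1" t fam i k] few by linarith
        ultimately show ?thesis using t(2,3) nz one sno unfolding C_def St_def by auto
      qed
      have sub: "set (p @ x # q) \<inter> S \<subseteq> set (fam i) \<inter> S" "set (rev q @ x # r) \<inter> S \<subseteq> set (fam i) \<inter> S" using outS pr by auto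
      show "C (fam(i := p @ x # q)) \<or> C (fam(i := rev q @ x # r))"
      proof (cases "i < k")
        case True
        from nonzero_switch[of col p x r q] nz[OF True] ne pr
        consider "nonzero col (p @ x # q)" | "nonzero col (rev q @ x # r)" by auto
        then show ?thesis
        proof cases
          case 1
          then show ?thesis using good[OF sub(1)] True by simp
        next
          case 2
          then show ?thesis using good[OF sub(2)] True by simp
        qed
      next
        case False
        then have "card (set (fam i) \<inter> S) = 1" using one i by (simp add: m_def)
        then obtain t where t: "set (fam i) \<inter> S = {t}" by (meson card_1_singletonE)
        then have "t \<in> S" "t \<in> set p \<or> t \<in> set r" using pr outS by auto
        then consider "t \<in> set p" | "t \<in> set r" by blast
        then show ?thesis
        proof cases
          case 1
          then have "set (p @ x # q) \<inter> S = {t}" using sub(1) t \<open>t \<in> S\<close> by auto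
          then show ?thesis using good[OF sub(1)] False by simp
        next
          case 2
          then have "set (rev q @ x # r) \<inter> S = {t}" using sub(2) t \<open>t \<in> S\<close> by auto
          then show ?thesis using good[OF sub(2)] False by simp
        qed
      qed
    next
      show "apath_family V E A m fam" using ap by (simp add: m_def)
      show "C fam" using St s by (simp add: C_def)
    qed (use F in auto)
    then obtain fam where C: "C fam" and ap: "apath_family V E A m fam"
      and hit: "card {j. j < 4 * k \<and> (\<exists>i<m. set (F j) \<inter> set (fam i) \<noteq> {})} \<le> 2 * m" by blast
    \<comment> \<open>Here \<open>m < 2 * k\<close>, so at most \<open>4 * k - 2\<close> paths are
      hit.\<close>
    have "card {j. j < 4 * k \<and> (\<exists>i<m. set (F j) \<inter> set (fam i) \<noteq> {})} + 2 \<le> 4 * k" using hit False by (simp add: m_def)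
    then obtain a b where ab: "a < 4 * k" "b < 4 * k" "a \<noteq> b" and un': "\<not> (\<exists>i<m. set (F a) \<inter> set (fam i) \<noteq> {})"
      "\<not> (\<exists>i<m. set (F b) \<inter> set (fam i) \<noteq> {})" by (rule two_unhit)
    have Fa: "gpath E (F a)" "set (F a) \<subseteq> V - S" "set (F a) \<inter> A = {last (F a)}" "E s (hd (F a))"
      and Fb: "gpath E (F b)" "set (F b) \<subseteq> V - S" "set (F b) \<inter> A = {last (F b)}" "E s (hd (F b))"
      and Fab: "set (F a) \<inter> set (F b) = {}" using F ab by blast+
    have Fne: "F a \<noteq> []" "F b \<noteq> []" using Fa(1) Fb(1) by auto
    have sF: "s \<notin> set (F a)" "s \<notin> set (F b)" using Fa(2) Fb(2) s(1) by auto
    have sno: "\<And>i. i < m \<Longrightarrow> s \<notin> set (fam i)" using C by (simp add: C_def)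
    \<comment> \<open>One fan path suffices if \<open>s\<close> belongs to \<open>A\<close>;
      otherwise two of them are joined at \<open>s\<close>.\<close>
    obtain t where t: "apath V E A t" "set t \<subseteq> insert s (set (F a) \<union> set (F b))" "s \<in> set t"
    proof (cases "s \<in> A")
      case True
      show thesis
      proof (rule that[of "s # F a"])
        have "2 \<le> length (s # F a)" using Fne by (cases "F a") auto
        moreover have "set (s # F a) \<inter> A = {hd (s # F a), last (s # F a)}" using True Fa(3) Fne by auto
        ultimately show "apath V E A (s # F a)"
          using Fa sF sV unfolding apath_def gpath_Cons by auto
      qed auto
    next
      case nA: False
      show thesis
      proof (rule that[of "rev (F a) @ s # F b"])
        have "gpath E (s # F b)" using Fb sF by (simp add: gpath_Cons)
        moreover have "gpath E (rev (F a))" using gpath_rev[OF Fa(1) sym] .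
        moreover have "E (last (rev (F a))) s" using sympD[OF sym Fa(4)] Fne by (simp add: last_rev)
        ultimately have "gpath E (rev (F a) @ s # F b)" using sF Fab unfolding gpath_append by auto
        moreover have "2 \<le> length (rev (F a) @ s # F b)" using Fne by (cases "F b") auto
        moreover have "set (rev (F a) @ s # F b) \<inter> A = {hd (rev (F a) @ s # F b), last (rev (F a) @ s # F b)}"
          using nA Fa(3) Fb(3) Fne by (auto simp: hd_append hd_rev)
        ultimately show "apath V E A (rev (F a) @ s # F b)"
          using Fa(2) Fb(2) sV unfolding apath_def by auto
      qed auto
    qed
    have "set t \<inter> set (fam i) = {}" if "i < m" for i
      using t(2) un' sno[OF that] that by blast
    then have "apath_family V E A (Suc m) (fam(m := t))" by (rule apath_family_extend[OF ap t(1)])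
    moreover have "set t \<inter> S = {s}" using t(2,3) s(1) Fa(2) Fb(2) by auto
    then have "St (Suc j) (fam(m := t))" using C by (auto simp: C_def St_def m_def less_Suc_eq)
    ultimately have "Q (Suc j)" using False by (auto simp: Q_def m_def)
    then show ?thesis using jmax[of "Suc j"] by simp
  qed
qed

section \<open>The linked core\<close>

lemma card_arcs_remove:
  assumes fin: "finite V" and sym: "symp E" and irr: "irreflp E" and x: "x \<in> V"
  shows "card (arcs V E V) = card (arcs (V - {x}) E (V - {x})) + 2 * card {u \<in> V. E x u}"
proof -
  have nx: "\<not> E x x" using irr by (auto dest: irreflpD)
  have "arcs V E V = arcs (V - {x}) E (V - {x}) \<union> arcs V E {x}" by (auto simp: arcs_def)
  moreover have "arcs (V - {x}) E (V - {x}) \<inter> arcs V E {x} = {}" by (auto simp: arcs_def)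
  ultimately have "card (arcs V E V) = card (arcs (V - {x}) E (V - {x})) + card (arcs V E {x})"
    using fin by (simp add: card_Un_disjoint finite_arcs)
  then show ?thesis using card_arcs_star[OF fin sym x nx] by simp
qed

lemma card_arcs_sum:
  assumes "finite V"
  shows "card (arcs V E V) = (\<Sum>v\<in>V. card {u \<in> V. E v u})"
proof -
  have "arcs V E V = (SIGMA v:V. {u \<in> V. E v u})" by (auto simp: arcs_def)
  then show ?thesis using assms by simp
qed

lemma card_arcs_le_square:
  assumes "finite V"
  shows "card (arcs V E V) \<le> card V * card V"
proof -
  have "card (arcs V E V) \<le> card (V \<times> V)" using assms by (intro card_mono) (auto simp: arcs_def)
  then show ?thesis by (simp add: card_cartesian_product)
qed

text \<open>The vertices are coloured one by one, each against the majority of its coloured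
  neighbours.\<close>

lemma large_cut:
  assumes "finite V" "symp E" "irreflp E"
  shows "\<exists>col :: 'a \<Rightarrow> bool. card (arcs V E V) \<le> 2 * card (arcs V (\<lambda>u v. E u v \<and> col u \<noteq> col v) V)"
  using assms(1)
proof induction
  case empty
  then show ?case by (simp add: arcs_def)
next
  case (insert x V)
  obtain col :: "'a \<Rightarrow> bool" where col: "card (arcs V E V) \<le> 2 * card (arcs V (\<lambda>u v. E u v \<and> col u \<noteq> col v) V)"
    using insert.IH by blast
  have nx: "\<not> E x x" using assms(3) by (auto dest: irreflpD)
  let ?N = "\<lambda>b. {u \<in> V. E x u \<and> col u = b}"
  have "{u \<in> insert x V. E x u} = ?N True \<union> ?N False" using nx by auto
  moreover have "card (?N True \<union> ?N False) = card (?N True) + card (?N False)"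
    using insert.hyps(1) by (intro card_Un_disjoint) auto
  ultimately have deg: "card {u \<in> insert x V. E x u} = card (?N True) + card (?N False)" by simp
  obtain b where b: "card (?N b) \<le> card (?N (\<not> b))"
  proof (cases "card (?N True) \<le> card (?N False)")
    case True
    then show thesis by (intro that[of True]) simp
  next
    case False
    then show thesis by (intro that[of False]) simp
  qed
  define col' where "col' = col(x := b)"
  let ?H = "\<lambda>u v. E u v \<and> col' u \<noteq> col' v"
  have symH: "symp ?H" by (rule sympI) (use sympD[OF assms(2)] in blast)
  have irrH: "irreflp ?H" by (rule irreflpI) simp
  have "insert x V - {x} = V" using insert.hyps(2) by simp
  note rem = card_arcs_remove[of "insert x V" _ x, unfolded this]
  have "arcs V ?H V = arcs V (\<lambda>u v. E u v \<and> col u \<noteq> col v) V" using insert.hyps(2) by (auto simp: arcs_def col'_def)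
  then have "card (arcs (insert x V) ?H (insert x V)) =
    card (arcs V (\<lambda>u v. E u v \<and> col u \<noteq> col v) V) + 2 * card {u \<in> insert x V. ?H x u}"
    using rem[of ?H] insert.hyps(1) symH irrH by simp
  moreover have "{u \<in> insert x V. ?H x u} = ?N (\<not> b)" using insert.hyps(2) nx by (auto simp: col'_def)
  moreover have "card (arcs (insert x V) E (insert x V)) = card (arcs V E V) + 2 * card {u \<in> insert x V. E x u}"
    using rem[of E] insert.hyps(1) assms(2,3) by simp
  moreover have "card {u \<in> insert x V. E x u} \<le> 2 * card (?N (\<not> b))" using deg b by (cases b) simp_all
  ultimately have "card (arcs (insert x V) E (insert x V)) \<le> 2 * card (arcs (insert x V) ?H (insert x V))"
    using col by simp
  then show ?case by blast
qed

text \<open>The core minimises its order subject to exceeding \<open>25 * k * (card U - 4 * k)\<close> arcs. This bound is additive along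
  separations of order less than \<open>4 * k\<close>, so such separations, like vertices of small degree, contradict minimality.\<close>

theorem linked_core:
  fixes V :: "'a set"
  assumes fin: "finite V" and sym: "symp E" and irr: "irreflp E" and k: "1 \<le> k" and big: "8 * k \<le> card V"
    and dense: "25 * k * card V \<le> card (arcs V E V)"
  shows "\<exists>K\<subseteq>V. 8 * k \<le> card K \<and> (\<forall>X\<subseteq>K. card X = 4 * k \<longrightarrow> linked K E X)"
proof -
  define e where "e = (\<lambda>U. card (arcs U E U))"
  define Q where "Q = (\<lambda>U. U \<subseteq> V \<and> 8 * k \<le> card U \<and> 25 * k * card U < e U + 100 * k * k)"
  have "0 < 100 * k * k" using k by simp
  then have "25 * k * card V < e V + 100 * k * k" using dense unfolding e_def by linarith
  then have "Q V" using big by (simp add: Q_def)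
  then obtain U where QU: "Q U" and min: "\<And>U'. Q U' \<Longrightarrow> card U \<le> card U'"
    using ex_has_least_nat[of Q V card] by blast
  have UV: "U \<subseteq> V" and U8: "8 * k \<le> card U" and eU: "25 * k * card U < e U + 100 * k * k" using QU by (auto simp: Q_def)
  have finU: "finite U" using UV fin finite_subset by blast
  have small: "e U' + 100 * k * k \<le> 25 * k * card U'" if "U' \<subset> U" "8 * k \<le> card U'" for U'
  proof (rule ccontr)
    assume "\<not> ?thesis"
    then have "Q U'" using that UV by (auto simp: Q_def)
    then show False using min[of U'] psubset_card_mono[OF finU that(1)] by simp
  qed
  \<comment> \<open>Since \<open>(x - 5 * k) * (20 * k - x)\<close> equals
    \<open>25 * k * x - 100 * k * k - x * x\<close>, a set of between \<open>5 * k\<close> and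
    \<open>20 * k\<close> vertices has too few ordered pairs for the required number of
    arcs.\<close>
  have U20: "20 * k \<le> card U"
  proof (rule ccontr)
    assume "\<not> ?thesis"
    then obtain d where d: "20 * k = card U + d" using le_Suc_ex[of "card U" "20 * k"] by auto
    obtain c where c: "card U = 5 * k + c" using U8 le_Suc_ex[of "5 * k" "card U"] by auto
    have "card U * card U + 100 * k * k + c * d = 25 * k * card U"
    proof -
      have "c * (c + d) = c * (15 * k)" using c d by simp
      then have "c * c + c * d = 15 * k * c" by (simp add: distrib_left)
      then show ?thesis unfolding c by (simp add: algebra_simps)
    qed
    then show False using eU card_arcs_le_square[OF finU, of E] by (simp add: e_def)
  qed
  \<comment> \<open>Removing a vertex lowers the bound by \<open>25 * k\<close>, so by minimality it
    must destroy at least that many arcs, twice its degree.\<close>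
  have deg: "12 * k \<le> card {u \<in> U. E v u}" if v: "v \<in> U" for v
  proof -
    have "U - {v} \<subset> U" "card (U - {v}) + 1 = card U" using v card_Suc_Diff1[OF finU v] by auto
    moreover have "8 * k \<le> card (U - {v})" using \<open>card (U - {v}) + 1 = card U\<close> U20 k by linarith
    ultimately have "e (U - {v}) + 100 * k * k \<le> 25 * k * card (U - {v})" by (intro small)
    moreover have "25 * k * card U = 25 * k * card (U - {v}) + 25 * k"
      using \<open>card (U - {v}) + 1 = card U\<close> by (metis distrib_left mult.right_neutral)
    moreover have "e U = e (U - {v}) + 2 * card {u \<in> U. E v u}"
      unfolding e_def by (rule card_arcs_remove[OF finU sym irr v])
    ultimately show ?thesis using eU by linarith
  qed
  have "linked U E X" if X: "X \<subseteq> U" "card X = 4 * k" for X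
  proof (rule massed_linked[of "2 * k"])
    have finX: "finite X" using X finU finite_subset by blast
    have cUX: "card U = card (U - X) + 4 * k" using X finX card_mono[OF finU X(1)] by (simp add: card_Diff_subset)
    show "massed (12 * (2 * k)) U E X"
      unfolding massed_def
    proof (intro conjI allI impI)
      \<comment> \<open>At most \<open>16 * k * k\<close> arcs lie inside \<open>X\<close>. They are
        paid for by the difference between 25 and 24, since at least \<open>16 * k\<close> vertices
        lie outside.\<close>
      have "arcs U E U = arcs U E (U - X) \<union> arcs X E X" using X by (auto simp: arcs_def)
      then have "e U \<le> card (arcs U E (U - X)) + card (arcs X E X)" unfolding e_def by (metis card_Un_le)
      moreover have "card (arcs X E X) \<le> 16 * k * k" using card_arcs_le_square[OF finX, of E] X(2) by simp
      moreover have "25 * k * card U = 24 * k * card (U - X) + k * card (U - X) + 100 * k * k"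
        unfolding cUX by (simp add: algebra_simps)
      moreover have "k * (16 * k) \<le> k * card (U - X)" using U20 cUX by (intro mult_le_mono2) simp
      then have "16 * k * k \<le> k * card (U - X)" by (simp add: algebra_simps)
      ultimately have "24 * k * card (U - X) < card (arcs U E (U - X))" using eU by linarith
      then show "12 * (2 * k) * card (U - X) < card (arcs U E (U - X))" by simp
    next
      fix W assume W: "W \<subseteq> U - X" "card (nbs U E W) < card X"
      \<comment> \<open>Both sides of the separation contain a vertex with its whole neighbourhood,
        so both have at least \<open>8 * k\<close> vertices and obey the bound \<open>small\<close>;
        the overlap is less than \<open>4 * k\<close>, and adding the bounds contradicts
        \<open>eU\<close>.\<close>
      have "W = {}"
      proof (rule ccontr)
        assume "W \<noteq> {}"
        then obtain w where w: "w \<in> W" by blast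
        let ?N = "nbs U E W"
        have NU: "?N \<subseteq> U" "?N \<inter> W = {}" by (auto simp: nbs_def)
        have finN: "finite ?N" and finW: "finite W" using NU W finU finite_subset by blast+
        have "\<not> X \<subseteq> ?N" using W(2) card_mono[OF finN, of X] by auto
        then obtain x where x: "x \<in> X" "x \<notin> ?N" by blast
        have xU: "x \<in> U" "x \<notin> W" using x(1) X W by auto
        have "{u \<in> U. E w u} \<subseteq> W \<union> ?N" using w by (auto simp: nbs_def)
        then have "card {u \<in> U. E w u} \<le> card (W \<union> ?N)" using finN finW by (intro card_mono) auto
        moreover have "w \<in> U" using w W by blast
        ultimately have "12 * k \<le> card (W \<union> ?N)" using deg[of w] by linarith
        then have "8 * k \<le> card (W \<union> ?N)" by linarith
        moreover have "W \<union> ?N \<subset> U" using xU x W NU by blast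
        ultimately have 1: "e (W \<union> ?N) + 100 * k * k \<le> 25 * k * card (W \<union> ?N)" by (intro small)
        have "{u \<in> U. E x u} \<subseteq> U - W"
        proof
          fix u assume u: "u \<in> {u \<in> U. E x u}"
          then have "E u x" using sympD[OF sym, of x u] by simp
          then show "u \<in> U - W" using u x xU by (auto simp: nbs_def)
        qed
        then have "card {u \<in> U. E x u} \<le> card (U - W)" using finU by (intro card_mono) auto
        then have "8 * k \<le> card (U - W)" using deg[OF xU(1)] by linarith
        moreover have "U - W \<subset> U" using w W by blast
        ultimately have 2: "e (U - W) + 100 * k * k \<le> 25 * k * card (U - W)" by (intro small)
        have "arcs U E U \<subseteq> arcs (W \<union> ?N) E (W \<union> ?N) \<union> arcs (U - W) E (U - W)"
        proof
          fix p assume "p \<in> arcs U E U"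
          then obtain a b where ab: "p = (a, b)" "a \<in> U" "b \<in> U" "E a b" by (auto simp: arcs_def)
          then have "E b a" using sympD[OF sym, of a b] by simp
          then show "p \<in> arcs (W \<union> ?N) E (W \<union> ?N) \<union> arcs (U - W) E (U - W)"
            using ab by (cases "a \<in> W"; cases "b \<in> W") (auto simp: arcs_def nbs_def)
        qed
        then have "e U \<le> card (arcs (W \<union> ?N) E (W \<union> ?N) \<union> arcs (U - W) E (U - W))"
          unfolding e_def using finN finW finU by (intro card_mono) (auto simp: finite_arcs)
        also have "\<dots> \<le> e (W \<union> ?N) + e (U - W)" unfolding e_def by (rule card_Un_le)
        finally have 3: "e U \<le> e (W \<union> ?N) + e (U - W)" .
        have "W \<subseteq> U" using W by blast
        then have "card W + card (U - W) = card U"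
          using card_mono[OF finU \<open>W \<subseteq> U\<close>] finW by (simp add: card_Diff_subset)
        then have "card (W \<union> ?N) + card (U - W) \<le> 4 * k + card U" using W(2) X(2) card_Un_le[of W ?N] by linarith
        then have "25 * k * (card (W \<union> ?N) + card (U - W)) \<le> 25 * k * (4 * k + card U)" by (rule mult_le_mono2)
        then have "25 * k * card (W \<union> ?N) + 25 * k * card (U - W) \<le> 100 * k * k + 25 * k * card U" by (simp add: algebra_simps)
        then show False using 1 2 3 eU by linarith
      qed
      then show "card (arcs U E W) \<le> 12 * (2 * k) * card W" by (simp add: arcs_def)
    qed
  qed (use finU sym irr X k in auto)
  then show ?thesis using UV U8 by blast
qed

section \<open>Closing paths to odd cycles\<close>

text \<open>The link \<open>l\<close> leads from the end of the path \<open>u l\<close> to the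
  beginning of the path \<open>v l\<close>. As \<open>u\<close> and \<open>v\<close> have the same
  image, both ends of each path used are prescribed, so links inside \<open>K\<close> avoid these
  paths completely. Paths outside the image may be crossed.\<close>

lemma family_links:
  fixes u v :: "nat \<Rightarrow> nat"
  assumes link: "\<And>X. X \<subseteq> K \<Longrightarrow> card X = 4 * k \<Longrightarrow> linked K H X" and K: "finite K" "4 * k \<le> card K"
    and fam: "apath_family V E K m fam" and I: "I \<subseteq> {..<2 * k}" "inj_on u I" "inj_on v I" "u ` I = v ` I" "u ` I \<subseteq> {..<m}"
  shows "\<exists>L. \<forall>l\<in>I. gpath H (last (fam (u l)) # L l @ [hd (fam (v l))]) \<and> set (L l) \<subseteq> K \<and>
    (\<forall>w\<in>u ` I. set (L l) \<inter> set (fam w) = {}) \<and> (\<forall>l'\<in>I. l \<noteq> l' \<longrightarrow> set (L l) \<inter> set (L l') = {})"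
proof -
  define s where "s = (\<lambda>l. last (fam (u l)))"
  define t where "t = (\<lambda>l. hd (fam (v l)))"
  have finI: "finite I" using I(1) finite_subset by blast
  have um: "u l < m" and vm: "v l < m" if "l \<in> I" for l using I(4,5) that by blast+
  have ends: "hd (fam i) \<in> set (fam i)" "last (fam i) \<in> set (fam i)" "hd (fam i) \<noteq> last (fam i)"
    "set (fam i) \<inter> K = {hd (fam i), last (fam i)}" if "i < m" for i
  proof -
    have ap: "apath V E K (fam i)" by (rule apath_familyD(1)[OF fam that])
    then have ne: "fam i \<noteq> []" and d: "distinct (fam i)" and l2: "2 \<le> length (fam i)" by (auto simp: apath_def gpath_def)
    then show "hd (fam i) \<in> set (fam i)" "last (fam i) \<in> set (fam i)" by auto
    show "hd (fam i) \<noteq> last (fam i)" using d l2 by (cases "fam i"; cases "tl (fam i)") auto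
    show "set (fam i) \<inter> K = {hd (fam i), last (fam i)}" using ap by (simp add: apath_def)
  qed
  have disj: "i = i'" if "i < m" "i' < m" "x \<in> set (fam i)" "x \<in> set (fam i')" for i i' x
    using apath_familyD(2)[OF fam that(1,2)] that(3,4) by blast
  have sinj: "inj_on s I"
  proof (rule inj_onI)
    fix l l' assume l: "l \<in> I" "l' \<in> I" "s l = s l'"
    then have "u l = u l'" using disj[of "u l" "u l'" "s l"] um[OF l(1)] um[OF l(2)] ends(2)[OF um[OF l(1)]] ends(2)[OF um[OF l(2)]] by (simp add: s_def)
    then show "l = l'" using l I(2) by (simp add: inj_on_eq_iff)
  qed
  have tinj: "inj_on t I"
  proof (rule inj_onI)
    fix l l' assume l: "l \<in> I" "l' \<in> I" "t l = t l'"
    then have "v l = v l'" using disj[of "v l" "v l'" "t l"] vm[OF l(1)] vm[OF l(2)] ends(1)[OF vm[OF l(1)]] ends(1)[OF vm[OF l(2)]] by (simp add: t_def)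
    then show "l = l'" using l I(3) by (simp add: inj_on_eq_iff)
  qed
  have st: "s l \<noteq> t l'" if "l \<in> I" "l' \<in> I" for l l'
  proof
    assume eq: "s l = t l'"
    have "u l = v l'"
      using disj[of "u l" "v l'" "s l"] ends(2)[OF um[OF that(1)]] ends(1)[OF vm[OF that(2)]] um[OF that(1)] vm[OF that(2)] eq
      by (simp add: s_def t_def)
    then show False using ends(3)[OF um[OF that(1)]] eq by (simp add: s_def t_def)
  qed
  have sK: "s l \<in> K" and tK: "t l \<in> K" if "l \<in> I" for l
    using ends(4)[OF um[OF that]] ends(4)[OF vm[OF that]] by (auto simp: s_def t_def)
  have "card (s ` I \<union> t ` I) \<le> card I + card I"
    using card_Un_le[of "s ` I" "t ` I"] card_image_le[OF finI, of s] card_image_le[OF finI, of t] by linarith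
  moreover have "card I \<le> 2 * k" using card_mono[OF _ I(1)] by simp
  ultimately have "card (s ` I \<union> t ` I) \<le> 4 * k" by linarith
  moreover have "s ` I \<union> t ` I \<subseteq> K" using sK tK by blast
  ultimately obtain X where X: "s ` I \<union> t ` I \<subseteq> X" "X \<subseteq> K" "card X = 4 * k"
    using exists_subset_between[of "s ` I \<union> t ` I" "4 * k" K] K by blast
  have pair: "pairing I s t X" using finI sinj tinj st X(1) by (auto simp: pairing_def)
  from linkedD[OF link[OF X(2,3)] pair] obtain P where P: "\<And>l. l \<in> I \<Longrightarrow> connected_on (P l) H \<and> P l \<subseteq> K \<and> s l \<in> P l \<and> t l \<in> P l \<and> P l \<inter> X = {s l, t l}"
    and Pd: "\<And>l l'. l \<in> I \<Longrightarrow> l' \<in> I \<Longrightarrow> l \<noteq> l' \<Longrightarrow> P l \<inter> P l' = {}"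
    by blast
  have "\<exists>L. gpath H (s l # L @ [t l]) \<and> set L \<subseteq> P l \<and> set L \<inter> X = {}" if l: "l \<in> I" for l
  proof -
    obtain q where q: "gpath H q" "set q \<subseteq> P l" "hd q = s l" "last q = t l"
      using connected_on_path[of "P l" H "s l" "t l"] P[OF l] by blast
    obtain q' where q': "q = s l # q'" using q(1,3) by (cases q) auto
    have "q' \<noteq> []" using q' q(4) st[OF l l] by auto
    then obtain L where L: "q' = L @ [t l]" using q(4) q' by (metis append_butlast_last_id last_ConsR)
    have "set L \<inter> X \<subseteq> {s l, t l}" using P[OF l] q(2) q' L by auto
    moreover have "s l \<notin> set L" "t l \<notin> set L" using q(1) q' L by (auto simp: gpath_def)
    ultimately show ?thesis using q(1,2) q' L by (intro exI[of _ L]) auto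
  qed
  then obtain L where L: "\<And>l. l \<in> I \<Longrightarrow> gpath H (s l # L l @ [t l]) \<and> set (L l) \<subseteq> P l \<and> set (L l) \<inter> X = {}" by metis
  show ?thesis
  proof (intro exI[of _ L] ballI conjI impI)
    fix l assume l: "l \<in> I"
    show "gpath H (last (fam (u l)) # L l @ [hd (fam (v l))])" using L[OF l] by (simp add: s_def t_def)
    show LK: "set (L l) \<subseteq> K" using L[OF l] P[OF l] by blast
    show "set (L l) \<inter> set (fam w) = {}" if w: "w \<in> u ` I" for w
    proof -
      have wm: "w < m" using w um by blast
      have "last (fam w) \<in> X" using w X(1) by (auto simp: s_def)
      moreover have "hd (fam w) \<in> X" using w X(1) unfolding I(4) by (auto simp: t_def)
      ultimately have "set (fam w) \<inter> K \<subseteq> X" using ends(4)[OF wm] by simp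
      then show ?thesis using LK L[OF l] by blast
    qed
    fix l' assume "l' \<in> I" "l \<noteq> l'"
    then show "set (L l) \<inter> set (L l') = {}" using L[OF l] L[of l'] Pd[OF l, of l'] by blast
  qed
qed

lemma bichromatic_link_parity:
  fixes col :: "'a \<Rightarrow> bool"
  assumes "successively (\<lambda>x y. col x \<noteq> col y) (a # m @ [b])"
  shows "even (length m) \<longleftrightarrow> (col a \<noteq> col b)"
  using assms
proof (induction m arbitrary: a)
  case (Cons c m)
  then have "successively (\<lambda>x y. col x \<noteq> col y) (c # m @ [b])" "col a \<noteq> col c" by auto
  with Cons.IH[of c] show ?case by (cases "col a"; cases "col b") auto
qed simp

lemma gpath_join:
  assumes "gpath E p" "gpath E p'" "gpath E (last p # m @ [hd p'])" "set m \<inter> set p = {}" "set m \<inter> set p' = {}" "set p \<inter> set p' = {}"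
  shows "gpath E (p @ m @ p')"
proof (cases "m = []")
  case True
  then show ?thesis using assms by (auto simp: gpath_append gpath_Cons)
next
  case False
  have ne: "p \<noteq> []" "p' \<noteq> []" using assms(1,2) by auto
  have m: "gpath E m" "E (last p) (hd m)" "E (last m) (hd p')"
    using assms(3) False by (auto simp: gpath_Cons gpath_append)
  then have "gpath E (m @ p')" using assms(2,5) by (simp add: gpath_append)
  then show ?thesis using assms m False ne by (auto simp: gpath_append)
qed

text \<open>Parity values add across a bichromatic link, so exactly one of the two paths must be
  nonzero.\<close>

lemma nonzero_join:
  assumes "nonzero col p \<noteq> nonzero col p'" "even (length m) \<longleftrightarrow> (col (last p) \<noteq> col (hd p'))" "p \<noteq> []" "p' \<noteq> []"
  shows "nonzero col (p @ m @ p')"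
  using assms by (auto simp: nonzero_def)

lemma odd_S_cycle_close:
  assumes p: "gpath E p" "set p \<subseteq> V" "2 \<le> length p" "nonzero col p" "set p \<inter> S \<noteq> {}"
    and m: "gpath (\<lambda>x y. E x y \<and> col x \<noteq> col y) (last p # m @ [hd p])" "set m \<subseteq> V" "set m \<inter> set p = {}"
  shows "odd_S_cycle V E S (p @ m)"
proof -
  let ?c = "p @ m"
  have pne: "p \<noteq> []" using p(1) by auto
  have suc: "successively (\<lambda>x y. E x y \<and> col x \<noteq> col y) (last p # m @ [hd p])" using m(1) by (simp add: gpath_def)
  then have "successively (\<lambda>x y. col x \<noteq> col y) (last p # m @ [hd p])" by (rule successively_mono) simp
  from bichromatic_link_parity[OF this] have oddc: "odd (length ?c)" using p(4) by (auto simp: nonzero_def)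
  moreover have "2 \<le> length ?c" using p(3) by simp
  ultimately have "3 \<le> length ?c" by presburger
  have sucE: "successively E (last p # m @ [hd p])" using suc by (rule successively_mono) simp
  have "successively E (p @ m)"
    using p(1) sucE by (cases "m = []") (auto simp: gpath_def successively_append_iff successively_Cons)
  then have step: "E (?c ! i) (?c ! Suc i)" if "Suc i < length ?c" for i using that unfolding successively_conv_nth by blast
  have closing: "E (last ?c) (hd p)"
    using sucE by (cases "m = []") (auto simp: successively_append_iff successively_Cons)
  have "is_cycle V E ?c"
    unfolding is_cycle_def
  proof (intro conjI allI impI)
    show "distinct ?c" using p(1) m by (auto simp: gpath_def)
    fix i assume i: "i < length ?c"
    show "E (?c ! i) (?c ! ((i + 1) mod length ?c))"
    proof (cases "Suc i < length ?c")
      case True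
      then show ?thesis using step by simp
    next
      case False
      then have "Suc i = length ?c" using i by simp
      moreover from this have "?c ! i = last ?c" using pne by (metis append_is_Nil_conv diff_Suc_1 last_conv_nth)
      moreover have "?c ! 0 = hd p" using pne by (simp add: hd_conv_nth nth_append)
      ultimately show ?thesis using closing by simp
    qed
  qed (use p m \<open>3 \<le> length ?c\<close> in auto)
  then show ?thesis using oddc p(5) unfolding odd_S_cycle_def by auto
qed

lemma odd_cycles_of_family:
  assumes link: "\<And>X. X \<subseteq> K \<Longrightarrow> card X = 4 * k \<Longrightarrow> linked K (\<lambda>x y. E x y \<and> col x \<noteq> col y) X"
    and K: "K \<subseteq> V" "finite K" "4 * k \<le> card K"
    and fam: "apath_family V E K (k + j) fam" and nz: "\<And>i. i < k \<Longrightarrow> nonzero col (fam i)"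
    and meet: "\<And>i. k \<le> i \<Longrightarrow> i < k + j \<Longrightarrow> set (fam i) \<inter> S \<noteq> {}"
    and enough: "k \<le> card {i. i < k \<and> set (fam i) \<inter> S \<noteq> {}} + j"
  shows "\<exists>C. (\<forall>i<k. odd_S_cycle V E S (C i)) \<and> (\<forall>i<k. \<forall>i'<k. i \<noteq> i' \<longrightarrow> set (C i) \<inter> set (C i') = {})"
proof -
  let ?H = "\<lambda>x y. E x y \<and> col x \<noteq> col y"
  define M where "M = {i. i < k \<and> set (fam i) \<inter> S \<noteq> {}}"
  have "card ({..<k} - M) \<le> card {k..<k + j}"
    using enough by (subst card_Diff_subset) (auto simp: M_def)
  then obtain \<tau> where \<tau>: "inj_on \<tau> ({..<k} - M)" "\<tau> ` ({..<k} - M) \<subseteq> {k..<k + j}"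
    using card_le_inj[of "{..<k} - M" "{k..<k + j}"] by auto
  have \<tau>k: "k \<le> \<tau> i" "\<tau> i < k + j" if "i < k" "i \<notin> M" for i using \<tau>(2) that by (auto simp: image_subset_iff)
  define main where "main = (\<lambda>i. if i \<in> M then i else \<tau> i)"
  define two where "two = (\<lambda>i. i < k \<and> i \<notin> M \<and> \<not> nonzero col (fam (\<tau> i)))"
  have main_inj: "i = i'" if "i < k" "i' < k" "main i = main i'" for i i'
    using that \<tau>(1) \<tau>k[of i] \<tau>k[of i'] by (auto simp: main_def M_def inj_on_def split: if_splits)
  have main_ne: "main i \<noteq> i'" if "i < k" "two i'" for i i'
    using that \<tau>k[of i] by (auto simp: main_def two_def)
  have main_lt: "main i < k + j" if "i < k" for i using \<tau>k[OF that] that by (auto simp: main_def)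
  \<comment> \<open>Links are numbered so that \<open>2 * i\<close> and \<open>2 * i + 1\<close>
    belong to the cycle \<open>i\<close>; the odd one exists only if two paths are combined.\<close>
  define I where "I = {l. l div 2 < k \<and> (odd l \<longrightarrow> two (l div 2))}"
  define u where "u = (\<lambda>l. if even l then main (l div 2) else l div 2)"
  \<comment> \<open>The even link closes the main path directly, or leads to the path
    \<open>i\<close>, from which the odd link returns.\<close>
  define v where "v = (\<lambda>l. if even l = two (l div 2) then l div 2 else main (l div 2))"
  have v: "v l = (if two (l div 2) then (if even l then l div 2 else main (l div 2)) else main (l div 2))" if "l \<in> I" for l
    using that by (auto simp: v_def I_def)
  have eqI: "l = l'" if "l div 2 = l' div 2" "even l = even l'" for l l' :: nat
    using that by (metis even_two_times_div_two odd_two_times_div_two_succ)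
  have uinj: "inj_on u I"
  proof (rule inj_onI)
    fix l l' assume l: "l \<in> I" "l' \<in> I" "u l = u l'"
    then show "l = l'" using main_inj[of "l div 2" "l' div 2"] main_ne[of "l div 2" "l' div 2"] main_ne[of "l' div 2" "l div 2"] eqI[of l l']
      by (cases "even l"; cases "even l'") (auto simp: u_def I_def)
  qed
  have vinj: "inj_on v I"
  proof (rule inj_onI)
    fix l l' assume l: "l \<in> I" "l' \<in> I" "v l = v l'"
    define i i' where "i = l div 2" and "i' = l' div 2"
    have i: "i < k" "i' < k" "odd l \<Longrightarrow> two i" "odd l' \<Longrightarrow> two i'" using l(1,2) by (auto simp: I_def i_def i'_def)
    have eq: "(if two i then (if even l then i else main i) else main i) = (if two i' then (if even l' then i' else main i') else main i')"
      unfolding i_def i'_def v[OF l(1), symmetric] v[OF l(2), symmetric] by (rule l(3))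
    have "i = i' \<and> even l = even l'"
      using i eq main_inj[of i i'] main_ne[of i i'] main_ne[of i' i] main_ne[of i i] by (simp split: if_splits; metis)
    then show "l = l'" using eqI[of l l'] by (simp add: i_def i'_def)
  qed
  have evI: "2 * i \<in> I" if "i < k" for i using that by (simp add: I_def)
  have odI: "2 * i + 1 \<in> I" if "two i" for i using that by (auto simp: I_def two_def)
  have u_ev: "u (2 * i) = main i" and u_od: "u (2 * i + 1) = i" for i by (simp_all add: u_def)
  have uv: "u ` I = v ` I"
  proof -
    have "u l \<in> v ` I" if l: "l \<in> I" for l
    proof (cases "two (l div 2)")
      case True
      have "l div 2 = v (2 * (l div 2))" "main (l div 2) = v (2 * (l div 2) + 1)" using True by (auto simp: v_def)
      moreover have "2 * (l div 2) \<in> I" using l by (intro evI) (simp add: I_def)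
      ultimately have "l div 2 \<in> v ` I" "main (l div 2) \<in> v ` I" using odI[OF True] by (blast intro: image_eqI)+
      then show ?thesis by (simp add: u_def)
    next
      case False
      then have "even l" "v l = main (l div 2)" using l v[OF l] by (auto simp: I_def)
      then show ?thesis using l by (auto simp: u_def image_iff intro!: bexI[of _ l])
    qed
    moreover have "finite I" by (rule finite_subset[of _ "{..<2 * k}"]) (auto simp: I_def)
    ultimately show ?thesis using card_image[OF uinj] card_image[OF vinj] by (intro card_subset_eq) auto
  qed
  have "u ` I \<subseteq> {..<k + j}" using main_lt by (auto simp: u_def I_def)
  moreover have "I \<subseteq> {..<2 * k}" by (auto simp: I_def)
  ultimately obtain L where L: "\<forall>l\<in>I. gpath ?H (last (fam (u l)) # L l @ [hd (fam (v l))]) \<and> set (L l) \<subseteq> K \<and>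
    (\<forall>w\<in>u ` I. set (L l) \<inter> set (fam w) = {}) \<and> (\<forall>l'\<in>I. l \<noteq> l' \<longrightarrow> set (L l) \<inter> set (L l') = {})"
    using family_links[OF link K(2,3) fam _ uinj vinj uv] by blast
  have Lfam: "set (L l) \<inter> set (fam (u l')) = {}" if "l \<in> I" "l' \<in> I" for l l' using L that by blast
  have LL: "set (L l) \<inter> set (L l') = {}" if "l \<in> I" "l' \<in> I" "l \<noteq> l'" for l l' using L that by blast
  have Lp: "gpath ?H (last (fam (u l)) # L l @ [hd (fam (v l))])" "set (L l) \<subseteq> V" if "l \<in> I" for l
    using L that K(1) by blast+
  \<comment> \<open>All paths and links reserved for the cycle \<open>i\<close>; these reservations
    are disjoint for different \<open>i\<close>.\<close>
  define D where "D = (\<lambda>i. \<Union>l\<in>{l \<in> I. l div 2 = i}. set (fam (u l)) \<union> set (L l))"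
  have ap: "gpath E (fam w)" "set (fam w) \<subseteq> V" "2 \<le> length (fam w)" if "w < k + j" for w
    using apath_familyD(1)[OF fam that] by (auto simp: apath_def)
  have cyc: "\<exists>c. odd_S_cycle V E S c \<and> set c \<subseteq> D i" if i: "i < k" for i
  proof -
    let ?a = "fam (main i)"
    note a = ap[OF main_lt[OF i]]
    have aS: "set ?a \<inter> S \<noteq> {}" using meet[of "\<tau> i"] \<tau>k[OF i] by (cases "i \<in> M") (auto simp: main_def M_def)
    have ev: "2 * i \<in> I" using evI[OF i] .
    have La: "set (L (2 * i)) \<inter> set ?a = {}" using Lfam[OF ev ev] by (simp add: u_ev)
    have Da: "set ?a \<union> set (L (2 * i)) \<subseteq> D i" unfolding D_def using ev u_ev[of i] by (intro subsetI UN_I[of "2 * i"]) auto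
    show ?thesis
    proof (cases "two i")
      case False
      have "v (2 * i) = main i" using False by (simp add: v_def)
      then have l: "gpath ?H (last ?a # L (2 * i) @ [hd ?a])" using Lp(1)[OF ev] by (simp add: u_ev)
      have "nonzero col ?a" using False nz[OF i] i by (auto simp: two_def main_def)
      from odd_S_cycle_close[OF a this aS l Lp(2)[OF ev] La] show ?thesis
        using Da by (intro exI[of _ "?a @ L (2 * i)"]) simp
    next
      case True
      let ?b = "fam i"
      have od: "2 * i + 1 \<in> I" using odI[OF True] .
      have "i < k + j" using i by simp
      note b = ap[OF this]
      have ve: "v (2 * i) = i" and vo: "v (2 * i + 1) = main i" using True by (simp_all add: v_def)
      have l1: "gpath ?H (last ?a # L (2 * i) @ [hd ?b])" using Lp(1)[OF ev] ve by (simp add: u_ev)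
      have l2: "gpath ?H (last ?b # L (2 * i + 1) @ [hd ?a])" using Lp(1)[OF od] vo u_od[of i] by simp
      have ab: "set ?a \<inter> set ?b = {}" using apath_familyD(2)[OF fam main_lt[OF i] \<open>i < k + j\<close>] main_ne[OF i True] by simp
      have Lb: "set (L (2 * i)) \<inter> set ?b = {}" using Lfam[OF ev od] u_od[of i] by simp
      have L2: "set (L (2 * i + 1)) \<inter> set ?a = {}" "set (L (2 * i + 1)) \<inter> set ?b = {}"
        using Lfam[OF od ev] Lfam[OF od od] u_od[of i] by (simp_all add: u_ev)
      have L12: "set (L (2 * i + 1)) \<inter> set (L (2 * i)) = {}" by (rule LL[OF od ev]) simp
      let ?p = "?a @ L (2 * i) @ ?b"
      have l1E: "gpath E (last ?a # L (2 * i) @ [hd ?b])" by (rule gpath_mono[OF l1]) simp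
      have gp: "gpath E ?p" by (rule gpath_join[OF a(1) b(1) l1E La Lb ab])
      have ne: "?a \<noteq> []" "?b \<noteq> []" using a(1) b(1) by auto
      have "successively (\<lambda>x y. col x \<noteq> col y) (last ?a # L (2 * i) @ [hd ?b])"
        using l1 unfolding gpath_def by (auto elim: successively_mono)
      from bichromatic_link_parity[OF this] have par: "even (length (L (2 * i))) \<longleftrightarrow> (col (last ?a) \<noteq> col (hd ?b))" .
      have "nonzero col ?a \<noteq> nonzero col ?b" using True nz[OF i] by (auto simp: two_def main_def)
      then have nzp: "nonzero col ?p" by (rule nonzero_join[OF _ par ne])
      have pV: "set ?p \<subseteq> V" using a(2) b(2) Lp(2)[OF ev] by auto
      have len: "2 \<le> length ?p" using a(3) by simp
      have pS: "set ?p \<inter> S \<noteq> {}" using aS by auto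
      have "last ?p = last ?b" "hd ?p = hd ?a" using ne by auto
      then have l2': "gpath ?H (last ?p # L (2 * i + 1) @ [hd ?p])" using l2 by simp
      have "set (L (2 * i + 1)) \<inter> set ?p = {}" using L2 L12 by auto
      from odd_S_cycle_close[OF gp pV len nzp pS l2' Lp(2)[OF od] this]
      have "odd_S_cycle V E S (?p @ L (2 * i + 1))" .
      moreover have "set ?b \<union> set (L (2 * i + 1)) \<subseteq> D i" unfolding D_def using od u_od[of i] by (intro subsetI UN_I[of "2 * i + 1"]) auto
      ultimately show ?thesis using Da by (intro exI[of _ "?p @ L (2 * i + 1)"]) auto
    qed
  qed
  then obtain C where C: "\<And>i. i < k \<Longrightarrow> odd_S_cycle V E S (C i) \<and> set (C i) \<subseteq> D i" by metis
  have "D i \<inter> D i' = {}" if "i \<noteq> i'" for i i'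
  proof (rule equals0I)
    fix x assume "x \<in> D i \<inter> D i'"
    then obtain l l' where l: "l \<in> I" "l div 2 = i" "x \<in> set (fam (u l)) \<union> set (L l)"
      and l': "l' \<in> I" "l' div 2 = i'" "x \<in> set (fam (u l')) \<union> set (L l')" by (auto simp: D_def)
    have ne: "l \<noteq> l'" using l(2) l'(2) that by auto
    then have "u l \<noteq> u l'" using uinj l(1) l'(1) by (auto simp: inj_on_def)
    moreover have "u l < k + j" "u l' < k + j" using \<open>u ` I \<subseteq> {..<k + j}\<close> l(1) l'(1) by auto
    ultimately have "set (fam (u l)) \<inter> set (fam (u l')) = {}" using apath_familyD(2)[OF fam] by simp
    then show False using l(3) l'(3) LL[OF l(1) l'(1) ne] Lfam[OF l(1) l'(1)] Lfam[OF l'(1) l(1)] by blast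
  qed
  then have "set (C i) \<inter> set (C i') = {}" if "i < k" "i' < k" "i \<noteq> i'" for i i'
    using C[OF that(1)] C[OF that(2)] that(3) by blast
  then show ?thesis using C by blast
qed

section \<open>From connectivity to the two alternatives\<close>

lemma bipartite_no_odd_cycle:
  assumes "bipartite_on V E" "is_cycle V E c" shows "even (length c)"
proof (rule ccontr)
  assume odd: "odd (length c)"
  obtain f :: "'a \<Rightarrow> bool" where f: "\<And>u v. u \<in> V \<Longrightarrow> v \<in> V \<Longrightarrow> E u v \<Longrightarrow> f u \<noteq> f v"
    using assms(1) by (auto simp: bipartite_on_def)
  have cV: "set c \<subseteq> V" and E: "\<And>i. i < length c \<Longrightarrow> E (c ! i) (c ! ((i + 1) mod length c))" and l3: "3 \<le> length c"
    using assms(2) by (auto simp: is_cycle_def)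
  have cm: "c ! i \<in> V" if "i < length c" for i using that cV nth_mem by blast
  have alt: "f (c ! i) = (even i \<longleftrightarrow> f (c ! 0))" if "i < length c" for i
    using that
  proof (induction i)
    case (Suc i)
    then have "f (c ! i) \<noteq> f (c ! Suc i)" using E[of i] f[OF cm cm, of i "Suc i"] by simp
    then show ?case using Suc by auto
  qed simp
  obtain n where n: "length c = Suc n" using l3 by (cases "length c") auto
  then have "E (c ! n) (c ! 0)" using E[of n] by simp
  then have "f (c ! n) \<noteq> f (c ! 0)" using f[OF cm cm, of n 0] n by simp
  then show False using alt[of n] odd n by simp
qed

text \<open>Deleting the neighbours of \<open>v\<close> would isolate it from some remaining vertex,
  which exists because there are more than \<open>n\<close> vertices.\<close>

lemma k_connected_degree:
  assumes G: "simple_graph V E" and kc: "k_connected V E n" and v: "v \<in> V"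
  shows "n \<le> card {u \<in> V. E v u}"
proof (rule ccontr)
  let ?N = "{u \<in> V. E v u}"
  assume "\<not> ?thesis"
  then have lt: "card ?N < n" by simp
  have fin: "finite V" and irr: "\<not> E v v" using G by (auto simp: simple_graph_def)
  have "?N \<subseteq> V" by blast
  then have con: "connected_on (V - ?N) E" using kc[unfolded k_connected_def, THEN conjunct2, rule_format, of ?N] lt by simp
  have "\<not> V \<subseteq> insert v ?N"
  proof
    assume "V \<subseteq> insert v ?N"
    then have "card V \<le> card (insert v ?N)" using fin by (intro card_mono) auto
    also have "\<dots> \<le> Suc (card ?N)" by (rule card_insert_le_m1) simp_all
    finally show False using lt kc unfolding k_connected_def by simp
  qed
  then obtain w where w: "w \<in> V" "w \<noteq> v" "w \<notin> ?N" by blast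
  then have "v \<in> V - ?N" "w \<in> V - ?N" using v irr by auto
  then have "(\<lambda>x y. x \<in> V - ?N \<and> y \<in> V - ?N \<and> E x y)\<^sup>*\<^sup>* v w"
    using con unfolding connected_on_def by (elim ballE) auto
  then show False
  proof (cases rule: converse_rtranclpE)
    case (step y)
    from step(1) show False by blast
  qed (use w in simp)
qed

theorem theorem1:
  fixes V :: "'a set" and E :: "'a \<Rightarrow> 'a \<Rightarrow> bool" and S :: "'a set" and k :: nat
  assumes "simple_graph V E"
    and "k \<ge> 1"
    and "k_connected V E (50 * k)"
    and "S \<subseteq> V"
  shows "(\<exists>C :: nat \<Rightarrow> 'a list.
            (\<forall>i < k. odd_S_cycle V E S (C i)) \<and>
            (\<forall>i < k. \<forall>j < k. i \<noteq> j \<longrightarrow> set (C i) \<inter> set (C j) = {}))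
       \<or> ((\<exists>X \<subseteq> V. card X \<le> 2 * k - 2 \<and> (\<forall>c. \<not> odd_S_cycle (V - X) E S c))
          \<and> (card S \<ge> k \<longrightarrow>
               (\<exists>Y \<subseteq> V. card Y \<le> 3 * k - 3 \<and> bipartite_on (V - Y) E)))"
proof (cases "\<exists>C. (\<forall>i<k. odd_S_cycle V E S (C i)) \<and> (\<forall>i<k. \<forall>j<k. i \<noteq> j \<longrightarrow> set (C i) \<inter> set (C j) = {})")
  case no: False
  have fin: "finite V" using assms(1) by (simp add: simple_graph_def)
  have sym: "symp E" by (rule sympI) (use assms(1) in \<open>simp add: simple_graph_def\<close>)
  have irr: "irreflp E" by (rule irreflpI) (use assms(1) in \<open>simp add: simple_graph_def\<close>)
  have deg: "50 * k \<le> card {y \<in> V. E v y}" if "v \<in> V" for v using k_connected_degree[OF assms(1,3) that] .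
  have conn: "connected_on (V - X) E" if "X \<subseteq> V" "card X < 50 * k" for X
    using assms(3)[unfolded k_connected_def, THEN conjunct2, rule_format, of X] that by simp
  have cV: "50 * k < card V" using assms(3) by (simp add: k_connected_def)
  have finS: "finite S" using assms(4) fin finite_subset by blast
  obtain col :: "'a \<Rightarrow> bool" where col: "card (arcs V E V) \<le> 2 * card (arcs V (\<lambda>u v. E u v \<and> col u \<noteq> col v) V)"
    using large_cut[OF fin sym irr] by blast
  let ?H = "\<lambda>u v. E u v \<and> col u \<noteq> col v"
  have symH: "symp ?H" by (rule sympI) (use sympD[OF sym] in blast)
  have irrH: "irreflp ?H" by (rule irreflpI) simp
  have "(\<Sum>v\<in>V. 50 * k) \<le> (\<Sum>v\<in>V. card {u \<in> V. E v u})" by (rule sum_mono) (rule deg)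
  then have "50 * k * card V \<le> card (arcs V E V)" using card_arcs_sum[OF fin, of E] by (simp add: mult.commute)
  then have dense: "25 * k * card V \<le> card (arcs V ?H V)" using col by linarith
  have "8 * k \<le> card V" using cV by linarith
  from linked_core[OF fin symH irrH assms(2) this dense] obtain K where
    K: "K \<subseteq> V" "8 * k \<le> card K" and link: "\<And>X. X \<subseteq> K \<Longrightarrow> card X = 4 * k \<Longrightarrow> linked K ?H X" by blast
  have finK: "finite K" using K(1) fin finite_subset by blast
  have K4: "4 * k \<le> card K" "6 * k \<le> card K" using K(2) by linarith+
  have conn6: "connected_on (V - X) E" if "X \<subseteq> V" "card X < 6 * k" for X using conn[OF that(1)] that(2) by simp
  have deg6: "6 * k \<le> card {y \<in> V. E v y}" if "v \<in> V" for v using deg[OF that] by linarith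
  have mono: "odd_S_cycle V E S c" if "odd_S_cycle V E T c" "T \<subseteq> S" for T c
    using that by (auto simp: odd_S_cycle_def)
  have contra: False if T: "T \<subseteq> S" and fam: "apath_family V E K (k + j) fam" "\<And>i. i < k \<Longrightarrow> nonzero col (fam i)"
    "\<And>i. k \<le> i \<Longrightarrow> i < k + j \<Longrightarrow> set (fam i) \<inter> T \<noteq> {}" "k \<le> card {i. i < k \<and> set (fam i) \<inter> T \<noteq> {}} + j" for T j fam
    using odd_cycles_of_family[OF link K(1) finK K4(1) fam] mono[OF _ T] no by blast
  have contra': False if T: "T \<subseteq> S" "card T \<le> 2 * k" and fam: "nonzero_family V E K col k fam"
    "(\<Sum>i<k. card (set (fam i) \<inter> T) - 1) + k \<le> card T" for T fam
  proof -
    have "T \<subseteq> V" using T(1) assms(4) by blast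
    from extend_family[OF fin sym this T(2) K(1) conn6 deg6 K4(2) fam] obtain j fam' where
      "apath_family V E K (k + j) fam'" "\<forall>i<k. nonzero col (fam' i)" "\<forall>i. k \<le> i \<longrightarrow> i < k + j \<longrightarrow> set (fam' i) \<inter> T \<noteq> {}"
      "k \<le> card {i. i < k \<and> set (fam' i) \<inter> T \<noteq> {}} + j" by blast
    then show False using contra[OF T(1), of j fam'] by simp
  qed
  have "\<exists>X\<subseteq>V. card X \<le> 2 * k - 2 \<and> (\<forall>c. \<not> odd_S_cycle (V - X) E S c)"
  proof (cases "card S \<le> 2 * k - 2")
    case True
    have "\<not> odd_S_cycle (V - S) E S c" for c by (auto simp: odd_S_cycle_def is_cycle_def)
    then show ?thesis using True assms(4) by blast
  next
    case False
    then have "2 * k - 1 \<le> card S" by linarith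
    then obtain T where T: "T \<subseteq> S" "card T = 2 * k - 1" by (meson obtain_subset_with_card_n)
    have TV: "T \<subseteq> V" using T(1) assms(4) by blast
    have conn2: "connected_on (V - X) E" if "X \<subseteq> V" "card X < 2 * k" for X using conn[OF that(1)] that(2) by simp
    have "2 * k \<le> card K" using K(2) by linarith
    from nonzero_paths_or_bipartite[OF fin sym irr K(1) this assms(2) conn2, of col] show ?thesis
    proof
      assume "\<exists>P. (\<forall>i<k. apath V E K (P i) \<and> nonzero col (P i)) \<and> (\<forall>i<k. \<forall>j<k. i \<noteq> j \<longrightarrow> set (P i) \<inter> set (P j) = {})"
      then obtain P0 where "nonzero_family V E K col k P0" by (auto simp: nonzero_family_def apath_family_def)
      moreover have "card T \<le> 2 * k" using T(2) by simp
      ultimately obtain P where P: "nonzero_family V E K col k P" "\<And>i. i < k \<Longrightarrow> card (set (P i) \<inter> T) \<le> 2"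
        using few_shared[OF fin sym TV _ K(1) assms(2) conn6 deg6 K4(2)] by blast
      have False
      \<comment> \<open>If all paths meet \<open>T\<close>, no extra path is needed, so
        \<open>j\<close> is 0.\<close>
      proof (cases "\<forall>i<k. set (P i) \<inter> T \<noteq> {}")
        case True
        then have "{i. i < k \<and> set (P i) \<inter> T \<noteq> {}} = {..<k}" by auto
        then show False using contra[OF T(1), of 0 P] P(1) by (simp add: nonzero_family_def)
      next
        case False
        then obtain i0 where i0: "i0 < k" "set (P i0) \<inter> T = {}" by blast
        \<comment> \<open>One path misses \<open>T\<close> and the others have excess at most one.
          The total excess is at most \<open>k - 1\<close>, which is exactly what
          \<open>2 * k - 1\<close> vertices allow.\<close>
        have "(\<Sum>i<k. card (set (P i) \<inter> T) - 1) = (\<Sum>i\<in>{..<k} - {i0}. card (set (P i) \<inter> T) - 1)"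
          using i0 by (simp add: sum.remove[of "{..<k}" i0])
        also have "\<dots> \<le> (\<Sum>i\<in>{..<k} - {i0}. 1)"
        proof (rule sum_mono)
          fix i assume "i \<in> {..<k} - {i0}"
          then show "card (set (P i) \<inter> T) - 1 \<le> 1" using P(2)[of i] by simp
        qed
        also have "\<dots> = k - 1" using i0(1) by simp
        finally have "(\<Sum>i<k. card (set (P i) \<inter> T) - 1) + k \<le> card T" using T(2) assms(2) by linarith
        then show False using contra'[OF T(1) \<open>card T \<le> 2 * k\<close> P(1)] by blast
      qed
      then show ?thesis ..
    next
      assume "\<exists>X\<subseteq>V. card X \<le> 2 * k - 2 \<and> bipartite_on (V - X) E"
      then obtain X where X: "X \<subseteq> V" "card X \<le> 2 * k - 2" "bipartite_on (V - X) E" by blast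
      have "\<not> odd_S_cycle (V - X) E S c" for c using bipartite_no_odd_cycle[OF X(3), of c] by (auto simp: odd_S_cycle_def)
      then show ?thesis using X by blast
    qed
  qed
  moreover have "\<exists>Y\<subseteq>V. card Y \<le> 3 * k - 3 \<and> bipartite_on (V - Y) E" if "k \<le> card S"
  proof -
    obtain T where T: "T \<subseteq> S" "card T = k" using \<open>k \<le> card S\<close> by (meson obtain_subset_with_card_n)
    have "T \<noteq> {}" using T(2) assms(2) by auto
    then obtain s where s: "s \<in> T" by blast
    have finT: "finite T" using T(1) finS finite_subset by blast
    \<comment> \<open>Deleting all but one vertex of \<open>T\<close> keeps the nonzero paths off
      \<open>T\<close> except at \<open>s\<close>. The excess is then 0 and \<open>k\<close>
      vertices suffice; the \<open>k - 1\<close> deleted ones enter \<open>Y\<close>.\<close>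
    let ?T = "T - {s}" let ?V = "V - ?T" let ?A = "K - ?T"
    have cT: "card ?T + 1 = k" using card_Suc_Diff1[OF finT s] T(2) by simp
    have TV: "?T \<subseteq> V" using T(1) assms(4) by blast
    have "card K \<le> card ?A + card ?T"
    proof -
      have "card K \<le> card (?A \<union> ?T)" using finK finT by (intro card_mono) auto
      then show ?thesis using card_Un_le[of ?A ?T] by linarith
    qed
    then have A2: "2 * k \<le> card ?A" using K(2) cT by linarith
    have conn': "connected_on (?V - X) E" if X: "X \<subseteq> ?V" "card X < 2 * k" for X
    proof -
      have "card (?T \<union> X) < 50 * k" using card_Un_le[of ?T X] X(2) cT by linarith
      then have "connected_on (V - (?T \<union> X)) E" using X(1) TV by (intro conn) auto
      moreover have "V - (?T \<union> X) = ?V - X" by blast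
      ultimately show ?thesis by simp
    qed
    have "?A \<subseteq> ?V" "finite ?V" using K(1) fin by auto
    from nonzero_paths_or_bipartite[OF this(2) sym irr this(1) A2 assms(2) conn', of col] show ?thesis
    proof
      assume "\<exists>P. (\<forall>i<k. apath ?V E ?A (P i) \<and> nonzero col (P i)) \<and> (\<forall>i<k. \<forall>j<k. i \<noteq> j \<longrightarrow> set (P i) \<inter> set (P j) = {})"
      then obtain P where P: "\<And>i. i < k \<Longrightarrow> apath ?V E ?A (P i)" "\<And>i. i < k \<Longrightarrow> nonzero col (P i)"
        "\<And>i j. i < k \<Longrightarrow> j < k \<Longrightarrow> i \<noteq> j \<Longrightarrow> set (P i) \<inter> set (P j) = {}" by blast
      have "apath V E K (P i)" if "i < k" for i
      proof -
        have "set (P i) \<subseteq> ?V" using P(1)[OF that] by (simp add: apath_def)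
        then have "set (P i) \<inter> K = set (P i) \<inter> ?A" "set (P i) \<subseteq> V" by blast+
        then show ?thesis using P(1)[OF that] by (simp add: apath_def)
      qed
      then have fam: "nonzero_family V E K col k P" using P by (simp add: nonzero_family_def apath_family_def)
      have "card (set (P i) \<inter> T) - 1 = 0" if "i < k" for i
      proof -
        have "set (P i) \<subseteq> ?V" using P(1)[OF that] by (simp add: apath_def)
        then have "set (P i) \<inter> T \<subseteq> {s}" by blast
        then show ?thesis using card_mono[of "{s}" "set (P i) \<inter> T"] by simp
      qed
      then have "(\<Sum>i<k. card (set (P i) \<inter> T) - 1) = 0" by simp
      then show ?thesis using contra'[OF T(1) _ fam] T(2) by simp
    next
      assume "\<exists>X\<subseteq>?V. card X \<le> 2 * k - 2 \<and> bipartite_on (?V - X) E"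
      then obtain X where X: "X \<subseteq> ?V" "card X \<le> 2 * k - 2" "bipartite_on (?V - X) E" by blast
      have "?V - X = V - (?T \<union> X)" by blast
      moreover have "card (?T \<union> X) \<le> 3 * k - 3" using card_Un_le[of ?T X] X(2) cT by linarith
      moreover have "?T \<union> X \<subseteq> V" using X(1) TV by blast
      ultimately show ?thesis using X(3) by (intro exI[of _ "?T \<union> X"]) simp
    qed
  qed
  ultimately show ?thesis by blast
qed simp

end
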